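(* Let $G$ be a connected, locally finite graph, and suppose that $\mathrm{Aut}(G)$ has a quasi-transitive nonunimodular subgroup. Then $p_c(G)<p_u(G)$.
   Context: For $p\in[0,1]$, $G[p]$ denotes the random subgraph of $G$ obtained by Bernoulli bond percolation: each edge is independently retained (open) with probability $p$ and deleted (closed) otherwise. Clusters are the connected components of $G[p]$. $p_c(G)=\inf\{p: G[p]$ contains an infinite cluster almost surely$\}$ and $p_u(G)=\inf\{p: G[p]$ contains a unique infinite cluster almost surely$\}$. A subgroup $\Gamma\subseteq\mathrm{Aut}(G)$ is quasi-transitive if its action on the vertex set $V$ has only finitely many orbits. It is unimodular if $|\mathrm{Stab}_v u|=|\mathrm{Stab}_u v|$ for all $u,v\in V$ in the same $\Gamma$-orbit, where $\mathrm{Stab}_x$ is the stabilizer of $x$ in $\Gamma$ and $\mathrm{Stab}_x y$ is the orbit of $y$ under $\mathrm{Stab}_x$; otherwise it is nonunimodular. *)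

theory Defs
  imports "HOL-Probability.Probability" "HOL-Algebra.Group_Action"
begin

section \<open>Graphs\<close>

text \<open>A graph is given by its vertex set \<open>V\<close> and its set \<open>E\<close> of edges, an edge being an
  unordered pair of distinct vertices. Both sets may be infinite.\<close>

definition simple_graph :: "'a set \<Rightarrow> 'a set set \<Rightarrow> bool" where
  "simple_graph V E \<longleftrightarrow> (\<forall>e\<in>E. e \<subseteq> V \<and> card e = 2)"

definition locally_finite_graph :: "'a set \<Rightarrow> 'a set set \<Rightarrow> bool" where
  "locally_finite_graph V E \<longleftrightarrow> (\<forall>v\<in>V. finite {e \<in> E. v \<in> e})"

definition joined :: "'a set set \<Rightarrow> 'a \<Rightarrow> 'a \<Rightarrow> bool" where
  "joined E = (\<lambda>u v. {u, v} \<in> E)\<^sup>*\<^sup>*"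

definition connected_graph :: "'a set \<Rightarrow> 'a set set \<Rightarrow> bool" where
  "connected_graph V E \<longleftrightarrow> (\<forall>u\<in>V. \<forall>v\<in>V. joined E u v)"

definition components_of_graph :: "'a set \<Rightarrow> 'a set set \<Rightarrow> 'a set set" where
  "components_of_graph V E = {{u \<in> V. joined E v u} | v. v \<in> V}"


section \<open>Automorphisms\<close>

text \<open>As in \<^theory>\<open>HOL-Algebra.Bij\<close>, permutations of \<open>V\<close> are extensional functions.
  The inclusion of the automorphism group into \<^term>\<open>BijGroup V\<close> is its action on \<open>V\<close>, so the
  notions of \<^theory>\<open>HOL-Algebra.Group_Action\<close> are used below with \<^term>\<open>\<lambda>g. g\<close> as the action.\<close>

definition graph_auto :: "'a set \<Rightarrow> 'a set set \<Rightarrow> ('a \<Rightarrow> 'a) set" where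
  "graph_auto V E = {f \<in> Bij V. \<forall>u\<in>V. \<forall>v\<in>V. {f u, f v} \<in> E \<longleftrightarrow> {u, v} \<in> E}"

definition GraphAutoGroup :: "'a set \<Rightarrow> 'a set set \<Rightarrow> ('a \<Rightarrow> 'a) monoid" where
  "GraphAutoGroup V E = BijGroup V \<lparr>carrier := graph_auto V E\<rparr>"

lemma subgroup_graph_auto: "subgroup (graph_auto V E) (BijGroup V)"
proof (rule subgroup.intro)
  show "graph_auto V E \<subseteq> carrier (BijGroup V)"
    by (auto simp: graph_auto_def BijGroup_def)
next
  fix f g
  assume fg: "f \<in> graph_auto V E" "g \<in> graph_auto V E"
  then have "g u \<in> V" if "u \<in> V" for u
    using that Bij_imp_funcset[of g V] by (auto simp: graph_auto_def)
  with fg show "f \<otimes>\<^bsub>BijGroup V\<^esub> g \<in> graph_auto V E"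
    by (auto simp: graph_auto_def BijGroup_def compose_Bij compose_eq)
next
  show "\<one>\<^bsub>BijGroup V\<^esub> \<in> graph_auto V E"
    by (simp add: graph_auto_def BijGroup_def id_Bij)
next
  fix f
  assume f: "f \<in> graph_auto V E"
  then have B: "f \<in> Bij V" by (simp add: graph_auto_def)
  have "{inv_into V f u, inv_into V f v} \<in> E \<longleftrightarrow> {u, v} \<in> E" if "u \<in> V" "v \<in> V" for u v
  proof -
    have "f (inv_into V f u) = u" "f (inv_into V f v) = v"
      using B that by (auto simp: Bij_def bij_betw_inv_into_right)
    moreover have "inv_into V f u \<in> V" "inv_into V f v \<in> V"
      using B that by (auto simp: Bij_inv_into_mem)
    ultimately show ?thesis using f unfolding graph_auto_def by force
  qed
  then show "inv\<^bsub>BijGroup V\<^esub> f \<in> graph_auto V E"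
    using B by (simp add: inv_BijGroup graph_auto_def restrict_inv_into_Bij)
qed

lemma group_GraphAutoGroup: "group (GraphAutoGroup V E)"
  unfolding GraphAutoGroup_def
  by (rule subgroup.subgroup_is_group[OF subgroup_graph_auto group_BijGroup])

definition quasi_transitive :: "'a set \<Rightarrow> 'a set set \<Rightarrow> ('a \<Rightarrow> 'a) set \<Rightarrow> bool" where
  "quasi_transitive V E \<Gamma> \<longleftrightarrow> finite (orbits (GraphAutoGroup V E \<lparr>carrier := \<Gamma>\<rparr>) V (\<lambda>g. g))"

definition stab_orbit :: "'a set \<Rightarrow> 'a set set \<Rightarrow> ('a \<Rightarrow> 'a) set \<Rightarrow> 'a \<Rightarrow> 'a \<Rightarrow> 'a set" where
  "stab_orbit V E \<Gamma> x y =
     (let G = GraphAutoGroup V E \<lparr>carrier := \<Gamma>\<rparr>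
      in orbit (G \<lparr>carrier := stabilizer G (\<lambda>g. g) x\<rparr>) (\<lambda>g. g) y)"

text \<open>In a connected, locally finite graph the sets \<^term>\<open>stab_orbit V E \<Gamma> x y\<close> with \<open>x, y \<in> V\<close> are
  finite (they lie in a sphere around \<open>x\<close>), so \<^const>\<open>card\<close> is their genuine cardinality.\<close>

definition unimodular :: "'a set \<Rightarrow> 'a set set \<Rightarrow> ('a \<Rightarrow> 'a) set \<Rightarrow> bool" where
  "unimodular V E \<Gamma> \<longleftrightarrow>
     (\<forall>u\<in>V. \<forall>v\<in>V. v \<in> orbit (GraphAutoGroup V E \<lparr>carrier := \<Gamma>\<rparr>) (\<lambda>g. g) u \<longrightarrow>
        card (stab_orbit V E \<Gamma> v u) = card (stab_orbit V E \<Gamma> u v))"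


section \<open>Bernoulli bond percolation\<close>

definition percolation :: "'a set set \<Rightarrow> real \<Rightarrow> ('a set \<Rightarrow> bool) measure" where
  "percolation E p = (\<Pi>\<^sub>M e\<in>E. measure_pmf (bernoulli_pmf p))"

definition open_edges :: "'a set set \<Rightarrow> ('a set \<Rightarrow> bool) \<Rightarrow> 'a set set" where
  "open_edges E \<omega> = {e \<in> E. \<omega> e}"

definition clusters :: "'a set \<Rightarrow> 'a set set \<Rightarrow> ('a set \<Rightarrow> bool) \<Rightarrow> 'a set set" where
  "clusters V E \<omega> = components_of_graph V (open_edges E \<omega>)"

text \<open>If \<open>V\<close> is infinite and the graph is connected, \<open>p = 1\<close> belongs to both sets below, so the
  infima are taken over nonempty sets bounded below.\<close>

definition p_c :: "'a set \<Rightarrow> 'a set set \<Rightarrow> real" where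
  "p_c V E = Inf {p \<in> {0..1}. AE \<omega> in percolation E p. \<exists>C\<in>clusters V E \<omega>. infinite C}"

definition p_u :: "'a set \<Rightarrow> 'a set set \<Rightarrow> real" where
  "p_u V E = Inf {p \<in> {0..1}. AE \<omega> in percolation E p. \<exists>!C. C \<in> clusters V E \<omega> \<and> infinite C}"

end

theory Submission
  imports Defs
begin

text \<open>Nonunimodularity yields a height \<open>h\<close> with \<open>h (g x) - h (g y) = h x - h y\<close>, unbounded on orbits, such
that mass transport holds with the density \<open>exp (h y - h x)\<close>. All estimates concern finite edge sets and
survive in the limit. At \<open>p_c\<close> the mean tilted offspring of a chain of upward connections is at most \<open>1\<close>:
otherwise the second moment method makes the root reach every depth with probability bounded below, hence
percolation at some smaller parameter by continuity. So climbing by \<open>t\<close> inside a half-space costs about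
\<open>exp (- t)\<close>, and conversely many vertices together climb with probability bounded below. Comparing the two
bounds the number of hits of a level from a slab; the tree-graph inequality bootstraps this to an expectation of
order \<open>exp (- 3/4 t)\<close>. Decomposing a path at its successive extremal layers then shows that the susceptibility
tilted by \<open>exp ((h v - h x) / 2)\<close> is finite at \<open>p_c\<close>. Finiteness is an open condition (a finite-size criterion),
and it makes the two-point function decay along orbits, which a unique infinite cluster forbids.\<close>

section \<open>Bernoulli expectations on finite edge sets\<close>

text \<open>The obstacle to a direct height is that the modular weight may be flat, or have local
  maxima, along the edges of the graph. It is corrected by a bounded invariant function until every
  vertex has a higher neighbour, so that any vertex can be pushed to a given level at a cost
  exponential in the height to be gained. The true climbing rate at the critical point is unknown;
  the mean offspring bound only shows that it is at least 1. Therefore the supremum of all decay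
  rates is used: just below it climbing is at most that unlikely, just above it large sets of
  vertices climb together, and the quotient of the two rates is as close to 1 as desired. This
  closeness gives the number of hits a tail of order n^(-(1-d)) with d small. The tilt 1/2 comes
  from mass transport, which turns the weight exp(s(h y - h x)) into exp((1-s)(h y - h x)): at s =
  1/2 upward and downward connections obey the same bound. The rate 3/4 is one choice between 1/2
  and 1; it leaves exp(-k/4) for the connections across height k, which is summable over the widths
  in the zigzag decomposition.\<close>

definition pexp :: "real \<Rightarrow> 'e set \<Rightarrow> ('e set \<Rightarrow> real) \<Rightarrow> real" where
 "pexp p F f = (\<Sum>S\<in>Pow F. p ^ card S * (1 - p) ^ card (F - S) * f S)"

lemma pexp_empty [simp]: "pexp p {} f = f {}"
 by (simp add: pexp_def)

text \<open>Conditioning on the state of the single edge \<open>e\<close>. As \<open>pexp\<close> is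
  a finite polynomial expression in \<open>p\<close>, induction over the edges with this step does
  the work of the product measure in all finite estimates.\<close>

lemma pexp_insert:
 assumes "finite F" "e \<notin> F"
 shows "pexp p (insert e F) f = p * pexp p F (\<lambda>S. f (insert e S)) + (1 - p) * pexp p F f"
proof -
 let ?w = "\<lambda>S. p ^ card S * (1 - p) ^ card (insert e F - S) * f S"
 have disj: "Pow F \<inter> insert e ` Pow F = {}" using assms(2) by auto
 have inj: "inj_on (insert e) (Pow F)"
 proof (rule inj_onI)
  fix S T assume "S \<in> Pow F" "T \<in> Pow F" "insert e S = insert e T"
  moreover from this have "e \<notin> S" "e \<notin> T" using assms(2) by auto
  ultimately show "S = T" using insert_ident by metis
 qed
 have "pexp p (insert e F) f = sum ?w (Pow F) + sum ?w (insert e ` Pow F)"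
  unfolding pexp_def Pow_insert by (rule sum.union_disjoint) (use assms disj in auto)
 also have "sum ?w (insert e ` Pow F) = (\<Sum>S\<in>Pow F. ?w (insert e S))"
  by (subst sum.reindex[OF inj]) simp
 also have "... = (\<Sum>S\<in>Pow F. p * (p ^ card S * (1 - p) ^ card (F - S) * f (insert e S)))"
 proof (rule sum.cong[OF refl])
  fix S assume S: "S \<in> Pow F"
  then have "card (insert e S) = Suc (card S)" "insert e F - insert e S = F - S"
   using assms finite_subset[of S F] by (auto simp: card_insert_if)
  then show "?w (insert e S) = p * (p ^ card S * (1 - p) ^ card (F - S) * f (insert e S))" by simp
 qed
 also have "sum ?w (Pow F) = (\<Sum>S\<in>Pow F. (1 - p) * (p ^ card S * (1 - p) ^ card (F - S) * f S))"
 proof (rule sum.cong[OF refl])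
  fix S assume S: "S \<in> Pow F"
  then have "insert e F - S = insert e (F - S)" "e \<notin> F - S" using assms by auto
  then have "card (insert e F - S) = Suc (card (F - S))" using assms by simp
  then show "?w S = (1 - p) * (p ^ card S * (1 - p) ^ card (F - S) * f S)" by simp
 qed
 finally show ?thesis unfolding pexp_def sum_distrib_left by simp
qed

lemma pexp_add: "pexp p F (\<lambda>S. f S + g S) = pexp p F f + pexp p F g"
 unfolding pexp_def distrib_left sum.distrib by (rule refl)

lemma pexp_cmult: "pexp p F (\<lambda>S. c * f S) = c * pexp p F f"
 unfolding pexp_def sum_distrib_left by (rule sum.cong) auto

lemma pexp_cmult2: "pexp p F (\<lambda>S. f S * c) = pexp p F f * c"
 unfolding pexp_def sum_distrib_right by (rule sum.cong) auto

lemma pexp_sum: "pexp p F (\<lambda>S. \<Sum>i\<in>I. f i S) = (\<Sum>i\<in>I. pexp p F (f i))"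
 unfolding pexp_def sum_distrib_left sum.swap[of _ I "Pow F"] by (rule refl)

lemma pexp_cong:
 assumes "\<And>S. S \<subseteq> F ==> f S = g S" shows "pexp p F f = pexp p F g"
 unfolding pexp_def by (rule sum.cong) (use assms in auto)

lemma pexp_const [simp]: "finite F ==> pexp p F (\<lambda>_. c) = c"
 by (induction F rule: finite_induct) (auto simp: pexp_insert algebra_simps)

lemma pexp_zero [simp]: "pexp p F (\<lambda>_. 0) = 0"
 by (simp add: pexp_def)

lemma pexp_mono:
 assumes "0 \<le> p" "p \<le> 1" "\<And>S. S \<subseteq> F ==> f S \<le> g S" shows "pexp p F f \<le> pexp p F g"
 unfolding pexp_def by (rule sum_mono) (use assms in \<open>auto intro!: mult_left_mono\<close>)

lemma pexp_nonneg:
 assumes "0 \<le> p" "p \<le> 1" "\<And>S. S \<subseteq> F ==> 0 \<le> f S" shows "0 \<le> pexp p F f"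
 using pexp_mono[of p F "\<lambda>_. 0" f] assms by simp

lemma pexp_le1:
 assumes "0 \<le> p" "p \<le> 1" "finite F" "\<And>S. S \<subseteq> F ==> f S \<le> 1" shows "pexp p F f \<le> 1"
 using pexp_mono[of p F f "\<lambda>_. 1"] assms by simp

lemma pexp_union:
 assumes "finite F" "finite G" "F \<inter> G = {}"
 shows "pexp p (F \<union> G) f = pexp p F (\<lambda>S. pexp p G (\<lambda>T. f (S \<union> T)))"
 using assms(1,3)
proof (induction F arbitrary: f rule: finite_induct)
 case empty then show ?case by simp
next
 case (insert e F)
 have "pexp p (insert e (F \<union> G)) f = p * pexp p (F \<union> G) (\<lambda>S. f (insert e S)) + (1 - p) * pexp p (F \<union> G) f"
  by (rule pexp_insert) (use insert assms in auto)
 also have "... = p * pexp p F (\<lambda>S. pexp p G (\<lambda>T. f (insert e S \<union> T))) + (1 - p) * pexp p F (\<lambda>S. pexp p G (\<lambda>T. f (S \<union> T)))"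
  using insert.IH[of f] insert.IH[of "\<lambda>S. f (insert e S)"] insert.prems by simp
 also have "... = pexp p (insert e F) (\<lambda>S. pexp p G (\<lambda>T. f (S \<union> T)))"
  by (rule pexp_insert[symmetric]) (use insert in auto)
 finally show ?case by simp
qed

lemma pexp_superset:
 assumes "finite G" "F \<subseteq> G" "\<And>S. S \<subseteq> G ==> f S = f (S \<inter> F)"
 shows "pexp p G f = pexp p F f"
proof -
 have fin: "finite F" "finite (G - F)" using finite_subset[OF assms(2,1)] assms(1) by auto
 have "pexp p (F \<union> (G - F)) f = pexp p F (\<lambda>S. pexp p (G - F) (\<lambda>T. f (S \<union> T)))"
  by (rule pexp_union) (use fin in auto)
 also have "... = pexp p F (\<lambda>S. pexp p (G - F) (\<lambda>T. f S))"
 proof (intro pexp_cong)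
  fix S T assume "S \<subseteq> F" "T \<subseteq> G - F"
  then have "S \<union> T \<subseteq> G" "(S \<union> T) \<inter> F = S" using assms by auto
  then show "f (S \<union> T) = f S" using assms(3)[of "S \<union> T"] by simp
 qed
 finally show ?thesis using assms fin by (simp add: Un_absorb1)
qed

lemma pexp_indep:
 assumes "finite F" "A \<subseteq> F" "B \<subseteq> F" "A \<inter> B = {}"
  and "\<And>S. S \<subseteq> F ==> f S = f (S \<inter> A)" "\<And>S. S \<subseteq> F ==> g S = g (S \<inter> B)"
 shows "pexp p F (\<lambda>S. f S * g S) = pexp p F f * pexp p F g"
proof -
 have fin: "finite A" "finite B" using finite_subset[OF assms(2,1)] finite_subset[OF assms(3,1)] by auto
 have "pexp p F (\<lambda>S. f S * g S) = pexp p (A \<union> B) (\<lambda>S. f S * g S)"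
 proof (rule pexp_superset)
  fix S assume S: "S \<subseteq> F"
  have "S \<inter> (A \<union> B) \<inter> A = S \<inter> A" "S \<inter> (A \<union> B) \<inter> B = S \<inter> B" "S \<inter> (A \<union> B) \<subseteq> F"
   using S by auto
  then have "f (S \<inter> (A \<union> B)) = f (S \<inter> A)" "g (S \<inter> (A \<union> B)) = g (S \<inter> B)"
   using assms(5)[of "S \<inter> (A \<union> B)"] assms(6)[of "S \<inter> (A \<union> B)"] by simp_all
  then show "f S * g S = f (S \<inter> (A \<union> B)) * g (S \<inter> (A \<union> B))"
   using assms(5,6) S by simp
 qed (use assms in auto)
 also have "... = pexp p A (\<lambda>S. pexp p B (\<lambda>T. f (S \<union> T) * g (S \<union> T)))"
  by (rule pexp_union) (use fin assms in auto)
 also have "... = pexp p A (\<lambda>S. pexp p B (\<lambda>T. f S * g T))"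
 proof (intro pexp_cong)
  fix S T assume ST: "S \<subseteq> A" "T \<subseteq> B"
  then have "(S \<union> T) \<inter> A = S" "(S \<union> T) \<inter> B = T" "S \<union> T \<subseteq> F" using assms by auto
  then show "f (S \<union> T) * g (S \<union> T) = f S * g T" using assms(5,6)[of "S \<union> T"] by simp
 qed
 also have "... = pexp p A f * pexp p B g"
  by (simp add: pexp_cmult pexp_cmult2)
 also have "pexp p A f = pexp p F f" using pexp_superset[of F A f] assms by simp
 also have "pexp p B g = pexp p F g" using pexp_superset[of F B g] assms by simp
 finally show ?thesis .
qed

lemma pexp_mono_set:
 assumes "0 \<le> p" "p \<le> 1" "finite G" "F \<subseteq> G" "\<And>S T. S \<subseteq> T ==> T \<subseteq> G ==> f S \<le> f T"
 shows "pexp p F f \<le> pexp p G f"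
proof -
 have fin: "finite F" using finite_subset[OF assms(4,3)] .
 have "pexp p F f = pexp p G (\<lambda>S. f (S \<inter> F))"
  by (subst pexp_superset[of G F "\<lambda>S. f (S \<inter> F)"])
   (use assms in \<open>auto simp: Int_absorb2 intro!: pexp_cong\<close>)
 also have "... \<le> pexp p G f"
  by (rule pexp_mono) (use assms in auto)
 finally show ?thesis .
qed

text \<open>In place of the monotone coupling, induction over the edges: with the law of the others
  fixed, the mean is affine in the parameter of \<open>e\<close>, and its slope is the effect of
  opening \<open>e\<close>, which is nonnegative.\<close>

lemma pexp_mono_p:
 assumes "finite F" "0 \<le> p" "p \<le> p'" "p' \<le> 1" "\<And>S T. S \<subseteq> T ==> T \<subseteq> F ==> f S \<le> f T"
 shows "pexp p F f \<le> pexp p' F f"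
 using assms(1,5)
proof (induction F arbitrary: f rule: finite_induct)
 case empty then show ?case by simp
next
 case (insert e F)
 let ?f1 = "\<lambda>S. f (insert e S)"
 have mono: "f S \<le> f T" if "S \<subseteq> T" "T \<subseteq> insert e F" for S T using insert.prems that by auto
 have 1: "pexp p F ?f1 \<le> pexp p' F ?f1" by (rule insert.IH) (rule mono, auto)
 have 2: "pexp p F f \<le> pexp p' F f" by (rule insert.IH) (rule mono, auto)
 have 3: "pexp p' F f \<le> pexp p' F ?f1" by (rule pexp_mono) (use assms in \<open>auto intro!: mono\<close>)
 have "p * pexp p F ?f1 + (1 - p) * pexp p F f \<le> p * pexp p' F ?f1 + (1 - p) * pexp p' F f"
  using 1 2 assms by (intro add_mono mult_left_mono) auto
 also have "... \<le> p' * pexp p' F ?f1 + (1 - p') * pexp p' F f"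
 proof -
  have "(p' - p) * (pexp p' F ?f1 - pexp p' F f) \<ge> 0" using 3 assms by simp
  then show ?thesis by (simp add: algebra_simps)
 qed
 finally show ?case using insert by (simp add: pexp_insert)
qed

lemma pexp_continuous: "continuous_on UNIV (\<lambda>p. pexp p F f)"
 unfolding pexp_def by (intro continuous_intros)

text \<open>The case of the FKG inequality in which one increasing event asks a fixed set of edges
  to be open. One edge at a time: the mean of an increasing function is at most its mean with that
  edge open, and the edge is open with probability \<open>p\<close>.\<close>

lemma pexp_forced:
 assumes "0 \<le> p" "p \<le> 1" "finite F" "D \<subseteq> F"
  "\<And>S T. S \<subseteq> T ==> T \<subseteq> F ==> f S \<le> f T" "\<And>S. S \<subseteq> F ==> 0 \<le> f S"
 shows "p ^ card D * pexp p F f \<le> pexp p F (\<lambda>S. of_bool (D \<subseteq> S) * f S)"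
proof -
 have "finite D" using finite_subset[OF assms(4,3)] .
 then show ?thesis using assms(4)
 proof (induction D rule: finite_induct)
  case empty then show ?case by simp
 next
  case (insert e D)
  let ?g = "\<lambda>S. of_bool (D \<subseteq> S) * f S"
  obtain F' where F': "F = insert e F'" "e \<notin> F'" "finite F'"
   using insert.prems assms(3) by (metis Set.set_insert finite_insert insert_subset)
  have DF: "D \<subseteq> F'" using insert F' by auto
  have g: "pexp p F ?g \<le> pexp p F' (\<lambda>S. ?g (insert e S))"
  proof -
   have "pexp p F' ?g \<le> pexp p F' (\<lambda>S. ?g (insert e S))"
   proof (rule pexp_mono[OF assms(1,2)])
    fix S assume S: "S \<subseteq> F'"
    then have "f S \<le> f (insert e S)" "0 \<le> f (insert e S)"
     using assms(5)[of S "insert e S"] assms(6)[of "insert e S"] F' by auto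
    then show "?g S \<le> ?g (insert e S)" by (auto simp: of_bool_def)
   qed
   then have "(1 - p) * pexp p F' ?g \<le> (1 - p) * pexp p F' (\<lambda>S. ?g (insert e S))"
    using assms by (intro mult_left_mono) auto
   moreover have "pexp p F ?g = p * pexp p F' (\<lambda>S. ?g (insert e S)) + (1 - p) * pexp p F' ?g"
    unfolding F'(1) by (rule pexp_insert) (use F' in auto)
   ultimately show ?thesis by (simp add: algebra_simps)
  qed
  have "p ^ card (insert e D) * pexp p F f = p * (p ^ card D * pexp p F f)"
   using insert by simp
  also have "... \<le> p * pexp p F ?g"
   using insert assms by (intro mult_left_mono) auto
  also have "... \<le> p * pexp p F' (\<lambda>S. ?g (insert e S))"
   using g assms by (intro mult_left_mono) auto
  also have "... = pexp p F (\<lambda>S. of_bool (insert e D \<subseteq> S) * f S)"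
  proof -
   have "pexp p F (\<lambda>S. of_bool (insert e D \<subseteq> S) * f S) =
    p * pexp p F' (\<lambda>S. of_bool (insert e D \<subseteq> insert e S) * f (insert e S)) + (1 - p) * pexp p F' (\<lambda>S. of_bool (insert e D \<subseteq> S) * f S)"
    unfolding F'(1) by (rule pexp_insert) (use F' in auto)
   moreover have "pexp p F' (\<lambda>S. of_bool (insert e D \<subseteq> S) * f S) = pexp p F' (\<lambda>S. 0)"
    by (rule pexp_cong) (use F' in auto)
   moreover have "pexp p F' (\<lambda>S. of_bool (insert e D \<subseteq> insert e S) * f (insert e S)) = pexp p F' (\<lambda>S. ?g (insert e S))"
    by (rule pexp_cong) (use F' insert in auto)
   ultimately show ?thesis by simp
  qed
  finally show ?case .
 qed
qed

section \<open>The van den Berg-Kesten inequality\<close>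

lemma pexp_insert2:
 assumes "finite F" "e \<notin> F"
 shows "pexp p (insert e F) (\<lambda>S. pexp p (insert e F) (R S)) =
  pexp p F (\<lambda>S. pexp p F (\<lambda>T. p * (p * R (insert e S) (insert e T) + (1 - p) * R (insert e S) T) +
  (1 - p) * (p * R S (insert e T) + (1 - p) * R S T)))"
 by (simp only: pexp_insert[OF assms] pexp_add pexp_cmult) (simp add: algebra_simps)

text \<open>Each edge is split into two independent copies, one available to \<open>A\<close>
  (through \<open>S\<close>), the other to \<open>B\<close> (through \<open>T\<close>), and the
  induction compares the two models one edge at a time. It runs over arbitrary sets of pairs because
  deleting \<open>e\<close> from the pairs that use it at most once does not preserve a product of
  two families.\<close>

lemma pexp_BK_pairs:
 assumes "finite F" "0 \<le> p" "p \<le> 1"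
 shows "pexp p F (\<lambda>S. of_bool (\<exists>(A, B)\<in>P. A \<inter> B = {} \<and> A \<union> B \<subseteq> S))
  \<le> pexp p F (\<lambda>S. pexp p F (\<lambda>T. of_bool (\<exists>(A, B)\<in>P. A \<subseteq> S \<and> B \<subseteq> T)))"
 using assms(1)
proof (induction F arbitrary: P rule: finite_induct)
 case empty
 then show ?case by (auto simp: of_bool_def)
next
 case (insert e F)
 \<comment> \<open>\<open>P0\<close> holds the pairs usable when \<open>e\<close> is closed,
   \<open>P1\<close> what is still to be found in \<open>F\<close> when \<open>e\<close> is open.
   Pairs with \<open>e\<close> on both sides are never disjoint.\<close>
 define P0 where "P0 = {(A, B)\<in>P. e \<notin> A \<and> e \<notin> B}"
 define P1 where "P1 = (\<lambda>(A, B). (A - {e}, B - {e})) ` {(A, B)\<in>P. \<not> (e \<in> A \<and> e \<in> B)}"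
 let ?L = "\<lambda>P S. of_bool (\<exists>(A, B)\<in>P. A \<inter> B = {} \<and> A \<union> B \<subseteq> S) :: real"
 let ?R = "\<lambda>P S T. of_bool (\<exists>(A, B)\<in>P. A \<subseteq> S \<and> B \<subseteq> T) :: real"
 have L0: "pexp p F (?L P) = pexp p F (?L P0)"
 proof (rule pexp_cong)
  fix S assume "S \<subseteq> F"
  then have "e \<notin> S" using insert by auto
  then have "(\<exists>(A, B)\<in>P. A \<inter> B = {} \<and> A \<union> B \<subseteq> S) \<longleftrightarrow> (\<exists>(A, B)\<in>P0. A \<inter> B = {} \<and> A \<union> B \<subseteq> S)"
   unfolding P0_def by blast
  then show "?L P S = ?L P0 S" by simp
 qed
 have L1: "pexp p F (\<lambda>S. ?L P (insert e S)) \<le> pexp p F (?L P1)"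
 proof (rule pexp_mono[OF assms(2,3)])
  fix S assume "S \<subseteq> F"
  show "?L P (insert e S) \<le> ?L P1 S"
  proof (cases "\<exists>(A, B)\<in>P. A \<inter> B = {} \<and> A \<union> B \<subseteq> insert e S")
   case True
   then obtain A B where AB: "(A, B) \<in> P" "A \<inter> B = {}" "A \<union> B \<subseteq> insert e S" by auto
   then have "(A - {e}, B - {e}) \<in> P1" unfolding P1_def by (intro image_eqI[of _ _ "(A, B)"]) auto
   then have "\<exists>(A, B)\<in>P1. A \<inter> B = {} \<and> A \<union> B \<subseteq> S"
    using AB by (intro bexI[of _ "(A - {e}, B - {e})"]) auto
   then show ?thesis by simp
  qed simp
 qed
 have key: "(1 - p) * ?R P0 S T + p * ?R P1 S T \<le>
  p * (p * ?R P (insert e S) (insert e T) + (1 - p) * ?R P (insert e S) T) +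
  (1 - p) * (p * ?R P S (insert e T) + (1 - p) * ?R P S T)"
  if ST: "S \<subseteq> F" "T \<subseteq> F" for S T
 proof -
  \<comment> \<open>In the order \<open>a\<close>, \<open>b\<close>, \<open>c\<close>,
    \<open>d\<close>: a pair is found with \<open>e\<close> closed in both copies, open only in the
    first, open only in the second, open in both.\<close>
  define a b c d r1 where "a = (\<exists>(A, B)\<in>P. A \<subseteq> S \<and> B \<subseteq> T)"
   and "b = (\<exists>(A, B)\<in>P. A \<subseteq> insert e S \<and> B \<subseteq> T)"
   and "c = (\<exists>(A, B)\<in>P. A \<subseteq> S \<and> B \<subseteq> insert e T)"
   and "d = (\<exists>(A, B)\<in>P. A \<subseteq> insert e S \<and> B \<subseteq> insert e T)"
   and "r1 = (\<exists>(A, B)\<in>P1. A \<subseteq> S \<and> B \<subseteq> T)"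
  have r0: "?R P0 S T \<le> of_bool a"
   unfolding P0_def a_def by auto
  have abcd: "a ==> b" "a ==> c" "b ==> d" "c ==> d"
   unfolding a_def b_def c_def d_def by blast+
  have r1: "r1 ==> b \<or> c"
  proof -
   assume r1
   then obtain A B where AB: "(A, B) \<in> P" "\<not> (e \<in> A \<and> e \<in> B)" "A - {e} \<subseteq> S" "B - {e} \<subseteq> T"
    unfolding r1_def P1_def by auto
   show "b \<or> c"
   proof (cases "e \<in> A")
    case True
    then have "b" unfolding b_def using AB by (intro bexI[of _ "(A, B)"]) auto
    then show ?thesis by simp
   next
    case False
    then have "c" unfolding c_def using AB by (intro bexI[of _ "(A, B)"]) auto
    then show ?thesis by simp
   qed
  qed
  have "(1 - p) * ?R P0 S T \<le> (1 - p) * of_bool a" using r0 assms by (intro mult_left_mono) auto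
  moreover have "p * of_bool r1 \<le> p * (of_bool (b \<or> c))" using r1 assms by (intro mult_left_mono) auto
  moreover have "(1 - p) * of_bool a + p * of_bool (b \<or> c) \<le>
   p * (p * of_bool d + (1 - p) * of_bool b) + (1 - p) * (p * of_bool c + (1 - p) * of_bool a)"
  proof -
   have pp: "0 \<le> p * (1 - p)" "0 \<le> p * p" using assms by auto
   have e1: "p * (p + (1 - p)) + (1 - p) * (p + (1 - p)) = 1" by (simp add: algebra_simps)
   show ?thesis
   proof (cases a)
    case True
    then show ?thesis using abcd e1 by simp
   next
    case a: False
    show ?thesis
    proof (cases "b \<or> c")
     \<comment> \<open>One particular copy of \<open>e\<close> is enough here. It is open with
       probability \<open>p\<close>, which is the whole left side when \<open>a\<close>
       fails.\<close>
     case bc: True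
     then have d using abcd by auto
     have "p \<le> p * p + p * (1 - p)" by (simp add: algebra_simps)
     moreover have "p \<le> p * (p + (1 - p)) + (1 - p) * p" using pp by (simp add: algebra_simps)
     ultimately show ?thesis using a bc \<open>d\<close> pp by (cases b; cases c) (auto simp: distrib_left mult.commute)
    next
     case False
     then show ?thesis using a pp assms by simp
    qed
   qed
  qed
  ultimately show ?thesis unfolding a_def b_def c_def d_def r1_def by linarith
 qed
 have "pexp p (insert e F) (?L P) = p * pexp p F (\<lambda>S. ?L P (insert e S)) + (1 - p) * pexp p F (?L P)"
  by (rule pexp_insert) (use insert in auto)
 also have "... \<le> p * pexp p F (?L P1) + (1 - p) * pexp p F (?L P0)"
  using L0 L1 assms by (intro add_mono mult_left_mono) auto
 also have "... \<le> p * pexp p F (\<lambda>S. pexp p F (?R P1 S)) + (1 - p) * pexp p F (\<lambda>S. pexp p F (?R P0 S))"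
  using insert.IH assms by (intro add_mono mult_left_mono) auto
 also have "... = pexp p F (\<lambda>S. pexp p F (\<lambda>T. (1 - p) * ?R P0 S T + p * ?R P1 S T))"
  by (simp add: pexp_add pexp_cmult)
 also have "... \<le> pexp p F (\<lambda>S. pexp p F (\<lambda>T. p * (p * ?R P (insert e S) (insert e T) + (1 - p) * ?R P (insert e S) T) +
  (1 - p) * (p * ?R P S (insert e T) + (1 - p) * ?R P S T)))"
  by (intro pexp_mono[OF assms(2,3)] key)
 also have "... = pexp p (insert e F) (\<lambda>S. pexp p (insert e F) (?R P S))"
  by (rule pexp_insert2[OF insert.hyps, symmetric])
 finally show ?case .
qed

text \<open>For a product family the expectation over two independent copies factorises.\<close>

lemma pexp_BK:
 assumes "finite F" "0 \<le> p" "p \<le> 1"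
 shows "pexp p F (\<lambda>S. of_bool (\<exists>A\<in>\<A>. \<exists>B\<in>\<B>. A \<inter> B = {} \<and> A \<union> B \<subseteq> S))
  \<le> pexp p F (\<lambda>S. of_bool (\<exists>A\<in>\<A>. A \<subseteq> S)) * pexp p F (\<lambda>S. of_bool (\<exists>B\<in>\<B>. B \<subseteq> S))"
proof -
 have "pexp p F (\<lambda>S. of_bool (\<exists>A\<in>\<A>. \<exists>B\<in>\<B>. A \<inter> B = {} \<and> A \<union> B \<subseteq> S))
  = pexp p F (\<lambda>S. of_bool (\<exists>(A, B)\<in>\<A> \<times> \<B>. A \<inter> B = {} \<and> A \<union> B \<subseteq> S))"
  by (rule pexp_cong) simp
 also have "... \<le> pexp p F (\<lambda>S. pexp p F (\<lambda>T. of_bool (\<exists>(A, B)\<in>\<A> \<times> \<B>. A \<subseteq> S \<and> B \<subseteq> T)))"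
  by (rule pexp_BK_pairs[OF assms])
 also have "... = pexp p F (\<lambda>S. pexp p F (\<lambda>T. of_bool (\<exists>A\<in>\<A>. A \<subseteq> S) * of_bool (\<exists>B\<in>\<B>. B \<subseteq> T)))"
  by (intro pexp_cong) auto
 finally show ?thesis by (simp add: pexp_cmult pexp_cmult2)
qed

lemma pexp_bij:
 assumes "inj_on g F" shows "pexp p (g ` F) f = pexp p F (\<lambda>S. f (g ` S))"
proof -
 have "inj_on (image g) (Pow F)" using assms by (simp add: inj_on_image_Pow)
 moreover have "Pow (g ` F) = image g ` Pow F" by (simp add: image_Pow_surj)
 ultimately have "pexp p (g ` F) f = (\<Sum>S\<in>Pow F. p ^ card (g ` S) * (1 - p) ^ card (g ` F - g ` S) * f (g ` S))"
  unfolding pexp_def by (simp add: sum.reindex)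
 also have "... = pexp p F (\<lambda>S. f (g ` S))"
  unfolding pexp_def
 proof (rule sum.cong[OF refl])
  fix S assume "S \<in> Pow F"
  then have S: "S \<subseteq> F" by simp
  have "g ` F - g ` S = g ` (F - S)" using assms S by (simp add: inj_on_image_set_diff)
  moreover have "card (g ` S) = card S" "card (g ` (F - S)) = card (F - S)"
   using assms S by (meson card_image inj_on_subset Diff_subset)+
  ultimately show "p ^ card (g ` S) * (1 - p) ^ card (g ` F - g ` S) * f (g ` S) =
   p ^ card S * (1 - p) ^ card (F - S) * f (g ` S)" by simp
 qed
 finally show ?thesis .
qed

text \<open>The form in which second moments are used: Cauchy-Schwarz for \<open>f\<close> times the
  indicator of \<open>f > 0\<close>.\<close>

lemma pexp_Cauchy_Schwarz:
 assumes "0 \<le> p" "p \<le> 1" "\<And>S. S \<subseteq> F ==> 0 \<le> f S"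
 shows "(pexp p F f)\<^sup>2 \<le> pexp p F (\<lambda>S. (f S)\<^sup>2) * pexp p F (\<lambda>S. of_bool (f S > 0))"
proof -
 let ?w = "\<lambda>S. p ^ card S * (1 - p) ^ card (F - S)"
 have w: "?w S \<ge> 0" for S using assms by simp
 have "pexp p F f = (\<Sum>S\<in>Pow F. (sqrt (?w S) * f S) * (sqrt (?w S) * of_bool (f S > 0)))"
  unfolding pexp_def
 proof (rule sum.cong[OF refl])
  fix S assume S: "S \<in> Pow F"
  have 1: "sqrt (?w S) * sqrt (?w S) = ?w S" using w[of S] real_sqrt_mult_self[of "?w S"] by (metis abs_of_nonneg)
  have 2: "f S * of_bool (f S > 0) = f S" using assms(3)[of S] S by (cases "f S > 0") auto
  have "(sqrt (?w S) * f S) * (sqrt (?w S) * of_bool (f S > 0)) = (sqrt (?w S) * sqrt (?w S)) * (f S * of_bool (f S > 0))"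
   by (simp only: mult_ac)
  then show "?w S * f S = (sqrt (?w S) * f S) * (sqrt (?w S) * of_bool (f S > 0))" by (simp only: 1 2)
 qed
 then have eq: "pexp p F f = (\<Sum>S\<in>Pow F. (sqrt (?w S) * f S) * (sqrt (?w S) * of_bool (f S > 0)))" .
 have "(pexp p F f)\<^sup>2 \<le> (\<Sum>S\<in>Pow F. (sqrt (?w S) * f S)\<^sup>2) * (\<Sum>S\<in>Pow F. (sqrt (?w S) * of_bool (f S > 0))\<^sup>2)"
  unfolding eq by (rule Cauchy_Schwarz_ineq_sum)
 also have "(\<Sum>S\<in>Pow F. (sqrt (?w S) * f S)\<^sup>2) = pexp p F (\<lambda>S. (f S)\<^sup>2)"
  unfolding pexp_def by (rule sum.cong[OF refl]) (use w in \<open>simp add: power_mult_distrib del: of_bool_eq(1)\<close>)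
 also have "(\<Sum>S\<in>Pow F. (sqrt (?w S) * of_bool (f S > 0))\<^sup>2) = pexp p F (\<lambda>S. of_bool (f S > 0))"
  unfolding pexp_def by (rule sum.cong[OF refl]) (use w in \<open>simp add: power_mult_distrib\<close>)
 finally show ?thesis .
qed

section \<open>Connection events and the two-point function\<close>

text \<open>Restricting the vertices instead of the edges allows half-spaces, slabs and balls to be
  used with one and the same random edge set.\<close>

definition con :: "'a set \<Rightarrow> 'a set set \<Rightarrow> 'a \<Rightarrow> 'a \<Rightarrow> bool" where
 "con U S x y \<longleftrightarrow> x \<in> U \<and> (\<lambda>u v. v \<in> U \<and> {u, v} \<in> S)\<^sup>*\<^sup>* x y"

lemma con_refl [simp]: "con U S x x \<longleftrightarrow> x \<in> U"
 by (simp add: con_def)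

lemma con_in: assumes "con U S x y" shows "x \<in> U" "y \<in> U"
proof -
 show "x \<in> U" using assms by (simp add: con_def)
 have "(\<lambda>u v. v \<in> U \<and> {u, v} \<in> S)\<^sup>*\<^sup>* x y" using assms by (simp add: con_def)
 then show "y \<in> U" using \<open>x \<in> U\<close> by (induction rule: rtranclp_induct) auto
qed

lemma con_trans: "con U S x y ==> con U S y z ==> con U S x z"
 by (auto simp: con_def)

lemma con_edge: "x \<in> U ==> y \<in> U ==> {x, y} \<in> S ==> con U S x y"
 by (auto simp: con_def)

lemma con_step: "con U S x y ==> z \<in> U ==> {y, z} \<in> S ==> con U S x z"
 using con_trans con_edge con_in(2) by metis

lemma con_mono: assumes "con U S x y" "U \<subseteq> U'" "S \<subseteq> S'" shows "con U' S' x y"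
proof -
 have "(\<lambda>u v. v \<in> U \<and> {u, v} \<in> S) \<le> (\<lambda>u v. v \<in> U' \<and> {u, v} \<in> S')" using assms by auto
 then have "(\<lambda>u v. v \<in> U \<and> {u, v} \<in> S)\<^sup>*\<^sup>* \<le> (\<lambda>u v. v \<in> U' \<and> {u, v} \<in> S')\<^sup>*\<^sup>*" by (rule rtranclp_mono)
 then show ?thesis using assms unfolding con_def by blast
qed

lemma con_induct [consumes 1, case_names refl step]:
 assumes "con U S x y" "P x" "\<And>y z. con U S x y ==> z \<in> U ==> {y, z} \<in> S ==> P y ==> P z"
 shows "P y"
proof -
 have "x \<in> U" using assms by (simp add: con_def)
 have "(\<lambda>u v. v \<in> U \<and> {u, v} \<in> S)\<^sup>*\<^sup>* x y" using assms by (simp add: con_def)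
 then show ?thesis
 proof (induction rule: rtranclp_induct)
  case (step y z)
  then show ?case using assms(3)[of y z] \<open>x \<in> U\<close> by (simp add: con_def)
 qed (rule assms)
qed

lemma con_sym: assumes "con U S x y" shows "con U S y x"
 using assms
proof (induction rule: con_induct)
 case refl then show ?case using con_in[OF assms] by simp
next
 case (step y z)
 then have "con U S z y" using con_edge[of z U y S] con_in(2)[OF step(1)] by (simp add: insert_commute)
 then show ?case using step con_trans by metis
qed

section \<open>Self-avoiding paths as edge-disjoint witnesses\<close>

fun ed :: "'a list \<Rightarrow> 'a set set" where
 "ed (x # y # zs) = insert {x, y} (ed (y # zs))"
| "ed _ = {}"

lemma finite_ed [simp]: "finite (ed xs)"
 by (induction xs rule: ed.induct) auto

lemma ed_append: "ed (as @ z # bs) = ed (as @ [z]) \<union> ed (z # bs)"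
proof (induction as)
 case (Cons a as)
 then show ?case by (cases as) auto
qed simp

lemma ed_snoc: "xs \<noteq> [] ==> ed (xs @ [v]) = insert {last xs, v} (ed xs)"
proof (induction xs)
 case (Cons a as)
 then show ?case by (cases as) auto
qed simp

lemma ed_elem: "e \<in> ed xs ==> \<exists>u v. e = {u, v} \<and> u \<in> set xs \<and> v \<in> set xs"
 by (induction xs rule: ed.induct) auto

lemma ed_elem_distinct: "e \<in> ed xs ==> distinct xs ==> \<exists>u v. e = {u, v} \<and> u \<noteq> v \<and> u \<in> set xs \<and> v \<in> set xs"
proof (induction xs rule: ed.induct)
 case (1 x y zs)
 show ?case
 proof (cases "e = {x, y}")
  case True
  then show ?thesis using 1 by (intro exI[of _ x] exI[of _ y]) auto
 next
  case False
  then have "e \<in> ed (y # zs)" using 1 by simp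
  then obtain u v where "e = {u, v} \<and> u \<noteq> v \<and> u \<in> set (y # zs) \<and> v \<in> set (y # zs)" using 1 by auto
  then show ?thesis by (intro exI[of _ u] exI[of _ v]) simp
 qed
qed auto

text \<open>An edge of a self-avoiding path has two different ends, so a common edge would give two
  common vertices.\<close>

lemma ed_disjoint:
 assumes "distinct xs" "distinct ys" "set xs \<inter> set ys \<subseteq> {z}" shows "ed xs \<inter> ed ys = {}"
proof (rule ccontr)
 assume "ed xs \<inter> ed ys \<noteq> {}"
 then obtain e where e: "e \<in> ed xs" "e \<in> ed ys" by auto
 obtain u v where uv: "e = {u, v}" "u \<noteq> v" "u \<in> set xs" "v \<in> set xs" using ed_elem_distinct[OF e(1) assms(1)] by auto
 obtain u' v' where "e = {u', v'}" "u' \<in> set ys" "v' \<in> set ys" using ed_elem[OF e(2)] by auto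
 then have "u \<in> set ys" "v \<in> set ys" using uv by auto
 then show False using uv assms(3) by auto
qed

lemma ed_vertices: "xs \<noteq> [] ==> set xs \<subseteq> insert (hd xs) (\<Union> (ed xs))"
 by (induction xs rule: ed.induct) auto

text \<open>Self-avoidance makes the two halves of a path edge-disjoint, hence admissible in the BK
  inequality. Which edges are open is kept apart, through \<open>ed\<close>.\<close>

definition spath :: "'a set \<Rightarrow> 'a list \<Rightarrow> 'a \<Rightarrow> 'a \<Rightarrow> bool" where
 "spath U xs x y \<longleftrightarrow> xs \<noteq> [] \<and> hd xs = x \<and> last xs = y \<and> distinct xs \<and> set xs \<subseteq> U"

lemma walk_con:
 assumes "xs \<noteq> []" "set xs \<subseteq> U" "ed xs \<subseteq> S" shows "con U S (hd xs) (last xs)"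
 using assms
proof (induction xs rule: ed.induct)
 case (1 x y zs)
 then have "con U S y (last (y # zs))" by simp
 moreover have "con U S x y" using 1 by (intro con_edge) auto
 ultimately show ?case using con_trans by (metis last_ConsR list.discI list.sel(1))
qed auto

lemma con_iff_spath: "con U S x y \<longleftrightarrow> (\<exists>xs. spath U xs x y \<and> ed xs \<subseteq> S)"
proof
 assume c: "con U S x y"
 then show "\<exists>xs. spath U xs x y \<and> ed xs \<subseteq> S"
 proof (induction rule: con_induct)
  case refl
  then show ?case using con_in[OF c] by (intro exI[of _ "[x]"]) (auto simp: spath_def)
 next
  case (step y z)
  then obtain xs where xs: "spath U xs x y" "ed xs \<subseteq> S" by auto
  show ?case
  proof (cases "z \<in> set xs")
   case True
   \<comment> \<open>Loop erasure on the fly: when the walk returns to \<open>z\<close>, only the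
     part up to the earlier visit is kept.\<close>
   then obtain as bs where ab: "xs = as @ z # bs" by (meson split_list)
   have "ed (as @ [z]) \<subseteq> S" using xs ab ed_append[of as z bs] by auto
   moreover have "hd (as @ [z]) = x" using xs ab by (cases as) (auto simp: spath_def)
   ultimately show ?thesis using xs ab by (intro exI[of _ "as @ [z]"]) (auto simp: spath_def)
  next
   case False
   then have "ed (xs @ [z]) \<subseteq> S" using xs step ed_snoc[of xs z] by (auto simp: spath_def)
   then show ?thesis using False xs step by (intro exI[of _ "xs @ [z]"]) (auto simp: spath_def)
  qed
 qed
next
 assume "\<exists>xs. spath U xs x y \<and> ed xs \<subseteq> S"
 then show "con U S x y" using walk_con unfolding spath_def by metis
qed

lemma spath_split:
 assumes "spath U (as @ z # bs) x y" "set (as @ [z]) \<subseteq> U1" "set (z # bs) \<subseteq> U2"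
 shows "spath U1 (as @ [z]) x z" "spath U2 (z # bs) z y" "ed (as @ [z]) \<inter> ed (z # bs) = {}"
  "ed (as @ z # bs) = ed (as @ [z]) \<union> ed (z # bs)"
proof -
 show "spath U1 (as @ [z]) x z" using assms by (cases as) (auto simp: spath_def)
 show "spath U2 (z # bs) z y" using assms by (auto simp: spath_def)
 show "ed (as @ [z]) \<inter> ed (z # bs) = {}" by (rule ed_disjoint[of _ _ z]) (use assms in \<open>auto simp: spath_def\<close>)
qed (rule ed_append)

section \<open>The two-point function in finite volume\<close>

definition cp :: "real \<Rightarrow> 'a set set \<Rightarrow> 'a set \<Rightarrow> 'a \<Rightarrow> 'a \<Rightarrow> real" where
 "cp p F U x y = pexp p F (\<lambda>S. of_bool (con U S x y))"

lemma cp_alt: "cp p F U x y = pexp p F (\<lambda>S. of_bool (\<exists>A\<in>{ed xs | xs. spath U xs x y}. A \<subseteq> S))"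
 unfolding cp_def by (rule pexp_cong) (auto simp: con_iff_spath)

lemma cp_sym: "cp p F U x y = cp p F U y x"
proof -
 have "con U S x y \<longleftrightarrow> con U S y x" for S using con_sym[of U S x y] con_sym[of U S y x] by blast
 then show ?thesis unfolding cp_def by simp
qed

lemma cp_nonneg: "0 \<le> p ==> p \<le> 1 ==> 0 \<le> cp p F U x y"
 unfolding cp_def by (rule pexp_nonneg) auto

lemma cp_le1: "0 \<le> p ==> p \<le> 1 ==> finite F ==> cp p F U x y \<le> 1"
 unfolding cp_def by (rule pexp_le1) auto

lemma of_bool_mono: "(P ==> Q) ==> (of_bool P :: real) \<le> of_bool Q"
 by auto

lemma cp_mono:
 assumes "0 \<le> p" "p \<le> 1" "finite G" "F \<subseteq> G" "U \<subseteq> U'" shows "cp p F U x y \<le> cp p G U' x y"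
proof -
 have "cp p F U x y \<le> cp p F U' x y"
  unfolding cp_def by (rule pexp_mono[OF assms(1,2)], rule of_bool_mono, erule con_mono) (use assms in auto)
 also have "... \<le> cp p G U' x y"
  unfolding cp_def by (rule pexp_mono_set[OF assms(1-4)], rule of_bool_mono, erule con_mono) auto
 finally show ?thesis .
qed

text \<open>An inequality of Simon-Lieb type. When every path can be cut at some \<open>z\<close>
  with prescribed regions on both sides, its halves are disjoint witnesses, so a union bound over
  \<open>z\<close> and BK give products.\<close>

lemma cp_split:
 assumes "finite F" "0 \<le> p" "p \<le> 1" "finite Z"
  and "\<And>xs. spath U xs x v ==> ed xs \<subseteq> F ==> \<exists>z\<in>Z. \<exists>as bs. xs = as @ z # bs \<and> set (as @ [z]) \<subseteq> U1 z \<and> set (z # bs) \<subseteq> U2 z"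
 shows "cp p F U x v \<le> (\<Sum>z\<in>Z. cp p F (U1 z) x z * cp p F (U2 z) z v)"
proof -
 let ?A = "\<lambda>z. {ed xs | xs. spath (U1 z) xs x z}" and ?B = "\<lambda>z. {ed xs | xs. spath (U2 z) xs z v}"
 have "cp p F U x v \<le> pexp p F (\<lambda>S. \<Sum>z\<in>Z. of_bool (\<exists>A\<in>?A z. \<exists>B\<in>?B z. A \<inter> B = {} \<and> A \<union> B \<subseteq> S))"
  unfolding cp_def
 proof (rule pexp_mono[OF assms(2,3)])
  fix S assume S: "S \<subseteq> F"
  show "of_bool (con U S x v) \<le> (\<Sum>z\<in>Z. of_bool (\<exists>A\<in>?A z. \<exists>B\<in>?B z. A \<inter> B = {} \<and> A \<union> B \<subseteq> S) :: real)"
  proof (cases "con U S x v")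
   case True
   then obtain xs where xs: "spath U xs x v" "ed xs \<subseteq> S" by (auto simp: con_iff_spath)
   obtain z as bs where z: "z \<in> Z" "xs = as @ z # bs" "set (as @ [z]) \<subseteq> U1 z" "set (z # bs) \<subseteq> U2 z"
    using assms(5)[OF xs(1)] xs(2) S by (meson order_trans)
   note sp = spath_split[OF xs(1)[unfolded z(2)] z(3,4)]
   have "\<exists>A\<in>?A z. \<exists>B\<in>?B z. A \<inter> B = {} \<and> A \<union> B \<subseteq> S"
    using sp xs(2) unfolding z(2)
    by (intro bexI[of _ "ed (as @ [z])"] bexI[of _ "ed (z # bs)"]) auto
   then have "1 \<le> (\<Sum>z\<in>{z}. of_bool (\<exists>A\<in>?A z. \<exists>B\<in>?B z. A \<inter> B = {} \<and> A \<union> B \<subseteq> S) :: real)" by simp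
   also have "... \<le> (\<Sum>z\<in>Z. of_bool (\<exists>A\<in>?A z. \<exists>B\<in>?B z. A \<inter> B = {} \<and> A \<union> B \<subseteq> S) :: real)"
    by (rule sum_mono2) (use z assms in auto)
   finally show ?thesis using True by simp
  next
   case False
   then show ?thesis by (simp add: sum_nonneg)
  qed
 qed
 also have "... = (\<Sum>z\<in>Z. pexp p F (\<lambda>S. of_bool (\<exists>A\<in>?A z. \<exists>B\<in>?B z. A \<inter> B = {} \<and> A \<union> B \<subseteq> S)))"
  by (rule pexp_sum)
 also have "... \<le> (\<Sum>z\<in>Z. cp p F (U1 z) x z * cp p F (U2 z) z v)"
  unfolding cp_alt by (intro sum_mono pexp_BK assms)
 finally show ?thesis .
qed

lemma spath_first:
 assumes "spath U xs x y" "z \<in> set xs" "P z"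
 obtains as w bs where "xs = as @ w # bs" "P w" "\<forall>a\<in>set as. \<not> P a"
proof -
 have "\<exists>a\<in>set xs. P a" using assms by auto
 then show thesis using split_list_first_prop[of xs P] that by metis
qed

text \<open>The tree-graph inequality of Aizenman and Newman: \<open>w\<close> is the branch point,
  and its three legs occur disjointly. BK is applied twice, first to the leg towards
  \<open>x\<close> against the other two taken together (\<open>?D\<close>).\<close>

lemma cp_tree:
 assumes "finite F" "0 \<le> p" "p \<le> 1" "finite Z" "\<And>xs. spath U xs x v ==> ed xs \<subseteq> F ==> set xs \<subseteq> Z"
 shows "pexp p F (\<lambda>S. of_bool (con U S x v \<and> con U S x v')) \<le> (\<Sum>w\<in>Z. cp p F U x w * (cp p F U w v * cp p F U v' w))"
proof -
 let ?A = "\<lambda>w. {ed xs | xs. spath U xs x w}" and ?B = "\<lambda>w. {ed xs | xs. spath U xs w v}" and ?C = "\<lambda>w. {ed xs | xs. spath U xs v' w}"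
 let ?D = "\<lambda>w. {B \<union> C | B C. B \<in> ?B w \<and> C \<in> ?C w \<and> B \<inter> C = {}}"
 have "pexp p F (\<lambda>S. of_bool (con U S x v \<and> con U S x v')) \<le>
  pexp p F (\<lambda>S. \<Sum>w\<in>Z. of_bool (\<exists>A\<in>?A w. \<exists>D\<in>?D w. A \<inter> D = {} \<and> A \<union> D \<subseteq> S))"
 proof (rule pexp_mono[OF assms(2,3)])
  fix S assume S: "S \<subseteq> F"
  show "of_bool (con U S x v \<and> con U S x v') \<le> (\<Sum>w\<in>Z. of_bool (\<exists>A\<in>?A w. \<exists>D\<in>?D w. A \<inter> D = {} \<and> A \<union> D \<subseteq> S) :: real)"
  proof (cases "con U S x v \<and> con U S x v'")
   case True
   then obtain xs where xs: "spath U xs x v" "ed xs \<subseteq> S" by (auto simp: con_iff_spath)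
   have "con U S v' x" using True con_sym by metis
   then obtain ys where ys: "spath U ys v' x" "ed ys \<subseteq> S" by (auto simp: con_iff_spath)
   have "x \<in> set ys" "x \<in> set xs" using xs ys unfolding spath_def by (metis hd_in_set last_in_set)+
   \<comment> \<open>The branch point is the first vertex of the path from \<open>v'\<close> to
     \<open>x\<close> that lies on the path from \<open>x\<close> to \<open>v\<close>.\<close>
   then obtain cs w ds where w: "ys = cs @ w # ds" "w \<in> set xs" "\<forall>a\<in>set cs. a \<notin> set xs"
    using spath_first[OF ys(1), of x "\<lambda>a. a \<in> set xs"] by metis
   obtain as bs where ab: "xs = as @ w # bs" using w(2) by (meson split_list)
   have U: "set xs \<subseteq> U" "set ys \<subseteq> U" using xs ys by (auto simp: spath_def)
   have sx: "set (as @ [w]) \<subseteq> U" "set (w # bs) \<subseteq> U" using U(1) unfolding ab by auto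
   have sy: "set (cs @ [w]) \<subseteq> U" "set (w # ds) \<subseteq> U" using U(2) unfolding w(1) by auto
   note 1 = spath_split[OF xs(1)[unfolded ab] sx]
   note 2 = spath_split[OF ys(1)[unfolded w(1)] sy]
   have dd: "distinct xs" "distinct ys" using xs ys by (auto simp: spath_def)
   have i1: "ed (w # bs) \<inter> ed (cs @ [w]) = {}"
    by (rule ed_disjoint[of _ _ w]) (use dd w ab in auto)
   have i2: "ed (as @ [w]) \<inter> ed (cs @ [w]) = {}"
    by (rule ed_disjoint[of _ _ w]) (use dd w ab in auto)
   have "ed (w # bs) \<union> ed (cs @ [w]) \<in> ?D w" using 1 2 i1 by blast
   moreover have "ed (as @ [w]) \<in> ?A w" using 1 by blast
   moreover have "ed (as @ [w]) \<inter> (ed (w # bs) \<union> ed (cs @ [w])) = {}" using 1 i2 by blast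
   moreover have "ed (as @ [w]) \<union> (ed (w # bs) \<union> ed (cs @ [w])) \<subseteq> S"
    using xs(2) ys(2) 1(4) 2(4) unfolding ab w(1) by blast
   ultimately have "\<exists>A\<in>?A w. \<exists>D\<in>?D w. A \<inter> D = {} \<and> A \<union> D \<subseteq> S" by blast
   then have "1 \<le> (\<Sum>w\<in>{w}. of_bool (\<exists>A\<in>?A w. \<exists>D\<in>?D w. A \<inter> D = {} \<and> A \<union> D \<subseteq> S) :: real)" by simp
   also have "... \<le> (\<Sum>w\<in>Z. of_bool (\<exists>A\<in>?A w. \<exists>D\<in>?D w. A \<inter> D = {} \<and> A \<union> D \<subseteq> S) :: real)"
    by (rule sum_mono2) (use w assms(4) assms(5)[OF xs(1)] xs(2) S in auto)
   finally show ?thesis using True by simp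
  next
   case False
   then have "of_bool (con U S x v \<and> con U S x v') = (0::real)" by simp
   then show ?thesis by (simp only:) (rule sum_nonneg, simp)
  qed
 qed
 also have "... = (\<Sum>w\<in>Z. pexp p F (\<lambda>S. of_bool (\<exists>A\<in>?A w. \<exists>D\<in>?D w. A \<inter> D = {} \<and> A \<union> D \<subseteq> S)))"
  by (rule pexp_sum)
 also have "... \<le> (\<Sum>w\<in>Z. pexp p F (\<lambda>S. of_bool (\<exists>A\<in>?A w. A \<subseteq> S)) * pexp p F (\<lambda>S. of_bool (\<exists>D\<in>?D w. D \<subseteq> S)))"
  by (intro sum_mono pexp_BK assms)
 also have "... \<le> (\<Sum>w\<in>Z. cp p F U x w * (cp p F U w v * cp p F U v' w))"
 proof (intro sum_mono mult_mono)
  fix w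
  have "pexp p F (\<lambda>S. of_bool (\<exists>D\<in>?D w. D \<subseteq> S)) = pexp p F (\<lambda>S. of_bool (\<exists>B\<in>?B w. \<exists>C\<in>?C w. B \<inter> C = {} \<and> B \<union> C \<subseteq> S))"
   by (intro pexp_cong arg_cong[where f=of_bool]) blast
  also have "... \<le> cp p F U w v * cp p F U v' w"
   unfolding cp_alt by (intro pexp_BK assms)
  finally show "pexp p F (\<lambda>S. of_bool (\<exists>D\<in>?D w. D \<subseteq> S)) \<le> cp p F U w v * cp p F U v' w" .
 qed (auto simp: cp_alt intro!: pexp_nonneg assms)
 finally show ?thesis .
qed

section \<open>Sums with values in the extended nonnegative reals, and the two-point function in
  infinite volume\<close>

abbreviation nsum :: "('a \<Rightarrow> ennreal) \<Rightarrow> ennreal" where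
 "nsum f \<equiv> (\<integral>\<^sup>+z. f z \<partial>count_space UNIV)"

lemma nsum_mono: "(\<And>z. f z \<le> g z) ==> nsum f \<le> nsum g"
 by (rule nn_integral_mono) simp

lemma nsum_add: "nsum (\<lambda>z. f z + g z) = nsum f + nsum g"
 by (rule nn_integral_add) auto

lemma nsum_cmult: "nsum (\<lambda>z. c * f z) = c * nsum f"
 by (rule nn_integral_cmult) auto

lemma nsum_multc: "nsum (\<lambda>z. f z * c) = nsum f * c"
 by (rule nn_integral_multc) auto

lemma nsum_swap: "nsum (\<lambda>x. nsum (\<lambda>y. f x y)) = nsum (\<lambda>y. nsum (\<lambda>x. f x y))"
 using nn_integral_fst_count_space[of "\<lambda>(x, y). f x y"] nn_integral_snd_count_space[of "\<lambda>(x, y). f x y"] by simp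

lemma nsum_finite: "finite A ==> (\<And>z. z \<notin> A ==> f z = 0) ==> nsum f = (\<Sum>z\<in>A. f z)"
 by (rule nn_integral_count_space') auto

lemma sum_le_nsum: assumes "finite A" shows "(\<Sum>z\<in>A. f z) \<le> nsum f"
proof -
 have "(\<Sum>z\<in>A. f z) = nsum (\<lambda>z. f z * indicator A z)"
  using assms by (subst nsum_finite[of A]) (auto simp: indicator_def)
 also have "... \<le> nsum f" by (rule nsum_mono) (auto simp: indicator_def)
 finally show ?thesis .
qed

text \<open>The index type may be uncountable. The sets where \<open>f\<close> is at least 1/(n+1)
  are finite because finite sums stay below \<open>c\<close>; they exhaust the support, and monotone
  convergence applies.\<close>

lemma nsum_le:
 assumes "\<And>A. finite A ==> (\<Sum>z\<in>A. f z) \<le> c" shows "nsum f \<le> c"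
proof (cases "c = \<infinity>")
 case False
 define B where "B n = {z. ennreal (1 / Suc n) \<le> f z}" for n :: nat
 have fin: "finite (B n)" for n
 proof (rule ccontr)
  assume inf: "infinite (B n)"
  obtain r where r: "c = ennreal r" "0 \<le> r" using False by (cases c) auto
  obtain m :: nat where m: "r * Suc n < m" using reals_Archimedean2 by blast
  obtain A where A: "A \<subseteq> B n" "finite A" "card A = m" using infinite_arbitrarily_large[OF inf] by metis
  have "ennreal (m * (1 / Suc n)) = (\<Sum>z\<in>A. ennreal (1 / Suc n))"
   using A by (simp add: ennreal_mult'[symmetric] ennreal_of_nat_eq_real_of_nat)
  also have "... \<le> (\<Sum>z\<in>A. f z)" using A by (intro sum_mono) (auto simp: B_def)
  also have "... \<le> c" by (rule assms[OF A(2)])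
  finally have "m * (1 / Suc n) \<le> r" using r by (simp add: ennreal_le_iff)
  then show False using m by (simp add: field_simps)
 qed
 have inc: "incseq B"
 proof (rule incseq_SucI, rule subsetI)
  fix n z assume "z \<in> B n"
  moreover have "ennreal (1 / Suc (Suc n)) \<le> ennreal (1 / Suc n)" by (intro ennreal_leI divide_left_mono) auto
  ultimately show "z \<in> B (Suc n)" unfolding B_def using order_trans by blast
 qed
 have eq: "f z = (SUP n. f z * indicator (B n) z)" for z
 proof (cases "f z = 0")
  case False
  have "\<exists>n. z \<in> B n"
  proof (cases "f z")
   case (real r)
   then have "0 < r" using False by auto
   then obtain n where "1 / Suc n < r" using nat_approx_posE by blast
   then show ?thesis unfolding B_def using real by (intro exI[of _ n]) (simp add: ennreal_leI)
  qed (auto simp: B_def)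
  then obtain n where n: "z \<in> B n" ..
  show ?thesis
  proof (rule antisym)
   have "f z = f z * indicator (B n) z" using n by simp
   also have "... \<le> (SUP n. f z * indicator (B n) z)" by (rule SUP_upper) simp
   finally show "f z \<le> (SUP n. f z * indicator (B n) z)" .
   show "(SUP n. f z * indicator (B n) z) \<le> f z" by (rule SUP_least) (auto simp: indicator_def)
  qed
 qed simp
 have "nsum f = nsum (\<lambda>z. SUP n. f z * indicator (B n) z)" using eq by simp
 also have "... = (SUP n. nsum (\<lambda>z. f z * indicator (B n) z))"
 proof (rule nn_integral_monotone_convergence_SUP)
  show "incseq (\<lambda>n z. f z * indicator (B n) z)"
   using inc by (auto simp: incseq_def le_fun_def indicator_def intro!: mult_left_mono)
 qed simp
 also have "... \<le> c"
 proof (rule SUP_least)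
  fix n
  have "nsum (\<lambda>z. f z * indicator (B n) z) = (\<Sum>z\<in>B n. f z * indicator (B n) z)" by (rule nsum_finite[OF fin]) auto
  also have "... = (\<Sum>z\<in>B n. f z)" by (rule sum.cong) auto
  finally show "nsum (\<lambda>z. f z * indicator (B n) z) \<le> c" using assms[OF fin] by simp
 qed
 finally show ?thesis .
qed simp

text \<open>Taking the supremum over finite volumes keeps the infinite product measure out of the
  estimates. For \<open>p\<close> in [0,1] the family is directed, since \<open>cp\<close> grows
  with \<open>F\<close>.\<close>

definition tau :: "'a set set \<Rightarrow> real \<Rightarrow> 'a set \<Rightarrow> 'a \<Rightarrow> 'a \<Rightarrow> ennreal" where
 "tau E p U x y = (SUP F\<in>{F. finite F \<and> F \<subseteq> E}. ennreal (cp p F U x y))"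

lemma cp_le_tau: "finite F ==> F \<subseteq> E ==> ennreal (cp p F U x y) \<le> tau E p U x y"
 unfolding tau_def by (rule SUP_upper) auto

lemma tau_le: "(\<And>F. finite F ==> F \<subseteq> E ==> ennreal (cp p F U x y) \<le> c) ==> tau E p U x y \<le> c"
 unfolding tau_def by (rule SUP_least) auto

lemma tau_sym: "tau E p U x y = tau E p U y x"
 unfolding tau_def using cp_sym by metis

lemma tau_mono: assumes "0 \<le> p" "p \<le> 1" "U \<subseteq> U'" shows "tau E p U x y \<le> tau E p U' x y"
proof (rule tau_le)
 fix F assume F: "finite F" "F \<subseteq> E"
 have "ennreal (cp p F U x y) \<le> ennreal (cp p F U' x y)" by (intro ennreal_leI cp_mono) (use assms F in auto)
 then show "ennreal (cp p F U x y) \<le> tau E p U' x y" using cp_le_tau[OF F] order_trans by blast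
qed

lemma tau_split:
 assumes "0 \<le> p" "p \<le> 1" "\<And>e. e \<in> E ==> finite e"
  and "\<And>xs. spath U xs x v ==> ed xs \<subseteq> E ==> \<exists>z. Q z \<and> (\<exists>as bs. xs = as @ z # bs \<and> set (as @ [z]) \<subseteq> U1 z \<and> set (z # bs) \<subseteq> U2 z)"
 shows "tau E p U x v \<le> nsum (\<lambda>z. of_bool (Q z) * (tau E p (U1 z) x z * tau E p (U2 z) z v))"
proof (rule tau_le)
 fix F assume F: "finite F" "F \<subseteq> E"
 \<comment> \<open>A path in \<open>F\<close> visits only ends of edges of \<open>F\<close>, apart
   from the trivial path at \<open>x\<close>; so the cut points range over a finite set.\<close>
 define Z where "Z = {z \<in> insert x (\<Union>F). Q z}"
 have "finite (insert x (\<Union>F))" using F assms(3) by auto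
 then have Z: "finite Z" unfolding Z_def by (rule rev_finite_subset) auto
 have "cp p F U x v \<le> (\<Sum>z\<in>Z. cp p F (U1 z) x z * cp p F (U2 z) z v)"
 proof (rule cp_split[OF F(1) assms(1,2) Z])
  fix xs assume xs: "spath U xs x v" "ed xs \<subseteq> F"
  then obtain z as bs where z: "Q z" "xs = as @ z # bs" "set (as @ [z]) \<subseteq> U1 z \<and> set (z # bs) \<subseteq> U2 z"
   using assms(4)[OF xs(1)] F(2) by (meson order_trans)
  have "z \<in> set xs" using z by simp
  also have "set xs \<subseteq> insert x (\<Union>F)" using ed_vertices[of xs] xs by (auto simp: spath_def)
  finally have "z \<in> Z" using z(1) by (simp add: Z_def)
  then show "\<exists>z\<in>Z. \<exists>as bs. xs = as @ z # bs \<and> set (as @ [z]) \<subseteq> U1 z \<and> set (z # bs) \<subseteq> U2 z" using z by blast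
 qed
 then have "ennreal (cp p F U x v) \<le> ennreal (\<Sum>z\<in>Z. cp p F (U1 z) x z * cp p F (U2 z) z v)" by (rule ennreal_leI)
 also have "... = (\<Sum>z\<in>Z. ennreal (cp p F (U1 z) x z) * ennreal (cp p F (U2 z) z v))"
  by (subst sum_ennreal[symmetric]) (auto intro!: sum.cong mult_nonneg_nonneg cp_nonneg ennreal_mult simp: assms)
 also have "... \<le> (\<Sum>z\<in>Z. of_bool (Q z) * (tau E p (U1 z) x z * tau E p (U2 z) z v))"
  by (intro sum_mono) (auto simp: Z_def intro!: mult_mono cp_le_tau F)
 also have "... \<le> nsum (\<lambda>z. of_bool (Q z) * (tau E p (U1 z) x z * tau E p (U2 z) z v))"
  by (rule sum_le_nsum[OF Z])
 finally show "ennreal (cp p F U x v) \<le> nsum (\<lambda>z. of_bool (Q z) * (tau E p (U1 z) x z * tau E p (U2 z) z v))" .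
qed

section \<open>Groups acting on a graph and mass transport\<close>

text \<open>Only the pointwise action on \<open>V\<close> is recorded, with the group laws as
  equations between values and quasi-transitivity as a finite set of representatives. The analysis
  then deals with plain functions instead of elements of \<open>BijGroup V\<close>.\<close>

locale gact =
 fixes V :: "'a set" and E :: "'a set set" and \<Gamma> :: "('a \<Rightarrow> 'a) set"
 assumes simple: "e \<in> E ==> \<exists>u v. e = {u, v} \<and> u \<noteq> v \<and> u \<in> V \<and> v \<in> V"
  and connected: "x \<in> V ==> y \<in> V ==> joined E x y"
  and locally_finite: "x \<in> V ==> finite {e \<in> E. x \<in> e}"
  and act_V: "g \<in> \<Gamma> ==> x \<in> V ==> g x \<in> V"
  and act_E: "g \<in> \<Gamma> ==> x \<in> V ==> y \<in> V ==> {g x, g y} \<in> E \<longleftrightarrow> {x, y} \<in> E"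
  and act_id: "\<exists>e\<in>\<Gamma>. \<forall>x\<in>V. e x = x"
  and act_comp: "g \<in> \<Gamma> ==> k \<in> \<Gamma> ==> \<exists>l\<in>\<Gamma>. \<forall>x\<in>V. l x = g (k x)"
  and act_inv: "g \<in> \<Gamma> ==> \<exists>l\<in>\<Gamma>. \<forall>x\<in>V. l (g x) = x \<and> g (l x) = x"
  and quasi: "\<exists>R. finite R \<and> R \<subseteq> V \<and> (\<forall>x\<in>V. \<exists>r\<in>R. \<exists>g\<in>\<Gamma>. x = g r)"
begin

lemma edge_V: "{x, y} \<in> E ==> x \<in> V \<and> y \<in> V \<and> x \<noteq> y"
 using simple[of "{x, y}"] by (auto simp: doubleton_eq_iff)

lemma finite_edge: "e \<in> E ==> finite e"
 using simple[of e] by auto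

definition nb :: "'a \<Rightarrow> 'a set" where "nb x = {y. {x, y} \<in> E}"

lemma finite_nb: "x \<in> V ==> finite (nb x)"
proof -
 assume x: "x \<in> V"
 have "nb x \<subseteq> \<Union> {e \<in> E. x \<in> e}" unfolding nb_def by auto
 moreover have "finite (\<Union> {e \<in> E. x \<in> e})" using locally_finite[OF x] finite_edge by auto
 ultimately show ?thesis by (rule finite_subset)
qed

lemma nb_V: "y \<in> nb x ==> y \<in> V" using edge_V by (auto simp: nb_def)

lemma nb_sym: "y \<in> nb x \<longleftrightarrow> x \<in> nb y" by (simp add: nb_def insert_commute)

lemma act_inj: "g \<in> \<Gamma> ==> x \<in> V ==> y \<in> V ==> g x = g y ==> x = y"
 using act_inv[of g] by metis

lemma act_nb: assumes "g \<in> \<Gamma>" "x \<in> V" shows "nb (g x) = g ` nb x"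
proof
 obtain l where l: "l \<in> \<Gamma>" "\<forall>x\<in>V. l (g x) = x \<and> g (l x) = x" using act_inv[OF assms(1)] by auto
 show "g ` nb x \<subseteq> nb (g x)" using act_E[OF assms] nb_V unfolding nb_def using edge_V by blast
 show "nb (g x) \<subseteq> g ` nb x"
 proof
  fix y assume y: "y \<in> nb (g x)"
  then have "y \<in> V" by (rule nb_V)
  then have "y = g (l y)" "l y \<in> V" using l act_V by auto
  then show "y \<in> g ` nb x" using y act_E[OF assms, of "l y"] by (auto simp: nb_def)
 qed
qed

primrec bal :: "nat \<Rightarrow> 'a \<Rightarrow> 'a set" where
 "bal 0 x = {x}"
| "bal (Suc n) x = bal n x \<union> (\<Union>u\<in>bal n x. nb u)"

lemma bal_V: "x \<in> V ==> bal n x \<subseteq> V"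
 using nb_V by (induction n) auto

lemma finite_bal: "x \<in> V ==> finite (bal n x)"
 by (induction n) (use bal_V finite_nb in auto)

lemma bal_self: "x \<in> bal n x" by (induction n) auto

lemma bal_mono: "n \<le> m ==> bal n x \<subseteq> bal m x"
 by (induction m rule: dec_induct) auto

lemma bal_trans: "y \<in> bal n x ==> z \<in> bal m y ==> z \<in> bal (n + m) x"
 by (induction m arbitrary: z) auto

lemma bal_sym: "y \<in> bal n x ==> x \<in> bal n y"
proof (induction n arbitrary: y)
 case (Suc n)
 show ?case
 proof (cases "y \<in> bal n x")
  case True
  then show ?thesis using Suc.IH by simp
 next
  case False
  then obtain u where u: "u \<in> bal n x" "y \<in> nb u" using Suc.prems by auto
  then have "u \<in> bal 1 y" using nb_sym by auto
  moreover have "x \<in> bal n u" using Suc.IH u by simp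
  ultimately have "x \<in> bal (1 + n) y" using bal_trans by blast
  then show ?thesis by simp
 qed
qed simp

lemma bal_ex: assumes "x \<in> V" "y \<in> V" shows "\<exists>n. y \<in> bal n x"
proof -
 have "(\<lambda>u v. {u, v} \<in> E)\<^sup>*\<^sup>* x y" using connected[OF assms] by (simp add: joined_def)
 then show ?thesis
 proof (induction rule: rtranclp_induct)
  case base then show ?case by (intro exI[of _ 0]) simp
 next
  case (step y z)
  then obtain n where "y \<in> bal n x" by auto
  then have "z \<in> bal (Suc n) x" using step by (auto simp: nb_def)
  then show ?case by blast
 qed
qed

lemma act_bal: "g \<in> \<Gamma> ==> x \<in> V ==> bal n (g x) = g ` bal n x"
proof (induction n)
 case (Suc n)
 have "(\<Union>u\<in>bal n (g x). nb u) = (\<Union>u\<in>bal n x. nb (g u))" using Suc by auto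
 also have "... = (\<Union>u\<in>bal n x. g ` nb u)"
  using act_nb[OF Suc(2)] bal_V[OF Suc(3)] by (intro SUP_cong) auto
 finally show ?case using Suc by auto
qed simp

lemma bal_walk:
 "y \<in> bal n x ==> \<exists>k\<le>n. \<exists>w. w 0 = x \<and> w k = y \<and> (\<forall>i<k. {w i, w (Suc i)} \<in> E)"
proof (induction n arbitrary: y)
 case 0 then show ?case by (intro exI[of _ 0]) (auto intro!: exI[of _ "\<lambda>_. x"])
next
 case (Suc n)
 show ?case
 proof (cases "y \<in> bal n x")
  case True
  then obtain k where "k \<le> n" "\<exists>w. w 0 = x \<and> w k = y \<and> (\<forall>i<k. {w i, w (Suc i)} \<in> E)" using Suc.IH by blast
  then show ?thesis by (intro exI[of _ k]) auto
 next
  case False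
  then obtain u where u: "u \<in> bal n x" "y \<in> nb u" using Suc.prems by auto
  obtain k w where k: "k \<le> n" "w 0 = x" "w k = u" "\<forall>i<k. {w i, w (Suc i)} \<in> E" using Suc.IH[OF u(1)] by blast
  have "\<forall>i<Suc k. {(w(Suc k := y)) i, (w(Suc k := y)) (Suc i)} \<in> E"
   using k u by (auto simp: less_Suc_eq nb_def)
  then show ?thesis using k by (intro exI[of _ "Suc k"] conjI exI[of _ "w(Suc k := y)"]) auto
 qed
qed

lemma walk_bal: "(\<forall>i<k. {w i, w (Suc i)} \<in> E) ==> i \<le> j ==> j \<le> k ==> w j \<in> bal (j - i) (w i)"
proof (induction j)
 case (Suc j)
 show ?case
 proof (cases "i = Suc j")
  case False
  then have "w j \<in> bal (j - i) (w i)" "w (Suc j) \<in> nb (w j)" using Suc by (auto simp: nb_def)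
  then have "w (Suc j) \<in> bal (Suc (j - i)) (w i)" by auto
  then show ?thesis using False Suc by (simp add: Suc_diff_le)
 qed simp
qed simp

section \<open>Stabilizer orbits, the modular weight and mass transport\<close>

definition orb :: "'a \<Rightarrow> 'a set" where "orb x = {g x | g. g \<in> \<Gamma>}"
text \<open>\<open>so x y\<close> is the orbit of \<open>y\<close> under the stabilizer of
  \<open>x\<close>; \<open>so2\<close> uses the common stabilizer of two vertices, and
  \<open>sop\<close> is the orbit of a pair. Counting \<open>sop\<close> in two ways yields all
  needed relations between indices of stabilizers.\<close>

definition so :: "'a \<Rightarrow> 'a \<Rightarrow> 'a set" where "so x y = {g y | g. g \<in> \<Gamma> \<and> g x = x}"
definition so2 :: "'a \<Rightarrow> 'a \<Rightarrow> 'a \<Rightarrow> 'a set" where "so2 x y z = {g z | g. g \<in> \<Gamma> \<and> g x = x \<and> g y = y}"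
definition sop :: "'a \<Rightarrow> 'a \<Rightarrow> 'a \<Rightarrow> ('a \<times> 'a) set" where "sop x y z = {(g y, g z) | g. g \<in> \<Gamma> \<and> g x = x}"

lemma orb_self: "x \<in> V ==> x \<in> orb x"
proof -
 assume x: "x \<in> V"
 obtain e where "e \<in> \<Gamma>" "\<forall>x\<in>V. e x = x" using act_id by auto
 then show ?thesis unfolding orb_def using x by (intro CollectI exI[of _ e]) auto
qed

lemma orb_V: "x \<in> V ==> orb x \<subseteq> V"
 using act_V unfolding orb_def by auto

lemma orb_sym: "x \<in> V ==> y \<in> orb x ==> x \<in> orb y"
 using act_inv unfolding orb_def by (smt (verit) mem_Collect_eq)

lemma orb_trans: "x \<in> V ==> y \<in> orb x ==> z \<in> orb y ==> z \<in> orb x"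
 using act_comp unfolding orb_def by (smt (verit) mem_Collect_eq)

lemma orb_act: "x \<in> V ==> g \<in> \<Gamma> ==> y \<in> orb x ==> g y \<in> orb x"
 using orb_trans unfolding orb_def by blast

lemma so_self: "x \<in> V ==> y \<in> V ==> y \<in> so x y"
proof -
 assume x: "x \<in> V" "y \<in> V"
 obtain e where "e \<in> \<Gamma>" "\<forall>x\<in>V. e x = x" using act_id by auto
 then show ?thesis unfolding so_def using x by (intro CollectI exI[of _ e]) auto
qed

lemma finite_so: assumes "x \<in> V" "y \<in> V" shows "finite (so x y)"
proof -
 obtain n where n: "y \<in> bal n x" using bal_ex[OF assms] by auto
 have "so x y \<subseteq> bal n x"
 proof
  fix z assume "z \<in> so x y"
  then obtain g where "g \<in> \<Gamma>" "g x = x" "z = g y" unfolding so_def by auto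
  then show "z \<in> bal n x" using act_bal[of g x n] assms n by auto
 qed
 then show ?thesis using finite_bal[OF assms(1)] finite_subset by blast
qed

lemma card_so_pos: "x \<in> V ==> y \<in> V ==> 0 < card (so x y)"
 using finite_so so_self by (metis card_gt_0_iff empty_iff)

lemma so2_sub: "so2 x y z \<subseteq> so x z" unfolding so2_def so_def by auto
lemma so2_comm: "so2 x y z = so2 y x z" unfolding so2_def by auto
lemma so2_self: "z \<in> V ==> x \<in> V ==> y \<in> V ==> z \<in> so2 x y z"
proof -
 assume x: "z \<in> V" "x \<in> V" "y \<in> V"
 obtain e where "e \<in> \<Gamma>" "\<forall>x\<in>V. e x = x" using act_id by auto
 then show ?thesis unfolding so2_def using x by (intro CollectI exI[of _ e]) auto
qed

lemma card_so2_pos: "x \<in> V ==> y \<in> V ==> z \<in> V ==> 0 < card (so2 x y z)"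
 using finite_subset[OF so2_sub finite_so] so2_self by (metis card_gt_0_iff empty_iff)

text \<open>Orbit-stabilizer count: the fibre over \<open>g y\<close> in the orbit of pairs is the
  image of \<open>so2 x y z\<close> under \<open>g\<close>.\<close>

lemma card_sop:
 assumes "x \<in> V" "y \<in> V" "z \<in> V" shows "card (sop x y z) = card (so x y) * card (so2 x y z)"
proof -
 define fib where "fib y' = {z'. (y', z') \<in> sop x y z}" for y'
 have fib: "card (fib y') = card (so2 x y z) \<and> finite (fib y')" if y': "y' \<in> so x y" for y'
 proof -
  obtain g where g: "g \<in> \<Gamma>" "g x = x" "y' = g y" using y' unfolding so_def by auto
  obtain l where l: "l \<in> \<Gamma>" "\<forall>x\<in>V. l (g x) = x \<and> g (l x) = x" using act_inv[OF g(1)] by auto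
  have lx: "l x = x" using l g assms by metis
  have "fib y' = g ` so2 x y z"
  proof
   show "fib y' \<subseteq> g ` so2 x y z"
   proof
    fix z' assume "z' \<in> fib y'"
    then obtain k where k: "k \<in> \<Gamma>" "k x = x" "k y = g y" "z' = k z" unfolding fib_def sop_def g by auto
    obtain q where q: "q \<in> \<Gamma>" "\<forall>x\<in>V. q x = l (k x)" using act_comp[OF l(1) k(1)] by auto
    have "q x = x" "q y = y" using q k l lx assms by auto
    then have "q z \<in> so2 x y z" unfolding so2_def using q(1) by (intro CollectI exI[of _ q]) auto
    moreover have "g (q z) = z'" using q k l assms act_V by auto
    ultimately show "z' \<in> g ` so2 x y z" by blast
   qed
   show "g ` so2 x y z \<subseteq> fib y'"
   proof
    fix z' assume "z' \<in> g ` so2 x y z"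
    then obtain k where k: "k \<in> \<Gamma>" "k x = x" "k y = y" "z' = g (k z)" unfolding so2_def by auto
    obtain q where q: "q \<in> \<Gamma>" "\<forall>x\<in>V. q x = g (k x)" using act_comp[OF g(1) k(1)] by auto
    then have "q x = x" "q y = y'" "q z = z'" using k g assms by auto
    then show "z' \<in> fib y'" unfolding fib_def sop_def using q(1) by blast
   qed
  qed
  moreover have "so2 x y z \<subseteq> V" unfolding so2_def using act_V assms by auto
  then have "inj_on g (so2 x y z)" using act_inj[OF g(1)] unfolding inj_on_def by blast
  moreover have "finite (so2 x y z)" using finite_subset[OF so2_sub finite_so] assms by auto
  ultimately show ?thesis by (simp add: card_image)
 qed
 have "sop x y z = Sigma (so x y) fib" unfolding fib_def sop_def so_def by auto
 then have "card (sop x y z) = (\<Sum>y'\<in>so x y. card (fib y'))"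
  using fib finite_so[OF assms(1,2)] by simp
 then show ?thesis using fib by simp
qed

lemma card_sop_swap: "card (sop x y z) = card (sop x z y)"
proof -
 have "sop x z y = prod.swap ` sop x y z" unfolding sop_def by force
 then show ?thesis by (simp add: card_image)
qed

lemma so_act: assumes "g \<in> \<Gamma>" "x \<in> V" "y \<in> V" shows "card (so (g x) (g y)) = card (so x y)"
proof -
 obtain l where l: "l \<in> \<Gamma>" "\<forall>x\<in>V. l (g x) = x \<and> g (l x) = x" using act_inv[OF assms(1)] by auto
 have "so (g x) (g y) = g ` so x y"
 proof
  show "so (g x) (g y) \<subseteq> g ` so x y"
  proof
   fix z assume "z \<in> so (g x) (g y)"
   then obtain k where k: "k \<in> \<Gamma>" "k (g x) = g x" "z = k (g y)" unfolding so_def by auto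
   obtain q where q: "q \<in> \<Gamma>" "\<forall>x\<in>V. q x = k (g x)" using act_comp[OF k(1) assms(1)] by auto
   obtain r where r: "r \<in> \<Gamma>" "\<forall>x\<in>V. r x = l (q x)" using act_comp[OF l(1) q(1)] by auto
   have "r x = x" "g (r y) = z" using r q k l assms act_V by auto
   moreover from this have "r y \<in> so x y" unfolding so_def using r(1) by (intro CollectI exI[of _ r]) auto
   ultimately show "z \<in> g ` so x y" by blast
  qed
  show "g ` so x y \<subseteq> so (g x) (g y)"
  proof
   fix z assume "z \<in> g ` so x y"
   then obtain k where k: "k \<in> \<Gamma>" "k x = x" "z = g (k y)" unfolding so_def by auto
   obtain q where q: "q \<in> \<Gamma>" "\<forall>x\<in>V. q x = g (k x)" using act_comp[OF assms(1) k(1)] by auto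
   obtain r where r: "r \<in> \<Gamma>" "\<forall>x\<in>V. r x = q (l x)" using act_comp[OF q(1) l(1)] by auto
   have "r (g x) = g x" "r (g y) = z" using r q k l assms act_V by auto
   then show "z \<in> so (g x) (g y)" unfolding so_def using r(1) by (intro CollectI exI[of _ r]) auto
  qed
 qed
 moreover have "so x y \<subseteq> V" unfolding so_def using act_V assms by auto
 then have "inj_on g (so x y)" using act_inj[OF assms(1)] unfolding inj_on_def by blast
 ultimately show ?thesis by (simp add: card_image)
qed

definition base :: 'a where "base = (SOME v. v \<in> V)"

text \<open>In terms of Haar measure on the closure of \<Gamma>, this is the measure of the
  stabilizer of \<open>x\<close> divided by that of \<open>base\<close>, expressed through orbit
  sizes. The two vertices may lie in different orbits.\<close>

definition hw :: "'a \<Rightarrow> real" where "hw x = card (so x base) / card (so base x)"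

context
 assumes ne: "V \<noteq> {}"
begin

lemma base_V: "base \<in> V" unfolding base_def using ne by (simp add: some_in_eq)

lemma hw_pos: "x \<in> V ==> 0 < hw x"
 unfolding hw_def using card_so_pos base_V by simp

text \<open>The orbits of pairs seen from \<open>x\<close>, from \<open>y\<close> and from
  \<open>base\<close> are each counted in both orders with \<open>card_sop\<close>; in the product
  of the three identities the orbit sizes under double stabilizers cancel.\<close>

lemma hw_cocycle:
 assumes "x \<in> V" "y \<in> V" shows "card (so x y) * hw y = card (so y x) * hw x"
proof -
 let ?A = "real (card (so2 x y base))" and ?B = "real (card (so2 x base y))" and ?C = "real (card (so2 y base x))"
 note b = base_V
 have "card (so x y) * card (so2 x y base) = card (so x base) * card (so2 x base y)"
  using card_sop[OF assms b] card_sop[OF assms(1) b assms(2)] card_sop_swap by metis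
 then have 1: "real (card (so x y)) * ?A = real (card (so x base)) * ?B"
  by (metis of_nat_mult)
 have "card (so y x) * card (so2 y x base) = card (so y base) * card (so2 y base x)"
  using card_sop[OF assms(2,1) b] card_sop[OF assms(2) b assms(1)] card_sop_swap by metis
 then have 2: "real (card (so y x)) * ?A = real (card (so y base)) * ?C"
  using so2_comm[of y x] by (metis of_nat_mult)
 have "card (so base x) * card (so2 base x y) = card (so base y) * card (so2 base y x)"
  using card_sop[OF b assms] card_sop[OF b assms(2,1)] card_sop_swap by metis
 then have 3: "real (card (so base x)) * ?B = real (card (so base y)) * ?C"
  using so2_comm[of base x] so2_comm[of base y] by (metis of_nat_mult)
 have pos: "?A > 0" "?B > 0" "?C > 0" "real (card (so base x)) > 0" "real (card (so base y)) > 0"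
  using card_so2_pos card_so_pos assms b by auto
 have e1: "real (card (so x y)) = real (card (so x base)) * ?B / ?A" using 1 pos by (simp add: field_simps)
 have e2: "real (card (so y x)) = real (card (so y base)) * ?C / ?A" using 2 pos by (simp add: field_simps)
 have e3: "?B = real (card (so base y)) * ?C / real (card (so base x))" using 3 pos by (simp add: field_simps)
 show ?thesis unfolding hw_def e1 e2 e3 using pos by (simp add: field_simps)
qed

lemma hw_ratio: "x \<in> V ==> y \<in> V ==> hw x / hw y = card (so x y) / card (so y x)"
 using hw_cocycle[of x y] hw_pos[of x] hw_pos[of y] card_so_pos[of y x] by (simp add: field_simps)

lemma hw_act: "g \<in> \<Gamma> ==> x \<in> V ==> y \<in> V ==> hw (g x) / hw (g y) = hw x / hw y"
 using hw_ratio[of x y] hw_ratio[of "g x" "g y"] so_act act_V by auto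

lemma ln_hw_act: "g \<in> \<Gamma> ==> x \<in> V ==> y \<in> V ==> ln (hw (g x)) - ln (hw (g y)) = ln (hw x) - ln (hw y)"
 using hw_act[of g x y] hw_pos[of x] hw_pos[of y] hw_pos[of "g x"] hw_pos[of "g y"] act_V[of g]
  ln_div[of "hw (g x)" "hw (g y)"] ln_div[of "hw x" "hw y"] by simp

lemma mass_transport:
 assumes "x \<in> V" "z \<in> V" and inv: "\<And>g u v. g \<in> \<Gamma> ==> u \<in> V ==> v \<in> V ==> F (g u) (g v) = (F u v :: ennreal)"
 shows "nsum (\<lambda>y. of_bool (y \<in> orb z) * F x y) = nsum (\<lambda>w. of_bool (w \<in> orb x) * (F w z * ennreal (hw w / hw z)))"
proof -
 \<comment> \<open>\<open>D y w\<close> says that one group element carries \<open>x\<close> to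
   \<open>w\<close> and \<open>y\<close> to \<open>z\<close>, so that \<open>F x y = F w z\<close>.
   The proof is a double count over this relation, whose rows and columns turn out to be stabilizer
   orbits.\<close>
 define D where "D y w \<longleftrightarrow> y \<in> V \<and> (\<exists>g\<in>\<Gamma>. g x = w \<and> g y = z)" for y w
 have rowD: "{w. D y w} = so z w0" if "D y w0" for y w0
 proof -
  obtain g where g: "y \<in> V" "g \<in> \<Gamma>" "g x = w0" "g y = z" using \<open>D y w0\<close> unfolding D_def by auto
  obtain l where l: "l \<in> \<Gamma>" "\<forall>x\<in>V. l (g x) = x \<and> g (l x) = x" using act_inv[OF g(2)] by auto
  show ?thesis
  proof
   show "{w. D y w} \<subseteq> so z w0"
   proof
    fix w assume "w \<in> {w. D y w}"
    then obtain k where k: "k \<in> \<Gamma>" "k x = w" "k y = z" unfolding D_def by auto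
    obtain q where q: "q \<in> \<Gamma>" "\<forall>x\<in>V. q x = k (l x)" using act_comp[OF k(1) l(1)] by auto
    have "l z = y" "l w0 = x" "w0 \<in> V" using l g assms act_V by auto
    then have "q z = z" "q w0 = w" using q k assms by auto
    then show "w \<in> so z w0" unfolding so_def using q(1) by (intro CollectI exI[of _ q]) auto
   qed
   show "so z w0 \<subseteq> {w. D y w}"
   proof
    fix w assume "w \<in> so z w0"
    then obtain k where k: "k \<in> \<Gamma>" "k z = z" "w = k w0" unfolding so_def by auto
    obtain q where q: "q \<in> \<Gamma>" "\<forall>x\<in>V. q x = k (g x)" using act_comp[OF k(1) g(2)] by auto
    then have "q x = w" "q y = z" using g k assms by auto
    then show "w \<in> {w. D y w}" unfolding D_def using q g by auto
   qed
  qed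
 qed
 have colD: "{y. D y w} = so x y0" if "D y0 w" for y0 w
 proof -
  obtain g where g: "y0 \<in> V" "g \<in> \<Gamma>" "g x = w" "g y0 = z" using \<open>D y0 w\<close> unfolding D_def by auto
  obtain l where l: "l \<in> \<Gamma>" "\<forall>x\<in>V. l (g x) = x \<and> g (l x) = x" using act_inv[OF g(2)] by auto
  show ?thesis
  proof
   show "{y. D y w} \<subseteq> so x y0"
   proof
    fix y assume "y \<in> {y. D y w}"
    then obtain k where k: "y \<in> V" "k \<in> \<Gamma>" "k x = w" "k y = z" unfolding D_def by auto
    obtain k' where k': "k' \<in> \<Gamma>" "\<forall>x\<in>V. k' (k x) = x \<and> k (k' x) = x" using act_inv[OF k(2)] by auto
    obtain q where q: "q \<in> \<Gamma>" "\<forall>x\<in>V. q x = k' (g x)" using act_comp[OF k'(1) g(2)] by auto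
    have "q x = x" "q y0 = y" using q k k' g assms by auto
    then show "y \<in> so x y0" unfolding so_def using q(1) by (intro CollectI exI[of _ q]) auto
   qed
   show "so x y0 \<subseteq> {y. D y w}"
   proof
    fix y assume "y \<in> so x y0"
    then obtain k where k: "k \<in> \<Gamma>" "k x = x" "y = k y0" unfolding so_def by auto
    obtain k' where k': "k' \<in> \<Gamma>" "\<forall>x\<in>V. k' (k x) = x \<and> k (k' x) = x" using act_inv[OF k(1)] by auto
    obtain q where q: "q \<in> \<Gamma>" "\<forall>x\<in>V. q x = g (k' x)" using act_comp[OF g(2) k'(1)] by auto
    have "y \<in> V" using k g act_V by auto
    moreover have "k' x = x" "k' y = y0" using k k' g assms by metis+
    ultimately have "q x = w" "q y = z" using q g assms by auto
    then show "y \<in> {y. D y w}" unfolding D_def using q \<open>y \<in> V\<close> by auto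
   qed
  qed
 qed
 have DV: "y \<in> V \<and> w \<in> V \<and> y \<in> orb z \<and> w \<in> orb x" if D: "D y w" for y w
 proof -
  obtain g where g: "y \<in> V" "g \<in> \<Gamma>" "g x = w" "g y = z" using D unfolding D_def by auto
  then have "z \<in> orb y" "w \<in> orb x" unfolding orb_def by auto
  then show ?thesis using g act_V assms orb_sym by blast
 qed
 have DF: "F x y = F w z \<and> card (so z w) = card (so y x) \<and> card (so x y) = card (so w z)" if "D y w" for y w
  using that inv so_act assms unfolding D_def by (metis)
 have count: "nsum (\<lambda>v. of_bool (v \<in> A) * c) = of_nat (card A) * c" if "finite A" for A :: "'a set" and c :: ennreal
  using that by (subst nsum_finite[of A]) auto
 \<comment> \<open>The mass \<open>F x y\<close> is spread evenly over its row, of size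
   \<open>card (so z w)\<close>. A column has size \<open>card (so w z)\<close>, which produces the
   quotient of the weights.\<close>
 let ?G = "\<lambda>y w. of_bool (D y w) * (F w z / of_nat (card (so z w)))"
 have L: "of_bool (y \<in> orb z) * F x y = nsum (?G y)" for y
 proof (cases "\<exists>w0. D y w0")
  case True
  then obtain w0 where w0: "D y w0" ..
  have c: "card (so z w0) > 0" using card_so_pos DV[OF w0] assms by auto
  have "nsum (?G y) = nsum (\<lambda>w. of_bool (w \<in> so z w0) * (F x y / of_nat (card (so z w0))))"
  proof (rule nn_integral_cong)
   fix w
   show "?G y w = of_bool (w \<in> so z w0) * (F x y / of_nat (card (so z w0)))"
    using rowD[OF w0] DF[of y w] DF[OF w0] by (cases "D y w") auto
  qed
  also have "... = of_nat (card (so z w0)) * (F x y / of_nat (card (so z w0)))"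
   by (rule count) (use finite_so DV[OF w0] assms in auto)
  also have "... = F x y"
   using c by (simp add: ennreal_times_divide ennreal_divide_times mult.commute mult_divide_eq_ennreal)
  finally show ?thesis using DV[OF w0] by simp
 next
  case False
  have "y \<notin> orb z"
  proof
   assume y: "y \<in> orb z"
   then have "z \<in> orb y" "y \<in> V" using orb_sym orb_V assms by auto
   then have "\<exists>w0. D y w0" unfolding D_def orb_def by auto
   then show False using False by simp
  qed
  then show ?thesis using False by simp
 qed
 have R: "nsum (\<lambda>y. ?G y w) = of_bool (w \<in> orb x) * (F w z * ennreal (hw w / hw z))" for w
 proof (cases "\<exists>y0. D y0 w")
  case True
  then obtain y0 where y0: "D y0 w" ..
  have "nsum (\<lambda>y. ?G y w) = nsum (\<lambda>y. of_bool (y \<in> so x y0) * (F w z / of_nat (card (so z w))))"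
   using colD[OF y0] by (intro nn_integral_cong) auto
  also have "... = of_nat (card (so x y0)) * (F w z / of_nat (card (so z w)))"
   by (rule count) (use finite_so DV[OF y0] assms in auto)
  also have "... = F w z * ennreal (hw w / hw z)"
  proof -
   have "hw w / hw z = card (so x y0) / card (so z w)" using hw_ratio[of w z] DV[OF y0] assms DF[OF y0] by simp
   moreover have "ennreal (real (card (so x y0)) / real (card (so z w))) = of_nat (card (so x y0)) / of_nat (card (so z w))"
    using card_so_pos[of z w] DV[OF y0] assms by (simp add: divide_ennreal ennreal_of_nat_eq_real_of_nat)
   ultimately show ?thesis by (simp add: ennreal_times_divide mult.commute)
  qed
  finally show ?thesis using DV[OF y0] by simp
 next
  case False
  have "w \<notin> orb x"
  proof
   assume "w \<in> orb x"
   then obtain g where g: "g \<in> \<Gamma>" "w = g x" unfolding orb_def by auto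
   obtain l where l: "l \<in> \<Gamma>" "\<forall>x\<in>V. l (g x) = x \<and> g (l x) = x" using act_inv[OF g(1)] by auto
   then have "D (l z) w" unfolding D_def using g act_V assms by auto
   then show False using False by blast
  qed
  then show ?thesis using False by simp
 qed
 have "nsum (\<lambda>y. of_bool (y \<in> orb z) * F x y) = nsum (\<lambda>y. nsum (?G y))" using L by simp
 also have "... = nsum (\<lambda>w. nsum (\<lambda>y. ?G y w))" by (rule nsum_swap)
 finally show ?thesis using R by simp
qed

end

end

section \<open>Height functions\<close>

text \<open>What the analysis needs from the group. \<open>rt\<close> marks one orbit;
  \<open>up\<close> climbs by at least \<open>c0\<close> per edge and enters that orbit within
  \<open>ll\<close> steps, though the rule may break the symmetry under \<Gamma>;
  \<open>down\<close> descends within the orbit along a short path that stays above its lower end.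
  Mass transport is exact on the marked orbit (\<open>mtp_rt\<close>) and loses a constant on all of
  \<open>V\<close> (\<open>mtp_le\<close>).\<close>

locale hgraph = gact V E \<Gamma> for V :: "'a set" and E :: "'a set set" and \<Gamma> :: "('a \<Rightarrow> 'a) set" +
 fixes h :: "'a \<Rightarrow> real" and up :: "'a \<Rightarrow> 'a" and rt :: 'a and c0 M CM :: real and ll deg :: nat
 assumes rt_V: "rt \<in> V"
  and h_act: "g \<in> \<Gamma> ==> x \<in> V ==> y \<in> V ==> h (g x) - h (g y) = h x - h y"
  and h_edge: "{x, y} \<in> E ==> \<bar>h x - h y\<bar> \<le> M"
  and c0_pos: "0 < c0"
  and up_edge: "x \<in> V ==> {x, up x} \<in> E"
  and up_h: "x \<in> V ==> h x + c0 \<le> h (up x)"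
  and up_reach: "x \<in> V ==> \<exists>i\<le>ll. (up ^^ i) x \<in> orb rt"
  and down: "w \<in> orb rt ==> \<exists>w'\<in>orb rt. \<exists>xs. xs \<noteq> [] \<and> hd xs = w' \<and> last xs = w \<and> set xs \<subseteq> V \<and> ed xs \<subseteq> E \<and>
     (\<forall>v\<in>set xs. h w' \<le> h v) \<and> h w' + c0 \<le> h w \<and> length xs \<le> Suc ll"
  and degree: "x \<in> V ==> card (nb x) \<le> deg"
  and mtp_le: "(\<And>g u v. g \<in> \<Gamma> ==> u \<in> V ==> v \<in> V ==> F (g u) (g v) = (F u v :: ennreal)) ==> z \<in> V ==>
     nsum (\<lambda>w. of_bool (w \<in> V) * F w z) \<le>
     ennreal CM * (SUP x\<in>V. nsum (\<lambda>y. of_bool (y \<in> V) * (F x y * ennreal (exp (h y - h x)))))"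
  and mtp_rt: "(\<And>g u v. g \<in> \<Gamma> ==> u \<in> V ==> v \<in> V ==> F (g u) (g v) = (F u v :: ennreal)) ==> x \<in> orb rt ==> z \<in> orb rt ==>
     nsum (\<lambda>y. of_bool (y \<in> orb rt) * F x y) =
     nsum (\<lambda>w. of_bool (w \<in> orb rt) * (F w z * ennreal (exp (h w - h z))))"
  and shift: "\<exists>g\<in>\<Gamma>. h (g rt) > h rt"

section \<open>Construction of the height function\<close>

context gact
begin

lemma finite_values:
 assumes "\<And>g x. g \<in> \<Gamma> ==> x \<in> V ==> f (g x) = f x" shows "finite (f ` V)"
proof -
 obtain R where R: "finite R" "R \<subseteq> V" "\<forall>x\<in>V. \<exists>r\<in>R. \<exists>g\<in>\<Gamma>. x = g r" using quasi by auto
 have "f ` V \<subseteq> f ` R"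
 proof
  fix y assume "y \<in> f ` V"
  then obtain x where x: "x \<in> V" "y = f x" by auto
  obtain r g where "r \<in> R" "g \<in> \<Gamma>" "x = g r" using R(3) x(1) by blast
  then show "y \<in> f ` R" using x assms R(2) by auto
 qed
 then show ?thesis by (rule finite_subset) (use R in simp)
qed

lemma bounded_values:
 assumes "\<And>g x. g \<in> \<Gamma> ==> x \<in> V ==> f (g x) = (f x :: real)"
 obtains B where "B \<ge> 0" "\<And>x. x \<in> V ==> \<bar>f x\<bar> \<le> B"
proof -
 have fin: "finite ((\<lambda>x. \<bar>f x\<bar>) ` V)" by (rule finite_values) (use assms in auto)
 show thesis
 proof (rule that[of "Max (insert 0 ((\<lambda>x. \<bar>f x\<bar>) ` V))"])
  show "0 \<le> Max (insert 0 ((\<lambda>x. \<bar>f x\<bar>) ` V))" using fin by (intro Max_ge) auto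
  fix x assume "x \<in> V"
  then show "\<bar>f x\<bar> \<le> Max (insert 0 ((\<lambda>x. \<bar>f x\<bar>) ` V))" using fin by (intro Max_ge) auto
 qed
qed

text \<open>A shortest walk from some \<open>x1\<close> to a heavier vertex of its orbit has, by
  minimality, its vertices in different orbits apart from the two ends. On the translates of this
  walk the height is made affine, elsewhere it is lowered in proportion to the distance from them.
  The correction is invariant under \<Gamma>, hence bounded.\<close>

lemma height_exists:
 assumes non: "x0 \<in> V" "g0 \<in> \<Gamma>" "hw (g0 x0) \<noteq> hw x0"
 obtains h up rt c0 M CM ll deg where "hgraph V E \<Gamma> h up rt c0 M CM ll deg"
proof -
 have ne: "V \<noteq> {}" using non by auto
 note hw_pos = hw_pos[OF ne] and ln_hw_act = ln_hw_act[OF ne] and hw_act = hw_act[OF ne]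
 define Pn where "Pn n \<longleftrightarrow> (\<exists>x\<in>V. \<exists>g\<in>\<Gamma>. hw x < hw (g x) \<and> g x \<in> bal n x)" for n
 have "\<exists>n. Pn n"
 proof -
  have "\<exists>x\<in>V. \<exists>g\<in>\<Gamma>. hw x < hw (g x)"
  proof (cases "hw x0 < hw (g0 x0)")
   case False
   then have lt: "hw (g0 x0) < hw x0" using non by simp
   obtain l where l: "l \<in> \<Gamma>" "\<forall>x\<in>V. l (g0 x) = x \<and> g0 (l x) = x" using act_inv[OF non(2)] by auto
   then show ?thesis using lt non act_V by (intro bexI[of _ "g0 x0"] bexI[of _ l]) auto
  qed (use non in auto)
  then obtain x g where x: "x \<in> V" "g \<in> \<Gamma>" "hw x < hw (g x)" by auto
  obtain n where "g x \<in> bal n x" using bal_ex[of x "g x"] x act_V by auto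
  then show ?thesis unfolding Pn_def using x by auto
 qed
 define n where "n = (LEAST n. Pn n)"
 have Pn: "Pn n" unfolding n_def using \<open>\<exists>n. Pn n\<close> by (rule LeastI_ex)
 have min: "\<not> Pn k" if "k < n" for k using that not_less_Least n_def by metis
 obtain x1 g1 where x1: "x1 \<in> V" "g1 \<in> \<Gamma>" "hw x1 < hw (g1 x1)" "g1 x1 \<in> bal n x1" using Pn Pn_def by auto
 obtain k w where kw: "k \<le> n" "w 0 = x1" "w k = g1 x1" "\<forall>i<k. {w i, w (Suc i)} \<in> E" using bal_walk[OF x1(4)] by auto
 have "g1 x1 \<in> bal k x1" using walk_bal[of k w 0 k] kw by auto
 then have "Pn k" unfolding Pn_def using x1 by auto
 then have "k = n" using min kw(1) by (metis le_neq_implies_less)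
 then have w: "w 0 = x1" "w n = g1 x1" "\<forall>i<n. {w i, w (Suc i)} \<in> E" using kw by auto
 have n0: "n > 0" using w x1 by (cases n) auto
 have wV: "w i \<in> V" if "i \<le> n" for i
 proof (cases "i = n")
  case True then show ?thesis using w x1 act_V by auto
 next
  case False then show ?thesis using w(3) that edge_V[of "w i" "w (Suc i)"] by auto
 qed
 \<comment> \<open>Two vertices of the walk in one orbit contradict minimality: if their weights
   differ, they are themselves a closer pair, and if they agree, \<open>l\<close> lets the walk skip
   the part between them.\<close>
 have distinct: "w j \<notin> orb (w i)" if ij: "i < j" "j \<le> n" "\<not> (i = 0 \<and> j = n)" for i j
 proof
  assume "w j \<in> orb (w i)"
  then obtain b where b: "b \<in> \<Gamma>" "w j = b (w i)" unfolding orb_def by auto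
  obtain l where l: "l \<in> \<Gamma>" "\<forall>x\<in>V. l (b x) = x \<and> b (l x) = x" using act_inv[OF b(1)] by auto
  have lw: "l (w j) = w i" using l b wV ij by auto
  have near: "w j \<in> bal (j - i) (w i)" using walk_bal[OF w(3)] ij by auto
  have lt: "j - i < n" using ij by auto
  consider "hw (w i) < hw (w j)" | "hw (w j) < hw (w i)" | "hw (w i) = hw (w j)" by linarith
  then show False
  proof cases
   case 1
   then have "Pn (j - i)" unfolding Pn_def using b near wV ij by (intro bexI[of _ "w i"] bexI[of _ b]) auto
   then show False using min lt by blast
  next
   case 2
   then have "Pn (j - i)" unfolding Pn_def using l(1) lw bal_sym[OF near] wV ij by (intro bexI[of _ "w j"] bexI[of _ l]) auto
   then show False using min lt by blast
  next
   case 3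
   have "w n \<in> bal (n - j) (w j)" using walk_bal[OF w(3)] ij by auto
   then have "l (w n) \<in> bal (n - j) (w i)" using act_bal[OF l(1), of "w j" "n - j"] lw wV ij by auto
   moreover have "w i \<in> bal i x1" using walk_bal[OF w(3), of 0 i] w(1) ij by auto
   ultimately have b2: "l (w n) \<in> bal (i + (n - j)) x1" by (rule bal_trans[rotated])
   obtain q where q: "q \<in> \<Gamma>" "\<forall>x\<in>V. q x = l (g1 x)" using act_comp[OF l(1) x1(2)] by auto
   have qx: "q x1 = l (w n)" using q x1 w by auto
   have "hw (l (w n)) / hw (l (w j)) = hw (w n) / hw (w j)" by (rule hw_act) (use l wV ij in auto)
   then have "hw (l (w n)) = hw (w n)" using lw 3 hw_pos[of "w j"] wV ij by (simp add: field_simps)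
   then have "hw x1 < hw (q x1)" using qx w x1 by simp
   then have "Pn (i + (n - j))" unfolding Pn_def using q x1 b2 qx by (intro bexI[of _ x1] bexI[of _ q]) auto
   moreover have "i + (n - j) < n" using ij by auto
   ultimately show False using min by blast
  qed
 qed
 define L where "L x = ln (hw x)" for x
 have L_act: "L (g x) - L (g y) = L x - L y" if "g \<in> \<Gamma>" "x \<in> V" "y \<in> V" for g x y
  unfolding L_def using ln_hw_act that by blast
 define c where "c = L (w n) - L (w 0)"
 have c_pos: "c > 0" unfolding c_def L_def using w x1 hw_pos act_V by simp
 define Cy where "Cy = (\<Union>i<n. orb (w i))"
 have CyV: "Cy \<subseteq> V" unfolding Cy_def by (rule UN_least) (use orb_V wV in auto)
 have Cy_act: "g x \<in> Cy \<longleftrightarrow> x \<in> Cy" if g: "g \<in> \<Gamma>" "x \<in> V" for g x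
 proof
  assume "x \<in> Cy"
  then obtain i where "i < n" "x \<in> orb (w i)" unfolding Cy_def by auto
  then show "g x \<in> Cy" unfolding Cy_def using orb_act[OF wV g(1), of i x] by auto
 next
  assume gx: "g x \<in> Cy"
  then obtain i where i: "i < n" "g x \<in> orb (w i)" unfolding Cy_def by auto
  obtain l where l: "l \<in> \<Gamma>" "\<forall>x\<in>V. l (g x) = x \<and> g (l x) = x" using act_inv[OF g(1)] by auto
  have "l (g x) \<in> orb (w i)" using orb_act[OF wV l(1) i(2)] i by auto
  then show "x \<in> Cy" unfolding Cy_def using i l g by auto
 qed
 define ix where "ix x = (THE i. i < n \<and> x \<in> orb (w i))" for x
 have ixI: "ix x = i" if "i < n" "x \<in> orb (w i)" for x i
 proof -
  have uniq: "j = i" if j: "j < n" "x \<in> orb (w j)" for j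
  proof (rule ccontr)
   assume "j \<noteq> i"
   have V: "w i \<in> V" "w j \<in> V" using wV j(1) \<open>i < n\<close> by auto
   have "w j \<in> orb (w i)" by (rule orb_trans[OF V(1) \<open>x \<in> orb (w i)\<close> orb_sym[OF V(2) j(2)]])
   moreover have "w i \<in> orb (w j)" by (rule orb_trans[OF V(2) j(2) orb_sym[OF V(1) \<open>x \<in> orb (w i)\<close>]])
   ultimately
   show False using distinct[of i j] distinct[of j i] \<open>j \<noteq> i\<close> j(1) \<open>i < n\<close> by (cases i j rule: linorder_cases) auto
  qed
  show ?thesis unfolding ix_def
  proof (rule the_equality)
   show "i < n \<and> x \<in> orb (w i)" using that by simp
  qed (use uniq in blast)
 qed
 have ix: "ix x < n" "x \<in> orb (w (ix x))" if "x \<in> Cy" for x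
  using that ixI unfolding Cy_def by auto
 have ix_act: "ix (g x) = ix x" if "g \<in> \<Gamma>" "x \<in> Cy" for g x
  by (rule ixI) (use ix[OF that(2)] orb_act[OF wV that(1)] in auto)
 define dC where "dC x = (LEAST k. \<exists>y\<in>Cy. y \<in> bal k x)" for x
 have w0Cy: "w 0 \<in> Cy" unfolding Cy_def using orb_self wV n0 by auto
 have dC: "\<exists>y\<in>Cy. y \<in> bal (dC x) x" if x: "x \<in> V" for x
 proof -
  have "w 0 \<in> V" using wV by simp
  then obtain k where "w 0 \<in> bal k x" using bal_ex[OF x] by blast
  then have "\<exists>k. \<exists>y\<in>Cy. y \<in> bal k x" using w0Cy by blast
  then show ?thesis unfolding dC_def by (rule LeastI_ex)
 qed
 have dC_le: "dC x \<le> k" if "y \<in> Cy" "y \<in> bal k x" for x y k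
  unfolding dC_def by (rule Least_le) (use that in auto)
 have dC_act: "dC (g x) = dC x" if g: "g \<in> \<Gamma>" "x \<in> V" for g x
 proof -
  have "(\<exists>y\<in>Cy. y \<in> bal k (g x)) \<longleftrightarrow> (\<exists>y\<in>Cy. y \<in> bal k x)" for k
  proof -
   have "y \<in> V" if "y \<in> bal k x" for y using that bal_V g by auto
   then show ?thesis unfolding act_bal[OF g] using Cy_act[OF g(1)] by blast
  qed
  then show ?thesis unfolding dC_def by simp
 qed
 \<comment> \<open>With this correction \<open>w i\<close> receives the height
   \<open>L (w 0) + i * c / n\<close>, and translates of the walk rise at the same constant
   slope.\<close>
 define fC where "fC x = (if x \<in> Cy then ix x * c / n + L (w 0) - L (w (ix x)) else 0)" for x
 obtain B where B: "B \<ge> 0" "\<And>x. x \<in> V ==> \<bar>fC x\<bar> \<le> B"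
  by (rule bounded_values[of fC]) (auto simp: fC_def Cy_act ix_act)
 obtain D where D: "D \<ge> 0" "\<And>x. x \<in> V ==> \<bar>real (dC x)\<bar> \<le> D"
  by (rule bounded_values[of "\<lambda>x. real (dC x)"]) (auto simp: dC_act)
 define mx where "mx x = Max (insert 0 ((\<lambda>y. \<bar>L x - L y\<bar>) ` nb x))" for x
 have mx: "mx (g x) = mx x" if "g \<in> \<Gamma>" "x \<in> V" for g x
 proof -
  have "(\<lambda>y. \<bar>L (g x) - L y\<bar>) ` nb (g x) = (\<lambda>y. \<bar>L x - L y\<bar>) ` nb x"
   unfolding act_nb[OF that] image_image using L_act[OF that] nb_V by (intro image_cong) auto
  then show ?thesis unfolding mx_def by simp
 qed
 obtain M0 where M0: "M0 \<ge> 0" "\<And>x. x \<in> V ==> \<bar>mx x\<bar> \<le> M0" by (rule bounded_values[of mx]) (use mx in auto)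
 have L_edge: "\<bar>L x - L y\<bar> \<le> M0" if "{x, y} \<in> E" for x y
 proof -
  have x: "x \<in> V" "y \<in> nb x" using edge_V[OF that] that by (auto simp: nb_def)
  then have "\<bar>L x - L y\<bar> \<le> mx x" unfolding mx_def using finite_nb by (intro Max_ge) auto
  then show ?thesis using M0(2)[OF x(1)] by linarith
 qed
 \<comment> \<open>One edge towards \<open>Cy\<close> must gain at least 1 after paying for the
   change of \<open>L\<close> (at most \<open>M0\<close>) and, on arrival, for the correction on
   \<open>Cy\<close> (at most \<open>B\<close>).\<close>
 define \<Lambda> where "\<Lambda> = M0 + B + 1"
 have L0: "\<Lambda> > 0" using M0 B by (simp add: \<Lambda>_def)
 define f where "f x = (if x \<in> Cy then fC x else - \<Lambda> * dC x)" for x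
 have f_act: "f (g x) = f x" if "g \<in> \<Gamma>" "x \<in> V" for g x
  unfolding f_def fC_def using that by (simp add: Cy_act ix_act dC_act)
 obtain Bf where Bf: "Bf \<ge> 0" "\<And>x. x \<in> V ==> \<bar>f x\<bar> \<le> Bf" by (rule bounded_values[of f]) (use f_act in auto)
 define h where "h x = L x + f x" for x
 define c1 where "c1 = min 1 (c / n)"
 have c1: "0 < c1" "c1 \<le> 1" "c1 \<le> c / n" unfolding c1_def using c_pos n0 by auto
 have hCy: "h (g (w i)) = L (g (w i)) + i * c / n + L (w 0) - L (w i)" if "i < n" "g \<in> \<Gamma>" for g i
 proof -
  have "g (w i) \<in> orb (w i)" using that unfolding orb_def by auto
  then have "g (w i) \<in> Cy" "ix (g (w i)) = i" using that ixI unfolding Cy_def by auto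
  then show ?thesis by (simp add: h_def f_def fC_def)
 qed
 \<comment> \<open>The end \<open>w n\<close> is an image of \<open>w 0\<close>, so it has index 0
   and no correction; the linear rise closes up cyclically.\<close>
 have hn: "h (g (w n)) = L (g (w n))" if gG: "g \<in> \<Gamma>" for g
 proof -
  obtain q where q: "q \<in> \<Gamma>" "\<forall>x\<in>V. q x = g (g1 x)" using act_comp[OF gG x1(2)] by auto
  have "g (w n) = q (w 0)" using q w x1 by auto
  then show ?thesis using hCy[OF n0 q(1)] by simp
 qed
 have step: "h (g (w (Suc i))) = h (g (w i)) + c / n" if i: "i < n" and g: "g \<in> \<Gamma>" for g i
 proof -
  have d: "L (g (w (Suc i))) - L (g (w i)) = L (w (Suc i)) - L (w i)" by (rule L_act) (use i g wV in auto)
  show ?thesis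
  proof (cases "Suc i = n")
   case True
   then have "h (g (w (Suc i))) = L (g (w (Suc i)))" using hn g by simp
   moreover have "real i * c / n = c - c / n" using True n0 by (simp add: field_simps flip: True)
   ultimately show ?thesis using hCy[OF i g] d True c_def by simp
  next
   case False
   then have s: "Suc i < n" using i by simp
   show ?thesis using hCy[OF s g] hCy[OF i g] d by (simp add: field_simps add_divide_distrib)
  qed
 qed
 have ex_up: "\<exists>y. {x, y} \<in> E \<and> h x + c1 \<le> h y \<and> (x \<notin> Cy \<longrightarrow> dC y < dC x) \<and> (x \<in> Cy \<longrightarrow> y \<in> Cy \<and> ix y = Suc (ix x) mod n)"
  if x: "x \<in> V" for x
 proof (cases "x \<in> Cy")
  case True
  then obtain g where g: "g \<in> \<Gamma>" "x = g (w (ix x))" using ix(2) unfolding orb_def by auto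
  let ?i = "ix x"
  have i: "?i < n" using ix True by auto
  let ?y = "g (w (Suc ?i))"
  have "{g (w ?i), ?y} \<in> E" using act_E[OF g(1)] w(3) i wV by auto
  moreover have "h ?y = h x + c / n" using step[OF i g(1)] g(2) by simp
  moreover have "?y \<in> Cy \<and> ix ?y = Suc ?i mod n"
  proof (cases "Suc ?i = n")
   case False
   then have "?y \<in> orb (w (Suc ?i))" "Suc ?i < n" using g i unfolding orb_def by auto
   then show ?thesis using ixI unfolding Cy_def by auto
  next
   case True
   obtain q where q: "q \<in> \<Gamma>" "\<forall>x\<in>V. q x = g (g1 x)" using act_comp[OF g(1) x1(2)] by auto
   have "?y = q (w 0)" using q w x1 True by auto
   then have "?y \<in> orb (w 0)" using q unfolding orb_def by auto
   then show ?thesis using ixI[OF n0] n0 True unfolding Cy_def by auto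
  qed
  ultimately show ?thesis using g(2) c1 True by (intro exI[of _ ?y]) auto
 next
  case False
  obtain y where y: "y \<in> Cy" "y \<in> bal (dC x) x" using dC[OF x] by auto
  obtain k where k: "dC x = Suc k" using y False by (cases "dC x") auto
  have "x \<in> bal (Suc k) y" using bal_sym[OF y(2)] k by simp
  moreover have "x \<notin> bal k y"
  proof
   assume "x \<in> bal k y"
   then have "dC x \<le> k" using dC_le[OF y(1) bal_sym] by simp
   then show False using k by simp
  qed
  ultimately obtain v where v: "v \<in> bal k y" "x \<in> nb v" by auto
  have vE: "{x, v} \<in> E" using v(2) by (auto simp: nb_def insert_commute)
  have vV: "v \<in> V" using edge_V[OF vE] by simp
  have dv: "dC v \<le> k" using dC_le[OF y(1) bal_sym[OF v(1)]] .
  have fx: "f x = - (\<Lambda> * Suc k)" using False k by (simp add: f_def)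
  have "f v \<ge> f x + M0 + 1"
  proof (cases "v \<in> Cy")
   case True
   then have "f v \<ge> - B" using B(2)[OF vV] by (simp add: f_def)
   moreover have "\<Lambda> * Suc k \<ge> \<Lambda> * 1" using L0 by (intro mult_left_mono) auto
   ultimately show ?thesis using fx \<Lambda>_def by linarith
  next
   case False
   then have "f v = - (\<Lambda> * dC v)" by (simp add: f_def)
   moreover have "\<Lambda> * dC v \<le> \<Lambda> * k" using L0 dv by (intro mult_left_mono) auto
   moreover have "\<Lambda> * Suc k = \<Lambda> * k + \<Lambda>" by (simp add: algebra_simps)
   ultimately show ?thesis using fx \<Lambda>_def B M0 by linarith
  qed
  then have "h x + c1 \<le> h v" using L_edge[OF vE] c1 by (simp add: h_def)
  then show ?thesis using vE dv k False by (intro exI[of _ v]) auto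
 qed
 \<comment> \<open>The choice also records progress: off \<open>Cy\<close> the distance to
   \<open>Cy\<close> drops, on \<open>Cy\<close> the index advances by one modulo \<open>n\<close>.
   Iteration therefore meets index 0, which is the orbit of \<open>x1\<close>.\<close>
 define up where "up x = (SOME y. {x, y} \<in> E \<and> h x + c1 \<le> h y \<and> (x \<notin> Cy \<longrightarrow> dC y < dC x) \<and> (x \<in> Cy \<longrightarrow> y \<in> Cy \<and> ix y = Suc (ix x) mod n))" for x
 have up: "{x, up x} \<in> E" "h x + c1 \<le> h (up x)" "x \<notin> Cy ==> dC (up x) < dC x" "x \<in> Cy ==> up x \<in> Cy" "x \<in> Cy ==> ix (up x) = Suc (ix x) mod n"
  if "x \<in> V" for x
  using someI_ex[OF ex_up[OF that]] unfolding up_def[symmetric] by auto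
 define K where "K = nat \<lceil>D\<rceil> + n"
 have orb0: "x \<in> orb x1" if "x \<in> Cy" "ix x = 0" for x using ix(2)[OF that(1)] that(2) w(1) by simp
 have cyc: "x \<in> V ==> x \<in> Cy ==> \<exists>i\<le>n - ix x. (up ^^ i) x \<in> orb x1" for x
 proof (induction "n - ix x" arbitrary: x)
  case 0
  then show ?case using ix(1)[of x] by simp
 next
  case (Suc k)
  show ?case
  proof (cases "ix x = 0")
   case True
   then show ?thesis using orb0 Suc by (intro exI[of _ 0]) auto
  next
   case False
   have upx: "up x \<in> V" "up x \<in> Cy" "ix (up x) = Suc (ix x) mod n" using up[OF Suc(3)] Suc(4) edge_V by auto
   show ?thesis
   proof (cases "Suc (ix x) = n")
    case True
    then have "up x \<in> orb x1" using orb0 upx by simp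
    then show ?thesis using True by (intro exI[of _ 1]) auto
   next
    case F: False
    then have "ix (up x) = Suc (ix x)" using upx ix(1)[OF Suc(4)] by simp
    then have "k = n - ix (up x)" using Suc(2) by simp
    from Suc(1)[OF this upx(1,2)] obtain i where "i \<le> n - ix (up x)" "(up ^^ i) (up x) \<in> orb x1" by blast
    then show ?thesis using \<open>ix (up x) = Suc (ix x)\<close> F ix(1)[OF Suc(4)]
     by (intro exI[of _ "Suc i"]) (auto simp: funpow_swap1)
   qed
  qed
 qed
 have reach: "x \<in> V ==> \<exists>i\<le>dC x + n. (up ^^ i) x \<in> orb x1" for x
 proof (induction "dC x" arbitrary: x rule: less_induct)
  case less
  show ?case
  proof (cases "x \<in> Cy")
   case True
   then obtain i where "i \<le> n - ix x" "(up ^^ i) x \<in> orb x1" using cyc less(2) by blast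
   then show ?thesis by (intro exI[of _ i]) auto
  next
   case False
   have l: "dC (up x) < dC x" "up x \<in> V" using up[OF less(2)] False edge_V by auto
   obtain i where "i \<le> dC (up x) + n" "(up ^^ i) (up x) \<in> orb x1" using less(1)[OF l] by auto
   then show ?thesis using l by (intro exI[of _ "Suc i"]) (auto simp: funpow_swap1)
  qed
 qed
 have dcn: "finite ((\<lambda>x. card (nb x)) ` V)"
 proof (rule finite_values)
  fix g x assume g: "g \<in> \<Gamma>" "x \<in> V"
  have "inj_on g (nb x)" using act_inj[OF g(1)] nb_V unfolding inj_on_def by blast
  then show "card (nb (g x)) = card (nb x)" unfolding act_nb[OF g] by (rule card_image)
 qed
 obtain R where R: "finite R" "R \<subseteq> V" "\<forall>x\<in>V. \<exists>r\<in>R. \<exists>g\<in>\<Gamma>. x = g r" using quasi by auto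
 \<comment> \<open>\<open>h\<close> differs from the logarithmic weight by the invariant function
   \<open>f\<close>. So the density \<open>exp (h y - h x)\<close> is exact within one orbit and off
   by a factor of at most \<open>exp (2 * Bf)\<close> between orbits.\<close>
 have eh: "hw y / hw x = exp (h y - h x) * exp (f x - f y)" if "x \<in> V" "y \<in> V" for x y
 proof -
  have "exp (h y - h x) * exp (f x - f y) = exp (L y - L x)" unfolding exp_add[symmetric] h_def by simp
  also have "... = hw y / hw x" unfolding L_def using hw_pos that by (simp add: exp_diff)
  finally show ?thesis by simp
 qed
 have f_orb: "f x = f y" if "x \<in> orb x1" "y \<in> orb x1" for x y
  using that f_act x1(1) unfolding orb_def by auto
 have "hgraph V E \<Gamma> h up x1 c1 (M0 + 2 * Bf) (card R * exp (2 * Bf)) K (Max (insert 0 ((\<lambda>x. card (nb x)) ` V)))"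
 proof (unfold_locales)
  show "x1 \<in> V" by fact
  show "h (g x) - h (g y) = h x - h y" if "g \<in> \<Gamma>" "x \<in> V" "y \<in> V" for g x y
   using L_act[OF that] f_act that by (simp add: h_def)
  show "\<bar>h x - h y\<bar> \<le> M0 + 2 * Bf" if "{x, y} \<in> E" for x y
   using L_edge[OF that] Bf(2)[of x] Bf(2)[of y] edge_V[OF that] unfolding h_def by linarith
  show "0 < c1" by (rule c1)
  show "{x, up x} \<in> E" "h x + c1 \<le> h (up x)" if "x \<in> V" for x using up that by auto
  show "\<exists>i\<le>K. (up ^^ i) x \<in> orb x1" if x: "x \<in> V" for x
  proof -
   obtain i where i: "i \<le> dC x + n" "(up ^^ i) x \<in> orb x1" using reach[OF x] by auto
   have "dC x \<le> nat \<lceil>D\<rceil>" using D(2)[OF x] by linarith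
   then show ?thesis using i unfolding K_def by (intro exI[of _ i]) auto
  qed
  show "\<exists>w'\<in>orb x1. \<exists>xs. xs \<noteq> [] \<and> hd xs = w' \<and> last xs = v \<and> set xs \<subseteq> V \<and> ed xs \<subseteq> E \<and>
     (\<forall>v\<in>set xs. h w' \<le> h v) \<and> h w' + c1 \<le> h v \<and> length xs \<le> Suc K" if v: "v \<in> orb x1" for v
  proof -
   obtain g where g: "g \<in> \<Gamma>" "v = g x1" using v unfolding orb_def by auto
   obtain l where l: "l \<in> \<Gamma>" "\<forall>x\<in>V. l (g1 x) = x \<and> g1 (l x) = x" using act_inv[OF x1(2)] by auto
   \<comment> \<open>The downward path is the walk itself, translated so that its last vertex
     \<open>g1 x1\<close> lands on \<open>v\<close>.\<close>
   obtain q where q: "q \<in> \<Gamma>" "\<forall>x\<in>V. q x = g (l x)" using act_comp[OF g(1) l(1)] by auto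
   have qn: "q (w n) = v" using q l w x1 g act_V by auto
   have hq: "i \<le> n ==> h (q (w i)) = h (q (w 0)) + i * c / n" for i
   proof (induction i)
    case (Suc i)
    then have "h (q (w (Suc i))) = h (q (w i)) + c / n" using step[of i q] q(1) by simp
    also have "h (q (w i)) = h (q (w 0)) + i * c / n" using Suc by simp
    finally show ?case by (simp add: add_divide_distrib algebra_simps)
   qed simp
   define xs where "xs = map (\<lambda>i. q (w i)) [0..<Suc n]"
   have edk: "k \<le> n ==> ed (map (\<lambda>i. q (w i)) [0..<Suc k]) \<subseteq> E" for k
   proof (induction k)
    case (Suc k)
    have "{q (w k), q (w (Suc k))} \<in> E" using act_E[OF q(1)] w(3) wV Suc by auto
    moreover have "ed (map (\<lambda>i. q (w i)) [0..<Suc (Suc k)]) = insert {last (map (\<lambda>i. q (w i)) [0..<Suc k]), q (w (Suc k))} (ed (map (\<lambda>i. q (w i)) [0..<Suc k]))"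
     using ed_snoc[of "map (\<lambda>i. q (w i)) [0..<Suc k]" "q (w (Suc k))"] by simp
    ultimately show ?case using Suc by (simp add: last_map)
   qed simp
   have "xs \<noteq> []" "hd xs = q (w 0)" "last xs = v" unfolding xs_def using qn by (auto simp: hd_map last_map simp del: upt_Suc)
   moreover have "set xs \<subseteq> V" unfolding xs_def using wV act_V[OF q(1)] by auto
   moreover have "ed xs \<subseteq> E" unfolding xs_def using edk by blast
   moreover have "\<forall>v\<in>set xs. h (q (w 0)) \<le> h v"
   proof
    fix v assume "v \<in> set xs"
    then obtain i where i: "i \<le> n" "v = q (w i)" unfolding xs_def by (auto simp: less_Suc_eq_le simp del: upt_Suc)
    have "0 \<le> i * c / n" using c_pos by simp
    then show "h (q (w 0)) \<le> h v" using hq[OF i(1)] i(2) by simp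
   qed
   moreover have "h (q (w 0)) + c1 \<le> h v"
   proof -
    have "h v = h (q (w 0)) + c" using hq[of n] qn n0 by simp
    moreover have "c / n \<le> c" using n0 c_pos by (simp add: field_simps)
    ultimately show ?thesis using c1 by linarith
   qed
   moreover have "length xs \<le> Suc K" unfolding xs_def K_def by simp
   moreover have "q (w 0) \<in> orb x1" using q w(1) unfolding orb_def by auto
   ultimately show ?thesis by blast
  qed
  show "card (nb x) \<le> Max (insert 0 ((\<lambda>x. card (nb x)) ` V))" if "x \<in> V" for x
   using dcn that by (intro Max_ge) auto
  show "\<exists>g\<in>\<Gamma>. h x1 < h (g x1)"
  proof (rule bexI[OF _ x1(2)])
   have "x1 \<in> orb x1" "g1 x1 \<in> orb x1" using orb_self x1 unfolding orb_def by auto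
   then have "f x1 = f (g1 x1)" by (rule f_orb)
   then show "h x1 < h (g1 x1)" unfolding h_def using c_pos c_def w by simp
  qed
  show "nsum (\<lambda>y. of_bool (y \<in> orb x1) * F x y) = nsum (\<lambda>w. of_bool (w \<in> orb x1) * (F w z * ennreal (exp (h w - h z))))"
   if inv: "\<And>g u v. g \<in> \<Gamma> ==> u \<in> V ==> v \<in> V ==> F (g u) (g v) = (F u v :: ennreal)" and xz: "x \<in> orb x1" "z \<in> orb x1" for F x z
  proof -
   have V: "x \<in> V" "z \<in> V" using xz orb_V x1 by auto
   have o: "orb x = orb x1" "orb z = orb x1" using xz orb_sym orb_trans x1(1) V by blast+
   have "hw w / hw z = exp (h w - h z)" if "w \<in> orb x1" for w
    using eh[of z w] f_orb[OF that xz(2)] V orb_V[OF x1(1)] that by auto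
   have "nsum (\<lambda>y. of_bool (y \<in> orb z) * F x y) = nsum (\<lambda>w. of_bool (w \<in> orb x) * (F w z * ennreal (hw w / hw z)))"
    by (rule mass_transport[OF ne V]) (rule inv)
   also have "... = nsum (\<lambda>w. of_bool (w \<in> orb x) * (F w z * ennreal (exp (h w - h z))))"
    by (rule nn_integral_cong) (use \<open>\<And>w. w \<in> orb x1 ==> hw w / hw z = exp (h w - h z)\<close> o in auto)
   finally show ?thesis unfolding o .
  qed
  show "nsum (\<lambda>w. of_bool (w \<in> V) * F w z) \<le> ennreal (card R * exp (2 * Bf)) * (SUP x\<in>V. nsum (\<lambda>y. of_bool (y \<in> V) * (F x y * ennreal (exp (h y - h x)))))"
   if inv: "\<And>g u v. g \<in> \<Gamma> ==> u \<in> V ==> v \<in> V ==> F (g u) (g v) = (F u v :: ennreal)" and z: "z \<in> V" for F z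
  proof -
   let ?S = "SUP x\<in>V. nsum (\<lambda>y. of_bool (y \<in> V) * (F x y * ennreal (exp (h y - h x))))"
   let ?F = "\<lambda>a b. F a b * ennreal (hw b / hw a)"
   have each: "nsum (\<lambda>w. of_bool (w \<in> orb r) * F w z) \<le> ennreal (exp (2 * Bf)) * ?S" if r: "r \<in> V" for r
   proof -
    have inv': "?F (g u) (g v) = ?F u v" if "g \<in> \<Gamma>" "u \<in> V" "v \<in> V" for g u v
     using inv[OF that] hw_act[OF that(1,3,2)] by simp
    have "nsum (\<lambda>w. of_bool (w \<in> orb r) * F w z) = nsum (\<lambda>w. of_bool (w \<in> orb r) * (?F w z * ennreal (hw w / hw z)))"
    proof (rule nn_integral_cong)
     fix w
     show "of_bool (w \<in> orb r) * F w z = of_bool (w \<in> orb r) * (?F w z * ennreal (hw w / hw z))"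
     proof (cases "w \<in> orb r")
      case True
      then have "w \<in> V" using orb_V r by auto
      then have pos: "0 < hw w" "0 < hw z" using hw_pos z by auto
      have "ennreal (hw z / hw w) * ennreal (hw w / hw z) = ennreal (hw z / hw w * (hw w / hw z))"
       by (rule ennreal_mult'[symmetric]) (use pos in simp)
      also have "... = 1" using pos by simp
      finally show ?thesis by (simp add: mult.assoc)
     qed simp
    qed
    also have "... = nsum (\<lambda>y. of_bool (y \<in> orb z) * ?F r y)" by (rule mass_transport[OF ne r z, symmetric]) (rule inv')
    also have "... \<le> nsum (\<lambda>y. ennreal (exp (2 * Bf)) * (of_bool (y \<in> V) * (F r y * ennreal (exp (h y - h r)))))"
    proof (rule nsum_mono)
     fix y
     show "of_bool (y \<in> orb z) * ?F r y \<le> ennreal (exp (2 * Bf)) * (of_bool (y \<in> V) * (F r y * ennreal (exp (h y - h r))))"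
     proof (cases "y \<in> orb z")
      case True
      then have y: "y \<in> V" using orb_V z by auto
      have "hw y / hw r \<le> exp (2 * Bf) * exp (h y - h r)"
       unfolding eh[OF r y] using Bf(2)[OF y] Bf(2)[OF r] by (subst mult.commute) (intro mult_right_mono, auto)
      then have "ennreal (hw y / hw r) \<le> ennreal (exp (2 * Bf)) * ennreal (exp (h y - h r))"
       by (subst ennreal_mult'[symmetric]) (auto intro: ennreal_leI)
      then have "F r y * ennreal (hw y / hw r) \<le> F r y * (ennreal (exp (2 * Bf)) * ennreal (exp (h y - h r)))"
       by (rule mult_left_mono) simp
      then show ?thesis using True y by (simp add: mult_ac)
     qed simp
    qed
    also have "... = ennreal (exp (2 * Bf)) * nsum (\<lambda>y. of_bool (y \<in> V) * (F r y * ennreal (exp (h y - h r))))"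
     by (rule nsum_cmult)
    also have "... \<le> ennreal (exp (2 * Bf)) * ?S" using r by (intro mult_left_mono SUP_upper) auto
    finally show ?thesis .
   qed
   have "nsum (\<lambda>w. of_bool (w \<in> V) * F w z) \<le> nsum (\<lambda>w. \<Sum>r\<in>R. of_bool (w \<in> orb r) * F w z)"
   proof (rule nsum_mono)
    fix w
    show "of_bool (w \<in> V) * F w z \<le> (\<Sum>r\<in>R. of_bool (w \<in> orb r) * F w z)"
    proof (cases "w \<in> V")
     case True
     then obtain r where r: "r \<in> R" "w \<in> orb r" using R(3) unfolding orb_def by blast
     have "of_bool (w \<in> V) * F w z = (\<Sum>r\<in>{r}. of_bool (w \<in> orb r) * F w z)" using r True by simp
     also have "... \<le> (\<Sum>r\<in>R. of_bool (w \<in> orb r) * F w z)" by (rule sum_mono2) (use r R in auto)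
     finally show ?thesis .
    qed simp
   qed
   also have "... = (\<Sum>r\<in>R. nsum (\<lambda>w. of_bool (w \<in> orb r) * F w z))" by (rule nn_integral_sum) simp
   also have "... \<le> (\<Sum>r\<in>R. ennreal (exp (2 * Bf)) * ?S)" using each R by (intro sum_mono) auto
   also have "... = ennreal (card R * exp (2 * Bf)) * ?S"
    by (simp add: ennreal_mult' ennreal_of_nat_eq_real_of_nat mult.assoc)
   finally show ?thesis .
  qed
 qed
 then show thesis by (rule that)
qed

end

section \<open>Second moments for chains of connections\<close>

text \<open>A random walk read off from the configuration: from \<open>x\<close> it moves to
  \<open>y\<close> with weight \<open>Wt x y S\<close>, inspecting only \<open>Ed x y\<close>. These
  edges lie at or above \<open>x\<close> and each has an end strictly below \<open>y\<close>,
  whereas later steps inspect edges at or above \<open>y\<close>. Hence the steps of one trajectory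
  use disjoint edges.\<close>

locale chain =
 fixes h :: "'a \<Rightarrow> real" and Nx :: "'a \<Rightarrow> 'a set" and Ed :: "'a \<Rightarrow> 'a \<Rightarrow> 'a set set"
  and Wt :: "'a \<Rightarrow> 'a \<Rightarrow> 'a set set \<Rightarrow> real" and p :: real
 assumes p01: "0 \<le> p" "p \<le> 1"
  and Nx_fin: "finite (Nx x)"
  and Ed_fin: "finite (Ed x y)"
  and Nx_h: "y \<in> Nx x ==> h x < h y"
  and Ed_lo: "e \<in> Ed x y ==> v \<in> e ==> h x \<le> h v"
  and Ed_hi: "e \<in> Ed x y ==> \<exists>v\<in>e. h v < h y"
  and Wt_nn: "0 \<le> Wt x y S"
  and Wt_sum: "(\<Sum>y\<in>Nx x. Wt x y S) \<le> 1"
  and Wt_dep: "Wt x y S = Wt x y (S \<inter> Ed x y)"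
begin

definition q :: "'a \<Rightarrow> 'a \<Rightarrow> real" where "q x y = pexp p (Ed x y) (Wt x y)"

primrec tr :: "nat \<Rightarrow> 'a \<Rightarrow> 'a list set" where
 "tr 0 x = {[x]}"
| "tr (Suc k) x = (\<Union>y\<in>Nx x. (#) x ` tr k y)"

fun TW :: "'a list \<Rightarrow> 'a set set \<Rightarrow> real" where
 "TW (x # y # zs) S = Wt x y S * TW (y # zs) S"
| "TW _ S = 1"

fun TE :: "'a list \<Rightarrow> 'a set set" where
 "TE (x # y # zs) = Ed x y \<union> TE (y # zs)"
| "TE _ = {}"

fun qv :: "'a list \<Rightarrow> real" where
 "qv (x # y # zs) = q x y * qv (y # zs)"
| "qv _ = 1"

primrec qk :: "nat \<Rightarrow> 'a \<Rightarrow> 'a \<Rightarrow> real" where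
 "qk 0 x y = of_bool (x = y)"
| "qk (Suc k) x y = (\<Sum>z\<in>Nx x. q x z * qk k z y)"

definition trT :: "'a set \<Rightarrow> nat \<Rightarrow> 'a \<Rightarrow> 'a list set" where "trT T k x = {vs \<in> tr k x. last vs \<in> T}"

lemma q_nn: "0 \<le> q x y" unfolding q_def by (rule pexp_nonneg) (use p01 Wt_nn in auto)

lemma qv_nn: "0 \<le> qv vs" by (induction vs rule: qv.induct) (use q_nn in auto)

lemma qk_nn: "0 \<le> qk k x y" by (induction k arbitrary: x) (auto intro!: sum_nonneg mult_nonneg_nonneg q_nn)

lemma TW_nn: "0 \<le> TW vs S" by (induction vs rule: qv.induct) (use Wt_nn in auto)

lemma finite_tr [simp]: "finite (tr k x)" by (induction k arbitrary: x) (use Nx_fin in auto)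

lemma finite_trT [simp]: "finite (trT T k x)" unfolding trT_def by simp

lemma finite_TE [simp]: "finite (TE vs)" by (induction vs rule: TE.induct) (use Ed_fin in auto)

lemma tr_hd: "vs \<in> tr k x ==> vs \<noteq> [] \<and> hd vs = x \<and> length vs = Suc k"
 by (induction k arbitrary: x vs) auto

lemma trT_D: "vs \<in> trT T k x ==> vs \<in> tr k x \<and> last vs \<in> T" unfolding trT_def by simp

lemma tr_h: "vs \<in> tr k x ==> h x \<le> h (last vs)"
proof (induction k arbitrary: x vs)
 case (Suc k)
 then obtain y ws where "y \<in> Nx x" "ws \<in> tr k y" "vs = x # ws" by auto
 then show ?case using Suc.IH[of ws y] Nx_h[of y x] tr_hd[of ws k y] by auto
qed simp

lemma TE_lo: "vs \<in> tr k x ==> e \<in> TE vs ==> v \<in> e ==> h x \<le> h v"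
proof (induction k arbitrary: x vs)
 case (Suc k)
 then obtain y ws where y: "y \<in> Nx x" "ws \<in> tr k y" "vs = x # ws" by auto
 then obtain zs where "ws = y # zs" using tr_hd[OF y(2)] by (cases ws) auto
 then show ?case using Suc.IH[OF y(2)] Suc.prems y Ed_lo[of e x y v] Nx_h[of y x] by fastforce
qed simp

lemma TE_hi: "vs \<in> tr k x ==> e \<in> TE vs ==> \<exists>v\<in>e. h v < h (last vs)"
proof (induction k arbitrary: x vs)
 case (Suc k)
 then obtain y ws where y: "y \<in> Nx x" "ws \<in> tr k y" "vs = x # ws" by auto
 then obtain zs where zs: "ws = y # zs" using tr_hd[OF y(2)] by (cases ws) auto
 show ?case
 proof (cases "e \<in> Ed x y")
  case True
  then obtain v where "v \<in> e" "h v < h y" using Ed_hi by blast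
  then show ?thesis using tr_h[OF y(2)] y zs by (intro bexI[of _ v]) auto
 next
  case False
  then have "e \<in> TE ws" using Suc.prems y zs by auto
  then show ?thesis using Suc.IH[OF y(2)] y zs by auto
 qed
qed simp

lemma TW_dep: "TE vs \<subseteq> B ==> TW vs S = TW vs (S \<inter> B)"
proof (induction vs rule: TE.induct)
 case (1 x y zs)
 have "Wt x y (S \<inter> B) = Wt x y (S \<inter> B \<inter> Ed x y)" by (rule Wt_dep)
 also have "S \<inter> B \<inter> Ed x y = S \<inter> Ed x y" using 1 by auto
 finally show ?case using 1 Wt_dep[of x y S] by simp
qed auto

lemma sum_tr_Suc: "(\<Sum>vs\<in>trT T (Suc k) x. f vs) = (\<Sum>y\<in>Nx x. \<Sum>ws\<in>trT T k y. f (x # ws))"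
proof -
 have eq: "trT T (Suc k) x = (\<Union>y\<in>Nx x. (#) x ` trT T k y)"
  unfolding trT_def using tr_hd by (fastforce)
 have "(\<Sum>vs\<in>trT T (Suc k) x. f vs) = (\<Sum>y\<in>Nx x. \<Sum>vs\<in>(#) x ` trT T k y. f vs)"
  unfolding eq
 proof (rule sum.UNION_disjoint)
  show "\<forall>y\<in>Nx x. \<forall>y'\<in>Nx x. y \<noteq> y' \<longrightarrow> (#) x ` trT T k y \<inter> (#) x ` trT T k y' = {}"
  proof (intro ballI impI)
   fix y y' :: 'a assume "y \<noteq> y'"
   then have "ws \<noteq> ws'" if "ws \<in> trT T k y" "ws' \<in> trT T k y'" for ws ws'
    using trT_D[OF that(1)] trT_D[OF that(2)] tr_hd by metis
   then show "(#) x ` trT T k y \<inter> (#) x ` trT T k y' = {}" by blast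
  qed
 qed (use Nx_fin in auto)
 then show ?thesis by (simp add: sum.reindex)
qed

lemma trT_UNIV: "trT UNIV k x = tr k x" unfolding trT_def by simp

lemma TW_Cons: "ws \<in> tr k y ==> TW (x # ws) S = Wt x y S * TW ws S"
 using tr_hd[of ws k y] by (cases ws) auto

lemma qv_Cons: "ws \<in> tr k y ==> qv (x # ws) = q x y * qv ws"
 using tr_hd[of ws k y] by (cases ws) auto

lemma TE_Cons: "ws \<in> tr k y ==> TE (x # ws) = Ed x y \<union> TE ws"
 using tr_hd[of ws k y] by (cases ws) auto

lemma TW_sum: "(\<Sum>vs\<in>tr k x. TW vs S) \<le> 1"
proof (induction k arbitrary: x)
 case (Suc k)
 have "(\<Sum>vs\<in>tr (Suc k) x. TW vs S) = (\<Sum>y\<in>Nx x. \<Sum>ws\<in>tr k y. Wt x y S * TW ws S)"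
  using sum_tr_Suc[of "\<lambda>vs. TW vs S" UNIV k x] TW_Cons unfolding trT_UNIV by simp
 also have "... = (\<Sum>y\<in>Nx x. Wt x y S * (\<Sum>ws\<in>tr k y. TW ws S))" by (simp add: sum_distrib_left)
 also have "... \<le> (\<Sum>y\<in>Nx x. Wt x y S * 1)" by (intro sum_mono mult_left_mono Suc Wt_nn)
 finally show ?case using Wt_sum[of x S] by simp
qed simp

lemma sum_qv: "(\<Sum>vs\<in>trT T k x. qv vs) = (\<Sum>y\<in>Nx x. q x y * (\<Sum>vs\<in>trT T (k - 1) y. qv vs))" if "k > 0"
proof -
 obtain j where j: "k = Suc j" using \<open>k > 0\<close> by (cases k) auto
 have "(\<Sum>vs\<in>trT T (Suc j) x. qv vs) = (\<Sum>y\<in>Nx x. \<Sum>ws\<in>trT T j y. q x y * qv ws)"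
  unfolding sum_tr_Suc by (intro sum.cong refl qv_Cons[of _ j]) (use trT_D in blast)
 then show ?thesis using j by (simp add: sum_distrib_left)
qed

lemma sum_qv_qk: "(\<Sum>vs\<in>trT {y} k x. qv vs) = qk k x y"
proof (induction k arbitrary: x)
 case 0 then show ?case by (auto simp: trT_def Collect_conv_if)
next
 case (Suc k) then show ?case using sum_qv[of "Suc k" "{y}" x] by simp
qed

lemma sum_split:
 fixes f :: "'a list \<Rightarrow> real"
 shows "(\<Sum>vs\<in>trT T (i + j) x. f vs) = (\<Sum>us\<in>tr i x. \<Sum>ws\<in>trT T j (last us). f (us @ tl ws))"
proof (induction i arbitrary: x f)
 case 0
 have eq: "[x] @ tl ws = ws" if "ws \<in> trT T j x" for ws using trT_D[OF that] tr_hd[of ws j x] by (cases ws) auto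
 have "(\<Sum>ws\<in>trT T j x. f ([x] @ tl ws)) = (\<Sum>ws\<in>trT T j x. f ws)" by (rule sum.cong) (use eq in auto)
 then show ?case by simp
next
 case (Suc i)
 have "(\<Sum>vs\<in>trT T (Suc i + j) x. f vs) = (\<Sum>y\<in>Nx x. \<Sum>ws\<in>trT T (i + j) y. f (x # ws))"
  using sum_tr_Suc by simp
 also have "... = (\<Sum>y\<in>Nx x. \<Sum>us\<in>tr i y. \<Sum>ws\<in>trT T j (last us). f (x # us @ tl ws))"
  using Suc.IH by simp
 also have "... = (\<Sum>y\<in>Nx x. \<Sum>us\<in>tr i y. \<Sum>ws\<in>trT T j (last (x # us)). f ((x # us) @ tl ws))"
 proof (rule sum.cong[OF refl], rule sum.cong[OF refl])
  fix y us assume "us \<in> tr i y"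
  then have "last (x # us) = last us" using tr_hd by fastforce
  then show "(\<Sum>ws\<in>trT T j (last us). f (x # us @ tl ws)) = (\<Sum>ws\<in>trT T j (last (x # us)). f ((x # us) @ tl ws))" by simp
 qed
 also have "... = (\<Sum>us\<in>tr (Suc i) x. \<Sum>ws\<in>trT T j (last us). f (us @ tl ws))"
  using sum_tr_Suc[of "\<lambda>us. \<Sum>ws\<in>trT T j (last us). f (us @ tl ws)" UNIV i x] unfolding trT_UNIV by simp
 finally show ?case .
qed

lemma append_facts:
 "us \<in> tr i x ==> ws \<in> tr j (last us) ==> us @ tl ws \<in> tr (i + j) x \<and> TW (us @ tl ws) S = TW us S * TW ws S \<and>
  TE (us @ tl ws) = TE us \<union> TE ws \<and> last (us @ tl ws) = last ws \<and> (us @ tl ws) ! i = last us \<and> take (Suc i) (us @ tl ws) = us"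
proof (induction i arbitrary: x us)
 case 0
 then have "us @ tl ws = ws" using tr_hd[of ws j x] by (cases ws) auto
 then show ?case using 0 tr_hd[of ws j x] by (cases ws) auto
next
 case (Suc i)
 then obtain y us' where y: "y \<in> Nx x" "us' \<in> tr i y" "us = x # us'" by auto
 have l: "last us = last us'" using y tr_hd[OF y(2)] by auto
 have IH: "us' @ tl ws \<in> tr (i + j) y \<and> TW (us' @ tl ws) S = TW us' S * TW ws S \<and>
  TE (us' @ tl ws) = TE us' \<union> TE ws \<and> last (us' @ tl ws) = last ws \<and> (us' @ tl ws) ! i = last us' \<and> take (Suc i) (us' @ tl ws) = us'"
  using Suc.IH[OF y(2)] Suc.prems l by auto
 have m: "us' @ tl ws \<in> tr (i + j) y" using IH by simp
 show ?case using IH l y TW_Cons[OF m, of x S] TW_Cons[OF y(2), of x S] TE_Cons[OF m, of x] TE_Cons[OF y(2), of x] tr_hd[OF m]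
  by (auto simp: mult.assoc)
qed

text \<open>\<open>Ed_hi\<close> for the first step and \<open>TE_lo\<close> for the rest make the
  inspected edge sets disjoint, so the means multiply.\<close>

lemma pexp_TW:
 assumes "finite F" "TE vs \<subseteq> F" "vs \<in> tr k x" shows "pexp p F (TW vs) = qv vs"
 using assms(2,3)
proof (induction k arbitrary: vs x)
 case 0
 then show ?case using assms by (auto simp: fun_eq_iff)
next
 case (Suc k)
 then obtain y ws where y: "y \<in> Nx x" "ws \<in> tr k y" "vs = x # ws" by auto
 have sub: "Ed x y \<subseteq> F" "TE ws \<subseteq> F" using Suc.prems TE_Cons[OF y(2)] y by auto
 have "pexp p F (TW vs) = pexp p F (\<lambda>S. Wt x y S * TW ws S)" using TW_Cons[OF y(2)] y by (intro pexp_cong) auto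
 also have "... = pexp p F (Wt x y) * pexp p F (TW ws)"
 proof (rule pexp_indep[OF assms(1) sub])
  show "Ed x y \<inter> TE ws = {}"
  proof (rule ccontr)
   assume "Ed x y \<inter> TE ws \<noteq> {}"
   then obtain e where e: "e \<in> Ed x y" "e \<in> TE ws" by auto
   then obtain v where "v \<in> e" "h v < h y" using Ed_hi by blast
   then show False using TE_lo[OF y(2) e(2)] by force
  qed
 qed (rule Wt_dep, rule TW_dep, simp)
 also have "pexp p F (Wt x y) = q x y" unfolding q_def by (rule pexp_superset[OF assms(1) sub(1)]) (rule Wt_dep)
 also have "pexp p F (TW ws) = qv ws" using Suc.IH sub y by auto
 finally show ?case using qv_Cons[OF y(2)] y by simp
qed

text \<open>\<open>Rg y\<close> contains every edge that a step from \<open>y\<close> may inspect;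
  \<open>cls\<close> then says that steps from the two vertices can interfere.\<close>

definition Rg :: "'a \<Rightarrow> 'a set set" where "Rg y = (\<Union>z\<in>Nx y. Ed y z)"
definition cls :: "'a \<Rightarrow> 'a \<Rightarrow> bool" where "cls y y' \<longleftrightarrow> Rg y \<inter> Rg y' \<noteq> {}"

lemma TE_nth: "vs \<in> tr k x ==> e \<in> TE vs ==> \<exists>i<k. e \<in> Rg (vs ! i) \<and> e \<notin> TE (take (Suc i) vs) \<and> e \<in> TE (take (Suc (Suc i)) vs)"
proof (induction k arbitrary: x vs)
 case (Suc k)
 then obtain y ws where y: "y \<in> Nx x" "ws \<in> tr k y" "vs = x # ws" by auto
 then obtain zs where zs: "ws = y # zs" using tr_hd[OF y(2)] by (cases ws) auto
 show ?case
 proof (cases "e \<in> Ed x y")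
  case True
  then show ?thesis using y zs unfolding Rg_def by (intro exI[of _ 0]) auto
 next
  case False
  then have "e \<in> TE ws" using Suc.prems y zs by auto
  then obtain i where i: "i < k" "e \<in> Rg (ws ! i)" "e \<notin> TE (take (Suc i) ws)" "e \<in> TE (take (Suc (Suc i)) ws)" using Suc.IH[OF y(2)] by auto
  then show ?thesis using y zs False by (intro exI[of _ "Suc i"]) auto
 qed
qed simp

lemma TE_take_mono: "TE (take i vs) \<subseteq> TE (take (i + j) vs)"
proof (induction vs arbitrary: i rule: TE.induct)
 case (1 x y zs)
 show ?case
 proof (cases i)
  case (Suc i')
  then show ?thesis using 1[of i'] by (cases i') auto
 qed simp
qed (auto simp: take_Cons' )

text \<open>Two trajectories that share an edge are cut at a pair of positions up to which they share none;
 from there on, the higher of the two continues independently of the past.\<close>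

lemma interaction:
 assumes "a \<in> tr k x" "b \<in> tr k x'" "TE a \<inter> TE b \<noteq> {}"
 shows "\<exists>i<k. \<exists>j<k. cls (a ! i) (b ! j) \<and> TE (take (Suc i) a) \<inter> TE (take (Suc j) b) = {}"
proof -
 define I where "I n \<longleftrightarrow> (\<exists>i<k. \<exists>j<k. n = i + j \<and> TE (take (Suc (Suc i)) a) \<inter> TE (take (Suc (Suc j)) b) \<noteq> {})" for n
 obtain e where e: "e \<in> TE a" "e \<in> TE b" using assms by auto
 obtain i j where "i < k" "e \<in> TE (take (Suc (Suc i)) a)" "j < k" "e \<in> TE (take (Suc (Suc j)) b)"
  using TE_nth[OF assms(1) e(1)] TE_nth[OF assms(2) e(2)] by auto
 then have "I (i + j)" unfolding I_def by blast
 \<comment> \<open>For minimal \<open>i + j\<close>, shortening either truncation makes the two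
   disjoint, so a shared edge is inspected in the last step of both.\<close>
 then have "I (LEAST n. I n)" by (rule LeastI)
 then obtain i j where ij: "i < k" "j < k" "(LEAST n. I n) = i + j" "TE (take (Suc (Suc i)) a) \<inter> TE (take (Suc (Suc j)) b) \<noteq> {}"
  unfolding I_def by blast
 have min: "\<not> I n" if "n < i + j" for n using that ij(3) not_less_Least by metis
 have sing: "TE (take (Suc 0) vs) = {}" for vs by (cases vs) auto
 have i1: "TE (take (Suc i) a) \<inter> TE (take (Suc (Suc j)) b) = {}"
 proof (cases i)
  case (Suc i')
  then show ?thesis using min[of "i' + j"] ij(1,2) unfolding I_def by (metis Suc_lessD add_Suc lessI)
 qed (simp add: sing)
 have i2: "TE (take (Suc (Suc i)) a) \<inter> TE (take (Suc j) b) = {}"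
 proof (cases j)
  case (Suc j')
  then show ?thesis using min[of "i + j'"] ij(1,2) unfolding I_def by (metis Suc_lessD add_Suc_right lessI)
 qed (simp add: sing)
 obtain e where e: "e \<in> TE (take (Suc (Suc i)) a)" "e \<in> TE (take (Suc (Suc j)) b)" using ij by auto
 have ea: "e \<in> TE a" "e \<in> TE b" using e TE_take_mono[of "Suc (Suc i)" a "length a"] TE_take_mono[of "Suc (Suc j)" b "length b"] by auto
 have "e \<in> Rg (a ! i)"
 proof -
  obtain i0 where i0: "i0 < k" "e \<in> Rg (a ! i0)" "e \<notin> TE (take (Suc i0) a)" "e \<in> TE (take (Suc (Suc i0)) a)" using TE_nth[OF assms(1) ea(1)] by auto
  have "e \<notin> TE (take (Suc i) a)" using i1 e by auto
  then have "\<not> i0 < i" using i0(4) TE_take_mono[of "Suc (Suc i0)" a "i - Suc i0"] by auto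
  moreover have "\<not> i < i0" using i0(3) e(1) TE_take_mono[of "Suc (Suc i)" a "i0 - Suc i"] by auto
  ultimately show ?thesis using i0 by (simp add: le_antisym not_less)
 qed
 moreover have "e \<in> Rg (b ! j)"
 proof -
  obtain i0 where i0: "i0 < k" "e \<in> Rg (b ! i0)" "e \<notin> TE (take (Suc i0) b)" "e \<in> TE (take (Suc (Suc i0)) b)" using TE_nth[OF assms(2) ea(2)] by auto
  have "e \<notin> TE (take (Suc j) b)" using i2 e by auto
  then have "\<not> i0 < j" using i0(4) TE_take_mono[of "Suc (Suc i0)" b "j - Suc i0"] by auto
  moreover have "\<not> j < i0" using i0(3) e(2) TE_take_mono[of "Suc (Suc j)" b "i0 - Suc j"] by auto
  ultimately show ?thesis using i0 by (simp add: le_antisym not_less)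
 qed
 moreover have "TE (take (Suc i) a) \<inter> TE (take (Suc j) b) = {}"
  using i1 TE_take_mono[of "Suc j" b 1] by auto
 ultimately show ?thesis unfolding cls_def using ij by blast
qed

text \<open>Edge-disjoint pairs contribute the square of the mean. Any other pair is cut at
  interfering positions \<open>i\<close> and \<open>j\<close>: the pasts are independent of each
  other, the continuation from the higher cut point is independent of both and keeps its mean, and
  the one from the lower cut point is bounded by 1. The factor 2 covers the choice of the higher
  trajectory.\<close>

lemma pair_bound:
 fixes A T k
 defines "TT \<equiv> \<Union>x\<in>A. trT T k x" and "pre \<equiv> \<lambda>i. \<Union>x\<in>A. tr i x"
 assumes A: "finite A" and F: "finite F" "\<And>vs. vs \<in> TT ==> TE vs \<subseteq> F"
 shows "pexp p F (\<lambda>S. (\<Sum>vs\<in>TT. TW vs S)\<^sup>2) \<le> (\<Sum>vs\<in>TT. qv vs)\<^sup>2 +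
  2 * (\<Sum>i<k. \<Sum>j<k. \<Sum>us\<in>pre i. \<Sum>us'\<in>pre j. of_bool (cls (last us) (last us') \<and> h (last us') \<le> h (last us) \<and> trT T (k - j) (last us') \<noteq> {}) *
   (qv us * qv us' * (\<Sum>ws\<in>trT T (k - i) (last us). qv ws)))"
proof -
 have fTT: "finite TT" unfolding TT_def using A by auto
 have fpre: "finite (pre i)" for i unfolding pre_def using A by auto
 define g where "g a b = pexp p F (\<lambda>S. TW a S * TW b S)" for a b
 have g_nn: "0 \<le> g a b" for a b unfolding g_def by (rule pexp_nonneg) (use p01 TW_nn in auto)
 have g_comm: "g a b = g b a" for a b unfolding g_def by (simp add: mult.commute)
 define R where "R i j a b \<longleftrightarrow> cls (a ! i) (b ! j) \<and> h (b ! j) \<le> h (a ! i) \<and> TE (take (Suc i) a) \<inter> TE (take (Suc j) b) = {}" for i j a b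
 define G where "G i j a b = of_bool (R i j a b) * g a b" for i j a b
 have G_nn: "0 \<le> G i j a b" for i j a b unfolding G_def using g_nn by simp
 have TT_tr: "\<exists>x. a \<in> tr k x" if "a \<in> TT" for a using that trT_D unfolding TT_def by blast
 have pt: "g a b \<le> qv a * qv b + (\<Sum>i<k. \<Sum>j<k. G i j a b + G j i b a)" if ab: "a \<in> TT" "b \<in> TT" for a b
 proof -
  obtain x x' where tr: "a \<in> tr k x" "b \<in> tr k x'" using TT_tr ab by blast
  have nn: "0 \<le> (\<Sum>i<k. \<Sum>j<k. G i j a b + G j i b a)" by (intro sum_nonneg add_nonneg_nonneg G_nn)
  show ?thesis
  proof (cases "TE a \<inter> TE b = {}")
   case True
   have "g a b = pexp p F (TW a) * pexp p F (TW b)" unfolding g_def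
    by (rule pexp_indep[OF F(1) F(2)[OF ab(1)] F(2)[OF ab(2)] True]) (rule TW_dep, simp)+
   also have "... = qv a * qv b" using pexp_TW[OF F(1) F(2)[OF ab(1)] tr(1)] pexp_TW[OF F(1) F(2)[OF ab(2)] tr(2)] by simp
   finally show ?thesis using nn by simp
  next
   case False
   obtain i j where ij: "i < k" "j < k" "cls (a ! i) (b ! j)" "TE (take (Suc i) a) \<inter> TE (take (Suc j) b) = {}"
    using interaction[OF tr False] by blast
   have "g a b \<le> G i j a b + G j i b a"
   proof (cases "h (b ! j) \<le> h (a ! i)")
    case True
    then have "G i j a b = g a b" unfolding G_def R_def using ij by simp
    then show ?thesis using G_nn[of j i b a] by simp
   next
    case False
    then have "R j i b a" unfolding R_def using ij by (auto simp: cls_def)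
    then have "G j i b a = g a b" unfolding G_def using g_comm by simp
    then show ?thesis using G_nn[of i j a b] by simp
   qed
   also have "... \<le> (\<Sum>j<k. G i j a b + G j i b a)"
    by (rule member_le_sum[where f="\<lambda>j. G i j a b + G j i b a"]) (use ij G_nn in auto)
   also have "... \<le> (\<Sum>i<k. \<Sum>j<k. G i j a b + G j i b a)"
    by (rule member_le_sum[where f="\<lambda>i. \<Sum>j<k. G i j a b + G j i b a"]) (use ij G_nn in \<open>auto intro!: sum_nonneg add_nonneg_nonneg\<close>)
   finally show ?thesis using qv_nn[of a] qv_nn[of b] by (simp add: add_increasing)
  qed
 qed
 have part: "(\<Sum>a\<in>TT. \<Sum>b\<in>TT. G i j a b) \<le> (\<Sum>us\<in>pre i. \<Sum>us'\<in>pre j. of_bool (cls (last us) (last us') \<and> h (last us') \<le> h (last us) \<and> trT T (k - j) (last us') \<noteq> {}) *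
   (qv us * qv us' * (\<Sum>ws\<in>trT T (k - i) (last us). qv ws)))" if ij: "i < k" "j < k" for i j
 proof -
  have split: "(\<Sum>a\<in>TT. f a) = (\<Sum>us\<in>pre i. \<Sum>ws\<in>trT T (k - i) (last us). f (us @ tl ws))" if "i < k" for f :: "'a list \<Rightarrow> real" and i
  proof -
   have "(\<Sum>a\<in>TT. f a) = (\<Sum>x\<in>A. \<Sum>a\<in>trT T k x. f a)" unfolding TT_def
   proof (rule sum.UNION_disjoint[OF A])
    show "\<forall>x\<in>A. \<forall>x'\<in>A. x \<noteq> x' \<longrightarrow> trT T k x \<inter> trT T k x' = {}" using trT_D tr_hd by (metis disjoint_iff)
   qed simp
   also have "... = (\<Sum>x\<in>A. \<Sum>us\<in>tr i x. \<Sum>ws\<in>trT T (k - i) (last us). f (us @ tl ws))"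
    using sum_split[of f T i "k - i"] that by simp
   also have "... = (\<Sum>us\<in>pre i. \<Sum>ws\<in>trT T (k - i) (last us). f (us @ tl ws))" unfolding pre_def
   proof (rule sum.UNION_disjoint[OF A, symmetric])
    show "\<forall>x\<in>A. \<forall>x'\<in>A. x \<noteq> x' \<longrightarrow> tr i x \<inter> tr i x' = {}" using tr_hd by (metis disjoint_iff)
   qed simp
   finally show ?thesis .
  qed
  have inTT: "us @ tl ws \<in> TT" if "us \<in> pre i" "ws \<in> trT T (k - i) (last us)" "i < k" for us ws i
  proof -
   obtain x where x: "x \<in> A" "us \<in> tr i x" using \<open>us \<in> pre i\<close> unfolding pre_def by auto
   have "us @ tl ws \<in> tr (i + (k - i)) x" "last (us @ tl ws) = last ws"
    using append_facts[OF x(2), of ws "k - i"] trT_D[OF that(2)] by auto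
   then show ?thesis unfolding TT_def trT_def using x trT_D[OF that(2)] that(3) by auto
  qed
  have "(\<Sum>a\<in>TT. \<Sum>b\<in>TT. G i j a b) = (\<Sum>us\<in>pre i. \<Sum>ws\<in>trT T (k - i) (last us). \<Sum>us'\<in>pre j. \<Sum>ws'\<in>trT T (k - j) (last us'). G i j (us @ tl ws) (us' @ tl ws'))"
   unfolding split[OF ij(1), of "\<lambda>a. \<Sum>b\<in>TT. G i j a b"] by (intro sum.cong refl split[OF ij(2)])
  also have "... = (\<Sum>us\<in>pre i. \<Sum>us'\<in>pre j. \<Sum>ws\<in>trT T (k - i) (last us). \<Sum>ws'\<in>trT T (k - j) (last us'). G i j (us @ tl ws) (us' @ tl ws'))"
   by (intro sum.cong refl sum.swap)
  also have "... \<le> (\<Sum>us\<in>pre i. \<Sum>us'\<in>pre j. of_bool (cls (last us) (last us') \<and> h (last us') \<le> h (last us) \<and> trT T (k - j) (last us') \<noteq> {}) *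
   (qv us * qv us' * (\<Sum>ws\<in>trT T (k - i) (last us). qv ws)))"
  proof (intro sum_mono)
   fix us us' assume us: "us \<in> pre i" "us' \<in> pre j"
   obtain x x' where x: "us \<in> tr i x" "us' \<in> tr j x'" using us unfolding pre_def by auto
   define Rp where "Rp \<longleftrightarrow> cls (last us) (last us') \<and> h (last us') \<le> h (last us) \<and> TE us \<inter> TE us' = {}"
   let ?W = "trT T (k - i) (last us)" and ?W' = "trT T (k - j) (last us')"
   have Gd: "G i j (us @ tl ws) (us' @ tl ws') = of_bool Rp * pexp p F (\<lambda>S. TW us S * TW ws S * (TW us' S * TW ws' S))"
    if w: "ws \<in> ?W" "ws' \<in> ?W'" for ws ws'
    using append_facts[OF x(1), of ws "k - i"] append_facts[OF x(2), of ws' "k - j"] trT_D[OF w(1)] trT_D[OF w(2)]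
    unfolding G_def R_def Rp_def g_def by simp
   have inner: "(\<Sum>ws'\<in>?W'. G i j (us @ tl ws) (us' @ tl ws')) \<le> of_bool (Rp \<and> ?W' \<noteq> {}) * (qv us * qv us' * qv ws)" if w: "ws \<in> ?W" for ws
   proof (cases "Rp \<and> ?W' \<noteq> {}")
    case True
    then obtain ws0 where ws0: "ws0 \<in> ?W'" by auto
    have wtr: "ws \<in> tr (k - i) (last us)" "ws0 \<in> tr (k - j) (last us')" using trT_D w ws0 by auto
    have TF: "TE us \<subseteq> F" "TE ws \<subseteq> F" "TE us' \<subseteq> F"
     using F(2)[OF inTT[OF us(1) w ij(1)]] F(2)[OF inTT[OF us(2) ws0 ij(2)]] append_facts[OF x(1) wtr(1)] append_facts[OF x(2) wtr(2)] by auto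
    have d1: "TE us \<inter> TE us' = {}" using True Rp_def by simp
    \<comment> \<open>Edges of \<open>ws\<close> lie at or above the higher cut point, while every
      edge of either past has an end strictly below it.\<close>
    have d2: "(TE us \<union> TE us') \<inter> TE ws = {}"
    proof (rule ccontr)
     assume "(TE us \<union> TE us') \<inter> TE ws \<noteq> {}"
     then obtain e where e: "e \<in> TE us \<or> e \<in> TE us'" "e \<in> TE ws" by auto
     have "\<exists>v\<in>e. h v < h (last us)"
      using e(1) TE_hi[OF x(1)] TE_hi[OF x(2)] True unfolding Rp_def by fastforce
     then show False using TE_lo[OF wtr(1) e(2)] by force
    qed
    have "(\<Sum>ws'\<in>?W'. G i j (us @ tl ws) (us' @ tl ws')) = (\<Sum>ws'\<in>?W'. pexp p F (\<lambda>S. TW us S * TW ws S * (TW us' S * TW ws' S)))"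
     using Gd[OF w] True by (intro sum.cong) auto
    also have "... = pexp p F (\<lambda>S. \<Sum>ws'\<in>?W'. TW us S * TW ws S * (TW us' S * TW ws' S))" by (rule pexp_sum[symmetric])
    also have "... \<le> pexp p F (\<lambda>S. (TW us S * TW us' S) * TW ws S)"
    proof (rule pexp_mono[OF p01])
     fix S
     have "(\<Sum>ws'\<in>?W'. TW ws' S) \<le> (\<Sum>ws'\<in>tr (k - j) (last us'). TW ws' S)"
      by (rule sum_mono2) (auto simp: trT_def TW_nn)
     then have le: "(\<Sum>ws'\<in>?W'. TW ws' S) \<le> 1" using TW_sum order_trans by blast
     have "(\<Sum>ws'\<in>?W'. TW us S * TW ws S * (TW us' S * TW ws' S)) = ((TW us S * TW us' S) * TW ws S) * (\<Sum>ws'\<in>?W'. TW ws' S)"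
      unfolding sum_distrib_left by (intro sum.cong) (auto simp: mult_ac)
     also have "... \<le> ((TW us S * TW us' S) * TW ws S) * 1"
      by (intro mult_left_mono le mult_nonneg_nonneg TW_nn)
     finally show "(\<Sum>ws'\<in>?W'. TW us S * TW ws S * (TW us' S * TW ws' S)) \<le> (TW us S * TW us' S) * TW ws S" by simp
    qed
    also have "... = pexp p F (\<lambda>S. TW us S * TW us' S) * pexp p F (TW ws)"
    proof (rule pexp_indep[OF F(1) _ TF(2) d2])
     show "TE us \<union> TE us' \<subseteq> F" using TF by simp
    next
     fix S
     have "TW us S = TW us (S \<inter> (TE us \<union> TE us'))" "TW us' S = TW us' (S \<inter> (TE us \<union> TE us'))"
      by (rule TW_dep, simp)+
     then show "TW us S * TW us' S = TW us (S \<inter> (TE us \<union> TE us')) * TW us' (S \<inter> (TE us \<union> TE us'))" by simp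
    qed (rule TW_dep, simp)
    also have "pexp p F (\<lambda>S. TW us S * TW us' S) = pexp p F (TW us) * pexp p F (TW us')"
     by (rule pexp_indep[OF F(1) TF(1,3) d1]) (rule TW_dep, simp)+
    finally show ?thesis using True pexp_TW[OF F(1) TF(1) x(1)] pexp_TW[OF F(1) TF(3) x(2)] pexp_TW[OF F(1) TF(2) wtr(1)] by simp
   next
    case False
    have "(\<Sum>ws'\<in>?W'. G i j (us @ tl ws) (us' @ tl ws')) = 0"
     using False Gd[OF w] by (intro sum.neutral) auto
    then show ?thesis using qv_nn[of us] qv_nn[of us'] qv_nn[of ws] by simp
   qed
   have "(\<Sum>ws\<in>?W. \<Sum>ws'\<in>?W'. G i j (us @ tl ws) (us' @ tl ws')) \<le> (\<Sum>ws\<in>?W. of_bool (Rp \<and> ?W' \<noteq> {}) * (qv us * qv us' * qv ws))"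
    by (intro sum_mono inner)
   also have "... = of_bool (Rp \<and> ?W' \<noteq> {}) * (qv us * qv us' * (\<Sum>ws\<in>?W. qv ws))"
    by (simp add: sum_distrib_left)
   also have "... \<le> of_bool (cls (last us) (last us') \<and> h (last us') \<le> h (last us) \<and> ?W' \<noteq> {}) * (qv us * qv us' * (\<Sum>ws\<in>?W. qv ws))"
    unfolding Rp_def by (intro mult_right_mono mult_nonneg_nonneg qv_nn sum_nonneg) auto
   finally show "(\<Sum>ws\<in>?W. \<Sum>ws'\<in>?W'. G i j (us @ tl ws) (us' @ tl ws')) \<le>
    of_bool (cls (last us) (last us') \<and> h (last us') \<le> h (last us) \<and> ?W' \<noteq> {}) * (qv us * qv us' * (\<Sum>ws\<in>?W. qv ws))" .
  qed
  finally show ?thesis .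
 qed
 have sw: "(\<Sum>a\<in>TT. \<Sum>b\<in>TT. \<Sum>i<k. \<Sum>j<k. f i j a b) = (\<Sum>i<k. \<Sum>j<k. \<Sum>a\<in>TT. \<Sum>b\<in>TT. f i j a b)" for f :: "nat \<Rightarrow> nat \<Rightarrow> 'a list \<Rightarrow> 'a list \<Rightarrow> real"
 proof -
  have "(\<Sum>a\<in>TT. \<Sum>b\<in>TT. \<Sum>i<k. \<Sum>j<k. f i j a b) = (\<Sum>a\<in>TT. \<Sum>i<k. \<Sum>b\<in>TT. \<Sum>j<k. f i j a b)"
   by (intro sum.cong refl sum.swap)
  also have "... = (\<Sum>i<k. \<Sum>a\<in>TT. \<Sum>b\<in>TT. \<Sum>j<k. f i j a b)" by (rule sum.swap)
  also have "... = (\<Sum>i<k. \<Sum>a\<in>TT. \<Sum>j<k. \<Sum>b\<in>TT. f i j a b)" by (intro sum.cong refl sum.swap)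
  also have "... = (\<Sum>i<k. \<Sum>j<k. \<Sum>a\<in>TT. \<Sum>b\<in>TT. f i j a b)" by (intro sum.cong refl sum.swap)
  finally show ?thesis .
 qed
 have g2: "(\<Sum>a\<in>TT. \<Sum>b\<in>TT. \<Sum>i<k. \<Sum>j<k. G j i b a) = (\<Sum>i<k. \<Sum>j<k. \<Sum>a\<in>TT. \<Sum>b\<in>TT. G i j a b)"
 proof -
  have "(\<Sum>a\<in>TT. \<Sum>b\<in>TT. \<Sum>i<k. \<Sum>j<k. G j i b a) = (\<Sum>b\<in>TT. \<Sum>a\<in>TT. \<Sum>i<k. \<Sum>j<k. G j i b a)" by (rule sum.swap)
  also have "... = (\<Sum>b\<in>TT. \<Sum>a\<in>TT. \<Sum>j<k. \<Sum>i<k. G j i b a)" by (intro sum.cong refl sum.swap)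
  finally show ?thesis unfolding sw .
 qed
 have "pexp p F (\<lambda>S. (\<Sum>vs\<in>TT. TW vs S)\<^sup>2) = pexp p F (\<lambda>S. \<Sum>a\<in>TT. \<Sum>b\<in>TT. TW a S * TW b S)"
  by (simp add: power2_eq_square sum_product)
 also have "... = (\<Sum>a\<in>TT. \<Sum>b\<in>TT. g a b)" unfolding g_def pexp_sum ..
 also have "... \<le> (\<Sum>a\<in>TT. \<Sum>b\<in>TT. qv a * qv b + (\<Sum>i<k. \<Sum>j<k. G i j a b + G j i b a))"
  by (intro sum_mono pt)
 also have "... = (\<Sum>a\<in>TT. \<Sum>b\<in>TT. qv a * qv b) + (\<Sum>a\<in>TT. \<Sum>b\<in>TT. \<Sum>i<k. \<Sum>j<k. G i j a b) + (\<Sum>a\<in>TT. \<Sum>b\<in>TT. \<Sum>i<k. \<Sum>j<k. G j i b a)"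
  by (simp add: sum.distrib)
 also have "(\<Sum>a\<in>TT. \<Sum>b\<in>TT. qv a * qv b) = (\<Sum>vs\<in>TT. qv vs)\<^sup>2"
  by (simp add: power2_eq_square sum_product)
 finally have fin: "pexp p F (\<lambda>S. (\<Sum>vs\<in>TT. TW vs S)\<^sup>2) \<le> (\<Sum>vs\<in>TT. qv vs)\<^sup>2 + 2 * (\<Sum>i<k. \<Sum>j<k. \<Sum>a\<in>TT. \<Sum>b\<in>TT. G i j a b)"
  unfolding g2 sw by simp
 have "(\<Sum>i<k. \<Sum>j<k. \<Sum>a\<in>TT. \<Sum>b\<in>TT. G i j a b) \<le> (\<Sum>i<k. \<Sum>j<k. \<Sum>us\<in>pre i. \<Sum>us'\<in>pre j. of_bool (cls (last us) (last us') \<and> h (last us') \<le> h (last us) \<and> trT T (k - j) (last us') \<noteq> {}) *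
   (qv us * qv us' * (\<Sum>ws\<in>trT T (k - i) (last us). qv ws)))"
  by (rule sum_mono, rule sum_mono, rule part) auto
 then show ?thesis using fin by linarith
qed

end

section \<open>Climbing chains\<close>

lemma con_image: assumes "con U S x y" shows "con (g ` U) ((`) g ` S) (g x) (g y)"
 using assms
proof (induction rule: con_induct)
 case refl
 show ?case using con_in[OF assms] by simp
next
 case (step y z)
 have "{g y, g z} \<in> (`) g ` S" using step(3) by (intro image_eqI[of _ _ "{y, z}"]) auto
 then show ?case using step con_step by (metis imageI)
qed

context gact
begin

lemma con_act:
 assumes "g \<in> \<Gamma>" "U \<subseteq> V" "\<And>e. e \<in> S ==> e \<subseteq> V" "x \<in> V" "y \<in> V"
 shows "con (g ` U) ((`) g ` S) (g x) (g y) \<longleftrightarrow> con U S x y"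
proof
 assume c: "con (g ` U) ((`) g ` S) (g x) (g y)"
 obtain l where l: "l \<in> \<Gamma>" "\<forall>x\<in>V. l (g x) = x \<and> g (l x) = x" using act_inv[OF assms(1)] by auto
 have "con (l ` g ` U) ((`) l ` (`) g ` S) (l (g x)) (l (g y))" by (rule con_image[OF c])
 moreover have "l ` g ` U = U" if "U \<subseteq> V" for U using l that by (force simp: image_image)
 moreover from this have "(`) l ` (`) g ` S = S" using assms(3) by (force simp: image_image)
 ultimately show "con U S x y" using l assms by simp
qed (rule con_image)

lemma act_edge: assumes "g \<in> \<Gamma>" "e \<subseteq> V" shows "g ` e \<in> E \<longleftrightarrow> e \<in> E"
proof
 assume "e \<in> E"
 then obtain u v where "e = {u, v}" "u \<in> V" "v \<in> V" using simple by blast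
 then show "g ` e \<in> E" using act_E[OF assms(1)] \<open>e \<in> E\<close> by auto
next
 assume ge: "g ` e \<in> E"
 obtain l where l: "l \<in> \<Gamma>" "\<forall>x\<in>V. l (g x) = x \<and> g (l x) = x" using act_inv[OF assms(1)] by auto
 obtain u v where uv: "g ` e = {u, v}" "u \<in> V" "v \<in> V" using simple[OF ge] by blast
 have "l ` g ` e = e" using l assms(2) by (force simp: image_image)
 moreover have "l ` g ` e = {l u, l v}" using uv by auto
 ultimately show "e \<in> E" using act_E[OF l(1) uv(2,3)] uv(1) ge by simp
qed

lemma edge_sub: "e \<in> E ==> e \<subseteq> V" using simple by blast

lemma act_orb: assumes "g \<in> \<Gamma>" "x \<in> V" "y \<in> V" shows "g y \<in> orb x \<longleftrightarrow> y \<in> orb x"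
proof
 assume gy: "g y \<in> orb x"
 obtain l where l: "l \<in> \<Gamma>" "\<forall>x\<in>V. l (g x) = x \<and> g (l x) = x" using act_inv[OF assms(1)] by auto
 then show "y \<in> orb x" using orb_act[OF assms(2) l(1) gy] assms by simp
qed (rule orb_act[OF assms(2,1)])

end

context hgraph
begin

abbreviation Orb :: "'a set" where "Orb \<equiv> orb rt"

lemma Orb_V: "x \<in> Orb ==> x \<in> V" using orb_V[OF rt_V] by auto

lemma up_V: "x \<in> V ==> up x \<in> V" using up_edge edge_V by blast

lemma upn_V: "x \<in> V ==> (up ^^ i) x \<in> V" by (induction i) (auto intro: up_V)

lemma upn_h: "x \<in> V ==> h x + i * c0 \<le> h ((up ^^ i) x)"
proof (induction i)
 case (Suc i)
 have "h ((up ^^ i) x) + c0 \<le> h ((up ^^ Suc i) x)" using up_h[OF upn_V[OF Suc(2)]] by simp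
 then show ?case using Suc by (simp add: algebra_simps)
qed simp

lemma upn_h_mono: "x \<in> V ==> i < j ==> h ((up ^^ i) x) < h ((up ^^ j) x)"
proof -
 assume x: "x \<in> V" "i < j"
 have "(up ^^ j) x = (up ^^ (j - i)) ((up ^^ i) x)" using x by (simp flip: funpow_add[THEN fun_cong, simplified])
 then have "h ((up ^^ i) x) + (j - i) * c0 \<le> h ((up ^^ j) x)" using upn_h[OF upn_V[OF x(1)], of i "j - i"] by simp
 moreover have "0 < (j - i) * c0" using x c0_pos by simp
 ultimately show ?thesis by linarith
qed

definition UP :: "nat \<Rightarrow> 'a \<Rightarrow> 'a set set" where "UP k x = (\<lambda>i. {(up ^^ i) x, (up ^^ Suc i) x}) ` {..<k}"

lemma UP_E: "x \<in> V ==> UP k x \<subseteq> E" unfolding UP_def using up_edge upn_V by auto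

lemma finite_UP [simp]: "finite (UP k x)" unfolding UP_def by simp

lemma card_UP: "card (UP k x) \<le> k" unfolding UP_def using card_image_le[of "{..<k}"] by (metis card_lessThan finite_lessThan)

lemma con_UP:
 assumes "x \<in> V" "i \<le> k" "UP k x \<subseteq> S" "\<And>j. j \<le> i ==> (up ^^ j) x \<in> U" shows "con U S x ((up ^^ i) x)"
 using assms(2,4)
proof (induction i)
 case 0
 then have "x \<in> U" using 0(2)[of 0] by simp
 then show ?case by simp
next
 case (Suc i)
 have "con U S x ((up ^^ i) x)" using Suc by simp
 moreover have "{(up ^^ i) x, (up ^^ Suc i) x} \<in> S" using assms(3) Suc(2) unfolding UP_def by auto
 ultimately show ?case using Suc(3)[of "Suc i"] con_step by fastforce
qed

text \<open>The number of \<open>up\<close> steps until the marked orbit is entered, with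
  \<open>wt x\<close> the vertex of entry. This ties arbitrary vertices to the orbit on which mass
  transport is exact.\<close>

definition kx :: "'a \<Rightarrow> nat" where "kx x = (LEAST i. (up ^^ i) x \<in> Orb)"
definition wt :: "'a \<Rightarrow> 'a" where "wt x = (up ^^ kx x) x"

lemma kx: "x \<in> V ==> wt x \<in> Orb" "x \<in> V ==> kx x \<le> ll"
proof -
 assume "x \<in> V"
 then obtain i where i: "i \<le> ll" "(up ^^ i) x \<in> Orb" using up_reach by auto
 show "wt x \<in> Orb" unfolding wt_def kx_def by (rule LeastI[of "\<lambda>i. (up ^^ i) x \<in> Orb", OF i(2)])
 have "kx x \<le> i" unfolding kx_def by (rule Least_le[of "\<lambda>i. (up ^^ i) x \<in> Orb", OF i(2)])
 then show "kx x \<le> ll" using i by simp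
qed

lemma kx_pos: "x \<in> V ==> x \<notin> Orb ==> 0 < kx x"
 using kx(1)[of x] unfolding wt_def by (cases "kx x") auto

definition Eb :: "nat \<Rightarrow> 'a \<Rightarrow> 'a set set" where "Eb R x = {e \<in> E. e \<subseteq> bal R x}"

lemma finite_Eb: "x \<in> V ==> finite (Eb R x)"
 unfolding Eb_def by (rule finite_subset[of _ "Pow (bal R x)"]) (use finite_bal in auto)

text \<open>A path from \<open>x\<close> to \<open>y\<close> in this set stays at or above
  \<open>x\<close> and touches the height of \<open>y\<close> only at \<open>y\<close>
  itself.\<close>

definition cU :: "'a \<Rightarrow> 'a \<Rightarrow> 'a set" where "cU x y = insert y {v \<in> V. h x \<le> h v \<and> h v < h y}"

lemma act_h_le: "g \<in> \<Gamma> ==> x \<in> V ==> y \<in> V ==> h (g x) \<le> h (g y) \<longleftrightarrow> h x \<le> h y"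
 "g \<in> \<Gamma> ==> x \<in> V ==> y \<in> V ==> h (g x) < h (g y) \<longleftrightarrow> h x < h y"
 using h_act[of g x y] by linarith+

lemma act_surj: "g \<in> \<Gamma> ==> z \<in> V ==> \<exists>x\<in>V. z = g x"
 using act_inv[of g] act_V by metis

lemma act_cU: assumes "g \<in> \<Gamma>" "x \<in> V" "y \<in> V" shows "cU (g x) (g y) = g ` cU x y"
proof
 show "cU (g x) (g y) \<subseteq> g ` cU x y"
 proof
  fix z assume z: "z \<in> cU (g x) (g y)"
  show "z \<in> g ` cU x y"
  proof (cases "z = g y")
   case False
   then have "z \<in> V" "h (g x) \<le> h z" "h z < h (g y)" using z by (auto simp: cU_def)
   moreover obtain v where "v \<in> V" "z = g v" using act_surj[OF assms(1) \<open>z \<in> V\<close>] by auto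
   ultimately show ?thesis using act_h_le assms unfolding cU_def by auto
  qed (simp add: cU_def)
 qed
 show "g ` cU x y \<subseteq> cU (g x) (g y)" using act_h_le assms act_V unfolding cU_def by auto
qed

lemma act_in_bal: "g \<in> \<Gamma> ==> x \<in> V ==> y \<in> V ==> g y \<in> bal R (g x) \<longleftrightarrow> y \<in> bal R x"
 unfolding act_bal
proof
 assume g: "g \<in> \<Gamma>" "x \<in> V" "y \<in> V" "g y \<in> g ` bal R x"
 then obtain z where "z \<in> bal R x" "g y = g z" by auto
 moreover from this have "y = z" using act_inj[OF g(1,3)] bal_V[OF g(2)] by blast
 ultimately show "y \<in> bal R x" by simp
qed simp

lemma act_Eb:
 assumes "g \<in> \<Gamma>" "x \<in> V" "S \<subseteq> E" shows "(`) g ` S \<inter> Eb R (g x) = (`) g ` (S \<inter> Eb R x)"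
proof -
 have "g ` e \<in> Eb R (g x) \<longleftrightarrow> e \<in> Eb R x" if "e \<in> S" for e
 proof -
  have e: "e \<in> E" "e \<subseteq> V" using that assms edge_sub by auto
  have "g ` e \<subseteq> bal R (g x) \<longleftrightarrow> e \<subseteq> bal R x" using act_in_bal[OF assms(1,2)] e by blast
  then show ?thesis unfolding Eb_def using act_edge[OF assms(1) e(2)] e by simp
 qed
 then show ?thesis by blast
qed

lemma card_bal: "x \<in> V ==> card (bal n x) \<le> (Suc deg) ^ n"
proof (induction n)
 case (Suc n)
 have "card (bal (Suc n) x) \<le> card (bal n x) + card (\<Union>u\<in>bal n x. nb u)" by (simp add: card_Un_le)
 also have "card (\<Union>u\<in>bal n x. nb u) \<le> (\<Sum>u\<in>bal n x. card (nb u))" by (rule card_UN_le[OF finite_bal[OF Suc(2)]])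
 also have "... \<le> (\<Sum>u\<in>bal n x. deg)" using degree bal_V[OF Suc(2)] by (intro sum_mono) auto
 also have "card (bal n x) + (\<Sum>u\<in>bal n x. deg) = Suc deg * card (bal n x)" by simp
 also have "... \<le> Suc deg * Suc deg ^ n" using Suc by (intro mult_left_mono) auto
 finally show ?case by simp
qed simp

lemma upn_bal: "x \<in> V ==> (up ^^ i) x \<in> bal i x"
proof (induction i)
 case (Suc i)
 have "up ((up ^^ i) x) \<in> nb ((up ^^ i) x)" using up_edge[OF upn_V[OF Suc(2)]] by (auto simp: nb_def)
 then show ?case using Suc by auto
qed simp

end

text \<open>\<open>R0\<close> is the least height gained by a step between orbit vertices,
  \<open>R\<close> the radius such a step may use. Both stay free: one step may be a single long
  climb, and the radius can be made to cover any finite volume.\<close>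

locale hchain = hgraph V E \<Gamma> h up rt c0 M CM ll deg for V :: "'a set" and E :: "'a set set" and \<Gamma> :: "('a \<Rightarrow> 'a) set"
  and h up rt c0 M CM ll deg +
 fixes p R0 :: real and R :: nat
 assumes p01': "0 \<le> p" "p \<le> 1" and R0: "0 < R0"
begin

definition cand :: "'a \<Rightarrow> 'a set set \<Rightarrow> 'a set" where
 "cand x S = {y \<in> Orb. y \<in> bal R x \<and> h x + R0 \<le> h y \<and> con (cU x y) (S \<inter> Eb R x) x y}"

text \<open>Restricting to the lowest candidates allows the decision for \<open>y\<close> to be made
  from edges with an end below \<open>y\<close>, as \<open>Ed_hi\<close> demands.\<close>

definition lc :: "'a \<Rightarrow> 'a set set \<Rightarrow> 'a set" where
 "lc x S = {y \<in> cand x S. \<forall>y'\<in>cand x S. h y \<le> h y'}"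

text \<open>Off the orbit the only move is the climb along \<open>up\<close> to \<open>wt x\<close>;
  from then on every trajectory stays in the orbit.\<close>

definition Nx :: "'a \<Rightarrow> 'a set" where
 "Nx x = (if x \<in> Orb then {y \<in> Orb. y \<in> bal R x \<and> h x + R0 \<le> h y} else if x \<in> V then {wt x} else {})"

definition Ed :: "'a \<Rightarrow> 'a \<Rightarrow> 'a set set" where
 "Ed x y = (if x \<in> Orb then (if y \<in> Nx x then {e \<in> Eb R x. (\<forall>v\<in>e. h x \<le> h v) \<and> (\<exists>v\<in>e. h v < h y)} else {})
  else if x \<in> V \<and> y = wt x then UP (kx x) x else {})"

text \<open>Among the lowest candidates one is chosen uniformly; the weight is the conditional
 probability of the choice. A deterministic rule would break the invariance under \<open>\<Gamma>\<close>.\<close>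

definition Wt :: "'a \<Rightarrow> 'a \<Rightarrow> 'a set set \<Rightarrow> real" where
 "Wt x y S = (if x \<in> Orb then of_bool (y \<in> lc x S) / card (lc x S)
  else if x \<in> V \<and> y = wt x then of_bool (UP (kx x) x \<subseteq> S) else 0)"

lemma cand_Nx: "x \<in> Orb ==> cand x S \<subseteq> Nx x" unfolding cand_def Nx_def by auto
lemma lc_cand: "lc x S \<subseteq> cand x S" unfolding lc_def by auto
lemma lc_Nx: "x \<in> Orb ==> lc x S \<subseteq> Nx x" using cand_Nx lc_cand by blast
lemma finite_Nx: "finite (Nx x)" unfolding Nx_def using finite_bal[OF Orb_V, of x R] by (auto intro: finite_subset[of _ "bal R x"])
lemma finite_lc: "x \<in> Orb ==> finite (lc x S)" using finite_subset[OF lc_Nx finite_Nx] .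
lemma finite_cand: "x \<in> Orb ==> finite (cand x S)" using finite_subset[OF cand_Nx finite_Nx] .

lemma lc_nonempty: assumes "x \<in> Orb" "cand x S \<noteq> {}" shows "lc x S \<noteq> {}"
proof -
 have "finite (h ` cand x S)" "h ` cand x S \<noteq> {}" using finite_cand assms by auto
 then have "Min (h ` cand x S) \<in> h ` cand x S" "\<forall>y'\<in>cand x S. Min (h ` cand x S) \<le> h y'" by auto
 then show ?thesis unfolding lc_def by auto
qed

lemma cand_mono: "S \<subseteq> S' ==> cand x S \<subseteq> cand x S'"
 unfolding cand_def using con_mono[of _ "S \<inter> Eb R x" _ _ _ "S' \<inter> Eb R x"] by blast

text \<open>A path witnessing \<open>y'\<close> stays at or above \<open>x\<close>; of two
  consecutive vertices only one can be \<open>y'\<close>, so each edge has an end strictly below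
  \<open>y'\<close>, hence strictly below \<open>y\<close>.\<close>

lemma cand_Ed:
 assumes x: "x \<in> Orb" and y: "y \<in> Nx x" "y' \<in> cand x S" "h y' \<le> h y" shows "y' \<in> cand x (S \<inter> Ed x y)"
proof -
 have c: "con (cU x y') (S \<inter> Eb R x) x y'" using y by (simp add: cand_def)
 have hx: "h x \<le> h y'" using y R0 by (auto simp: cand_def)
 have gen: "con (cU x y') (S \<inter> Ed x y \<inter> Eb R x) x z" if "con (cU x y') (S \<inter> Eb R x) x z" for z
  using that
 proof (induction rule: con_induct)
  case refl
  then show ?case using con_in[OF c] by simp
 next
  case (step a b)
  have ab: "a \<in> cU x y'" "b \<in> cU x y'" using con_in(2)[OF step(1)] step(2) by auto
  have E: "{a, b} \<in> E" using step(3) by (auto simp: Eb_def)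
  then have "a \<noteq> b" using edge_V by blast
  then have "h x \<le> h a" "h x \<le> h b" "h a < h y' \<or> h b < h y'" using ab hx unfolding cU_def by auto
  then have "{a, b} \<in> Ed x y" using step(3) x y unfolding Ed_def by auto
  then have "{a, b} \<in> S \<inter> Ed x y \<inter> Eb R x" using step(3) by simp
  then show ?case by (rule con_step[OF step(4,2)])
 qed
 have "con (cU x y') (S \<inter> Ed x y \<inter> Eb R x) x y'" by (rule gen[OF c])
 then show ?thesis using y by (simp add: cand_def)
qed

text \<open>Candidates not above \<open>y\<close> are seen within \<open>Ed x y\<close>, and
  candidates above \<open>y\<close> have no influence on whether \<open>y\<close> is among the
  lowest.\<close>

lemma lc_Ed:
 assumes x: "x \<in> Orb" and y: "y \<in> Nx x"
 shows "y \<in> lc x S \<longleftrightarrow> y \<in> lc x (S \<inter> Ed x y)" "y \<in> lc x S ==> lc x S = lc x (S \<inter> Ed x y)"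
proof -
 have sub: "cand x (S \<inter> Ed x y) \<subseteq> cand x S" by (rule cand_mono) auto
 have down: "y' \<in> cand x (S \<inter> Ed x y)" if "y' \<in> cand x S" "h y' \<le> h y" for y' by (rule cand_Ed[OF x y that])
 show iff: "y \<in> lc x S \<longleftrightarrow> y \<in> lc x (S \<inter> Ed x y)"
 proof
  assume "y \<in> lc x S"
  then show "y \<in> lc x (S \<inter> Ed x y)" unfolding lc_def using sub down by auto
 next
  assume l: "y \<in> lc x (S \<inter> Ed x y)"
  have "h y \<le> h y'" if "y' \<in> cand x S" for y'
  proof (rule ccontr)
   assume "\<not> h y \<le> h y'"
   then show False using down[OF that] l unfolding lc_def by auto
  qed
  then show "y \<in> lc x S" using l sub unfolding lc_def by auto
 qed
 assume l: "y \<in> lc x S"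
 then have l': "y \<in> lc x (S \<inter> Ed x y)" using iff by simp
 show "lc x S = lc x (S \<inter> Ed x y)"
 proof
  show "lc x S \<subseteq> lc x (S \<inter> Ed x y)"
  proof
   fix z assume z: "z \<in> lc x S"
   then have "h z \<le> h y" "z \<in> cand x S" using l unfolding lc_def by auto
   then show "z \<in> lc x (S \<inter> Ed x y)" using z down sub unfolding lc_def by auto
  qed
  show "lc x (S \<inter> Ed x y) \<subseteq> lc x S"
  proof
   fix z assume z: "z \<in> lc x (S \<inter> Ed x y)"
   then have "h z \<le> h y" using l' unfolding lc_def by auto
   moreover have "h y \<le> h y'" if "y' \<in> cand x S" for y' using l that unfolding lc_def by auto
   ultimately show "z \<in> lc x S" using z sub unfolding lc_def by fastforce
  qed
 qed
qed

sublocale chain h Nx Ed Wt p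
proof
 show "0 \<le> p" "p \<le> 1" by (rule p01')+
 show "finite (Nx x)" for x by (rule finite_Nx)
 show "finite (Ed x y)" for x y unfolding Ed_def using finite_Eb[OF Orb_V] by auto
 show "h x < h y" if "y \<in> Nx x" for x y
 proof (cases "x \<in> Orb")
  case True then show ?thesis using that R0 unfolding Nx_def by auto
 next
  case False
  then have "x \<in> V" "y = wt x" using that unfolding Nx_def by (auto split: if_splits)
  then show ?thesis using upn_h_mono[of x 0 "kx x"] kx_pos False unfolding wt_def by simp
 qed
 show "h x \<le> h v" if e: "e \<in> Ed x y" "v \<in> e" for e x y v
 proof (cases "x \<in> Orb")
  case True then show ?thesis using e unfolding Ed_def by (auto split: if_splits)
 next
  case False
  then have x: "x \<in> V" "e \<in> UP (kx x) x" using e unfolding Ed_def by (auto split: if_splits)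
  then obtain j where "v = (up ^^ j) x \<or> v = (up ^^ Suc j) x" using e(2) unfolding UP_def by auto
  then have "\<exists>i. v = (up ^^ i) x" by (elim disjE) (intro exI, assumption)+
  then obtain i where "v = (up ^^ i) x" by (elim exE)
  then have "h x + i * c0 \<le> h v" using upn_h[OF x(1), of i] by simp
  moreover have "0 \<le> i * c0" using c0_pos by simp
  ultimately show ?thesis by linarith
 qed
 show "\<exists>v\<in>e. h v < h y" if e: "e \<in> Ed x y" for e x y
 proof (cases "x \<in> Orb")
  case True then show ?thesis using e unfolding Ed_def by (auto split: if_splits)
 next
  case False
  then have x: "x \<in> V" "e \<in> UP (kx x) x" "y = wt x" using e unfolding Ed_def by (auto split: if_splits)
  then obtain i where i: "i < kx x" "e = {(up ^^ i) x, (up ^^ Suc i) x}" unfolding UP_def by auto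
  then show ?thesis using upn_h_mono[OF x(1) i(1)] x(3) unfolding wt_def by auto
 qed
 show "0 \<le> Wt x y S" for x y S unfolding Wt_def by auto
 show "(\<Sum>y\<in>Nx x. Wt x y S) \<le> 1" for x S
 proof (cases "x \<in> Orb")
  case True
  have "(\<Sum>y\<in>Nx x. Wt x y S) = (\<Sum>y\<in>Nx x. of_bool (y \<in> lc x S)) / card (lc x S)"
   using True unfolding Wt_def by (simp add: sum_divide_distrib)
  also have "(\<Sum>y\<in>Nx x. of_bool (y \<in> lc x S)) = real (card (lc x S))"
  proof -
   have "(\<Sum>y\<in>Nx x. of_bool (y \<in> lc x S)) = (\<Sum>y\<in>lc x S. (1::real))"
    by (rule sum.mono_neutral_cong_right) (use finite_Nx lc_Nx[OF True] in auto)
   then show ?thesis by simp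
  qed
  finally show ?thesis by simp
 next
  case False
  then show ?thesis unfolding Nx_def Wt_def by (cases "x \<in> V") auto
 qed
 show "Wt x y S = Wt x y (S \<inter> Ed x y)" for x y S
 proof (cases "x \<in> Orb")
  case x: True
  show ?thesis
  proof (cases "y \<in> Nx x")
   case True
   note l = lc_Ed[OF x True, of S]
   show ?thesis
   proof (cases "y \<in> lc x S")
    case True
    then show ?thesis using x l unfolding Wt_def by simp
   next
    case False
    then show ?thesis using x l(1) unfolding Wt_def by simp
   qed
  next
   case False
   then show ?thesis using x lc_Nx[OF x] unfolding Wt_def by auto
  qed
 next
  case False
  then show ?thesis unfolding Wt_def Ed_def by auto
 qed
qed

lemma Ed_E: "Ed x y \<subseteq> E"
 unfolding Ed_def Eb_def using UP_E by auto

lemma TE_E: "TE vs \<subseteq> E"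
 by (induction vs rule: TE.induct) (use Ed_E in auto)

lemma Nx_V: "x \<in> V ==> y \<in> Nx x ==> y \<in> Orb"
 unfolding Nx_def using kx by (auto split: if_splits)

lemma act_cand:
 assumes g: "g \<in> \<Gamma>" "x \<in> V" "y \<in> V" "S \<subseteq> E" shows "g y \<in> cand (g x) ((`) g ` S) \<longleftrightarrow> y \<in> cand x S"
proof -
 have "con (cU (g x) (g y)) ((`) g ` S \<inter> Eb R (g x)) (g x) (g y) \<longleftrightarrow> con (cU x y) (S \<inter> Eb R x) x y"
  unfolding act_cU[OF g(1-3)] act_Eb[OF g(1,2,4)]
  by (rule con_act) (use g edge_sub in \<open>auto simp: cU_def Eb_def\<close>)
 moreover have "h (g x) + R0 \<le> h (g y) \<longleftrightarrow> h x + R0 \<le> h y" using h_act[OF g(1-3)] by linarith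
 ultimately show ?thesis unfolding cand_def using act_orb[OF g(1) rt_V g(3)] act_in_bal[OF g(1-3)] by simp
qed

lemma act_cand_im:
 assumes g: "g \<in> \<Gamma>" "x \<in> V" "S \<subseteq> E" shows "cand (g x) ((`) g ` S) = g ` cand x S"
proof
 show "cand (g x) ((`) g ` S) \<subseteq> g ` cand x S"
 proof
  fix z assume z: "z \<in> cand (g x) ((`) g ` S)"
  then have "z \<in> V" using Orb_V by (auto simp: cand_def)
  then obtain y where "y \<in> V" "z = g y" using act_surj[OF g(1)] by auto
  then show "z \<in> g ` cand x S" using z act_cand[OF g(1,2) _ g(3)] by auto
 qed
 show "g ` cand x S \<subseteq> cand (g x) ((`) g ` S)"
 proof
  fix z assume "z \<in> g ` cand x S"
  then obtain y where y: "y \<in> cand x S" "z = g y" by auto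
  then have "y \<in> V" using Orb_V by (auto simp: cand_def)
  then show "z \<in> cand (g x) ((`) g ` S)" using y act_cand[OF g(1,2) _ g(3)] by auto
 qed
qed

lemma act_lc:
 assumes g: "g \<in> \<Gamma>" "x \<in> V" "S \<subseteq> E" shows "lc (g x) ((`) g ` S) = g ` lc x S"
proof -
 have V: "y \<in> V" if "y \<in> cand x S" for y using that Orb_V by (auto simp: cand_def)
 show ?thesis unfolding lc_def act_cand_im[OF g] using act_h_le(1)[OF g(1)] V by (auto simp: image_iff) 
qed

lemma act_Nx: assumes g: "g \<in> \<Gamma>" "x \<in> Orb" shows "Nx (g x) = g ` Nx x"
proof -
 have x: "x \<in> V" "g x \<in> Orb" using g Orb_V act_orb rt_V by auto
 have iff: "g y \<in> Nx (g x) \<longleftrightarrow> y \<in> Nx x" if "y \<in> V" for y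
  using act_orb[OF g(1) rt_V that] act_in_bal[OF g(1) x(1) that] h_act[OF g(1) x(1) that] x g unfolding Nx_def by auto
 have V: "y \<in> V" if "y \<in> Nx z" "z \<in> V" for y z using Nx_V that Orb_V by blast
 show ?thesis
 proof
  show "Nx (g x) \<subseteq> g ` Nx x"
  proof
   fix z assume z: "z \<in> Nx (g x)"
   then have "z \<in> V" using V x Orb_V by blast
   then obtain y where "y \<in> V" "z = g y" using act_surj[OF g(1)] by auto
   then show "z \<in> g ` Nx x" using z iff by auto
  qed
  show "g ` Nx x \<subseteq> Nx (g x)" using iff V x by blast
 qed
qed

lemma act_Ed: assumes g: "g \<in> \<Gamma>" "x \<in> Orb" "y \<in> Nx x" shows "Ed (g x) (g y) = (`) g ` Ed x y"
proof -
 have x: "x \<in> V" "g x \<in> Orb" "y \<in> V" using g Orb_V act_orb rt_V Nx_V by blast+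
 have gy: "g y \<in> Nx (g x)" using act_Nx[OF g(1,2)] g(3) by auto
 let ?P = "\<lambda>x y e. (\<forall>v\<in>e. h x \<le> h v) \<and> (\<exists>v\<in>e. h v < h y)"
 have P: "?P (g x) (g y) (g ` e) \<longleftrightarrow> ?P x y e" if "e \<subseteq> V" for e
  using act_h_le[OF g(1)] x that by (auto simp: subset_iff)
 have surj: "\<exists>d. d \<subseteq> V \<and> d \<in> E \<and> e = g ` d" if e: "e \<in> E" for e
 proof -
  obtain l where l: "l \<in> \<Gamma>" "\<forall>x\<in>V. l (g x) = x \<and> g (l x) = x" using act_inv[OF g(1)] by auto
  have eV: "e \<subseteq> V" using edge_sub[OF e] .
  have "g ` l ` e = e" using l eV by (force simp: image_image)
  moreover have "l ` e \<subseteq> V" using eV act_V[OF l(1)] by auto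
  moreover have "l ` e \<in> E" using act_edge[OF l(1) eV] e by simp
  ultimately show ?thesis by (intro exI[of _ "l ` e"]) simp
 qed
 have Eb: "g ` d \<in> Eb R (g x) \<longleftrightarrow> d \<in> Eb R x" if "d \<in> E" for d
  using act_Eb[OF g(1) x(1), of "{d}" R] that by auto
 show ?thesis
 proof
  show "Ed (g x) (g y) \<subseteq> (`) g ` Ed x y"
  proof
   fix e assume e: "e \<in> Ed (g x) (g y)"
   then have "e \<in> E" using Ed_E by blast
   then obtain d where d: "d \<subseteq> V" "d \<in> E" "e = g ` d" using surj by blast
   then show "e \<in> (`) g ` Ed x y" using e P[OF d(1)] Eb[OF d(2)] g(2,3) gy x unfolding Ed_def by auto
  qed
  show "(`) g ` Ed x y \<subseteq> Ed (g x) (g y)"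
  proof
   fix e assume "e \<in> (`) g ` Ed x y"
   then obtain d where d: "d \<in> Ed x y" "e = g ` d" by auto
   then have "d \<in> E" "d \<subseteq> V" using Ed_E edge_sub by blast+
   then show "e \<in> Ed (g x) (g y)" using d P Eb g(2,3) gy x unfolding Ed_def by auto
  qed
 qed
qed

text \<open>This is where the uniform choice among the lowest candidates pays off: the step
  probabilities become admissible for mass transport.\<close>

lemma act_q: assumes g: "g \<in> \<Gamma>" "x \<in> Orb" "y \<in> V" shows "q (g x) (g y) = q x y"
proof (cases "y \<in> Nx x")
 case True
 have x: "x \<in> V" "g x \<in> Orb" using g Orb_V act_orb rt_V by auto
 have inj: "inj_on ((`) g) (Ed x y)"
 proof (rule inj_onI)
  fix d d' assume "d \<in> Ed x y" "d' \<in> Ed x y" "g ` d = g ` d'"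
  moreover from this have "d \<subseteq> V" "d' \<subseteq> V" using Ed_E edge_sub by blast+
  moreover have "inj_on g V" using act_inj[OF g(1)] by (auto simp: inj_on_def)
  ultimately show "d = d'" using inj_on_image_eq_iff[of g V d d'] by simp
 qed
 have "q (g x) (g y) = pexp p (Ed x y) (\<lambda>S. Wt (g x) (g y) ((`) g ` S))"
  unfolding q_def act_Ed[OF g(1,2) True] by (rule pexp_bij[OF inj])
 also have "... = pexp p (Ed x y) (Wt x y)"
 proof (rule pexp_cong)
  fix S assume "S \<subseteq> Ed x y"
  then have S: "S \<subseteq> E" using Ed_E by blast
  have V: "lc x S \<subseteq> V" using lc_Nx[OF g(2)] Nx_V x Orb_V by blast
  have "inj_on g (lc x S)" using act_inj[OF g(1)] V by (auto simp: inj_on_def)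
  then have "card (lc (g x) ((`) g ` S)) = card (lc x S)" unfolding act_lc[OF g(1) x(1) S] by (rule card_image)
  moreover have "g y \<in> lc (g x) ((`) g ` S) \<longleftrightarrow> y \<in> lc x S"
   unfolding act_lc[OF g(1) x(1) S] using act_inj[OF g(1)] V g(3) by blast
  ultimately show "Wt (g x) (g y) ((`) g ` S) = Wt x y S" using x g(2) unfolding Wt_def by simp
 qed
 finally show ?thesis unfolding q_def .
next
 case False
 have x: "x \<in> V" "g x \<in> Orb" using g Orb_V act_orb rt_V by auto
 have z: "q a b = 0" if "a \<in> Orb" "b \<notin> Nx a" for a b
 proof -
  have "Wt a b = (\<lambda>_. 0)" using lc_Nx[OF that(1)] that unfolding Wt_def by (intro ext) auto
  then show ?thesis unfolding q_def by simp
 qed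
 have "g y \<notin> Nx (g x)"
 proof
  assume "g y \<in> Nx (g x)"
  then obtain y' where y': "y' \<in> Nx x" "g y = g y'" unfolding act_Nx[OF g(1,2)] by auto
  then have "y = y'" using act_inj[OF g(1,3) Orb_V[OF Nx_V[OF x(1)]]] by blast
  then show False using False y' by simp
 qed
 then show ?thesis using z g(2) False x by simp
qed

end

text \<open>The path is stopped at its first vertex with \<open>P\<close>. All edges used until then
  have an end without \<open>P\<close>, so the edges between vertices with \<open>P\<close> remain
  unexplored.\<close>

lemma con_first:
 assumes "con U S x z" "P z"
 shows "\<exists>z'\<in>U. P z' \<and> con (insert z' {v \<in> U. \<not> P v}) {e \<in> S. \<exists>v\<in>e. \<not> P v} x z'"
proof -
 let ?S = "{e \<in> S. \<exists>v\<in>e. \<not> P v}"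
 let ?G = "\<exists>z'\<in>U. P z' \<and> con (insert z' {v \<in> U. \<not> P v}) ?S x z'"
 have xU: "x \<in> U" using con_in[OF assms(1)] by simp
 have "(\<not> P y \<and> con {v \<in> U. \<not> P v} ?S x y) \<or> ?G" if "con U S x y" for y
  using that
 proof (induction rule: con_induct)
  case refl
  show ?case
  proof (cases "P x")
   case True
   then have ?G using xU by (intro bexI[of _ x]) auto
   then show ?thesis by simp
  qed (use xU in simp)
 next
  case (step y z)
  show ?case
  proof (cases ?G)
   case False
   then have y: "\<not> P y" "con {v \<in> U. \<not> P v} ?S x y" using step.IH by auto
   have e: "{y, z} \<in> ?S" using step.hyps y(1) by auto
   show ?thesis
   proof (cases "P z")
    case True
    have "con (insert z {v \<in> U. \<not> P v}) ?S x y" by (rule con_mono[OF y(2)]) auto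
    then have "con (insert z {v \<in> U. \<not> P v}) ?S x z" by (rule con_step) (use e in auto)
    then have ?G using True step.hyps by (intro bexI[of _ z]) auto
    then show ?thesis by simp
   next
    case z: False
    have "con {v \<in> U. \<not> P v} ?S x z" by (rule con_step[OF y(2)]) (use e z step.hyps in auto)
    then show ?thesis using z by simp
   qed
  qed simp
 qed
 from this[OF assms(1)] show ?thesis using assms(2) by auto
qed

text \<open>The edges of \<open>F\<close> are revealed first. Whenever they satisfy
  \<open>Q\<close>, the fresh edges of \<open>G\<close> produce \<open>R\<close> with probability at
  least \<open>c\<close>.\<close>

lemma pexp_reveal:
 assumes "0 \<le> p" "p \<le> 1" "finite F" "finite G" "F \<inter> G = {}"
  and "\<And>S. S \<subseteq> F ==> Q S ==> c \<le> pexp p G (\<lambda>T. of_bool (R (S \<union> T)))"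
 shows "c * pexp p F (\<lambda>S. of_bool (Q S)) \<le> pexp p (F \<union> G) (\<lambda>S. of_bool (R S))"
proof -
 have "c * pexp p F (\<lambda>S. of_bool (Q S)) = pexp p F (\<lambda>S. c * of_bool (Q S))" by (rule pexp_cmult[symmetric])
 also have "... \<le> pexp p F (\<lambda>S. pexp p G (\<lambda>T. of_bool (R (S \<union> T))))"
 proof (rule pexp_mono[OF assms(1,2)])
  fix S assume "S \<subseteq> F"
  then show "c * of_bool (Q S) \<le> pexp p G (\<lambda>T. of_bool (R (S \<union> T)))"
   using assms(6) pexp_nonneg[OF assms(1,2), of G "\<lambda>T. of_bool (R (S \<union> T))"] by (cases "Q S") auto
 qed
 also have "... = pexp p (F \<union> G) (\<lambda>S. of_bool (R S))" by (rule pexp_union[symmetric]) (use assms in auto)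
 finally show ?thesis .
qed

lemma pexp_forced_prob:
 assumes "0 \<le> p" "p \<le> 1" "finite F" "D \<subseteq> F" "card D \<le> n"
 shows "p ^ n \<le> pexp p F (\<lambda>S. of_bool (D \<subseteq> S))"
proof -
 have "p ^ n \<le> p ^ card D" by (rule power_decreasing) (use assms in auto)
 also have "... \<le> pexp p F (\<lambda>S. of_bool (D \<subseteq> S) * 1)"
  using pexp_forced[OF assms(1-4), of "\<lambda>_. 1"] assms(3) by simp
 finally show ?thesis by simp
qed

section \<open>Climbing events\<close>

context hgraph
begin

lemma M_nn: "0 \<le> M" using h_edge[OF up_edge[OF rt_V]] by (meson abs_ge_zero order_trans)

lemma bal_h: "x \<in> V ==> y \<in> bal n x ==> \<bar>h y - h x\<bar> \<le> n * M"
proof (induction n arbitrary: y)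
 case (Suc n)
 show ?case
 proof (cases "y \<in> bal n x")
  case True
  then have "\<bar>h y - h x\<bar> \<le> n * M" using Suc by simp
  moreover have "n * M \<le> Suc n * M" by (intro mult_right_mono M_nn) simp
  ultimately show ?thesis by linarith
 next
  case False
  then obtain u where u: "u \<in> bal n x" "y \<in> nb u" using Suc by auto
  then have "\<bar>h u - h x\<bar> \<le> n * M" "\<bar>h u - h y\<bar> \<le> M" using Suc h_edge by (auto simp: nb_def)
  then show ?thesis by (simp add: algebra_simps)
 qed
qed simp

definition UpTo :: "'a \<Rightarrow> real \<Rightarrow> 'a set set \<Rightarrow> bool" where
 "UpTo x t S \<longleftrightarrow> (\<exists>z. h x + t \<le> h z \<and> con {v \<in> V. h x \<le> h v} S x z)"

text \<open>The constant is uniform in the vertex, the height and the finite volume, so that for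
  given \<open>p\<close> the admissible rates \<open>b\<close> form a set whose supremum is
  meaningful.\<close>

definition decay :: "real \<Rightarrow> real \<Rightarrow> bool" where
 "decay p b \<longleftrightarrow> (\<exists>C. \<forall>x\<in>Orb. \<forall>t\<ge>0. \<forall>F. finite F \<longrightarrow> F \<subseteq> E \<longrightarrow> pexp p F (\<lambda>S. of_bool (UpTo x t S)) \<le> C * exp (- b * t))"

lemma UpTo_mono: "UpTo x t S ==> S \<subseteq> S' ==> UpTo x t S'"
 unfolding UpTo_def using con_mono[of "{v \<in> V. h x \<le> h v}" S x _ "{v \<in> V. h x \<le> h v}" S'] by blast

lemma edges_in_ball:
 assumes "finite F" "F \<subseteq> E" "x \<in> V" shows "\<exists>n. F \<subseteq> Eb n x"
 using assms(1,2)
proof (induction rule: finite_induct)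
 case (insert e F)
 then obtain n where n: "F \<subseteq> Eb n x" by auto
 obtain u v where uv: "e = {u, v}" "u \<in> V" "v \<in> V" using insert simple by blast
 obtain a b where ab: "u \<in> bal a x" "v \<in> bal b x" using bal_ex[OF assms(3)] uv by blast
 let ?m = "max n (max a b)"
 have "bal k x \<subseteq> bal ?m x" if "k \<in> {n, a, b}" for k by (rule bal_mono) (use that in auto)
 then have "insert e F \<subseteq> Eb ?m x" using n ab uv(1) insert(4) unfolding Eb_def by blast
 then show ?case by blast
qed auto

end

lemma (in chain) qv_append: "us \<in> tr i x ==> ws \<in> tr j (last us) ==> qv (us @ tl ws) = qv us * qv ws"
proof (induction i arbitrary: x us)
 case 0
 then have "us @ tl ws = ws" using tr_hd[of ws j x] by (cases ws) auto
 then show ?case using 0 by simp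
next
 case (Suc i)
 then obtain y us' where y: "y \<in> Nx x" "us' \<in> tr i y" "us = x # us'" by auto
 have l: "last us = last us'" using y tr_hd[OF y(2)] by auto
 have m: "us' @ tl ws \<in> tr (i + j) y" using append_facts[OF y(2), of ws j] Suc.prems l by simp
 show ?case using Suc.IH[OF y(2)] Suc.prems l y qv_Cons[OF m, of x] qv_Cons[OF y(2), of x] by simp
qed

section \<open>Step probabilities and the general second moment bound\<close>

context hchain
begin

lemma q_zero: "x \<in> Orb ==> y \<notin> Nx x ==> q x y = 0"
proof -
 assume "x \<in> Orb" "y \<notin> Nx x"
 then have "Wt x y = (\<lambda>_. 0)" using lc_Nx unfolding Wt_def by (intro ext) auto
 then show ?thesis unfolding q_def by simp
qed

lemma q_le1: "q x y \<le> 1"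
 unfolding q_def
proof (rule pexp_le1[OF p01' Ed_fin])
 fix S
 show "Wt x y S \<le> 1"
 proof (cases "y \<in> Nx x")
  case True
  then have "Wt x y S \<le> (\<Sum>y\<in>Nx x. Wt x y S)" by (intro member_le_sum) (use Wt_nn finite_Nx in auto)
  then show ?thesis using Wt_sum[of x S] by simp
 next
  case False
  then have "Wt x y S = 0 \<or> x \<notin> Orb" using lc_Nx unfolding Wt_def by auto
  then show ?thesis unfolding Wt_def by auto
 qed
qed

definition q0 :: real where "q0 = (\<Sum>y\<in>Nx rt. q rt y)"
text \<open>The tilted mean offspring. By mass transport it is also the mean number of predecessors
  of an orbit vertex (\<open>q_col\<close>), that is, the branching number of the chain read
  downwards.\<close>

definition mm :: real where "mm = (\<Sum>y\<in>Nx rt. q rt y * exp (h y - h rt))"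

lemma q0_nn: "0 \<le> q0" unfolding q0_def by (intro sum_nonneg q_nn)
lemma mm_nn: "0 \<le> mm" unfolding mm_def by (intro sum_nonneg mult_nonneg_nonneg q_nn) auto

lemma q0_le_mm: "q0 * exp R0 \<le> mm"
 unfolding q0_def mm_def sum_distrib_right
proof (rule sum_mono)
 fix y assume "y \<in> Nx rt"
 then have "h rt + R0 \<le> h y" using orb_self[OF rt_V] unfolding Nx_def by auto
 then show "q rt y * exp R0 \<le> q rt y * exp (h y - h rt)" by (intro mult_left_mono q_nn) auto
qed

lemma sum_q: assumes "x \<in> Orb" shows "(\<Sum>y\<in>Nx x. q x y) = q0"
proof -
 obtain g where g: "g \<in> \<Gamma>" "x = g rt" using assms unfolding orb_def by auto
 have rt: "rt \<in> Orb" by (rule orb_self[OF rt_V])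
 have V: "Nx rt \<subseteq> V" using Nx_V[OF rt_V] Orb_V by auto
 have "(\<Sum>y\<in>Nx x. q x y) = (\<Sum>y\<in>g ` Nx rt. q (g rt) y)" using act_Nx[OF g(1) rt] g by simp
 also have "... = (\<Sum>y\<in>Nx rt. q (g rt) (g y))"
  by (rule sum.reindex_cong[of g]) (use act_inj[OF g(1)] V in \<open>auto simp: inj_on_def\<close>)
 also have "... = q0" unfolding q0_def by (rule sum.cong[OF refl]) (use act_q[OF g(1) rt] V in auto)
 finally show ?thesis .
qed

lemma sum_q_prob: assumes "x \<in> Orb" shows "(\<Sum>y\<in>Nx x. q x y) = pexp p (Eb R x) (\<lambda>S. of_bool (cand x S \<noteq> {}))"
proof -
 have "(\<Sum>y\<in>Nx x. q x y) = (\<Sum>y\<in>Nx x. pexp p (Eb R x) (Wt x y))"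
 proof (rule sum.cong[OF refl])
  fix y assume "y \<in> Nx x"
  have "pexp p (Eb R x) (Wt x y) = pexp p (Ed x y) (Wt x y)"
  proof (rule pexp_superset[OF finite_Eb[OF Orb_V[OF assms]]])
   show "Ed x y \<subseteq> Eb R x" using assms by (auto simp: Ed_def)
  qed (rule Wt_dep)
  then show "q x y = pexp p (Eb R x) (Wt x y)" unfolding q_def by simp
 qed
 also have "... = pexp p (Eb R x) (\<lambda>S. \<Sum>y\<in>Nx x. Wt x y S)" by (rule pexp_sum[symmetric])
 also have "... = pexp p (Eb R x) (\<lambda>S. of_bool (cand x S \<noteq> {}))"
 proof (rule pexp_cong)
  fix S
  have "(\<Sum>y\<in>Nx x. Wt x y S) = (\<Sum>y\<in>Nx x. of_bool (y \<in> lc x S)) / card (lc x S)"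
   using assms unfolding Wt_def by (simp add: sum_divide_distrib)
  also have "(\<Sum>y\<in>Nx x. of_bool (y \<in> lc x S)) = real (card (lc x S))"
  proof -
   have "(\<Sum>y\<in>Nx x. of_bool (y \<in> lc x S)) = (\<Sum>y\<in>lc x S. (1::real))"
    by (rule sum.mono_neutral_cong_right) (use finite_Nx lc_Nx[OF assms] in auto)
   then show ?thesis by simp
  qed
  also have "real (card (lc x S)) / card (lc x S) = of_bool (cand x S \<noteq> {})"
   using lc_nonempty[OF assms, of S] lc_cand[of x S] finite_lc[OF assms, of S] by auto
  finally show "(\<Sum>y\<in>Nx x. Wt x y S) = of_bool (cand x S \<noteq> {})" .
 qed
 finally show ?thesis .
qed

text \<open>The edges with an end below level \<open>L\<close> are revealed until a path first
  reaches \<open>L\<close>, at \<open>z\<close>. The climb from \<open>z\<close> to the orbit uses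
  at most \<open>ll\<close> edges with both ends at or above \<open>L\<close>, none of them
  revealed, whence the cost \<open>p ^ ll\<close>. The extra radius \<open>ll\<close> makes room for
  this climb.\<close>

lemma q0_ge:
 assumes x: "x \<in> Orb" and R: "R = R' + ll" and F: "F \<subseteq> Eb R' x"
 shows "p ^ ll * pexp p F (\<lambda>S. of_bool (UpTo x R0 S)) \<le> q0"
proof -
 have xV: "x \<in> V" by (rule Orb_V[OF x])
 define L where "L = h x + R0"
 define A where "A = {e \<in> Eb R' x. \<exists>v\<in>e. \<not> L \<le> h v}"
 define B where "B = {e \<in> Eb R x. \<forall>v\<in>e. L \<le> h v}"
 define U where "U = {v \<in> V. h x \<le> h v}"
 let ?Q = "\<lambda>S. \<exists>z\<in>U. L \<le> h z \<and> con (insert z {v \<in> U. \<not> L \<le> h v}) S x z"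
 have bal: "bal R' x \<subseteq> bal R x" by (rule bal_mono) (use R in simp)
 have fin: "finite A" "finite B" "A \<subseteq> Eb R x" "B \<subseteq> Eb R x" "A \<inter> B = {}"
  using bal finite_subset[OF _ finite_Eb[OF xV, of R'], of A] finite_subset[OF _ finite_Eb[OF xV, of R], of B]
  unfolding A_def B_def by (auto simp: Eb_def)
 have "p ^ ll * pexp p A (\<lambda>S. of_bool (?Q S)) \<le> pexp p (A \<union> B) (\<lambda>S. of_bool (cand x S \<noteq> {}))"
 proof (rule pexp_reveal[OF p01' fin(1,2,5)])
  fix S assume S: "S \<subseteq> A" "?Q S"
  then obtain z where z: "z \<in> V" "h x \<le> h z" "L \<le> h z" "con (insert z {v \<in> U. \<not> L \<le> h v}) S x z" unfolding U_def by auto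
  have "z = x \<or> (\<exists>y. {y, z} \<in> S)" using z(4) by (cases rule: con_induct[of _ S x z]) auto
  moreover have "z \<noteq> x" using z(3) R0 unfolding L_def by auto
  ultimately obtain y where "{y, z} \<in> S" by auto
  then have zb: "z \<in> bal R' x" using S(1) unfolding A_def Eb_def by auto
  have UPB: "UP (kx z) z \<subseteq> B"
  proof
   fix e assume e: "e \<in> UP (kx z) z"
   then obtain i where i: "i < kx z" "e = {(up ^^ i) z, (up ^^ Suc i) z}" unfolding UP_def by auto
   have LL: "L \<le> h ((up ^^ j) z)" for j
   proof -
    have "0 \<le> j * c0" using c0_pos by simp
    then show ?thesis using z(3) upn_h[OF z(1), of j] by linarith
   qed
   have bb: "(up ^^ j) z \<in> bal R x" if "j \<le> ll" for j
    using bal_trans[OF zb upn_bal[OF z(1), of j]] bal_mono[of "R' + j" R x] that R by auto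
   show "e \<in> B" using i kx(2)[OF z(1)] UP_E[OF z(1)] e LL[of i] LL[of "Suc i"] bb[of i] bb[of "Suc i"] unfolding B_def Eb_def by auto
  qed
  have "p ^ ll \<le> pexp p B (\<lambda>T. of_bool (UP (kx z) z \<subseteq> T))"
   by (rule pexp_forced_prob[OF p01' fin(2) UPB]) (use card_UP[of "kx z" z] kx(2)[OF z(1)] in simp)
  also have "... \<le> pexp p B (\<lambda>T. of_bool (cand x (S \<union> T) \<noteq> {}))"
  proof (rule pexp_mono[OF p01'], rule of_bool_mono)
   fix T assume T: "T \<subseteq> B" "UP (kx z) z \<subseteq> T"
   let ?w = "wt z"
   have hw: "h z \<le> h ?w" "\<And>j. j < kx z ==> h ((up ^^ j) z) < h ?w"
   proof -
    show "h z \<le> h ?w" unfolding wt_def using upn_h_mono[OF z(1), of 0 "kx z"] by (cases "kx z = 0") auto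
    show "h ((up ^^ j) z) < h ?w" if "j < kx z" for j unfolding wt_def by (rule upn_h_mono[OF z(1) that])
   qed
   have sub: "(S \<union> T) \<inter> Eb R x = S \<union> T" using S T fin by auto
   have "con (cU x ?w) (S \<union> T) x z"
   proof (rule con_mono[OF z(4)])
    show "insert z {v \<in> U. \<not> L \<le> h v} \<subseteq> cU x ?w"
    proof
     fix v assume "v \<in> insert z {v \<in> U. \<not> L \<le> h v}"
     then consider "v = z" "kx z = 0" | "v = z" "0 < kx z" | "v \<in> V" "h x \<le> h v" "h v < L" unfolding U_def by force
     then show "v \<in> cU x ?w"
     proof cases
      case 2
      then show ?thesis using hw(2)[of 0] z unfolding cU_def by simp
     qed (use hw z in \<open>auto simp: cU_def wt_def\<close>)
    qed
   qed auto
   moreover have "con (cU x ?w) (S \<union> T) z ?w" unfolding wt_def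
   proof (rule con_UP[OF z(1) order_refl])
    fix j assume "j \<le> kx z"
    moreover have "h x \<le> h ((up ^^ j) z)"
    proof -
     have "0 \<le> j * c0" using c0_pos by simp
     then show ?thesis using z(2) upn_h[OF z(1), of j] by linarith
    qed
    ultimately show "(up ^^ j) z \<in> cU x ((up ^^ kx z) z)" using hw(2)[of j] upn_V[OF z(1), of j]
     unfolding cU_def wt_def by (cases "j = kx z") auto
   qed (use T in auto)
   ultimately have "con (cU x ?w) (S \<union> T) x ?w" by (rule con_trans)
   moreover have "?w \<in> bal R x"
    using bal_trans[OF zb upn_bal[OF z(1), of "kx z"]] bal_mono[of "R' + kx z" R x] kx(2)[OF z(1)] R unfolding wt_def by auto
   moreover have "h x + R0 \<le> h ?w" using hw(1) z(3) unfolding L_def by simp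
   ultimately have "?w \<in> cand x (S \<union> T)" unfolding cand_def using kx(1)[OF z(1)] sub by simp
   then show "cand x (S \<union> T) \<noteq> {}" by auto
  qed
  finally show "p ^ ll \<le> pexp p B (\<lambda>T. of_bool (cand x (S \<union> T) \<noteq> {}))" .
 qed
 also have "... \<le> pexp p (Eb R x) (\<lambda>S. of_bool (cand x S \<noteq> {}))"
 proof (rule pexp_mono_set[OF p01' finite_Eb[OF xV]], use fin in blast, rule of_bool_mono)
  fix S T assume "S \<subseteq> T" "cand x S \<noteq> {}"
  then show "cand x T \<noteq> {}" using cand_mono[of S T x] by blast
 qed
 also have "... = q0" using sum_q_prob[OF x] sum_q[OF x] by simp
 finally have 1: "p ^ ll * pexp p A (\<lambda>S. of_bool (?Q S)) \<le> q0" .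
 have "pexp p F (\<lambda>S. of_bool (UpTo x R0 S)) \<le> pexp p (Eb R' x) (\<lambda>S. of_bool (UpTo x R0 S))"
  by (rule pexp_mono_set[OF p01' finite_Eb[OF xV] F], rule of_bool_mono, rule UpTo_mono)
 also have "... \<le> pexp p (Eb R' x) (\<lambda>S. of_bool (?Q (S \<inter> A)))"
 proof (rule pexp_mono[OF p01'], rule of_bool_mono)
  fix S assume S: "S \<subseteq> Eb R' x" "UpTo x R0 S"
  then obtain z where "L \<le> h z" "con U S x z" unfolding UpTo_def L_def U_def by auto
  then obtain z' where z': "z' \<in> U" "L \<le> h z'" "con (insert z' {v \<in> U. \<not> L \<le> h v}) {e \<in> S. \<exists>v\<in>e. \<not> L \<le> h v} x z'"
   using con_first[of U S x z "\<lambda>v. L \<le> h v"] by blast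
  have "{e \<in> S. \<exists>v\<in>e. \<not> L \<le> h v} = S \<inter> A" using S unfolding A_def by auto
  then show "?Q (S \<inter> A)" using z' by auto
 qed
 also have "... = pexp p A (\<lambda>S. of_bool (?Q (S \<inter> A)))"
 proof (rule pexp_superset[OF finite_Eb[OF xV]])
  show "A \<subseteq> Eb R' x" unfolding A_def by auto
 qed (simp add: Int_assoc)
 also have "... = pexp p A (\<lambda>S. of_bool (?Q S))" by (rule pexp_cong) (simp add: inf_absorb1)
 finally have "p ^ ll * pexp p F (\<lambda>S. of_bool (UpTo x R0 S)) \<le> p ^ ll * pexp p A (\<lambda>S. of_bool (?Q S))"
  by (rule mult_left_mono) (use p01' in simp)
 then show ?thesis using 1 by linarith
qed

lemma Wt_con: assumes "x \<in> V" "y \<in> Nx x" "0 < Wt x y S" shows "con {v \<in> V. h x \<le> h v} S x y"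
proof (cases "x \<in> Orb")
 case True
 then have y: "y \<in> cand x S" using assms lc_cand[of x S] unfolding Wt_def by (auto simp: of_bool_def split: if_splits)
 then have "con (cU x y) (S \<inter> Eb R x) x y" "h x \<le> h y" "y \<in> V" using R0 Orb_V unfolding cand_def by auto
 then show ?thesis using con_mono[of "cU x y" "S \<inter> Eb R x" x y "{v \<in> V. h x \<le> h v}" S] unfolding cU_def by auto
next
 case False
 then have y: "y = wt x" "UP (kx x) x \<subseteq> S" using assms unfolding Wt_def by (auto simp: of_bool_def split: if_splits)
 show ?thesis unfolding y wt_def
 proof (rule con_UP[OF assms(1) order_refl y(2)])
  fix j :: nat
  have "0 \<le> j * c0" using c0_pos by simp
  then have "h x \<le> h ((up ^^ j) x)" using upn_h[OF assms(1), of j] by linarith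
  then show "(up ^^ j) x \<in> {v \<in> V. h x \<le> h v}" using upn_V[OF assms(1)] by simp
 qed
qed

lemma TW_con: "vs \<in> tr k x ==> x \<in> V ==> 0 < TW vs S ==> con {v \<in> V. h x \<le> h v} S x (last vs)"
proof (induction k arbitrary: x vs)
 case (Suc k)
 then obtain y ws where y: "y \<in> Nx x" "ws \<in> tr k y" "vs = x # ws" by auto
 have "0 < Wt x y S * TW ws S" using Suc(4) TW_Cons[OF y(2)] y(3) by simp
 then have pos: "0 < Wt x y S" "0 < TW ws S" using Wt_nn[of x y S] TW_nn[of ws S] by (auto simp: zero_less_mult_iff)
 have "y \<in> V" using Nx_V[OF Suc(3) y(1)] Orb_V by auto
 then have "con {v \<in> V. h y \<le> h v} S y (last ws)" using Suc.IH[OF y(2)] pos by simp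
 then have "con {v \<in> V. h x \<le> h v} S y (last ws)" by (rule con_mono) (use Nx_h[OF y(1)] in auto)
 then have "con {v \<in> V. h x \<le> h v} S x (last ws)" by (rule con_trans[OF Wt_con[OF Suc(3) y(1) pos(1)]])
 then show ?case using tr_hd[OF y(2)] y(3) by auto
qed auto

lemma tr_Orb: "vs \<in> tr k x ==> x \<in> Orb ==> last vs \<in> Orb \<and> h x + k * R0 \<le> h (last vs) \<and> h (last vs) \<le> h x + k * (R * M)"
proof (induction k arbitrary: x vs)
 case (Suc k)
 then obtain y ws where y: "y \<in> Nx x" "ws \<in> tr k y" "vs = x # ws" by auto
 have yO: "y \<in> Orb" "h x + R0 \<le> h y" "y \<in> bal R x" using y Suc unfolding Nx_def by auto
 then have "h y \<le> h x + R * M" using bal_h[OF Orb_V[OF Suc(3)], of y R] by auto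
 then show ?case using Suc.IH[OF y(2) yO(1)] yO y(3) tr_hd[OF y(2)] by (auto simp: algebra_simps)
qed simp

lemma tr_V: "vs \<in> tr k x ==> x \<in> V ==> last vs \<in> V \<and> (k > 0 \<longrightarrow> last vs \<in> Orb \<and> h x + (k - 1) * R0 \<le> h (last vs))"
proof (cases k)
 case (Suc k')
 assume a: "vs \<in> tr k x" "x \<in> V"
 then obtain y ws where y: "y \<in> Nx x" "ws \<in> tr k' y" "vs = x # ws" using Suc by auto
 have "y \<in> Orb" using Nx_V[OF a(2) y(1)] .
 then show ?thesis using tr_Orb[OF y(2)] Nx_h[OF y(1)] y(3) tr_hd[OF y(2)] Suc Orb_V by auto
qed simp

definition cr :: nat where "cr = max R ll + max R ll"

lemma Rg_bal: "y \<in> V ==> e \<in> Rg y ==> e \<subseteq> bal (max R ll) y"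
proof -
 assume y: "y \<in> V" "e \<in> Rg y"
 then obtain z where z: "e \<in> Ed y z" unfolding Rg_def by auto
 show ?thesis
 proof (cases "y \<in> Orb")
  case True
  then show ?thesis using z bal_mono[of R "max R ll" y] unfolding Ed_def Eb_def by (auto split: if_splits)
 next
  case False
  then have "e \<in> UP (kx y) y" using z unfolding Ed_def by (auto split: if_splits)
  then obtain i where i: "i < kx y" "e = {(up ^^ i) y, (up ^^ Suc i) y}" unfolding UP_def by auto
  have bb: "(up ^^ j) y \<in> bal (max R ll) y" if "j \<le> kx y" for j
  proof -
   have "j \<le> max R ll" using kx(2)[OF y(1)] that by simp
   then show ?thesis using upn_bal[OF y(1), of j] bal_mono[of j "max R ll" y] by blast
  qed
  then show ?thesis using i bb[of i] bb[of "Suc i"] by auto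
 qed
qed

lemma cls_bal: "y \<in> V ==> y' \<in> V ==> cls y y' ==> y' \<in> bal cr y"
proof -
 assume y: "y \<in> V" "y' \<in> V" "cls y y'"
 then obtain e where e: "e \<in> Rg y" "e \<in> Rg y'" unfolding cls_def by auto
 then have "e \<in> E" using Ed_E unfolding Rg_def by blast
 then obtain u v where "e = {u, v}" using simple by blast
 then have u: "u \<in> bal (max R ll) y" "u \<in> bal (max R ll) y'" using Rg_bal[OF y(1) e(1)] Rg_bal[OF y(2) e(2)] by auto
 show ?thesis unfolding cr_def by (rule bal_trans[OF u(1) bal_sym[OF u(2)]])
qed

lemma pre_sum: fixes f :: "'a list \<Rightarrow> real" assumes "finite A" shows "(\<Sum>us\<in>(\<Union>x\<in>A. trT T i x). f us) = (\<Sum>x\<in>A. \<Sum>us\<in>trT T i x. f us)"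
proof (rule sum.UNION_disjoint[OF assms])
 show "\<forall>x\<in>A. \<forall>y\<in>A. x \<noteq> y \<longrightarrow> trT T i x \<inter> trT T i y = {}"
 proof (intro ballI impI)
  fix x y :: 'a assume "x \<noteq> y"
  then show "trT T i x \<inter> trT T i y = {}" using tr_hd[of _ i x] tr_hd[of _ i y] unfolding trT_def by auto
 qed
qed simp

lemma col_sum:
 fixes c :: real
 assumes A: "finite A" "finite B" and c: "\<And>y. (\<Sum>x\<in>A. qk j x y) \<le> c"
 shows "(\<Sum>us\<in>(\<Union>x\<in>A. tr j x). of_bool (last us \<in> B) * qv us) \<le> card B * c"
proof -
 have "(\<Sum>us\<in>(\<Union>x\<in>A. tr j x). of_bool (last us \<in> B) * qv us) = (\<Sum>x\<in>A. \<Sum>us\<in>tr j x. of_bool (last us \<in> B) * qv us)"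
  using pre_sum[OF A(1), where T = UNIV and i = j and f = "\<lambda>us. of_bool (last us \<in> B) * qv us"] by (simp add: trT_UNIV)
 also have "... = (\<Sum>x\<in>A. \<Sum>y\<in>B. qk j x y)"
 proof (rule sum.cong[OF refl])
  fix x
  have "(\<Sum>us\<in>tr j x. of_bool (last us \<in> B) * qv us) = (\<Sum>us\<in>tr j x. \<Sum>y\<in>B. of_bool (last us = y) * qv us)"
   by (rule sum.cong[OF refl]) (simp add: A(2) flip: sum_distrib_right)
  also have "... = (\<Sum>y\<in>B. \<Sum>us\<in>tr j x. of_bool (last us = y) * qv us)" by (rule sum.swap)
  also have "... = (\<Sum>y\<in>B. qk j x y)"
  proof (rule sum.cong[OF refl])
   fix y
   have "(\<Sum>us\<in>tr j x. of_bool (last us = y) * qv us) = (\<Sum>us\<in>trT {y} j x. qv us)"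
    by (rule sum.mono_neutral_cong_right) (auto simp: trT_def)
   then show "(\<Sum>us\<in>tr j x. of_bool (last us = y) * qv us) = qk j x y" by (simp add: sum_qv_qk)
  qed
  finally show "(\<Sum>us\<in>tr j x. of_bool (last us \<in> B) * qv us) = (\<Sum>y\<in>B. qk j x y)" .
 qed
 also have "... = (\<Sum>y\<in>B. \<Sum>x\<in>A. qk j x y)" by (rule sum.swap)
 also have "... \<le> (\<Sum>y\<in>B. c)" by (rule sum_mono[OF c])
 finally show ?thesis by simp
qed

text \<open>Interfering vertices are within distance \<open>cr\<close>, so in
  \<open>pair_bound\<close> the sum over the second past costs the size of a ball times a column sum
  \<open>c j\<close>, and what remains is the mean again. \<open>fs\<close> records which pairs of
  times can interfere at all. That the edges of \<open>F\<close> lie above points of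
  \<open>A\<close> later makes them independent of an exploration below.\<close>

lemma second_moment:
 fixes A T k
 defines "TT \<equiv> \<Union>x\<in>A. trT T k x"
 defines "mX \<equiv> \<Sum>vs\<in>TT. qv vs"
 assumes A: "finite A" "A \<subseteq> V" and c: "\<And>j y. j < k ==> (\<Sum>x\<in>A. qk j x y) \<le> c j" "\<And>j. 0 \<le> c j"
  and fs: "\<And>i j x x' us us'. i < k ==> j < k ==> x \<in> A ==> x' \<in> A ==> us \<in> tr i x ==> us' \<in> tr j x' ==> trT T (k - i) (last us) \<noteq> {} ==>
   trT T (k - j) (last us') \<noteq> {} ==> h (last us') \<le> h (last us) ==> fs i j"
 shows "\<exists>F. finite F \<and> F \<subseteq> E \<and> (\<forall>e\<in>F. \<exists>x\<in>A. \<forall>v\<in>e. h x \<le> h v) \<and>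
  mX\<^sup>2 \<le> (mX\<^sup>2 + 2 * mX * (Suc deg ^ cr) * (\<Sum>i<k. \<Sum>j<k. of_bool (fs i j) * c j)) * pexp p F (\<lambda>S. of_bool (\<exists>vs\<in>TT. 0 < TW vs S))"
proof -
 define F where "F = (\<Union>vs\<in>TT. TE vs)"
 define K where "K = real (Suc deg ^ cr)"
 define r where "r i us = (\<Sum>ws\<in>trT T (k - i) (last us). qv ws)" for i us
 define pre where "pre i = (\<Union>x\<in>A. tr i x)" for i
 have fin: "finite TT" unfolding TT_def using A by auto
 have F: "finite F" "F \<subseteq> E" unfolding F_def using fin TE_E by auto
 have Flo: "\<forall>e\<in>F. \<exists>x\<in>A. \<forall>v\<in>e. h x \<le> h v" 
 proof
  fix e assume "e \<in> F"
  then obtain x vs where "x \<in> A" "vs \<in> tr k x" "e \<in> TE vs" unfolding F_def TT_def trT_def by auto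
  then show "\<exists>x\<in>A. \<forall>v\<in>e. h x \<le> h v" using TE_lo[of vs k x e] by blast
 qed
 have r_nn: "0 \<le> r i us" for i us unfolding r_def by (intro sum_nonneg qv_nn)
 have mX_nn: "0 \<le> mX" unfolding mX_def by (intro sum_nonneg qv_nn)
 define X where "X S = (\<Sum>vs\<in>TT. TW vs S)" for S
 have X_nn: "0 \<le> X S" for S unfolding X_def by (intro sum_nonneg TW_nn)
 have mX: "pexp p F X = mX"
 proof -
  have "pexp p F X = (\<Sum>vs\<in>TT. pexp p F (TW vs))" unfolding X_def by (rule pexp_sum)
  also have "... = mX" unfolding mX_def
  proof (rule sum.cong[OF refl])
   fix vs assume vs: "vs \<in> TT"
   then obtain x where "vs \<in> tr k x" unfolding TT_def trT_def by auto
   moreover have "TE vs \<subseteq> F" using vs unfolding F_def by auto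
   ultimately show "pexp p F (TW vs) = qv vs" using pexp_TW[OF F(1)] by blast
  qed
  finally show ?thesis .
 qed
 have XP: "0 < X S ==> \<exists>vs\<in>TT. 0 < TW vs S" for S
 proof (rule ccontr)
  assume a: "0 < X S" "\<not> (\<exists>vs\<in>TT. 0 < TW vs S)"
  then have "X S \<le> 0" unfolding X_def by (intro sum_nonpos) auto
  then show False using a by simp
 qed
 have splitE: "(\<Sum>us\<in>pre i. qv us * r i us) = mX" if "i < k" for i
 proof -
  have "(\<Sum>us\<in>pre i. qv us * r i us) = (\<Sum>x\<in>A. \<Sum>us\<in>tr i x. qv us * r i us)"
   using pre_sum[OF A(1), where T = UNIV and i = i and f = "\<lambda>us. qv us * r i us"] unfolding pre_def by (simp add: trT_UNIV)
  also have "... = (\<Sum>x\<in>A. \<Sum>vs\<in>trT T k x. qv vs)"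
  proof (rule sum.cong[OF refl])
   fix x
   have "(\<Sum>vs\<in>trT T (i + (k - i)) x. qv vs) = (\<Sum>us\<in>tr i x. \<Sum>ws\<in>trT T (k - i) (last us). qv (us @ tl ws))" by (rule sum_split)
   also have "... = (\<Sum>us\<in>tr i x. qv us * r i us)" unfolding r_def sum_distrib_left
   proof (rule sum.cong[OF refl], rule sum.cong[OF refl])
    fix us ws assume u: "us \<in> tr i x" and w: "ws \<in> trT T (k - i) (last us)"
    show "qv (us @ tl ws) = qv us * qv ws"
     by (rule qv_append[OF u trT_D[OF w, THEN conjunct1]])
   qed
   finally show "(\<Sum>us\<in>tr i x. qv us * r i us) = (\<Sum>vs\<in>trT T k x. qv vs)" using that by simp
  qed
  also have "... = mX" unfolding mX_def TT_def by (rule pre_sum[OF A(1), symmetric])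
  finally show ?thesis .
 qed
 have preV: "last us \<in> V" if us: "us \<in> pre i" for us i
 proof -
  obtain x where "x \<in> A" "us \<in> tr i x" using us unfolding pre_def by auto
  then show ?thesis using tr_V[of us i x] A by auto
 qed
 have main: "(\<Sum>us\<in>pre i. \<Sum>us'\<in>pre j. of_bool (cls (last us) (last us') \<and> h (last us') \<le> h (last us) \<and> trT T (k - j) (last us') \<noteq> {}) * (qv us * qv us' * r i us))
   \<le> of_bool (fs i j) * (mX * K * c j)" if ij: "i < k" "j < k" for i j
 proof -
  have "(\<Sum>us\<in>pre i. \<Sum>us'\<in>pre j. of_bool (cls (last us) (last us') \<and> h (last us') \<le> h (last us) \<and> trT T (k - j) (last us') \<noteq> {}) * (qv us * qv us' * r i us))
   \<le> (\<Sum>us\<in>pre i. \<Sum>us'\<in>pre j. of_bool (fs i j) * (qv us * r i us) * (of_bool (last us' \<in> bal cr (last us)) * qv us'))"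
  proof (intro sum_mono)
   fix us us' assume u: "us \<in> pre i" "us' \<in> pre j"
   have "fs i j" if "r i us \<noteq> 0" "cls (last us) (last us')" "h (last us') \<le> h (last us)" "trT T (k - j) (last us') \<noteq> {}"
   proof -
    have "trT T (k - i) (last us) \<noteq> {}" using that(1) unfolding r_def by auto
    moreover obtain x x' where "x \<in> A" "us \<in> tr i x" "x' \<in> A" "us' \<in> tr j x'" using u unfolding pre_def by auto
    ultimately show "fs i j" using fs[OF ij] that by blast
   qed
   moreover have "cls (last us) (last us') ==> last us' \<in> bal cr (last us)" using cls_bal[OF preV[OF u(1)] preV[OF u(2)]] .
   moreover have "0 \<le> (qv us * r i us) * qv us'" using qv_nn r_nn by simp
   ultimately show "of_bool (cls (last us) (last us') \<and> h (last us') \<le> h (last us) \<and> trT T (k - j) (last us') \<noteq> {}) * (qv us * qv us' * r i us)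
    \<le> of_bool (fs i j) * (qv us * r i us) * (of_bool (last us' \<in> bal cr (last us)) * qv us')"
    by (cases "r i us = 0") (auto simp: of_bool_def mult.commute mult.left_commute)
  qed
  also have "... = (\<Sum>us\<in>pre i. of_bool (fs i j) * (qv us * r i us) * (\<Sum>us'\<in>pre j. of_bool (last us' \<in> bal cr (last us)) * qv us'))"
   by (simp add: sum_distrib_left)
  also have "... \<le> (\<Sum>us\<in>pre i. of_bool (fs i j) * (qv us * r i us) * (K * c j))"
  proof (intro sum_mono mult_left_mono)
   fix us assume u: "us \<in> pre i"
   have "(\<Sum>us'\<in>pre j. of_bool (last us' \<in> bal cr (last us)) * qv us') \<le> card (bal cr (last us)) * c j"
    unfolding pre_def by (rule col_sum[OF A(1) finite_bal[OF preV[OF u]] c(1)[OF ij(2)]])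
   also have "... \<le> K * c j" unfolding K_def
    by (intro mult_right_mono c(2)) (use card_bal[OF preV[OF u], of cr] in \<open>simp add: of_nat_mono flip: of_nat_power\<close>)
   finally show "(\<Sum>us'\<in>pre j. of_bool (last us' \<in> bal cr (last us)) * qv us') \<le> K * c j" .
  qed (use qv_nn r_nn in auto)
  also have "... = of_bool (fs i j) * (K * c j) * (\<Sum>us\<in>pre i. qv us * r i us)" by (simp add: sum_distrib_left mult_ac)
  also have "... = of_bool (fs i j) * (mX * K * c j)" using splitE[OF ij(1)] by simp
  finally show ?thesis .
 qed
 have "pexp p F (\<lambda>S. (X S)\<^sup>2) \<le> mX\<^sup>2 + 2 * (\<Sum>i<k. \<Sum>j<k. of_bool (fs i j) * (mX * K * c j))"
 proof -
  have "pexp p F (\<lambda>S. (X S)\<^sup>2) \<le> mX\<^sup>2 + 2 * (\<Sum>i<k. \<Sum>j<k. \<Sum>us\<in>pre i. \<Sum>us'\<in>pre j. of_bool (cls (last us) (last us') \<and> h (last us') \<le> h (last us) \<and> trT T (k - j) (last us') \<noteq> {}) * (qv us * qv us' * r i us))"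
   unfolding X_def mX_def TT_def pre_def r_def by (rule pair_bound[OF A(1) F(1)]) (auto simp: F_def TT_def)
  also have "... \<le> mX\<^sup>2 + 2 * (\<Sum>i<k. \<Sum>j<k. of_bool (fs i j) * (mX * K * c j))"
   by (intro add_left_mono mult_left_mono sum_mono main) auto
  finally show ?thesis .
 qed
 also have "... = mX\<^sup>2 + 2 * mX * K * (\<Sum>i<k. \<Sum>j<k. of_bool (fs i j) * c j)"
  by (simp add: sum_distrib_left mult_ac del: sum_mult_of_bool_eq sum_of_bool_mult_eq)
 finally have sec: "pexp p F (\<lambda>S. (X S)\<^sup>2) \<le> mX\<^sup>2 + 2 * mX * K * (\<Sum>i<k. \<Sum>j<k. of_bool (fs i j) * c j)" .
 have "mX\<^sup>2 \<le> pexp p F (\<lambda>S. (X S)\<^sup>2) * pexp p F (\<lambda>S. of_bool (X S > 0))"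
  using pexp_Cauchy_Schwarz[OF p01', of F X] X_nn mX by simp
 also have "... \<le> (mX\<^sup>2 + 2 * mX * K * (\<Sum>i<k. \<Sum>j<k. of_bool (fs i j) * c j)) * pexp p F (\<lambda>S. of_bool (\<exists>vs\<in>TT. 0 < TW vs S))"
  by (intro mult_mono sec pexp_mono[OF p01'] pexp_nonneg[OF p01'] of_bool_mono XP) (use mX_nn c(2) in \<open>auto simp: K_def intro!: add_nonneg_nonneg mult_nonneg_nonneg sum_nonneg\<close>)
 finally show ?thesis using F Flo unfolding K_def by (intro exI[of _ F]) simp
qed

end

section \<open>Critical climbing probabilities\<close>

text \<open>The last terms dominate. In \<open>deep\<close> the factor \<open>real (k - j)\<close>
  counts, up to a constant, the times \<open>i\<close> that can interfere with
  \<open>j\<close>.\<close>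

lemma sum_weighted_powers:
 fixes m :: real assumes "1 < m"
 shows "(\<Sum>j<k. m ^ j * real (k - j)) \<le> m ^ k * (m / (m - 1)\<^sup>2)"
proof (induction k)
 case (Suc k)
 have "(\<Sum>j<Suc k. m ^ j * real (Suc k - j)) = (\<Sum>j<Suc k. m ^ j * real (k - j) + m ^ j)"
  by (rule sum.cong[OF refl]) (auto simp: Suc_diff_le algebra_simps)
 also have "... = (\<Sum>j<k. m ^ j * real (k - j)) + (\<Sum>j<Suc k. m ^ j)" by (simp add: sum.distrib)
 also have "(\<Sum>j<Suc k. m ^ j) = (m ^ Suc k - 1) / (m - 1)" using geometric_sum[of m "Suc k"] assms by simp
 also have "... \<le> m ^ Suc k / (m - 1)" using assms by (intro divide_right_mono) auto
 also have "(\<Sum>j<k. m ^ j * real (k - j)) + m ^ Suc k / (m - 1) \<le> m ^ k * (m / (m - 1)\<^sup>2) + m ^ Suc k / (m - 1)" using Suc by simp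
 also have "... = m ^ Suc k * (1 / (m - 1)\<^sup>2 + 1 / (m - 1))" by (simp add: algebra_simps)
 also have "1 / (m - 1)\<^sup>2 + 1 / (m - 1) = m / (m - 1)\<^sup>2"
 proof -
  obtain d where "m = d + 1" by (metis diff_add_cancel)
  then show ?thesis by (simp add: add_divide_distrib power2_eq_square)
 qed
 finally show ?case by simp
qed (use assms in simp)

context hgraph
begin

lemma UP_UpTo: assumes "x \<in> V" "t \<le> n * c0" "UP n x \<subseteq> S" shows "UpTo x t S"
proof -
 have "con {v \<in> V. h x \<le> h v} S x ((up ^^ n) x)"
 proof (rule con_UP[OF assms(1) order_refl assms(3)])
  fix j :: nat
  have "0 \<le> j * c0" using c0_pos by simp
  then have "h x \<le> h ((up ^^ j) x)" using upn_h[OF assms(1), of j] by linarith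
  then show "(up ^^ j) x \<in> {v \<in> V. h x \<le> h v}" using upn_V[OF assms(1)] by simp
 qed
 moreover have "h x + t \<le> h ((up ^^ n) x)" using upn_h[OF assms(1), of n] assms(2) by linarith
 ultimately show ?thesis unfolding UpTo_def by blast
qed

lemma UP_lo: assumes "x \<in> V" "e \<in> UP n x" "v \<in> e" shows "h x \<le> h v"
proof -
 obtain j where "e = {(up ^^ j) x, (up ^^ Suc j) x}" using assms unfolding UP_def by auto
 then consider "v = (up ^^ j) x" | "v = (up ^^ Suc j) x" using assms(3) by blast
 then obtain i where i: "v = (up ^^ i) x" by cases blast+
 have "0 \<le> i * c0" using c0_pos by simp
 then show ?thesis using upn_h[OF assms(1), of i] i by simp
qed

end

section \<open>Column sums, deep connections and joint climbs\<close>

context hchain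
begin

text \<open>Mass transport exchanges row and column, and its density removes the tilt.\<close>

lemma q_col: assumes y: "y \<in> Orb" shows "nsum (\<lambda>x. of_bool (x \<in> Orb) * ennreal (q x y)) = ennreal mm"
proof -
 let ?F = "\<lambda>u v. of_bool (u \<in> Orb) * ennreal (q u v * exp (h v - h u))"
 have rt: "rt \<in> Orb" by (rule orb_self[OF rt_V])
 have inv: "?F (g u) (g v) = ?F u v" if "g \<in> \<Gamma>" "u \<in> V" "v \<in> V" for g u v
 proof (cases "u \<in> Orb")
  case True
  have "h (g v) - h (g u) = h v - h u" using h_act that by blast
  then show ?thesis using True act_orb[OF that(1) rt_V that(2)] act_q[OF that(1) True that(3)] by simp
 next
  case False
  then show ?thesis using act_orb[OF that(1) rt_V that(2)] by simp
 qed
 have "nsum (\<lambda>x. of_bool (x \<in> Orb) * ennreal (q x y)) = nsum (\<lambda>w. of_bool (w \<in> Orb) * (?F w y * ennreal (exp (h w - h y))))"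
 proof (rule arg_cong[of _ _ nsum], rule ext)
  fix w
  have "ennreal (q w y * exp (h y - h w)) * ennreal (exp (h w - h y)) = ennreal (q w y)"
   by (subst ennreal_mult'[symmetric]) (use q_nn in \<open>auto simp: mult.assoc simp flip: exp_add\<close>)
  then show "of_bool (w \<in> Orb) * ennreal (q w y) = of_bool (w \<in> Orb) * (?F w y * ennreal (exp (h w - h y)))" by auto
 qed
 also have "... = nsum (\<lambda>y. of_bool (y \<in> Orb) * ?F rt y)" by (rule mtp_rt[OF inv rt y, symmetric])
 also have "... = (\<Sum>y\<in>Nx rt. of_bool (y \<in> Orb) * ?F rt y)"
  by (rule nsum_finite[OF finite_Nx]) (use q_zero[OF rt] in simp)
 also have "... = (\<Sum>y\<in>Nx rt. ennreal (q rt y * exp (h y - h rt)))"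
  by (rule sum.cong[OF refl]) (use Nx_V[OF rt_V] rt in simp)
 also have "... = ennreal mm" unfolding mm_def by (rule sum_ennreal) (use q_nn in simp)
 finally show ?thesis .
qed

lemma qk_far: "x \<in> Orb ==> y \<notin> bal (k * R) x ==> qk k x y = 0"
proof (induction k arbitrary: x)
 case (Suc k)
 have "qk k z y = 0" if "z \<in> Nx x" for z
 proof (rule Suc.IH)
  show "z \<in> Orb" using Nx_V[OF Orb_V[OF Suc(2)] that] .
  have "z \<in> bal R x" using that Suc(2) unfolding Nx_def by simp
  then show "y \<notin> bal (k * R) z" using bal_trans[of z R x y "k * R"] Suc(3) by auto
 qed
 then show ?case by simp
qed (use bal_self in auto)

lemma qk_off: "x \<in> Orb ==> y \<notin> Orb ==> qk k x y = 0"
proof (induction k arbitrary: x)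
 case (Suc k)
 have "qk k z y = 0" if "z \<in> Nx x" for z
  by (rule Suc.IH[OF Nx_V[OF Orb_V[OF Suc(2)] that] Suc(3)])
 then show ?case by simp
qed auto

lemma qk_col: assumes y: "y \<in> Orb" shows "nsum (\<lambda>x. of_bool (x \<in> Orb) * ennreal (qk k x y)) = ennreal (mm ^ k)"
proof (induction k)
 case 0
 have "nsum (\<lambda>x. of_bool (x \<in> Orb) * ennreal (qk 0 x y)) = (\<Sum>x\<in>{y}. of_bool (x \<in> Orb) * ennreal (qk 0 x y))"
  by (rule nsum_finite) auto
 then show ?case using y by simp
next
 case (Suc k)
 have "nsum (\<lambda>x. of_bool (x \<in> Orb) * ennreal (qk (Suc k) x y)) =
  nsum (\<lambda>x. nsum (\<lambda>z. of_bool (x \<in> Orb) * ennreal (q x z) * (of_bool (z \<in> Orb) * ennreal (qk k z y))))"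
 proof (rule arg_cong[of _ _ nsum], rule ext)
  fix x
  show "of_bool (x \<in> Orb) * ennreal (qk (Suc k) x y) = nsum (\<lambda>z. of_bool (x \<in> Orb) * ennreal (q x z) * (of_bool (z \<in> Orb) * ennreal (qk k z y)))"
  proof (cases "x \<in> Orb")
   case True
   have "nsum (\<lambda>z. of_bool (x \<in> Orb) * ennreal (q x z) * (of_bool (z \<in> Orb) * ennreal (qk k z y))) =
     (\<Sum>z\<in>Nx x. of_bool (x \<in> Orb) * ennreal (q x z) * (of_bool (z \<in> Orb) * ennreal (qk k z y)))"
    by (rule nsum_finite[OF finite_Nx]) (use q_zero[OF True] in simp)
   also have "... = (\<Sum>z\<in>Nx x. ennreal (q x z * qk k z y))"
    by (rule sum.cong[OF refl]) (use True Nx_V[OF Orb_V[OF True]] q_nn in \<open>auto simp: ennreal_mult'\<close>)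
   also have "... = ennreal (qk (Suc k) x y)" unfolding qk.simps by (rule sum_ennreal) (use q_nn qk_nn in simp)
   finally show ?thesis using True by simp
  qed simp
 qed
 also have "... = nsum (\<lambda>z. nsum (\<lambda>x. of_bool (x \<in> Orb) * ennreal (q x z) * (of_bool (z \<in> Orb) * ennreal (qk k z y))))" by (rule nsum_swap)
 also have "... = nsum (\<lambda>z. ennreal mm * (of_bool (z \<in> Orb) * ennreal (qk k z y)))"
 proof (rule arg_cong[of _ _ nsum], rule ext)
  fix z
  show "nsum (\<lambda>x. of_bool (x \<in> Orb) * ennreal (q x z) * (of_bool (z \<in> Orb) * ennreal (qk k z y))) = ennreal mm * (of_bool (z \<in> Orb) * ennreal (qk k z y))"
   by (cases "z \<in> Orb") (simp_all add: nsum_multc q_col)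
 qed
 also have "... = ennreal (mm ^ Suc k)" unfolding nsum_cmult Suc.IH using mm_nn by (simp add: ennreal_mult')
 finally show ?case .
qed

lemma qk_col_le: assumes "finite A" "A \<subseteq> Orb" shows "(\<Sum>x\<in>A. qk k x y) \<le> mm ^ k"
proof (cases "y \<in> Orb")
 case True
 have "ennreal (\<Sum>x\<in>A. qk k x y) = (\<Sum>x\<in>A. ennreal (qk k x y))" by (rule sum_ennreal[symmetric]) (use qk_nn in simp)
 also have "... = (\<Sum>x\<in>A. of_bool (x \<in> Orb) * ennreal (qk k x y))" by (rule sum.cong[OF refl]) (use assms(2) in auto)
 also have "... \<le> ennreal (mm ^ k)" unfolding qk_col[OF True, of k, symmetric] by (rule sum_le_nsum[OF assms(1)])
 finally show ?thesis using mm_nn by (simp add: ennreal_le_iff)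
next
 case False
 then have "(\<Sum>x\<in>A. qk k x y) = 0" using qk_off assms(2) by (intro sum.neutral) auto
 then show ?thesis using mm_nn by simp
qed

lemma sum_TT: assumes "finite A" shows "(\<Sum>vs\<in>(\<Union>x\<in>A. trT {y} k x). qv vs) = (\<Sum>x\<in>A. qk k x y)"
 using pre_sum[OF assms, where T = "{y}" and i = k and f = qv] by (simp add: sum_qv_qk)

text \<open>Second moment for trajectories of \<open>k\<close> steps that end at \<open>rt\<close>;
  their mean number is \<open>mm ^ k\<close>. When the vertices at times \<open>i\<close> and
  \<open>j\<close> interfere with the first one higher, comparing the remaining climbs bounds
  \<open>k - i\<close> by \<open>b\<close> times \<open>k - j\<close>. The correlation sum is then
  of order \<open>mm ^ k\<close>, so the second moment is comparable to the squared mean.\<close>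

lemma deep:
 assumes m: "1 < mm"
 shows "\<exists>c>0. \<forall>k::nat. \<exists>F. finite F \<and> F \<subseteq> E \<and> c \<le> pexp p F (\<lambda>S. of_bool (\<exists>x\<in>V. h x + k * R0 \<le> h rt \<and> con V S x rt))"
proof -
 \<comment> \<open>Largest possible height gain of a step over the least.\<close>
 define b where "b = R * M / R0"
 define C where "C = mm / (mm - 1)\<^sup>2"
 define D where "D = 1 + 2 * (Suc deg ^ cr) * b * C"
 have b: "0 \<le> b" unfolding b_def using M_nn R0 by simp
 have C: "0 \<le> C" unfolding C_def using m by simp
 have D: "1 \<le> D" unfolding D_def using b C by simp
 have rt: "rt \<in> Orb" by (rule orb_self[OF rt_V])
 have "\<exists>F. finite F \<and> F \<subseteq> E \<and> 1 / D \<le> pexp p F (\<lambda>S. of_bool (\<exists>x\<in>V. h x + k * R0 \<le> h rt \<and> con V S x rt))" for k :: nat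
 proof -
  \<comment> \<open>A step has range \<open>R\<close>, so \<open>k\<close> steps cannot reach
    \<open>rt\<close> from outside this ball and \<open>A\<close> captures the full column
    sum.\<close>
  define A where "A = Orb \<inter> bal (k * R) rt"
  define TT where "TT = (\<Union>x\<in>A. trT {rt} k x)"
  define fs where "fs i j \<longleftrightarrow> (k - i) * R0 \<le> (k - j) * (R * M)" for i j :: nat
  have A: "finite A" "A \<subseteq> Orb" "A \<subseteq> V" unfolding A_def using finite_bal[OF rt_V] Orb_V by auto
  have mX: "(\<Sum>vs\<in>TT. qv vs) = mm ^ k"
  proof -
   have "ennreal (mm ^ k) = nsum (\<lambda>x. of_bool (x \<in> Orb) * ennreal (qk k x rt))" by (rule qk_col[OF rt, symmetric])
   also have "... = (\<Sum>x\<in>A. of_bool (x \<in> Orb) * ennreal (qk k x rt))"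
   proof (rule nsum_finite[OF A(1)])
    fix z assume "z \<notin> A"
    then have "z \<in> Orb ==> rt \<notin> bal (k * R) z" using bal_sym[of rt "k * R" z] unfolding A_def by blast
    then show "of_bool (z \<in> Orb) * ennreal (qk k z rt) = 0" using qk_far[of z rt k] by (cases "z \<in> Orb") auto
   qed
   also have "... = (\<Sum>x\<in>A. ennreal (qk k x rt))" by (rule sum.cong[OF refl]) (use A(2) in auto)
   also have "... = ennreal (\<Sum>x\<in>A. qk k x rt)" by (rule sum_ennreal) (use qk_nn in simp)
   finally have "mm ^ k = (\<Sum>x\<in>A. qk k x rt)" using mm_nn qk_nn by (simp add: sum_nonneg)
   then show ?thesis unfolding TT_def sum_TT[OF A(1)] by simp
  qed
  have "\<exists>F. finite F \<and> F \<subseteq> E \<and> (\<forall>e\<in>F. \<exists>x\<in>A. \<forall>v\<in>e. h x \<le> h v) \<and>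
   (\<Sum>vs\<in>TT. qv vs)\<^sup>2 \<le> ((\<Sum>vs\<in>TT. qv vs)\<^sup>2 + 2 * (\<Sum>vs\<in>TT. qv vs) * (Suc deg ^ cr) * (\<Sum>i<k. \<Sum>j<k. of_bool (fs i j) * mm ^ j)) *
    pexp p F (\<lambda>S. of_bool (\<exists>vs\<in>TT. 0 < TW vs S))"
   unfolding TT_def
  proof (rule second_moment[OF A(1,3)])
   show "(\<Sum>x\<in>A. qk j x y) \<le> mm ^ j" for j y by (rule qk_col_le[OF A(1,2)])
   show "0 \<le> mm ^ j" for j using mm_nn by simp
   fix i j x x' us us'
   assume ij: "i < k" "j < k" "x \<in> A" "x' \<in> A" "us \<in> tr i x" "us' \<in> tr j x'" "trT {rt} (k - i) (last us) \<noteq> {}"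
    "trT {rt} (k - j) (last us') \<noteq> {}" "h (last us') \<le> h (last us)"
   obtain ws ws' where w: "ws \<in> tr (k - i) (last us)" "last ws = rt" "ws' \<in> tr (k - j) (last us')" "last ws' = rt"
    using ij(7,8) unfolding trT_def by auto
   have "last us \<in> Orb" "last us' \<in> Orb" using tr_Orb[OF ij(5)] tr_Orb[OF ij(6)] ij(3,4) A(2) by auto
   then have "h (last us) + (k - i) * R0 \<le> h rt" "h rt \<le> h (last us') + (k - j) * (R * M)"
    using tr_Orb[OF w(1)] tr_Orb[OF w(3)] w by auto
   then show "fs i j" unfolding fs_def using ij(9) by linarith
  qed
  then obtain F where F: "finite F" "F \<subseteq> E" and sm:
   "(mm ^ k)\<^sup>2 \<le> ((mm ^ k)\<^sup>2 + 2 * mm ^ k * (Suc deg ^ cr) * (\<Sum>i<k. \<Sum>j<k. of_bool (fs i j) * mm ^ j)) * pexp p F (\<lambda>S. of_bool (\<exists>vs\<in>TT. 0 < TW vs S))"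
   unfolding mX by auto
  let ?P = "pexp p F (\<lambda>S. of_bool (\<exists>vs\<in>TT. 0 < TW vs S))"
  have P: "0 \<le> ?P" by (rule pexp_nonneg[OF p01']) simp
  have "(\<Sum>i<k. \<Sum>j<k. of_bool (fs i j) * mm ^ j) = (\<Sum>j<k. \<Sum>i<k. of_bool (fs i j) * mm ^ j)" by (rule sum.swap)
  also have "... \<le> (\<Sum>j<k. b * (mm ^ j * real (k - j)))"
  proof (rule sum_mono)
   fix j assume "j \<in> {..<k}"
   let ?B = "nat \<lfloor>(k - j) * b\<rfloor>"
   have "(\<Sum>i<k. of_bool (fs i j) * mm ^ j) = real (card {i\<in>{..<k}. fs i j}) * mm ^ j"
    by (simp flip: sum_distrib_right) (simp add: Int_def)
   also have "... \<le> real ?B * mm ^ j"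
   proof (intro mult_right_mono of_nat_mono)
    have "card {i\<in>{..<k}. fs i j} = card ((\<lambda>i. k - i) ` {i\<in>{..<k}. fs i j})"
     by (rule card_image[symmetric]) (auto simp: inj_on_def)
    also have "... \<le> card {1..?B}"
    proof (rule card_mono)
     show "(\<lambda>i. k - i) ` {i\<in>{..<k}. fs i j} \<subseteq> {1..?B}"
     proof
      fix n assume "n \<in> (\<lambda>i. k - i) ` {i\<in>{..<k}. fs i j}"
      then obtain i where i: "n = k - i" "i < k" "fs i j" by auto
      then have "real n \<le> (k - j) * b" using R0 unfolding fs_def b_def by (simp add: field_simps)
      then have "n \<le> ?B" by (simp add: le_nat_floor)
      then show "n \<in> {1..?B}" using i by simp
     qed
    qed simp
    finally show "card {i\<in>{..<k}. fs i j} \<le> ?B" by simp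
   qed (use mm_nn in simp)
   also have "... \<le> ((k - j) * b) * mm ^ j" using b mm_nn by (intro mult_right_mono of_nat_floor) auto
   finally show "(\<Sum>i<k. of_bool (fs i j) * mm ^ j) \<le> b * (mm ^ j * real (k - j))" by (simp add: mult_ac)
  qed
  also have "... = b * (\<Sum>j<k. mm ^ j * real (k - j))" by (rule sum_distrib_left[symmetric])
  also have "... \<le> b * (mm ^ k * C)" unfolding C_def by (intro mult_left_mono sum_weighted_powers m b)
  finally have s: "(\<Sum>i<k. \<Sum>j<k. of_bool (fs i j) * mm ^ j) \<le> b * (mm ^ k * C)" .
  have "(mm ^ k)\<^sup>2 \<le> ((mm ^ k)\<^sup>2 + 2 * mm ^ k * (Suc deg ^ cr) * (b * (mm ^ k * C))) * ?P"
   by (rule order_trans[OF sm]) (intro mult_right_mono add_left_mono mult_left_mono s P; use mm_nn in simp)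
  also have "... = (mm ^ k)\<^sup>2 * (D * ?P)" unfolding D_def by (simp add: algebra_simps power2_eq_square)
  finally have "1 \<le> D * ?P" using m by (simp add: mult_le_cancel_left1)
  then have "1 / D \<le> ?P" using D by (simp add: field_simps)
  also have "?P \<le> pexp p F (\<lambda>S. of_bool (\<exists>x\<in>V. h x + k * R0 \<le> h rt \<and> con V S x rt))"
  proof (rule pexp_mono[OF p01'], rule of_bool_mono)
   fix S assume "\<exists>vs\<in>TT. 0 < TW vs S"
   then obtain vs x where vs: "0 < TW vs S" "x \<in> A" "vs \<in> tr k x" "last vs = rt" unfolding TT_def trT_def by auto
   have x: "x \<in> V" "x \<in> Orb" using vs(2) A by auto
   have "con V S x rt" by (rule con_mono[OF TW_con[OF vs(3) x(1) vs(1), unfolded vs(4)]]) auto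
   moreover have "h x + k * R0 \<le> h rt" using tr_Orb[OF vs(3) x(2)] vs(4) by simp
   ultimately show "\<exists>x\<in>V. h x + k * R0 \<le> h rt \<and> con V S x rt" using x by auto
  qed
  finally show ?thesis using F by blast
 qed
 then show ?thesis using D by (intro exI[of _ "1 / D"]) auto
qed

text \<open>A start off the orbit moves to \<open>wt x\<close> first, and at most
  \<open>Suc deg ^ ll\<close> starts share this image. So the column sums remain bounded for
  arbitrary start sets.\<close>

lemma qk_col_V:
 assumes m: "mm \<le> 1" and A: "finite A" "A \<subseteq> V" shows "(\<Sum>x\<in>A. qk k x y) \<le> 2 + Suc deg ^ ll"
proof -
 have m1: "mm ^ j \<le> 1" for j using m mm_nn by (rule power_le_one[rotated])
 have "(\<Sum>x\<in>A \<inter> Orb. qk k x y) \<le> mm ^ k" by (rule qk_col_le) (use A in auto)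
 then have 1: "(\<Sum>x\<in>A \<inter> Orb. qk k x y) \<le> 1" using m1[of k] by linarith
 have 2: "(\<Sum>x\<in>A - Orb. qk k x y) \<le> 1 + Suc deg ^ ll"
 proof (cases k)
  case 0
  have "(\<Sum>x\<in>A - Orb. qk k x y) = (\<Sum>x\<in>(A - Orb) \<inter> {y}. 1)"
   unfolding 0 by (rule sum.mono_neutral_cong_right) (use A in auto)
  also have "... \<le> 1" using card_mono[of "{y}" "(A - Orb) \<inter> {y}"] by simp
  finally show ?thesis by (simp add: add_increasing2)
 next
  case (Suc k')
  let ?B = "wt ` (A - Orb)"
  have B: "finite ?B" "?B \<subseteq> Orb" using A kx by auto
  have "(\<Sum>x\<in>A - Orb. qk k x y) \<le> (\<Sum>x\<in>A - Orb. qk k' (wt x) y)"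
  proof (rule sum_mono)
   fix x assume "x \<in> A - Orb"
   then have "Nx x = {wt x}" using A unfolding Nx_def by auto
   then have "qk k x y = q x (wt x) * qk k' (wt x) y" using Suc by simp
   then show "qk k x y \<le> qk k' (wt x) y" using mult_left_le_one_le[OF qk_nn[of k' "wt x" y] q_nn q_le1, of x "wt x"] by simp
  qed
  also have "... = (\<Sum>w\<in>?B. \<Sum>x\<in>{x \<in> A - Orb. wt x = w}. qk k' (wt x) y)" by (rule sum.image_gen) (use A in simp)
  also have "... \<le> (\<Sum>w\<in>?B. Suc deg ^ ll * qk k' w y)"
  proof (rule sum_mono)
   fix w assume w: "w \<in> ?B"
   have "{x \<in> A - Orb. wt x = w} \<subseteq> bal ll w"
   proof
    fix x assume "x \<in> {x \<in> A - Orb. wt x = w}"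
    then have x: "x \<in> V" "wt x = w" using A by auto
    have "w \<in> bal (kx x) x" using upn_bal[OF x(1), of "kx x"] x(2) unfolding wt_def by simp
    then show "x \<in> bal ll w" using bal_sym bal_mono[OF kx(2)[OF x(1)], of w] by blast
   qed
   moreover have wV: "w \<in> V" using w B Orb_V by auto
   ultimately have "card {x \<in> A - Orb. wt x = w} \<le> Suc deg ^ ll"
    using card_mono[OF finite_bal[OF wV]] card_bal[OF wV, of ll] by (meson order_trans)
   then have "real (card {x \<in> A - Orb. wt x = w}) \<le> Suc deg ^ ll" by (metis of_nat_le_iff)
   then have "real (card {x \<in> A - Orb. wt x = w}) * qk k' w y \<le> Suc deg ^ ll * qk k' w y" by (rule mult_right_mono[OF _ qk_nn])
   then show "(\<Sum>x\<in>{x \<in> A - Orb. wt x = w}. qk k' (wt x) y) \<le> Suc deg ^ ll * qk k' w y" by simp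
  qed
  also have "... = Suc deg ^ ll * (\<Sum>w\<in>?B. qk k' w y)" by (rule sum_distrib_left[symmetric])
  also have "... \<le> real (Suc deg ^ ll) * 1" by (intro mult_left_mono order_trans[OF qk_col_le[OF B] m1]) simp
  finally show ?thesis by simp
 qed
 have "(\<Sum>x\<in>A. qk k x y) = (\<Sum>x\<in>A \<inter> Orb. qk k x y) + (\<Sum>x\<in>A - Orb. qk k x y)"
  using A(1) by (simp add: sum.Int_Diff[symmetric])
 then show ?thesis using 1 2 by simp
qed

lemma q0_le1: "q0 \<le> 1"
proof -
 have rt: "rt \<in> Orb" by (rule orb_self[OF rt_V])
 have "q0 = pexp p (Eb R rt) (\<lambda>S. of_bool (cand rt S \<noteq> {}))" using sum_q[OF rt] sum_q_prob[OF rt] by simp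
 also have "... \<le> 1" by (rule pexp_le1[OF p01' finite_Eb[OF rt_V]]) simp
 finally show ?thesis .
qed

lemma tr_mass: "x \<in> Orb ==> (\<Sum>vs\<in>tr k x. qv vs) = q0 ^ k"
proof (induction k arbitrary: x)
 case (Suc k)
 have "(\<Sum>vs\<in>tr (Suc k) x. qv vs) = (\<Sum>y\<in>Nx x. q x y * (\<Sum>vs\<in>tr k y. qv vs))" using sum_qv[of "Suc k" UNIV x] by (simp add: trT_UNIV)
 also have "... = (\<Sum>y\<in>Nx x. q x y * q0 ^ k)"
  by (rule sum.cong[OF refl]) (use Suc.IH Nx_V[OF Orb_V[OF Suc(2)]] in simp)
 also have "... = q0 ^ Suc k" using sum_q[OF Suc(2)] by (simp flip: sum_distrib_right)
 finally show ?case .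
qed simp

lemma tr_mass_ge: assumes "x \<in> V" "0 < k" shows "p ^ ll * q0 ^ k \<le> (\<Sum>vs\<in>tr k x. qv vs)"
proof (cases "x \<in> Orb")
 case True
 have "p ^ ll * q0 ^ k \<le> 1 * q0 ^ k" using p01' q0_nn by (intro mult_right_mono power_le_one) auto
 then show ?thesis using tr_mass[OF True] by simp
next
 case False
 obtain k' where k: "k = Suc k'" using assms(2) by (cases k) auto
 have "(\<Sum>vs\<in>tr k x. qv vs) = q x (wt x) * (\<Sum>vs\<in>tr k' (wt x). qv vs)"
  using sum_qv[of k UNIV x] assms False k by (simp add: trT_UNIV Nx_def)
 also have "... = q x (wt x) * q0 ^ k'" using tr_mass[OF kx(1)[OF assms(1)]] by simp
 finally have *: "(\<Sum>vs\<in>tr k x. qv vs) = q x (wt x) * q0 ^ k'" .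
 have "q x (wt x) = pexp p (UP (kx x) x) (\<lambda>S. of_bool (UP (kx x) x \<subseteq> S))"
  using False assms unfolding q_def Ed_def Wt_def by simp
 also have "... \<ge> p ^ ll"
  by (rule pexp_forced_prob[OF p01']) (use card_UP[of "kx x" x] kx(2)[OF assms(1)] in auto)
 finally have "p ^ ll * q0 ^ k \<le> q x (wt x) * q0 ^ k'"
  using q0_nn q0_le1 p01' unfolding k by (intro mult_mono power_decreasing) (auto intro: mult_left_le_one_le q_nn)
 then show ?thesis using * by simp
qed

definition cst :: real where "cst = 1 / (1 + 2 * real (Suc deg ^ cr) * (2 + real (Suc deg ^ ll)))"

lemma cst_pos: "0 < cst" unfolding cst_def by (intro divide_pos_pos add_pos_nonneg) auto

text \<open>With bounded column sums the correlations are at most a constant times the mean times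
  the square of \<open>k\<close>. Once the mean is at least that square they are absorbed, and the
  success probability is bounded below independently of \<open>A\<close>. Only \<open>k - 1\<close>
  steps are credited with \<open>R0\<close>, as the first may be the climb from off the
  orbit.\<close>

lemma up_many:
 assumes m: "mm \<le> 1" and A: "finite A" "A \<subseteq> V" and k: "0 < k" "k\<^sup>2 \<le> card A * p ^ ll * q0 ^ k"
 shows "\<exists>F. finite F \<and> F \<subseteq> E \<and> (\<forall>e\<in>F. \<exists>x\<in>A. \<forall>v\<in>e. h x \<le> h v) \<and>
  cst \<le> pexp p F (\<lambda>S. of_bool (\<exists>w\<in>A. UpTo w (real (k - 1) * R0) S))"
proof -
 define TT where "TT = (\<Union>x\<in>A. trT UNIV k x)"
 define mX where "mX = (\<Sum>vs\<in>TT. qv vs)"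
 define c where "c = 2 + real (Suc deg ^ ll)"
 define K where "K = real (Suc deg ^ cr)"
 have c: "0 \<le> c" "0 \<le> K" unfolding c_def K_def by auto
 have "mX = (\<Sum>x\<in>A. \<Sum>vs\<in>tr k x. qv vs)" unfolding mX_def TT_def
  using pre_sum[OF A(1), where T = UNIV and i = k and f = qv] by (simp add: trT_UNIV)
 also have "... \<ge> (\<Sum>x\<in>A. p ^ ll * q0 ^ k)" by (intro sum_mono tr_mass_ge) (use A k in auto)
 finally have mX: "k\<^sup>2 \<le> mX" using k(2) by simp
 have "0 < real (k\<^sup>2)" using k(1) by simp
 then have mXp: "0 < mX" using mX by linarith
 have ex: "\<exists>F. finite F \<and> F \<subseteq> E \<and> (\<forall>e\<in>F. \<exists>x\<in>A. \<forall>v\<in>e. h x \<le> h v) \<and>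
   mX\<^sup>2 \<le> (mX\<^sup>2 + 2 * mX * (Suc deg ^ cr) * (\<Sum>i<k. \<Sum>j<k. of_bool True * c)) * pexp p F (\<lambda>S. of_bool (\<exists>vs\<in>TT. 0 < TW vs S))"
  unfolding mX_def TT_def
 proof (rule second_moment[OF A])
  show "(\<Sum>x\<in>A. qk j x y) \<le> c" for j y using qk_col_V[OF m A] unfolding c_def by simp
 qed (rule c(1), rule TrueI)
 have s: "(\<Sum>i<k. \<Sum>j<k. of_bool True * c) = k\<^sup>2 * c" by (simp add: power2_eq_square)
 obtain F where F: "finite F" "F \<subseteq> E" "\<forall>e\<in>F. \<exists>x\<in>A. \<forall>v\<in>e. h x \<le> h v" and
  sm: "mX\<^sup>2 \<le> (mX\<^sup>2 + 2 * mX * K * (k\<^sup>2 * c)) * pexp p F (\<lambda>S. of_bool (\<exists>vs\<in>TT. 0 < TW vs S))"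
  using ex[unfolded s, folded K_def] by blast
 let ?P = "pexp p F (\<lambda>S. of_bool (\<exists>vs\<in>TT. 0 < TW vs S))"
 have P: "0 \<le> ?P" by (rule pexp_nonneg[OF p01']) simp
 have "mX\<^sup>2 \<le> (mX\<^sup>2 + 2 * mX * K * (mX * c)) * ?P"
  by (rule order_trans[OF sm]) (intro mult_right_mono add_left_mono mult_left_mono mX P c; use c mXp in simp)
 also have "... = mX\<^sup>2 * ((1 + 2 * K * c) * ?P)" by (simp add: algebra_simps power2_eq_square)
 finally have "1 \<le> (1 + 2 * K * c) * ?P" using mXp by (simp add: mult_le_cancel_left1)
 moreover have "0 < 1 + 2 * K * c" using c by (simp add: add_pos_nonneg)
 ultimately have "1 / (1 + 2 * K * c) \<le> ?P" by (simp add: field_simps)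
 also have "?P \<le> pexp p F (\<lambda>S. of_bool (\<exists>w\<in>A. UpTo w (real (k - 1) * R0) S))"
 proof (rule pexp_mono[OF p01'], rule of_bool_mono)
  fix S assume "\<exists>vs\<in>TT. 0 < TW vs S"
  then obtain vs x where vs: "0 < TW vs S" "x \<in> A" "vs \<in> tr k x" unfolding TT_def trT_def by auto
  have x: "x \<in> V" using vs(2) A by auto
  have "con {v \<in> V. h x \<le> h v} S x (last vs)" by (rule TW_con[OF vs(3) x vs(1)])
  moreover have "h x + real (k - 1) * R0 \<le> h (last vs)" using tr_V[OF vs(3) x] k(1) by simp
  ultimately show "\<exists>w\<in>A. UpTo w (real (k - 1) * R0) S" unfolding UpTo_def using vs(2) by blast
 qed
 finally have P': "cst \<le> pexp p F (\<lambda>S. of_bool (\<exists>w\<in>A. UpTo w (real (k - 1) * R0) S))" unfolding cst_def K_def c_def .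
 show ?thesis by (intro exI[of _ F] conjI F P')
qed

end

lemma card_ed_le: "card (ed xs) \<le> length xs"
proof (induction xs rule: ed.induct)
 case (1 x y zs)
 have "card (insert {x, y} (ed (y # zs))) \<le> Suc (card (ed (y # zs)))" by (rule card_insert_le_m1) simp_all
 then show ?case using 1 by simp
qed auto

lemma nat_ceiling_bounds:
 assumes "0 < (c::real)" shows "x \<le> real (nat \<lceil>x / c\<rceil>) * c" "0 \<le> x ==> real (nat \<lceil>x / c\<rceil>) \<le> x / c + 1"
proof -
 have "x / c \<le> real (nat \<lceil>x / c\<rceil>)" by (rule real_nat_ceiling_ge)
 then show "x \<le> real (nat \<lceil>x / c\<rceil>) * c" using assms by (simp add: pos_divide_le_eq)
 assume "0 \<le> x"
 then have "0 \<le> x / c" using assms by simp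
 then have "0 \<le> \<lceil>x / c\<rceil>" by linarith
 then have "real (nat \<lceil>x / c\<rceil>) = of_int \<lceil>x / c\<rceil>" by simp
 then show "real (nat \<lceil>x / c\<rceil>) \<le> x / c + 1" using ceiling_correct[of "x / c"] by linarith
qed

section \<open>Decay rates and the converse estimate for large sets\<close>

context hgraph
begin

abbreviation mmp :: "real \<Rightarrow> real \<Rightarrow> nat \<Rightarrow> real" where "mmp p R0 R \<equiv> hchain.mm V E \<Gamma> h up rt p R0 R"

text \<open>The finite-volume property that holds at a positive critical parameter by
  continuity.\<close>

definition subcr :: "real \<Rightarrow> bool" where "subcr p \<longleftrightarrow> (\<forall>R0>0. \<forall>R. mmp p R0 R \<le> 1)"

lemma hchainI: "0 \<le> p ==> p \<le> 1 ==> 0 < R0 ==> hchain V E \<Gamma> h up rt c0 M CM ll deg p R0"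
 by unfold_locales

lemma mm_cont: assumes "0 < R0" shows "continuous_on {0..1} (\<lambda>p. mmp p R0 R)"
proof -
 let ?N = "hchain.Nx V E \<Gamma> h up rt R0 R" and ?D = "hchain.Ed V E \<Gamma> h up rt R0 R" and ?W = "hchain.Wt V E \<Gamma> h up rt R0 R"
 have eq: "mmp p R0 R = (\<Sum>y\<in>?N rt. pexp p (?D rt y) (?W rt y) * exp (h y - h rt))" if "p \<in> {0..1}" for p
 proof -
  interpret c: hchain V E \<Gamma> h up rt c0 M CM ll deg p R0 R using that assms by (intro hchainI) auto
  show ?thesis unfolding c.mm_def c.q_def ..
 qed
 have "continuous_on {0..1} (\<lambda>p. \<Sum>y\<in>?N rt. pexp p (?D rt y) (?W rt y) * exp (h y - h rt))"
  by (intro continuous_on_sum continuous_on_mult continuous_on_const continuous_on_subset[OF pexp_continuous]) simp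
 then show ?thesis by (subst continuous_on_cong[OF refl eq]) auto
qed

text \<open>One step of gain \<open>t\<close> with a radius covering \<open>F\<close>: its tilted
  mean is at most 1, so it succeeds with probability at most \<open>exp (- t)\<close>.\<close>

lemma decay_one:
 assumes p: "0 < p" "p \<le> 1" and s: "subcr p" and x: "x \<in> Orb" and t: "0 \<le> t" and F: "finite F" "F \<subseteq> E"
 shows "pexp p F (\<lambda>S. of_bool (UpTo x t S)) \<le> 1 / p ^ ll * exp (- 1 * t)"
proof (cases "t = 0")
 case True
 have "pexp p F (\<lambda>S. of_bool (UpTo x t S)) \<le> 1" by (rule pexp_le1) (use p F in auto)
 also have "1 \<le> 1 / p ^ ll" using p by (simp add: power_le_one)
 finally show ?thesis using True by simp
next
 case False
 then have t: "0 < t" using t by simp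
 obtain R' where R': "F \<subseteq> Eb R' x" using edges_in_ball[OF F Orb_V[OF x]] by auto
 interpret c: hchain V E \<Gamma> h up rt c0 M CM ll deg p t "R' + ll" using p t by (intro hchainI) auto
 have "p ^ ll * pexp p F (\<lambda>S. of_bool (UpTo x t S)) \<le> c.q0" by (rule c.q0_ge[OF x refl R'])
 moreover have "c.q0 * exp t \<le> 1" using c.q0_le_mm s t unfolding subcr_def by (meson order_trans)
 then have "c.q0 \<le> exp (- t)" by (simp add: exp_minus field_simps)
 ultimately have "p ^ ll * pexp p F (\<lambda>S. of_bool (UpTo x t S)) \<le> exp (- t)" by linarith
 then show ?thesis using p by (simp add: field_simps)
qed

lemma UP_prob:
 assumes "0 \<le> p" "p \<le> 1" "x \<in> V" "t \<le> n * c0" shows "p ^ n \<le> pexp p (UP n x) (\<lambda>S. of_bool (UpTo x t S))"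
proof -
 have "p ^ n \<le> pexp p (UP n x) (\<lambda>S. of_bool (UP n x \<subseteq> S))"
  by (rule pexp_forced_prob[OF assms(1,2) _ order_refl card_UP]) simp
 also have "... \<le> pexp p (UP n x) (\<lambda>S. of_bool (UpTo x t S))"
  by (rule pexp_mono[OF assms(1,2)], rule of_bool_mono, rule UP_UpTo[OF assms(3,4)])
 finally show ?thesis .
qed

text \<open>The climb along \<open>n\<close> edges of \<open>up\<close> already has probability at
  least \<open>p ^ n\<close>, which no faster decay allows.\<close>

lemma decay_le: assumes p: "0 < p" "p \<le> 1" and d: "decay p b" shows "b \<le> ln (1 / p) / c0"
proof -
 have rt: "rt \<in> Orb" by (rule orb_self[OF rt_V])
 obtain C where "\<forall>x\<in>Orb. \<forall>t\<ge>0. \<forall>F. finite F \<longrightarrow> F \<subseteq> E \<longrightarrow> pexp p F (\<lambda>S. of_bool (UpTo x t S)) \<le> C * exp (- b * t)"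
  using d unfolding decay_def by (elim exE)
 note C = this[rule_format, OF rt]
 have le: "(p * exp (b * c0)) ^ n \<le> C" for n
 proof -
  have "p ^ n \<le> C * exp (- b * (n * c0))"
   using UP_prob[of p rt "n * c0" n] C[of "n * c0" "UP n rt"] UP_E[OF rt_V, of n] p c0_pos rt_V by simp
  then have "p ^ n * exp (b * (n * c0)) \<le> C" by (simp add: exp_minus field_simps)
  then show ?thesis by (simp add: power_mult_distrib exp_of_nat_mult[symmetric] mult_ac)
 qed
 have "p * exp (b * c0) \<le> 1"
 proof (rule ccontr)
  assume "\<not> p * exp (b * c0) \<le> 1"
  then obtain n where "C < (p * exp (b * c0)) ^ n" using real_arch_pow by fastforce
  then show False using le[of n] by simp
 qed
 then have "exp (b * c0) \<le> 1 / p" using p by (simp add: field_simps)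
 then have "b * c0 \<le> ln (1 / p)" using p by (simp add: ln_ge_iff)
 then show ?thesis using c0_pos by (simp add: field_simps)
qed

text \<open>Failure of the rate \<open>k'\<close> supplies one climb, of some height
  \<open>t\<close>, more likely than \<open>exp (- k' * t)\<close>. Used as the step of a chain it
  succeeds with probability at least \<open>exp (- k2 * t)\<close>. As \<open>k\<close> exceeds
  \<open>k2\<close>, a set of \<open>exp (k * r)\<close> vertices has many climbs by
  \<open>r\<close> on average, and \<open>up_many\<close> applies.\<close>

lemma spread:
 assumes p: "0 < p" "p \<le> 1" and s: "subcr p" and k: "0 < k'" "k' < k" and nd: "\<not> decay p k'"
 shows "\<exists>c>0. \<forall>r\<ge>0. \<forall>W. finite W \<longrightarrow> W \<subseteq> V \<longrightarrow> exp (k * r) \<le> card W \<longrightarrow>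
  (\<exists>F. finite F \<and> F \<subseteq> E \<and> (\<forall>e\<in>F. \<exists>w\<in>W. \<forall>v\<in>e. h w \<le> h v) \<and> c \<le> pexp p F (\<lambda>S. of_bool (\<exists>w\<in>W. UpTo w r S)))"
proof -
 have p0: "0 \<le> p" using p by simp
 define k2 where "k2 = (k + k') / 2"
 have k2: "k' < k2" "k2 < k" "0 < k2" unfolding k2_def using k by auto
 \<comment> \<open>Chosen so that \<open>exp (- (k2 - k') * T)\<close> equals the cost
   \<open>p ^ ll\<close> of returning to the orbit. The factor \<open>exp (k' * T)\<close> in
   \<open>big\<close> forces \<open>t\<close> to exceed \<open>T\<close>.\<close>
 define T where "T = ll * ln (1 / p) / (k2 - k')"
 have T: "0 \<le> T" unfolding T_def using p k2 by simp
 obtain x t F where x: "x \<in> Orb" and t: "0 \<le> t" and F: "finite F" "F \<subseteq> E"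
  and big: "exp (k' * T) * exp (- k' * t) < pexp p F (\<lambda>S. of_bool (UpTo x t S))"
 proof -
  have "\<not> (\<forall>x\<in>Orb. \<forall>t\<ge>0. \<forall>F. finite F \<longrightarrow> F \<subseteq> E \<longrightarrow> pexp p F (\<lambda>S. of_bool (UpTo x t S)) \<le> exp (k' * T) * exp (- k' * t))"
   using nd unfolding decay_def by (rule contrapos_nn) (rule exI)
  then show thesis using that by (auto simp: not_le)
 qed
 have "pexp p F (\<lambda>S. of_bool (UpTo x t S)) \<le> 1" by (rule pexp_le1) (use p F in auto)
 then have "exp (k' * T) * exp (- k' * t) < 1" using big by linarith
 then have "exp (k' * T - k' * t) < 1" by (simp add: exp_diff exp_minus field_simps)
 then have "k' * T < k' * t" by simp
 then have tT: "T < t" using k by simp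
 then have t0: "0 < t" using T by simp
 obtain R' where R': "F \<subseteq> Eb R' x" using edges_in_ball[OF F Orb_V[OF x]] by auto
 interpret c: hchain V E \<Gamma> h up rt c0 M CM ll deg p t "R' + ll" using p t0 by (intro hchainI) auto
 have mm: "c.mm \<le> 1" using s t0 unfolding subcr_def by blast
 have q0: "exp (- k2 * t) \<le> c.q0"
 proof -
  have "exp (- k2 * t) = exp (- k' * t) * exp (- (k2 - k') * t)" by (simp add: algebra_simps flip: exp_add)
  also have "... \<le> exp (- k' * t) * p ^ ll"
  proof (intro mult_left_mono)
   have "exp (- (k2 - k') * t) \<le> exp (- (k2 - k') * T)" using tT k2 by simp
   also have "- (k2 - k') * T = ll * ln p"
   proof -
    have "(k2 - k') * T = ll * ln (1 / p)" unfolding T_def using k2 by simp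
    then show ?thesis using p by (simp add: ln_div algebra_simps)
   qed
   also have "exp (ll * ln p) = p ^ ll" using p by (simp add: exp_of_nat_mult)
   finally show "exp (- (k2 - k') * t) \<le> p ^ ll" .
  qed simp
  also have "exp (- k' * t) * p ^ ll \<le> p ^ ll * pexp p F (\<lambda>S. of_bool (UpTo x t S))"
  proof -
   have "1 * exp (- k' * t) \<le> exp (k' * T) * exp (- k' * t)" by (intro mult_right_mono) (use T k in auto)
   then have "exp (- k' * t) \<le> pexp p F (\<lambda>S. of_bool (UpTo x t S))" using big by linarith
   from mult_left_mono[OF this, of "p ^ ll"] show ?thesis using p by (simp add: mult.commute)
  qed
  also have "... \<le> c.q0" by (rule c.q0_ge[OF x refl R'])
  finally show ?thesis .
 qed
 define C where "C = p ^ ll * exp (- k2 * t * 2)"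
 have C: "0 < C" unfolding C_def using p by simp
 define a where "a = k - k2"
 have a: "0 < a" unfolding a_def using k2 by simp
 \<comment> \<open>Beyond \<open>r0\<close> the surplus \<open>exp (a * r)\<close> beats the squared
   number of steps: it is at least the cube of \<open>a * r / 3\<close>, and 4 * 27 = 108. Up to
   \<open>r0\<close> a single vertex climbing along \<open>up\<close> suffices.\<close>
 define r0 where "r0 = max (2 * t) (108 / (t\<^sup>2 * C * a ^ 3))"
 have r0: "0 \<le> r0" "2 * t \<le> r0" unfolding r0_def using t0 by auto
 define n0 where "n0 = nat \<lceil>r0 / c0\<rceil>"
 have n0: "r0 \<le> n0 * c0" unfolding n0_def by (rule nat_ceiling_bounds(1)[OF c0_pos])
 define c1 where "c1 = min c.cst (p ^ n0)"
 have "0 < c1" unfolding c1_def using c.cst_pos p by simp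
 moreover have "\<exists>F. finite F \<and> F \<subseteq> E \<and> (\<forall>e\<in>F. \<exists>w\<in>W. \<forall>v\<in>e. h w \<le> h v) \<and> c1 \<le> pexp p F (\<lambda>S. of_bool (\<exists>w\<in>W. UpTo w r S))"
  if r: "0 \<le> r" and W: "finite W" "W \<subseteq> V" "exp (k * r) \<le> card W" for r W
 proof (cases "r \<le> r0")
  case True
  have "1 \<le> exp (k * r)" using k r by simp
  then have "W \<noteq> {}" using W by auto
  then obtain w where w: "w \<in> W" "w \<in> V" using W by auto
  have "p ^ n0 \<le> pexp p (UP n0 w) (\<lambda>S. of_bool (UpTo w r S))" by (rule UP_prob[OF p0 p(2) w(2)]) (use n0 True in simp)
  also have "... \<le> pexp p (UP n0 w) (\<lambda>S. of_bool (\<exists>w\<in>W. UpTo w r S))"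
   by (rule pexp_mono[OF p0 p(2)], rule of_bool_mono) (use w in blast)
  finally have "c1 \<le> pexp p (UP n0 w) (\<lambda>S. of_bool (\<exists>w\<in>W. UpTo w r S))" unfolding c1_def by simp
  moreover have "\<forall>e\<in>UP n0 w. \<exists>w\<in>W. \<forall>v\<in>e. h w \<le> h v" using UP_lo[OF w(2)] w(1) by blast
  ultimately show ?thesis using UP_E[OF w(2)] by (intro exI[of _ "UP n0 w"]) simp
 next
  case False
  \<comment> \<open>One more step than the height \<open>r\<close> requires, since the first step
    need not gain \<open>t\<close>.\<close>
  define m where "m = Suc (nat \<lceil>r / t\<rceil>)"
  have m1: "r \<le> real (m - 1) * t" unfolding m_def using nat_ceiling_bounds(1)[OF t0, of r] by simp
  have m2: "m \<le> r / t + 2" unfolding m_def using nat_ceiling_bounds(2)[OF t0 r] by simp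
  have rt2: "2 \<le> r / t" using False r0 t0 by (simp add: field_simps)
  have "real (m\<^sup>2) \<le> (2 * (r / t))\<^sup>2" unfolding of_nat_power by (rule power_mono) (use m2 rt2 in auto)
  also have "... = 4 * r\<^sup>2 / t\<^sup>2" by (simp add: power_divide power_mult_distrib)
  also have "... \<le> C * (a * r / 3) ^ 3"
  proof -
   have "108 / (t\<^sup>2 * C * a ^ 3) \<le> r" using False unfolding r0_def by simp
   then have "108 \<le> r * (t\<^sup>2 * C * a ^ 3)" using t0 C a by (simp add: field_simps)
   then have "108 * r\<^sup>2 \<le> r * (t\<^sup>2 * C * a ^ 3) * r\<^sup>2" by (rule mult_right_mono) simp
   then show ?thesis using t0 by (simp add: field_simps power2_eq_square power3_eq_cube)
  qed
  also have "... \<le> C * exp (a * r / 3) ^ 3"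
  proof (intro mult_left_mono power_mono)
   show "a * r / 3 \<le> exp (a * r / 3)" using exp_ge_add_one_self[of "a * r / 3"] by linarith
  qed (use C a r in auto)
  also have "exp (a * r / 3) ^ 3 = exp (a * r)" by (simp flip: exp_of_nat_mult)
  also have "C * exp (a * r) = exp (k * r) * p ^ ll * exp (- k2 * (r + 2 * t))"
   unfolding C_def a_def by (simp add: algebra_simps flip: exp_add)
  also have "... \<le> card W * p ^ ll * c.q0 ^ m"
  proof (intro mult_mono)
   have "real m * t \<le> r + 2 * t" using m2 t0 by (simp add: field_simps)
   then have "exp (- k2 * (r + 2 * t)) \<le> exp (m * (- k2 * t))" using k2 by (simp add: mult.left_commute)
   also have "... = exp (- k2 * t) ^ m" by (rule exp_of_nat_mult)
   also have "... \<le> c.q0 ^ m" by (intro power_mono q0) simp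
   finally show "exp (- k2 * (r + 2 * t)) \<le> c.q0 ^ m" .
  qed (use W p in auto)
  finally have mW: "real (m\<^sup>2) \<le> card W * p ^ ll * c.q0 ^ m" by simp
  have "0 < m" unfolding m_def by simp
  from c.up_many[OF mm W(1,2) this] mW obtain F where F: "finite F" "F \<subseteq> E" "\<forall>e\<in>F. \<exists>x\<in>W. \<forall>v\<in>e. h x \<le> h v"
   "c.cst \<le> pexp p F (\<lambda>S. of_bool (\<exists>w\<in>W. UpTo w (real (m - 1) * t) S))" unfolding of_nat_power by blast
  have "pexp p F (\<lambda>S. of_bool (\<exists>w\<in>W. UpTo w (real (m - 1) * t) S)) \<le> pexp p F (\<lambda>S. of_bool (\<exists>w\<in>W. UpTo w r S))"
  proof (rule pexp_mono[OF p0 p(2)], rule of_bool_mono)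
   fix S assume "\<exists>w\<in>W. UpTo w (real (m - 1) * t) S"
   then obtain w z where "w \<in> W" "h w + real (m - 1) * t \<le> h z" "con {v \<in> V. h w \<le> h v} S w z" unfolding UpTo_def by blast
   moreover from this have "h w + r \<le> h z" using m1 by linarith
   ultimately show "\<exists>w\<in>W. UpTo w r S" unfolding UpTo_def by blast
  qed
  then have P: "c1 \<le> pexp p F (\<lambda>S. of_bool (\<exists>w\<in>W. UpTo w r S))" using F(4) unfolding c1_def by linarith
  show ?thesis by (intro exI[of _ F] conjI F P)
 qed
 ultimately show ?thesis by blast
qed

text \<open>\<open>al\<close> is the supremum of the decay rates, at least 1 by
  \<open>decay_one\<close> and finite by \<open>decay_le\<close>. A rate slightly below it decays, a
  rate slightly above it fails and so spreads; because \<open>al\<close> is at least 1, absolute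
  errors of order \<open>d\<close> give the relative error claimed.\<close>

lemma exponents:
 assumes p: "0 < p" "p \<le> 1" and s: "subcr p" and d: "0 < d" "d < 1"
 obtains b k where "1 - d \<le> b" "(1 - d) * k \<le> b" "0 < k" "decay p b"
  "\<exists>c>0. \<forall>r\<ge>0. \<forall>W. finite W \<longrightarrow> W \<subseteq> V \<longrightarrow> exp (k * r) \<le> card W \<longrightarrow>
  (\<exists>F. finite F \<and> F \<subseteq> E \<and> (\<forall>e\<in>F. \<exists>w\<in>W. \<forall>v\<in>e. h w \<le> h v) \<and> c \<le> pexp p F (\<lambda>S. of_bool (\<exists>w\<in>W. UpTo w r S)))"
proof -
 let ?S = "{b. decay p b}"
 have one: "1 \<in> ?S" unfolding decay_def using decay_one[OF p s] by (intro CollectI exI[of _ "1 / p ^ ll"]) blast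
 have bdd: "bdd_above ?S" using decay_le[OF p] by (intro bdd_aboveI) auto
 define al where "al = Sup ?S"
 have al: "1 \<le> al" unfolding al_def by (rule cSup_upper[OF one bdd])
 have "al - d / 4 < Sup ?S" unfolding al_def using d by simp
 then obtain b where b: "decay p b" "al - d / 4 < b" using less_cSupE[of _ ?S] one by blast
 have nd: "\<not> decay p (al + d / 8)"
 proof
  assume "decay p (al + d / 8)"
  then have "al + d / 8 \<le> al" unfolding al_def by (intro cSup_upper[OF _ bdd]) simp
  then show False using d by simp
 qed
 have "(1 - d) * (al + d / 4) \<le> al - d / 4"
 proof -
  have "d * 1 \<le> d * al" using al d by (intro mult_left_mono) auto
  moreover have "0 \<le> d * d" by simp
  moreover have "(1 - d) * (al + d / 4) = al + d / 4 - d * al - d * d / 4" by (simp add: field_simps)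
  ultimately show ?thesis using d by linarith
 qed
 then have 1: "(1 - d) * (al + d / 4) \<le> b" using b by linarith
 show thesis
  by (rule that[OF _ 1 _ b(1) spread[OF p s _ _ nd]]) (use al d b in auto)
qed

lemma lowpath1: "w \<in> Orb ==> \<exists>y\<in>Orb. \<exists>D. finite D \<and> D \<subseteq> E \<and> card D \<le> m * Suc ll \<and> h y + m * c0 \<le> h w \<and> con {v \<in> V. h y \<le> h v} D y w"
proof (induction m)
 case 0
 show ?case by (rule bexI[OF _ 0], rule exI[of _ "{}"]) (use 0 Orb_V in auto)
next
 case (Suc m)
 obtain y D where y: "y \<in> Orb" "finite D" "D \<subseteq> E" "card D \<le> m * Suc ll" "h y + m * c0 \<le> h w" "con {v \<in> V. h y \<le> h v} D y w"
  using Suc by blast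
 obtain y' xs where x: "y' \<in> Orb" "xs \<noteq> []" "hd xs = y'" "last xs = y" "set xs \<subseteq> V" "ed xs \<subseteq> E"
  "\<forall>v\<in>set xs. h y' \<le> h v" "h y' + c0 \<le> h y" "length xs \<le> Suc ll" using down[OF y(1)] by blast
 have "con {v \<in> V. h y' \<le> h v} (ed xs \<union> D) (hd xs) (last xs)" by (rule walk_con) (use x in auto)
 moreover have "con {v \<in> V. h y' \<le> h v} (ed xs \<union> D) y w" by (rule con_mono[OF y(6)]) (use x(8) c0_pos in auto)
 ultimately have c: "con {v \<in> V. h y' \<le> h v} (ed xs \<union> D) y' w" unfolding x(3,4) by (rule con_trans)
 have "card (ed xs \<union> D) \<le> card (ed xs) + card D" by (rule card_Un_le)
 then have "card (ed xs \<union> D) \<le> Suc m * Suc ll" using y(4) card_ed_le[of xs] x(9) by simp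
 then show ?case
  by (intro bexI[OF _ x(1)] exI[of _ "ed xs \<union> D"] conjI c) (use x y in \<open>auto simp: algebra_simps\<close>)
qed

text \<open>Turns a climb from \<open>x\<close> above a floor \<open>a\<close> into a climb of the
  orbit vertex \<open>y\<close> inside its own half-space; opening \<open>D\<close> costs a factor
  exponential in \<open>h x - a\<close>. The path goes from \<open>x\<close> up to the orbit and
  from there down by repeated use of \<open>down\<close>.\<close>

lemma lowpath:
 obtains C :: real where "0 \<le> C" "\<And>x a. x \<in> V ==> a \<le> h x ==> \<exists>y\<in>Orb. \<exists>D. finite D \<and> D \<subseteq> E \<and> card D \<le> C * (h x - a) + C \<and> h y \<le> a \<and> con {v \<in> V. h y \<le> h v} D y x"
proof
 define C where "C = max (Suc ll / c0) (ll + (ll * M / c0 + 1) * Suc ll)"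
 show "0 \<le> C" unfolding C_def using c0_pos by (simp add: le_max_iff_disj)
 fix x a assume x: "x \<in> V" "a \<le> h x"
 define w where "w = wt x"
 have w: "w \<in> Orb" "w \<in> bal (kx x) x" "kx x \<le> ll" unfolding w_def using kx[OF x(1)] upn_bal[OF x(1), of "kx x"] by (auto simp: wt_def)
 have hw: "\<bar>h w - h x\<bar> \<le> ll * M" 
 proof -
  have "\<bar>h w - h x\<bar> \<le> kx x * M" by (rule bal_h[OF x(1) w(2)])
  also have "... \<le> ll * M" using w(3) M_nn by (intro mult_right_mono) auto
  finally show ?thesis .
 qed
 have hwx: "h x \<le> h w" unfolding w_def wt_def using upn_h_mono[OF x(1), of 0 "kx x"] by (cases "kx x = 0") auto
 define m where "m = nat \<lceil>(h w - a) / c0\<rceil>"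
 have m1: "h w - a \<le> m * c0" unfolding m_def by (rule nat_ceiling_bounds(1)[OF c0_pos])
 have "m \<le> (h w - a) / c0 + 1" unfolding m_def by (rule nat_ceiling_bounds(2)[OF c0_pos]) (use hwx x in simp)
 also have "... \<le> (h x - a) / c0 + (ll * M / c0 + 1)"
  using divide_right_mono[of "h w - a" "h x - a + ll * M" c0] hw c0_pos by (simp add: add_divide_distrib)
 finally have m2: "m \<le> (h x - a) / c0 + (ll * M / c0 + 1)" .
 obtain y D where y: "y \<in> Orb" "finite D" "D \<subseteq> E" "card D \<le> m * Suc ll" "h y + m * c0 \<le> h w" "con {v \<in> V. h y \<le> h v} D y w"
  using lowpath1[OF w(1)] by blast
 have hy: "h y \<le> a" using y(5) m1 by linarith
 have "con {v \<in> V. h y \<le> h v} (UP (kx x) x) x ((up ^^ kx x) x)"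
 proof (rule con_UP[OF x(1) order_refl order_refl])
  fix j :: nat
  have "0 \<le> j * c0" using c0_pos by simp
  then have "h y \<le> h ((up ^^ j) x)" using upn_h[OF x(1), of j] hy x(2) by linarith
  then show "(up ^^ j) x \<in> {v \<in> V. h y \<le> h v}" using upn_V[OF x(1)] by simp
 qed
 then have "con {v \<in> V. h y \<le> h v} (UP (kx x) x) w x" unfolding w_def wt_def by (rule con_sym)
 then have c1: "con {v \<in> V. h y \<le> h v} (D \<union> UP (kx x) x) w x" by (rule con_mono) auto
 have "con {v \<in> V. h y \<le> h v} (D \<union> UP (kx x) x) y w" by (rule con_mono[OF y(6)]) auto
 then have c: "con {v \<in> V. h y \<le> h v} (D \<union> UP (kx x) x) y x" by (rule con_trans[OF _ c1])
 have "card (D \<union> UP (kx x) x) \<le> card D + card (UP (kx x) x)" by (rule card_Un_le)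
 then have "card (D \<union> UP (kx x) x) \<le> m * Suc ll + ll" using y(4) card_UP[of "kx x" x] w(3) by linarith
 then have "real (card (D \<union> UP (kx x) x)) \<le> real m * Suc ll + ll" by (metis of_nat_add of_nat_le_iff of_nat_mult)
 also have "... \<le> ((h x - a) / c0 + (ll * M / c0 + 1)) * Suc ll + ll" using m2 by (intro add_right_mono mult_right_mono) auto
 also have "... = Suc ll / c0 * (h x - a) + (ll + (ll * M / c0 + 1) * Suc ll)" by (simp add: algebra_simps)
 also have "... \<le> C * (h x - a) + C" unfolding C_def using x(2) by (intro add_mono mult_right_mono) auto
 finally have "real (card (D \<union> UP (kx x) x)) \<le> C * (h x - a) + C" .
 then show "\<exists>y\<in>Orb. \<exists>D. finite D \<and> D \<subseteq> E \<and> card D \<le> C * (h x - a) + C \<and> h y \<le> a \<and> con {v \<in> V. h y \<le> h v} D y x"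
  by (intro bexI[OF _ y(1)] exI[of _ "D \<union> UP (kx x) x"] conjI c hy) (use y UP_E[OF x(1)] in auto)
qed

definition band :: "real \<Rightarrow> real \<Rightarrow> 'a set" where "band a L = {v \<in> V. a \<le> h v \<and> h v < L}"

text \<open>The exits of the slab through its top: \<open>z\<close> is the only vertex of its path
  at or above \<open>L\<close>.\<close>

definition hits :: "real \<Rightarrow> real \<Rightarrow> 'a \<Rightarrow> 'a set set \<Rightarrow> 'a set" where
 "hits a L x S = {z. L \<le> h z \<and> con (insert z (band a L)) S x z}"

lemma hits_mono: "S \<subseteq> S' ==> hits a L x S \<subseteq> hits a L x S'"
 unfolding hits_def by (intro Collect_mono conj_mono impI con_mono[of _ S x _ _ S']) auto

lemma hits_sub: assumes "h x < L" shows "hits a L x S \<subseteq> \<Union>S"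
proof
 fix z assume "z \<in> hits a L x S"
 then have z: "L \<le> h z" "con (insert z (band a L)) S x z" unfolding hits_def by auto
 have "z = x \<or> (\<exists>y. {y, z} \<in> S)" using z(2) by (cases rule: con_induct[of _ S x z]) auto
 then show "z \<in> \<Union>S" using z(1) assms by auto
qed

text \<open>Each edge used has an end below \<open>L\<close>, which makes the hits independent of
  the edges lying above.\<close>

lemma hits_lo: assumes "S \<subseteq> E" shows "hits a L x S = hits a L x {e \<in> S. \<exists>v\<in>e. h v < L}"
proof
 show "hits a L x S \<subseteq> hits a L x {e \<in> S. \<exists>v\<in>e. h v < L}"
 proof
  fix z assume "z \<in> hits a L x S"
  then have z: "L \<le> h z" "con (insert z (band a L)) S x z" unfolding hits_def by auto
  let ?U = "insert z (band a L)"
  have "con ?U {e \<in> S. \<exists>v\<in>e. h v < L} x y" if "con ?U S x y" for y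
   using that
  proof (induction rule: con_induct)
   case refl
   show ?case using con_in[OF z(2)] by simp
  next
   case (step u v)
   have "u \<noteq> v" using step(3) assms edge_V by blast
   moreover have "u \<in> ?U" using con_in[OF step(1)] by simp
   ultimately have "h u < L \<or> h v < L" using step(2) unfolding band_def by auto
   then have "{u, v} \<in> {e \<in> S. \<exists>v\<in>e. h v < L}" using step(3) by auto
   then show ?case by (rule con_step[OF step(4,2)])
  qed
  from this[OF z(2)] show "z \<in> hits a L x {e \<in> S. \<exists>v\<in>e. h v < L}" using z(1) unfolding hits_def by simp
 qed
qed (rule hits_mono, auto)

end

section \<open>Hitting a level from a slab\<close>

lemma sum_inverse_le: "1 \<le> n ==> (\<Sum>j=1..n. 1 / real j) \<le> 1 + ln n"
proof (induction n rule: nat_induct_at_least)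
 case (Suc n)
 have "ln (n / Suc n) \<le> n / Suc n - 1" using Suc by (intro ln_le_minus_one) simp
 also have "... = - (1 / Suc n)" by (simp add: field_simps)
 finally have "1 / Suc n \<le> ln (Suc n) - ln n" using Suc by (simp add: ln_div)
 then show ?case using Suc by simp
qed simp

text \<open>Comparison with the harmonic sum costs one factor \<open>real n powr d\<close>; the
  logarithm costs another, divided by \<open>d\<close>.\<close>

lemma sum_powr_le:
 assumes "0 < d" "d < 1" "1 \<le> n" shows "(\<Sum>j=1..n. real j powr - (1 - d)) \<le> real n powr (2 * d) / d"
proof -
 have "(\<Sum>j=1..n. real j powr - (1 - d)) \<le> (\<Sum>j=1..n. real n powr d * (1 / real j))"
 proof (rule sum_mono)
  fix j assume j: "j \<in> {1..n}"
  have "real j powr - (1 - d) = real j powr d * (1 / j)" using j by (simp add: powr_diff)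
  also have "... \<le> real n powr d * (1 / j)" using j assms by (intro mult_right_mono powr_mono2) auto
  finally show "real j powr - (1 - d) \<le> real n powr d * (1 / j)" .
 qed
 also have "... = real n powr d * (\<Sum>j=1..n. 1 / real j)" by (rule sum_distrib_left[symmetric])
 also have "... \<le> real n powr d * (real n powr d / d)"
 proof (intro mult_left_mono)
  have "1 + d * ln n \<le> exp (d * ln n)" by (rule exp_ge_add_one_self)
  also have "... = real n powr d" using assms by (simp add: powr_def)
  finally have "(1 + d * ln n) / d \<le> real n powr d / d" by (rule divide_right_mono) (use assms in simp)
  then have "1 / d + ln n \<le> real n powr d / d" using assms by (simp add: add_divide_distrib)
  moreover have "1 \<le> 1 / d" using assms by simp
  ultimately show "(\<Sum>j=1..n. 1 / real j) \<le> real n powr d / d" using sum_inverse_le[OF assms(3)] by linarith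
 qed simp
 also have "... = real n powr (2 * d) / d" using powr_add[of "real n" d d] by simp
 finally show ?thesis .
qed

lemma con_last: "con U S x z ==> z = x \<or> (\<exists>y. {y, z} \<in> S)"
 by (induction rule: con_induct) auto

context hgraph
begin

text \<open>If there are \<open>n\<close> hits, then together they climb by a further
  \<open>r = ln n / k\<close> with probability at least \<open>c\<close>, through edges above
  \<open>L\<close> that are independent of the hits. Hence the vertex \<open>y\<close> below
  \<open>x\<close> climbs to \<open>L + r\<close>, which is at most of order
  \<open>exp (- b * (L + r - h y))\<close>. The relation between \<open>b\<close> and
  \<open>k\<close> converts the additional height into the power of \<open>n\<close>.\<close>

lemma hit_tail:
 assumes p: "0 < p" "p \<le> 1" and s: "subcr p" and d: "0 < d" "d < 1"
 obtains C where "0 \<le> C" "\<And>x a L F n. x \<in> V ==> a \<le> h x ==> h x < L ==> finite F ==> F \<subseteq> E ==> 1 \<le> n ==>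
  pexp p F (\<lambda>S. of_bool (n \<le> card (hits a L x S))) \<le> C * exp (C * (h x - a)) * exp (- (1 - d) * (L - h x)) * real n powr - (1 - d)"
proof -
 have p0: "0 \<le> p" using p by simp
 obtain b k where bk: "1 - d \<le> b" "(1 - d) * k \<le> b" "0 < k" "decay p b" and
  ex: "\<exists>c>0. \<forall>r\<ge>0. \<forall>W. finite W \<longrightarrow> W \<subseteq> V \<longrightarrow> exp (k * r) \<le> card W \<longrightarrow>
  (\<exists>F. finite F \<and> F \<subseteq> E \<and> (\<forall>e\<in>F. \<exists>w\<in>W. \<forall>v\<in>e. h w \<le> h v) \<and> c \<le> pexp p F (\<lambda>S. of_bool (\<exists>w\<in>W. UpTo w r S)))"
  by (rule exponents[OF p s d])
 from ex obtain c where c: "0 < c" and sp: "\<forall>r\<ge>0. \<forall>W. finite W \<longrightarrow> W \<subseteq> V \<longrightarrow> exp (k * r) \<le> card W \<longrightarrow>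
  (\<exists>F. finite F \<and> F \<subseteq> E \<and> (\<forall>e\<in>F. \<exists>w\<in>W. \<forall>v\<in>e. h w \<le> h v) \<and> c \<le> pexp p F (\<lambda>S. of_bool (\<exists>w\<in>W. UpTo w r S)))"
  by (elim exE conjE)
 obtain C1 where "\<forall>x\<in>Orb. \<forall>t\<ge>0. \<forall>F. finite F \<longrightarrow> F \<subseteq> E \<longrightarrow> pexp p F (\<lambda>S. of_bool (UpTo x t S)) \<le> C1 * exp (- b * t)"
  using bk(4) unfolding decay_def by (elim exE)
 note C1 = this[rule_format]
 have C10: "0 \<le> C1"
 proof -
  have "0 \<le> pexp p {} (\<lambda>S. of_bool (UpTo rt 0 S))" by (rule pexp_nonneg[OF p0 p(2)]) simp
  also have "... \<le> C1 * exp (- b * 0)" by (rule C1[OF orb_self[OF rt_V]]) auto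
  finally show ?thesis by simp
 qed
 obtain C2 where C2: "0 \<le> C2" and lp: "\<And>x a. x \<in> V ==> a \<le> h x ==> \<exists>y\<in>Orb. \<exists>D. finite D \<and> D \<subseteq> E \<and> card D \<le> C2 * (h x - a) + C2 \<and> h y \<le> a \<and> con {v \<in> V. h y \<le> h v} D y x"
 proof (rule lowpath)
  fix C :: real assume a: "0 \<le> C" and b: "\<And>x a. x \<in> V ==> a \<le> h x ==> \<exists>y\<in>Orb. \<exists>D. finite D \<and> D \<subseteq> E \<and> card D \<le> C * (h x - a) + C \<and> h y \<le> a \<and> con {v \<in> V. h y \<le> h v} D y x"
  show thesis by (rule that[OF a]) (rule b)
 qed
 define l where "l = ln (1 / p)"
 have l: "0 \<le> l" unfolding l_def using p by simp
 define C where "C = max (C2 * l) (C1 / c * exp (C2 * l))"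
 have C: "0 \<le> C" "C2 * l \<le> C" "C1 / c * exp (C2 * l) \<le> C" unfolding C_def using C2 l by (auto simp: le_max_iff_disj)
 show thesis
 proof (rule that[OF C(1)])
  fix x a L F and n :: nat
  assume x: "x \<in> V" "a \<le> h x" "h x < L" and F: "finite F" "F \<subseteq> E" and n: "1 \<le> n"
  define r where "r = ln n / k"
  have r: "0 \<le> r" "exp (k * r) = n" unfolding r_def using bk(3) n by auto
  define Zs where "Zs = {z \<in> \<Union>F. L \<le> h z}"
  have "finite (\<Union>F)" using F finite_edge by auto
  then have Zs: "finite Zs" "Zs \<subseteq> V" unfolding Zs_def using F edge_sub finite_subset[of "{z \<in> \<Union>F. L \<le> h z}" "\<Union>F"] by auto
  have "\<forall>W\<in>{W \<in> Pow Zs. n \<le> card W}. \<exists>F. finite F \<and> F \<subseteq> E \<and> (\<forall>e\<in>F. \<exists>w\<in>W. \<forall>v\<in>e. h w \<le> h v) \<and> c \<le> pexp p F (\<lambda>S. of_bool (\<exists>w\<in>W. UpTo w r S))"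
  proof
   fix W assume W: "W \<in> {W \<in> Pow Zs. n \<le> card W}"
   then have "finite W" "W \<subseteq> V" "exp (k * r) \<le> card W" using Zs r finite_subset[of W Zs] by auto
   then show "\<exists>F. finite F \<and> F \<subseteq> E \<and> (\<forall>e\<in>F. \<exists>w\<in>W. \<forall>v\<in>e. h w \<le> h v) \<and> c \<le> pexp p F (\<lambda>S. of_bool (\<exists>w\<in>W. UpTo w r S))"
    by (rule sp[rule_format, OF r(1)])
  qed
  then obtain FW where FW: "\<forall>W\<in>{W \<in> Pow Zs. n \<le> card W}. finite (FW W) \<and> FW W \<subseteq> E \<and> (\<forall>e\<in>FW W. \<exists>w\<in>W. \<forall>v\<in>e. h w \<le> h v) \<and> c \<le> pexp p (FW W) (\<lambda>S. of_bool (\<exists>w\<in>W. UpTo w r S))"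
   by (rule bchoice[THEN exE])
  \<comment> \<open>The set of hits is random, so the edges for all its possible values
    \<open>W\<close> are pooled; all of them lie at or above \<open>L\<close>.\<close>
  define G where "G = (\<Union>W\<in>{W \<in> Pow Zs. n \<le> card W}. FW W)"
  define Fl where "Fl = {e \<in> F. \<exists>v\<in>e. h v < L}"
  have G: "finite G" "G \<subseteq> E" unfolding G_def using FW Zs by auto
  have Fl: "finite Fl" "Fl \<subseteq> E" "Fl \<subseteq> F" unfolding Fl_def using F by auto
  have "L \<le> h v" if eG: "e \<in> G" and ve: "v \<in> e" for e v
  proof -
   obtain W where W: "W \<in> Pow Zs" "n \<le> card W" "e \<in> FW W" using eG unfolding G_def by auto
   then have "\<exists>w\<in>W. \<forall>v\<in>e. h w \<le> h v" using FW by auto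
   then obtain w where "w \<in> W" "h w \<le> h v" using ve by auto
   then show ?thesis using W(1) unfolding Zs_def by auto
  qed
  then have disj: "Fl \<inter> G = {}" unfolding Fl_def by fastforce
  let ?R = "\<lambda>S. \<exists>z. L + r \<le> h z \<and> con {v \<in> V. a \<le> h v} S x z"
  have rev: "c * pexp p Fl (\<lambda>S. of_bool (n \<le> card (hits a L x S))) \<le> pexp p (Fl \<union> G) (\<lambda>S. of_bool (?R S))"
  proof (rule pexp_reveal[OF p0 p(2) Fl(1) G(1) disj])
   fix S assume S: "S \<subseteq> Fl" "n \<le> card (hits a L x S)"
   define W where "W = hits a L x S"
   have W: "W \<subseteq> Zs" using hits_sub[OF x(3), of a S] S Fl(3) unfolding W_def Zs_def hits_def by blast
   then have Wi: "W \<in> {W \<in> Pow Zs. n \<le> card W}" using S unfolding W_def by simp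
   have "c \<le> pexp p (FW W) (\<lambda>T. of_bool (\<exists>w\<in>W. UpTo w r T))" using FW Wi by blast
   also have "... \<le> pexp p G (\<lambda>T. of_bool (\<exists>w\<in>W. UpTo w r T))"
   proof (rule pexp_mono_set[OF p0 p(2) G(1)])
    show "FW W \<subseteq> G" unfolding G_def using Wi by (rule UN_upper)
    fix S T :: "'a set set" assume ST: "S \<subseteq> T"
    show "of_bool (\<exists>w\<in>W. UpTo w r S) \<le> (of_bool (\<exists>w\<in>W. UpTo w r T) :: real)"
     by (rule of_bool_mono) (elim bexE, rule bexI, rule UpTo_mono[OF _ ST])
   qed
   also have "... \<le> pexp p G (\<lambda>T. of_bool (?R (S \<union> T)))"
   proof (rule pexp_mono[OF p0 p(2)], rule of_bool_mono)
    fix T assume "\<exists>w\<in>W. UpTo w r T"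
    then obtain w z where w: "w \<in> W" "h w + r \<le> h z" "con {v \<in> V. h w \<le> h v} T w z" unfolding UpTo_def by blast
    have w2: "L \<le> h w" "con (insert w (band a L)) S x w" "w \<in> V" using w(1) W Zs unfolding W_def hits_def by auto
    have "con {v \<in> V. a \<le> h v} (S \<union> T) x w" by (rule con_mono[OF w2(2)]) (use w2 x in \<open>auto simp: band_def\<close>)
    moreover have "con {v \<in> V. a \<le> h v} (S \<union> T) w z" by (rule con_mono[OF w(3)]) (use w2 x in auto)
    ultimately have "con {v \<in> V. a \<le> h v} (S \<union> T) x z" by (rule con_trans)
    moreover have "L + r \<le> h z" using w(2) w2(1) by linarith
    ultimately show "?R (S \<union> T)" by blast
   qed
   finally show "c \<le> pexp p G (\<lambda>T. of_bool (?R (S \<union> T)))" .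
  qed
  obtain y D where y: "y \<in> Orb" "finite D" "D \<subseteq> E" "card D \<le> C2 * (h x - a) + C2" "h y \<le> a" "con {v \<in> V. h y \<le> h v} D y x"
   using lp[OF x(1,2)] by blast
  \<comment> \<open>\<open>D\<close> may overlap the other edges; it is opened by positive
    correlation instead of independence.\<close>
  let ?H = "Fl \<union> G \<union> D"
  have H: "finite ?H" "?H \<subseteq> E" using Fl G y by auto
  have Rm: "of_bool (?R S) \<le> (of_bool (?R T) :: real)" if ST: "S \<subseteq> T" for S T
   by (rule of_bool_mono) (elim exE conjE, intro exI conjI, assumption, erule con_mono[OF _ order_refl ST])
  have "p ^ card D * pexp p (Fl \<union> G) (\<lambda>S. of_bool (?R S)) \<le> p ^ card D * pexp p ?H (\<lambda>S. of_bool (?R S))"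
   by (intro mult_left_mono pexp_mono_set[OF p0 p(2) H(1)] Rm) (use p in auto)
  also have "... \<le> pexp p ?H (\<lambda>S. of_bool (D \<subseteq> S) * of_bool (?R S))"
   by (intro pexp_forced[OF p0 p(2) H(1)] Rm) auto
  also have "... \<le> pexp p ?H (\<lambda>S. of_bool (UpTo y (L + r - h y) S))"
  proof (rule pexp_mono[OF p0 p(2)])
   fix S
   have "UpTo y (L + r - h y) S" if S: "D \<subseteq> S" "?R S"
   proof -
    obtain z where z: "L + r \<le> h z" "con {v \<in> V. a \<le> h v} S x z" using S(2) by blast
    have "con {v \<in> V. h y \<le> h v} S y x" by (rule con_mono[OF y(6)]) (use S in auto)
    moreover have "con {v \<in> V. h y \<le> h v} S x z" by (rule con_mono[OF z(2)]) (use y(5) in auto)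
    ultimately have "con {v \<in> V. h y \<le> h v} S y z" by (rule con_trans)
    then show ?thesis unfolding UpTo_def using z(1) by (intro exI[of _ z]) auto
   qed
   then show "of_bool (D \<subseteq> S) * of_bool (?R S) \<le> (of_bool (UpTo y (L + r - h y) S) :: real)" by (cases "D \<subseteq> S"; cases "?R S") auto
  qed
  also have "... \<le> C1 * exp (- b * (L + r - h y))" by (rule C1[OF y(1) _ H]) (use y(5) x r in linarith)
  also have "... \<le> C1 * (exp (- (1 - d) * (L - h x)) * real n powr - (1 - d))"
  proof (intro mult_left_mono C10)
   have "exp (- b * (L + r - h y)) \<le> exp (- b * (L - h x) + - b * r)"
   proof -
    have "b * (L - h x + r) \<le> b * (L + r - h y)" using bk(1) d y(5) x(2) by (intro mult_left_mono) auto
    then show ?thesis by (simp add: algebra_simps)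
   qed
   also have "... = exp (- b * (L - h x)) * exp (- b * r)" by (rule exp_add)
   also have "... \<le> exp (- (1 - d) * (L - h x)) * real n powr - (1 - d)"
   proof (rule mult_mono)
    have "- b * (L - h x) \<le> - (1 - d) * (L - h x)" using x bk(1) by (intro mult_right_mono) auto
    then show "exp (- b * (L - h x)) \<le> exp (- (1 - d) * (L - h x))" by (simp only: exp_le_cancel_iff)
    have "(1 - d) * k * r \<le> b * r" using r bk(2) by (intro mult_right_mono) auto
    moreover have "k * r = ln n" unfolding r_def using bk(3) by simp
    ultimately have "(1 - d) * ln n \<le> b * r" by (simp add: mult.assoc)
    then have "- b * r \<le> - (1 - d) * ln n" by (simp only: mult_minus_left neg_le_iff_le)
    then have "exp (- b * r) \<le> exp (- (1 - d) * ln n)" by (simp only: exp_le_cancel_iff)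
    also have "... = real n powr - (1 - d)" using n by (simp add: powr_def)
    finally show "exp (- b * r) \<le> real n powr - (1 - d)" .
   qed auto
   finally show "exp (- b * (L + r - h y)) \<le> exp (- (1 - d) * (L - h x)) * real n powr - (1 - d)" .
  qed
  finally have up: "p ^ card D * pexp p (Fl \<union> G) (\<lambda>S. of_bool (?R S)) \<le> C1 * (exp (- (1 - d) * (L - h x)) * real n powr - (1 - d))" .
  have pD: "exp (- (l * (C2 * (h x - a) + C2))) \<le> p ^ card D"
  proof -
   have "l * card D \<le> l * (C2 * (h x - a) + C2)" using y(4) l by (intro mult_left_mono) auto
   then have "exp (- (l * (C2 * (h x - a) + C2))) \<le> exp (card D * - l)" by (simp add: mult.commute)
   also have "... = exp (- l) ^ card D" by (rule exp_of_nat_mult)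
   also have "exp (- l) = p" unfolding l_def using p by (simp add: ln_div)
   finally show ?thesis .
  qed
  let ?P = "pexp p F (\<lambda>S. of_bool (n \<le> card (hits a L x S)))" and ?Q = "exp (- (1 - d) * (L - h x)) * real n powr - (1 - d)"
  have eq: "?P = pexp p Fl (\<lambda>S. of_bool (n \<le> card (hits a L x S)))"
  proof (rule pexp_superset[OF F(1) Fl(3)])
   fix S assume "S \<subseteq> F"
   then have "{e \<in> S. \<exists>v\<in>e. h v < L} = S \<inter> Fl" "S \<subseteq> E" unfolding Fl_def using F by auto
   then show "of_bool (n \<le> card (hits a L x S)) = of_bool (n \<le> card (hits a L x (S \<inter> Fl)))" using hits_lo[of S a L x] by simp
  qed
  have P0: "0 \<le> ?P" by (rule pexp_nonneg[OF p0 p(2)]) simp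
  have "exp (- (l * (C2 * (h x - a) + C2))) * (c * ?P) \<le> p ^ card D * (c * ?P)"
   by (rule mult_right_mono[OF pD]) (use c P0 in simp)
  also have "... \<le> p ^ card D * pexp p (Fl \<union> G) (\<lambda>S. of_bool (?R S))" using rev p unfolding eq by (intro mult_left_mono) auto
  also have "... \<le> C1 * ?Q" by (rule up)
  finally have le: "exp (- (l * (C2 * (h x - a) + C2))) * (c * ?P) \<le> C1 * ?Q" .
  define Y where "Y = exp (C2 * l) * exp (C2 * l * (h x - a))"
  have Y: "Y * exp (- (l * (C2 * (h x - a) + C2))) = 1" "0 \<le> Y" unfolding Y_def by (simp_all add: algebra_simps flip: exp_add)
  have "c * ?P = Y * (exp (- (l * (C2 * (h x - a) + C2))) * (c * ?P))" using Y(1) by (simp add: mult.assoc[symmetric])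
  also have "... \<le> Y * (C1 * ?Q)" by (rule mult_left_mono[OF le Y(2)])
  finally have "?P \<le> Y * (C1 * ?Q) / c" using c by (simp add: pos_le_divide_eq mult.commute)
  also have "... = C1 / c * exp (C2 * l) * exp (C2 * l * (h x - a)) * ?Q" unfolding Y_def by simp
  finally have "?P \<le> C1 / c * exp (C2 * l) * exp (C2 * l * (h x - a)) * ?Q" .
  also have "... \<le> C * exp (C * (h x - a)) * ?Q"
   using C x by (intro mult_right_mono mult_mono) (auto intro!: mult_right_mono)
  finally show "?P \<le> C * exp (C * (h x - a)) * exp (- (1 - d) * (L - h x)) * real n powr - (1 - d)" by (simp add: mult.assoc)
 qed
qed

definition hitU :: "'a set \<Rightarrow> real \<Rightarrow> 'a \<Rightarrow> 'a set set \<Rightarrow> 'a set" where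
 "hitU U L x S = {z. L \<le> h z \<and> con (insert z U) S x z}"

lemma hitU_sub: assumes "h x < L" shows "hitU U L x S \<subseteq> \<Union>S"
proof
 fix z assume "z \<in> hitU U L x S"
 then have z: "L \<le> h z" "con (insert z U) S x z" unfolding hitU_def by auto
 have "z = x \<or> (\<exists>y. {y, z} \<in> S)" by (rule con_last[OF z(2)])
 then show "z \<in> \<Union>S" using z(1) assms by auto
qed

lemma finite_Union_edges: "finite F ==> F \<subseteq> E ==> finite (\<Union>F)" using finite_edge by auto

text \<open>Each vertex reached from \<open>x\<close> is prolonged upwards to the level \<open>L\<close> at bounded cost.\<close>

lemma force_up:
 assumes p: "0 \<le> p" "p \<le> 1" and F: "finite F" "F \<subseteq> E" and A: "finite A" "A \<subseteq> V" and x: "h x < L"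
  and j: "\<And>v. v \<in> A ==> \<exists>j\<le>J. L \<le> h ((up ^^ j) v) \<and> (\<forall>i<j. (up ^^ i) v \<in> U) \<and> UP j v \<subseteq> F"
 shows "p ^ J * (\<Sum>v\<in>A. cp p F U x v) \<le> real (Suc deg ^ J) * pexp p F (\<lambda>S. real (card (hitU U L x S)))"
proof -
 obtain jj where "\<forall>v\<in>A. jj v \<le> J \<and> L \<le> h ((up ^^ jj v) v) \<and> (\<forall>i<jj v. (up ^^ i) v \<in> U) \<and> UP (jj v) v \<subseteq> F"
  using bchoice[of A "\<lambda>v j. j \<le> J \<and> L \<le> h ((up ^^ j) v) \<and> (\<forall>i<j. (up ^^ i) v \<in> U) \<and> UP j v \<subseteq> F"] j by metis
 note jj = this[rule_format]
 define zz where "zz v = (up ^^ jj v) v" for v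
 have one: "p ^ J * cp p F U x v \<le> pexp p F (\<lambda>S. of_bool (zz v \<in> hitU U L x S))" if v: "v \<in> A" for v
 proof -
  let ?D = "UP (jj v) v"
  have vV: "v \<in> V" using v A by auto
  have "p ^ J \<le> p ^ card ?D" using p jj[OF v] card_UP[of "jj v" v] by (intro power_decreasing) auto
  then have "p ^ J * cp p F U x v \<le> p ^ card ?D * cp p F U x v" by (intro mult_right_mono cp_nonneg p) 
  also have "... \<le> pexp p F (\<lambda>S. of_bool (?D \<subseteq> S) * of_bool (con U S x v))" unfolding cp_def
  proof (rule pexp_forced[OF p F(1)])
   show "?D \<subseteq> F" using jj[OF v] by simp
   fix S T :: "'a set set" assume ST: "S \<subseteq> T"
   show "of_bool (con U S x v) \<le> (of_bool (con U T x v) :: real)" by (rule of_bool_mono) (erule con_mono[OF _ order_refl ST])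
  qed simp
  also have "... \<le> pexp p F (\<lambda>S. of_bool (zz v \<in> hitU U L x S))"
  proof (rule pexp_mono[OF p])
   fix S
   have "zz v \<in> hitU U L x S" if S: "?D \<subseteq> S" "con U S x v"
   proof -
    have "con (insert (zz v) U) S v (zz v)" unfolding zz_def
    proof (rule con_UP[OF vV order_refl S(1)])
     fix i assume "i \<le> jj v"
     then show "(up ^^ i) v \<in> insert ((up ^^ jj v) v) U" using jj[OF v] by (cases "i = jj v") auto
    qed
    moreover have "con (insert (zz v) U) S x v" by (rule con_mono[OF S(2)]) auto
    ultimately have "con (insert (zz v) U) S x (zz v)" using con_trans[of "insert (zz v) U" S x v "zz v"] by simp
    then show ?thesis unfolding hitU_def using jj[OF v] unfolding zz_def by simp
   qed
   then show "of_bool (?D \<subseteq> S) * of_bool (con U S x v) \<le> (of_bool (zz v \<in> hitU U L x S) :: real)" by (cases "?D \<subseteq> S"; cases "con U S x v") auto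
  qed
  finally show ?thesis .
 qed
 have "p ^ J * (\<Sum>v\<in>A. cp p F U x v) \<le> (\<Sum>v\<in>A. pexp p F (\<lambda>S. of_bool (zz v \<in> hitU U L x S)))"
  unfolding sum_distrib_left by (rule sum_mono[OF one])
 also have "... = pexp p F (\<lambda>S. \<Sum>v\<in>A. of_bool (zz v \<in> hitU U L x S))" by (rule pexp_sum[symmetric])
 also have "... \<le> pexp p F (\<lambda>S. real (Suc deg ^ J) * real (card (hitU U L x S)))"
 proof (rule pexp_mono[OF p])
  fix S assume S: "S \<subseteq> F"
  let ?B = "hitU U L x S"
  have Bs: "?B \<subseteq> \<Union>S" by (rule hitU_sub[OF x])
  have "finite (\<Union>S)" using finite_Union_edges[of S] S F finite_subset[of S F] by auto
  then have B: "finite ?B" "?B \<subseteq> V" using finite_subset[OF Bs] Bs S F(2) edge_sub by blast+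
  \<comment> \<open>A hit serves only vertices within distance \<open>J\<close>.\<close>
  have c: "card {v \<in> A. zz v \<in> ?B} \<le> card ?B * Suc deg ^ J"
  proof -
  have "card {v \<in> A. zz v \<in> ?B} \<le> card (\<Union>z\<in>?B. bal J z)"
  proof (rule card_mono)
   show "finite (\<Union>z\<in>?B. bal J z)" using B finite_bal by auto
   show "{v \<in> A. zz v \<in> ?B} \<subseteq> (\<Union>z\<in>?B. bal J z)"
   proof
    fix v assume v: "v \<in> {v \<in> A. zz v \<in> ?B}"
    then have "zz v \<in> bal (jj v) v" using upn_bal[of v "jj v"] A unfolding zz_def by auto
    then have "v \<in> bal (jj v) (zz v)" by (rule bal_sym)
    then have "v \<in> bal J (zz v)" using bal_mono[of "jj v" J "zz v"] jj v by auto
    then show "v \<in> (\<Union>z\<in>?B. bal J z)" using v by auto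
   qed
  qed
  also have "card (\<Union>z\<in>?B. bal J z) \<le> (\<Sum>z\<in>?B. card (bal J z))" by (rule card_UN_le[OF B(1)])
  also have "... \<le> (\<Sum>z\<in>?B. Suc deg ^ J)" using card_bal B(2) by (intro sum_mono) auto
  finally show ?thesis by simp
  qed
  have "(\<Sum>v\<in>A. of_bool (zz v \<in> ?B)) = real (card {v \<in> A. zz v \<in> ?B})" using A(1) by (simp add: Int_def)
  also have "... \<le> real (card ?B * Suc deg ^ J)" by (rule of_nat_mono[OF c])
  also have "... = real (Suc deg ^ J) * real (card ?B)" by (simp only: of_nat_mult mult.commute)
  finally show "(\<Sum>v\<in>A. of_bool (zz v \<in> ?B)) \<le> real (Suc deg ^ J) * real (card ?B)" .
 qed
 also have "... = real (Suc deg ^ J) * pexp p F (\<lambda>S. real (card (hitU U L x S)))" by (rule pexp_cmult)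
 finally show ?thesis .
qed

end

lemma ln_le_exp: "0 < x ==> ln x \<le> y \<longleftrightarrow> x \<le> exp (y::real)"
 by (metis exp_le_cancel_iff exp_ln)

text \<open>The bootstrap after taking logarithms: \<open>k\<close> stands for the susceptibility
  and \<open>m\<close> for the truncation point, so that one third of \<open>k\<close> returns on
  the right.\<close>

lemma bootstrap_arith:
 fixes k :: real
 assumes "k \<le> u + l + a + 1 / 6 * m" "m \<le> c + 2 * k + u" "l \<le> a1" "a \<le> a1" "c \<le> c'" "0 \<le> a1" "0 \<le> u" "0 \<le> c'"
 shows "k \<le> 3 * (2 * u + 2 * a1 + c')"
proof -
 have "1 / 6 * m \<le> 1 / 6 * (c + 2 * k + u)" using assms(2) by (rule mult_left_mono) simp
 then have "6 * k \<le> 6 * u + 6 * a1 + 6 * a1 + (c' + 2 * k + u)" using assms by simp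
 then show ?thesis using assms by simp
qed

section \<open>Moments of the number of hits and the bootstrap for the slab\<close>

context hgraph
begin

lemma finite_hitU: assumes "h x < L" "finite S" "S \<subseteq> E" shows "finite (hitU U L x S)"
 by (rule finite_subset[OF hitU_sub[OF assms(1)] finite_Union_edges[OF assms(2,3)]])

text \<open>Each hit is a neighbour of a vertex of \<open>B\<close> joined to \<open>x\<close>,
  whence the factor \<open>deg\<close> for each of the two hits. The three legs of the tree-graph
  inequality are each summed to at most \<open>K\<close>.\<close>

lemma hit_moment:
 assumes p: "0 \<le> p" "p \<le> 1" and F: "finite F" "F \<subseteq> E" and B: "finite B" "B \<subseteq> V" "\<And>v. v \<in> B ==> h v < L" and x: "x \<in> B"
  and K: "\<And>y. y \<in> B ==> (\<Sum>v\<in>B. cp p F B y v) \<le> K"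
 shows "pexp p F (\<lambda>S. (real (card (hitU B L x S)))\<^sup>2) \<le> (real deg)\<^sup>2 * K ^ 3"
proof -
 define Y where "Y S = (\<Sum>v\<in>B. of_bool (con B S x v) :: real)" for S
 have nn: "0 \<le> cp p F B u v" for u v by (rule cp_nonneg[OF p])
 have K0: "0 \<le> K" using K[OF x] sum_nonneg[of B "cp p F B x"] nn by fastforce
 have le: "real (card (hitU B L x S)) \<le> real deg * Y S" if S: "S \<subseteq> F" for S
 proof -
  have SE: "S \<subseteq> E" using S F by auto
  let ?C = "{v \<in> B. con B S x v}"
  have sub: "hitU B L x S \<subseteq> (\<Union>v\<in>?C. nb v)"
  proof
   fix z assume "z \<in> hitU B L x S"
   then have z: "L \<le> h z" "con (insert z B) S x z" unfolding hitU_def by auto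
   have "con B S x y \<or> (\<exists>v\<in>?C. z \<in> nb v)" if y: "con (insert z B) S x y" for y
    using y
   proof (induction rule: con_induct)
    case refl
    show ?case using x by simp
   next
    case (step u v)
    show ?case
    proof (cases "\<exists>v\<in>?C. z \<in> nb v")
     case False
     then have u: "con B S x u" using step(4) by simp
     then have uB: "u \<in> B" by (rule con_in(2))
     have "v \<noteq> z"
     proof
      assume "v = z"
      then have "z \<in> nb u" using step(3) SE unfolding nb_def by auto
      then show False using False u uB by auto
     qed
     then have "v \<in> B" using step(2) by simp
     then have "con B S x v" by (rule con_step[OF u _ step(3)])
     then show ?thesis by simp
    qed simp
   qed
   from this[OF z(2)] have "con B S x z \<or> (\<exists>v\<in>?C. z \<in> nb v)" .
   moreover have "\<not> con B S x z" using con_in(2)[of B S x z] B(3)[of z] z(1) by auto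
   ultimately show "z \<in> (\<Union>v\<in>?C. nb v)" by auto
  qed
  have fC: "finite ?C" "?C \<subseteq> V" using B by auto
  have "card (hitU B L x S) \<le> card (\<Union>v\<in>?C. nb v)"
   by (rule card_mono[OF _ sub]) (use fC finite_nb in auto)
  also have "... \<le> (\<Sum>v\<in>?C. card (nb v))" by (rule card_UN_le[OF fC(1)])
  also have "... \<le> (\<Sum>v\<in>?C. deg)" using degree fC by (intro sum_mono) auto
  also have "... = deg * card ?C" by simp
  finally have "real (card (hitU B L x S)) \<le> real deg * real (card ?C)" by (simp flip: of_nat_mult)
  also have "real (card ?C) = Y S" unfolding Y_def using B(1) by (simp add: Int_def)
  finally show ?thesis .
 qed
 have "pexp p F (\<lambda>S. (real (card (hitU B L x S)))\<^sup>2) \<le> pexp p F (\<lambda>S. (real deg)\<^sup>2 * (Y S)\<^sup>2)"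
 proof (rule pexp_mono[OF p])
  fix S assume "S \<subseteq> F"
  from power_mono[OF le[OF this], of 2] show "(real (card (hitU B L x S)))\<^sup>2 \<le> (real deg)\<^sup>2 * (Y S)\<^sup>2" by (simp add: power_mult_distrib)
 qed
 also have "... = (real deg)\<^sup>2 * pexp p F (\<lambda>S. (Y S)\<^sup>2)" by (rule pexp_cmult)
 also have "... \<le> (real deg)\<^sup>2 * K ^ 3"
 proof (rule mult_left_mono)
  have "pexp p F (\<lambda>S. (Y S)\<^sup>2) = pexp p F (\<lambda>S. \<Sum>v\<in>B. \<Sum>v'\<in>B. of_bool (con B S x v \<and> con B S x v'))"
  proof (rule pexp_cong)
   fix S
   have "(Y S)\<^sup>2 = (\<Sum>v\<in>B. \<Sum>v'\<in>B. of_bool (con B S x v) * of_bool (con B S x v'))"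
    unfolding Y_def power2_eq_square by (rule sum_product)
   also have "... = (\<Sum>v\<in>B. \<Sum>v'\<in>B. of_bool (con B S x v \<and> con B S x v'))"
    by (rule sum.cong[OF refl], rule sum.cong[OF refl]) (simp only: of_bool_conj)
   finally show "(Y S)\<^sup>2 = (\<Sum>v\<in>B. \<Sum>v'\<in>B. of_bool (con B S x v \<and> con B S x v'))" .
  qed
  also have "... = (\<Sum>v\<in>B. \<Sum>v'\<in>B. pexp p F (\<lambda>S. of_bool (con B S x v \<and> con B S x v')))"
   unfolding pexp_sum ..
  also have "... \<le> (\<Sum>v\<in>B. \<Sum>v'\<in>B. \<Sum>w\<in>B. cp p F B x w * (cp p F B w v * cp p F B v' w))"
   by (rule sum_mono, rule sum_mono, rule cp_tree[OF F(1) p B(1)]) (simp add: spath_def)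
  also have "... = (\<Sum>v\<in>B. \<Sum>w\<in>B. \<Sum>v'\<in>B. cp p F B x w * (cp p F B w v * cp p F B v' w))"
   by (rule sum.cong[OF refl], rule sum.swap)
  also have "... = (\<Sum>w\<in>B. \<Sum>v\<in>B. \<Sum>v'\<in>B. cp p F B x w * (cp p F B w v * cp p F B w v'))"
   by (subst sum.swap) (simp only: cp_sym[of p F B _ "_::'a"])
  also have "... = (\<Sum>w\<in>B. cp p F B x w * ((\<Sum>v\<in>B. cp p F B w v) * (\<Sum>v'\<in>B. cp p F B w v')))"
   by (rule sum.cong[OF refl]) (simp only: sum_product, simp only: sum_distrib_left)
  also have "... \<le> (\<Sum>w\<in>B. cp p F B x w * (K * K))"
   by (intro sum_mono mult_left_mono mult_mono K nn sum_nonneg K0)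
  also have "... = (\<Sum>w\<in>B. cp p F B x w) * (K * K)" by (rule sum_distrib_right[symmetric])
  also have "... \<le> K * (K * K)" by (rule mult_right_mono[OF K[OF x]]) (use K0 in simp)
  finally show "pexp p F (\<lambda>S. (Y S)\<^sup>2) \<le> K ^ 3" by (simp add: power3_eq_cube mult.assoc)
 qed simp
 finally show ?thesis .
qed

lemma truncate:
 fixes N n :: nat assumes "1 \<le> n" shows "real N \<le> (\<Sum>j=1..n. of_bool (j \<le> N)) + (real N)\<^sup>2 / n"
proof -
 have "(\<Sum>j=1..n. of_bool (j \<le> N)) = real (card {j \<in> {1..n}. j \<le> N})" by (simp add: Int_def)
 also have "{j \<in> {1..n}. j \<le> N} = {1..min n N}" by auto
 finally have s: "(\<Sum>j=1..n. of_bool (j \<le> N)) = real (min n N)" by simp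
 show ?thesis
 proof (cases "N \<le> n")
  case True
  then show ?thesis unfolding s by simp
 next
  case False
  then have "real n * real N \<le> real N * real N" by (intro mult_right_mono) auto
  then have "real N \<le> (real N)\<^sup>2 / n" using assms by (simp add: field_simps power2_eq_square)
  then show ?thesis unfolding s by simp
 qed
qed

lemma hitU_band: assumes "B \<subseteq> band a L" shows "hitU B L x S \<subseteq> hits a L x S"
proof
 fix z assume z: "z \<in> hitU B L x S"
 have "con (insert z (band a L)) S x z" by (rule con_mono[of "insert z B"]) (use z assms in \<open>auto simp: hitU_def\<close>)
 then show "z \<in> hits a L x S" using z unfolding hitU_def hits_def by simp
qed

text \<open>The truncated first moment is controlled by the tail bound, the excess by the second moment.\<close>

lemma hit_mean:
 assumes p: "0 < p" "p \<le> 1" and s: "subcr p" and d: "0 < d" "d < 1"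
 obtains C where "0 \<le> C" "\<And>x a L F B n K. x \<in> B ==> finite B ==> B \<subseteq> band a L ==> finite F ==> F \<subseteq> E ==> 1 \<le> n ==>
  (\<And>y. y \<in> B ==> (\<Sum>v\<in>B. cp p F B y v) \<le> K) ==>
  pexp p F (\<lambda>S. real (card (hitU B L x S))) \<le> C * exp (C * (h x - a)) * exp (- (1 - d) * (L - h x)) * real n powr (2 * d) + (real deg)\<^sup>2 * K ^ 3 / n"
proof (rule hit_tail[OF p s d])
 fix C assume C: "0 \<le> C" and ht: "\<And>x a L F n. x \<in> V ==> a \<le> h x ==> h x < L ==> finite F ==> F \<subseteq> E ==> 1 \<le> n ==>
  pexp p F (\<lambda>S. of_bool (n \<le> card (hits a L x S))) \<le> C * exp (C * (h x - a)) * exp (- (1 - d) * (L - h x)) * real n powr - (1 - d)"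
 have p0: "0 \<le> p" using p by simp
 have Cd: "C \<le> C / d" using C d by (simp add: field_simps mult_left_le)
 show thesis
 proof (rule that[of "C / d"])
  show "0 \<le> C / d" using C d by simp
  fix x a L F B and n :: nat and K
  assume x: "x \<in> B" and B: "finite B" "B \<subseteq> band a L" and F: "finite F" "F \<subseteq> E" and n: "1 \<le> n"
   and K: "\<And>y. y \<in> B ==> (\<Sum>v\<in>B. cp p F B y v) \<le> K"
  have xV: "x \<in> V" "a \<le> h x" "h x < L" using x B(2) unfolding band_def by auto
  define Z where "Z = C * exp (C * (h x - a)) * exp (- (1 - d) * (L - h x))"
  have Z: "0 \<le> Z" unfolding Z_def using C by simp
  let ?N = "\<lambda>S. card (hitU B L x S)"
  have tail: "pexp p F (\<lambda>S. of_bool (j \<le> ?N S)) \<le> Z * real j powr - (1 - d)" if j: "1 \<le> j" for j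
  proof -
   have "pexp p F (\<lambda>S. of_bool (j \<le> ?N S)) \<le> pexp p F (\<lambda>S. of_bool (j \<le> card (hits a L x S)))"
   proof (rule pexp_mono[OF p0 p(2)], rule of_bool_mono)
    fix S assume S: "S \<subseteq> F" "j \<le> ?N S"
    have "finite S" "S \<subseteq> E" using S F finite_subset by auto
    then have "finite (hits a L x S)" using finite_subset[OF hits_sub[OF xV(3)] finite_Union_edges] by blast
    then have "?N S \<le> card (hits a L x S)" by (rule card_mono[OF _ hitU_band[OF B(2)]])
    then show "j \<le> card (hits a L x S)" using S(2) by simp
   qed
   also have "... \<le> Z * real j powr - (1 - d)" unfolding Z_def by (rule ht[OF xV F j])
   finally show ?thesis .
  qed
  have "pexp p F (\<lambda>S. real (?N S)) \<le> pexp p F (\<lambda>S. (\<Sum>j=1..n. of_bool (j \<le> ?N S)) + (real (?N S))\<^sup>2 * (1 / n))"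
   by (rule pexp_mono[OF p0 p(2)]) (use truncate[OF n] in simp)
  also have "... = (\<Sum>j=1..n. pexp p F (\<lambda>S. of_bool (j \<le> ?N S))) + pexp p F (\<lambda>S. (real (?N S))\<^sup>2) * (1 / n)"
   unfolding pexp_add pexp_sum pexp_cmult2 ..
  also have "... \<le> (\<Sum>j=1..n. Z * real j powr - (1 - d)) + (real deg)\<^sup>2 * K ^ 3 * (1 / n)"
   by (intro add_mono sum_mono tail mult_right_mono hit_moment[OF p0 p(2) F B(1) _ _ x K]) (use B(2) in \<open>auto simp: band_def\<close>)
  also have "(\<Sum>j=1..n. Z * real j powr - (1 - d)) = Z * (\<Sum>j=1..n. real j powr - (1 - d))" by (rule sum_distrib_left[symmetric])
  also have "... \<le> Z * (real n powr (2 * d) / d)" by (intro mult_left_mono sum_powr_le d n Z)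
  also have "... = C / d * exp (C * (h x - a)) * exp (- (1 - d) * (L - h x)) * real n powr (2 * d)" unfolding Z_def by simp
  also have "... \<le> C / d * exp (C / d * (h x - a)) * exp (- (1 - d) * (L - h x)) * real n powr (2 * d)"
  proof (intro mult_right_mono mult_left_mono)
   have "C * (h x - a) \<le> C / d * (h x - a)" using xV by (intro mult_right_mono Cd) simp
   then show "exp (C * (h x - a)) \<le> exp (C / d * (h x - a))" by (simp only: exp_le_cancel_iff)
  qed (use C d in auto)
  finally show "pexp p F (\<lambda>S. real (?N S)) \<le> C / d * exp (C / d * (h x - a)) * exp (- (1 - d) * (L - h x)) * real n powr (2 * d) + (real deg)\<^sup>2 * K ^ 3 / n"
   by simp
 qed
qed

text \<open>The finite-volume condition under which \<open>force_up\<close> applies: climbing along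
  \<open>up\<close> leaves neither \<open>F\<close> nor, below level \<open>L\<close>, the set
  \<open>B\<close>.\<close>

definition closed_in :: "real \<Rightarrow> 'a set set \<Rightarrow> 'a set \<Rightarrow> bool" where
 "closed_in L F B \<longleftrightarrow> (\<forall>v\<in>B. {v, up v} \<in> F \<and> (h (up v) < L \<longrightarrow> up v \<in> B))"

lemma closed_exit:
 fixes J :: nat assumes c: "closed_in L F B" and v: "v \<in> B" "v \<in> V" and J: "L - h v \<le> J * c0"
 shows "\<exists>j\<le>J. L \<le> h ((up ^^ j) v) \<and> (\<forall>i<j. (up ^^ i) v \<in> B) \<and> UP j v \<subseteq> F"
proof -
 define j where "j = (LEAST j. L \<le> h ((up ^^ j) v))"
 have J: "L \<le> h ((up ^^ J) v)" using upn_h[OF v(2), of J] J by linarith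
 have j: "L \<le> h ((up ^^ j) v)" "j \<le> J" unfolding j_def by (rule LeastI[of "\<lambda>j. L \<le> h ((up ^^ j) v)", OF J], rule Least_le[of "\<lambda>j. L \<le> h ((up ^^ j) v)", OF J])
 have lo: "h ((up ^^ i) v) < L" if "i < j" for i using not_less_Least[of i "\<lambda>j. L \<le> h ((up ^^ j) v)"] that unfolding j_def by simp
 have B: "(up ^^ i) v \<in> B" if "i < j" for i using that
 proof (induction i)
  case (Suc i)
  then have "(up ^^ i) v \<in> B" by simp
  then show ?case using c lo[OF Suc(2)] unfolding closed_in_def by simp
 qed (use v in simp)
 have "UP j v \<subseteq> F" unfolding UP_def using B c unfolding closed_in_def by auto
 then show ?thesis using j B by blast
qed

text \<open>Let \<open>K\<close> be the largest susceptibility over \<open>B\<close>. Pushing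
  vertices to the level bounds \<open>K\<close> by \<open>exp (c1 * t)\<close> times the mean number
  of hits, and that mean is at most an exponential in \<open>t\<close> times
  \<open>n powr (1 / 6)\<close>, plus a multiple of \<open>K ^ 3 / n\<close>. With \<open>n\<close>
  of order \<open>K ^ 2\<close>, up to an exponential in \<open>t\<close>, the excess uses up half
  of \<open>K\<close> and the main term grows only like the cube root of \<open>K\<close>; so
  \<open>K\<close> is at most exponential in \<open>t\<close>.\<close>

lemma susceptibility_slab:
 assumes p: "0 < p" "p \<le> 1" and s: "subcr p"
 obtains C where "0 \<le> C" "\<And>x a L F B. x \<in> B ==> finite B ==> B \<subseteq> band a L ==> finite F ==> F \<subseteq> E ==> closed_in L F B ==>
  (\<Sum>v\<in>B. cp p F B x v) \<le> exp (C * (L - a + 1))"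
proof (rule hit_mean[OF p s, of "1 / 12"])
 fix A assume A: "0 \<le> A" and hm: "\<And>x a L F B n K. x \<in> B ==> finite B ==> B \<subseteq> band a L ==> finite F ==> F \<subseteq> E ==> 1 \<le> n ==>
  (\<And>y. y \<in> B ==> (\<Sum>v\<in>B. cp p F B y v) \<le> K) ==>
  pexp p F (\<lambda>S. real (card (hitU B L x S))) \<le> A * exp (A * (h x - a)) * exp (- (1 - 1 / 12) * (L - h x)) * real n powr (2 * (1 / 12)) + (real deg)\<^sup>2 * K ^ 3 / n"
 have p0: "0 \<le> p" using p by simp
 define m where "m = ln (Suc deg / p)"
 have m: "0 \<le> m" unfolding m_def using p by (intro ln_ge_zero) (simp add: field_simps)
 have em: "exp m = Suc deg / p" unfolding m_def using p by simp
 define A1 where "A1 = ln (2 * (A + 1)) + A"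
 have A1: "0 \<le> A1" "ln (2 * (A + 1)) \<le> A1" "A \<le> A1" unfolding A1_def using A by auto
 define c1 where "c1 = m / c0 + m"
 have c1: "0 \<le> c1" "m / c0 \<le> c1" "m \<le> c1" unfolding c1_def using m c0_pos by auto
 define c2 where "c2 = ln (4 * (1 + (real deg)\<^sup>2))"
 have c2: "0 \<le> c2" unfolding c2_def by (intro ln_ge_zero) simp
 define C where "C = 3 * (2 * c1 + 2 * A1 + c2)"
 show thesis
 proof (rule that[of C])
  show "0 \<le> C" unfolding C_def using c1 A1 c2 by simp
  fix x a L F B
  assume x: "x \<in> B" and B: "finite B" "B \<subseteq> band a L" and F: "finite F" "F \<subseteq> E" and cl: "closed_in L F B"
  have BV: "v \<in> V" "a \<le> h v" "h v < L" if "v \<in> B" for v using that B(2) unfolding band_def by auto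
  define t where "t = L - a + 1"
  have t: "1 \<le> t" using BV[OF x] unfolding t_def by simp
  define Kf where "Kf y = (\<Sum>v\<in>B. cp p F B y v)" for y
  define K where "K = Max (Kf ` B)"
  have K: "Kf y \<le> K" if "y \<in> B" for y unfolding K_def using that B(1) by simp
  have "K \<in> Kf ` B" unfolding K_def by (rule Max_in) (use B x in auto)
  then obtain y where y: "y \<in> B" "K = Kf y" by auto
  have K1: "1 \<le> K"
  proof -
   have "1 = cp p F B x x" unfolding cp_def using x F by simp
   also have "... \<le> Kf x" unfolding Kf_def by (rule member_le_sum[OF x]) (use B cp_nonneg[OF p0 p(2)] in auto)
   finally show ?thesis using K[OF x] by linarith
  qed
  define J where "J = nat \<lceil>(L - a) / c0\<rceil>"
  have J1: "L - a \<le> J * c0" unfolding J_def by (rule nat_ceiling_bounds(1)[OF c0_pos])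
  have J2: "J \<le> (L - a) / c0 + 1" unfolding J_def by (rule nat_ceiling_bounds(2)[OF c0_pos]) (use BV[OF x] in linarith)
  have mJ: "J * m \<le> c1 * t"
  proof -
   have "J * m \<le> ((L - a) / c0 + 1) * m" by (rule mult_right_mono[OF J2 m])
   also have "... = m / c0 * (L - a) + m" by (simp add: algebra_simps)
   also have "... \<le> c1 * (L - a) + c1" using c1 BV[OF x] by (intro add_mono mult_right_mono) auto
   finally show ?thesis unfolding t_def by (simp add: algebra_simps)
  qed
  let ?N = "pexp p F (\<lambda>S. real (card (hitU B L y S)))"
  have N0: "0 \<le> ?N" by (rule pexp_nonneg[OF p0 p(2)]) simp
  have KN: "K \<le> exp (c1 * t) * ?N"
  proof -
   have "p ^ J * Kf y \<le> real (Suc deg ^ J) * ?N" unfolding Kf_def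
   proof (rule force_up[OF p0 p(2) F B(1)])
    show "B \<subseteq> V" "h y < L" using BV y(1) by auto
    fix v assume v: "v \<in> B"
    show "\<exists>j\<le>J. L \<le> h ((up ^^ j) v) \<and> (\<forall>i<j. (up ^^ i) v \<in> B) \<and> UP j v \<subseteq> F"
     by (rule closed_exit[OF cl v BV(1)[OF v]]) (use J1 BV[OF v] in linarith)
   qed
   then have "K \<le> (Suc deg / p) ^ J * ?N" using p y(2) by (simp add: power_divide field_simps)
   also have "(Suc deg / p) ^ J = exp (J * m)" unfolding em[symmetric] by (rule exp_of_nat_mult[symmetric])
   also have "exp (J * m) * ?N \<le> exp (c1 * t) * ?N" using mJ N0 by (intro mult_right_mono) auto
   finally show ?thesis .
  qed
  define D where "D = 1 + (real deg)\<^sup>2"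
  have D: "1 \<le> D" "(real deg)\<^sup>2 \<le> D" unfolding D_def by auto
  \<comment> \<open>Makes the excess term equal to \<open>K / (2 * exp (c1 * t))\<close>, half of
    \<open>K\<close> after the cost of forcing.\<close>
  define w where "w = 2 * D * K\<^sup>2 * exp (c1 * t)"
  have w1: "1 \<le> w"
  proof -
   have "1 * 1 * 1 * 1 \<le> w" unfolding w_def using D K1 c1 t by (intro mult_mono) (auto intro: one_le_power)
   then show ?thesis by simp
  qed
  define n where "n = nat \<lceil>w\<rceil>"
  have n: "w \<le> n" "n \<le> 2 * w" "1 \<le> n" unfolding n_def using w1 by linarith+
  have "?N \<le> A * exp (A * (h y - a)) * exp (- (1 - 1 / 12) * (L - h y)) * real n powr (2 * (1 / 12)) + (real deg)\<^sup>2 * K ^ 3 / n"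
   by (rule hm[OF y(1) B F n(3)]) (use K in \<open>simp add: Kf_def\<close>)
  also have "... \<le> A * exp (A * t) * 1 * real n powr (1 / 6) + D * K ^ 3 / w"
   using A BV[OF y(1)] K1 n w1 D unfolding t_def by (intro add_mono mult_mono frac_le) (auto intro!: mult_left_mono)
  also have "D * K ^ 3 / w = K / (2 * exp (c1 * t))" unfolding w_def using D K1 by (simp add: field_simps power3_eq_cube power2_eq_square)
  finally have "exp (c1 * t) * ?N \<le> exp (c1 * t) * (A * exp (A * t) * real n powr (1 / 6) + K / (2 * exp (c1 * t)))"
   by (intro mult_left_mono) auto
  then have "K \<le> exp (c1 * t) * (A * exp (A * t) * real n powr (1 / 6)) + K / 2" using KN by (simp add: distrib_left)
  then have "K \<le> exp (c1 * t) * (2 * A * exp (A * t) * real n powr (1 / 6))" by simp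
  also have "... \<le> exp (c1 * t) * (2 * (A + 1) * exp (A * t) * real n powr (1 / 6))" by (intro mult_left_mono mult_right_mono) auto
  also have "... = exp (c1 * t + ln (2 * (A + 1)) + A * t + 1 / 6 * ln n)"
   using A n by (simp add: exp_add powr_def mult_ac)
  finally have "K \<le> exp (c1 * t + ln (2 * (A + 1)) + A * t + 1 / 6 * ln n)" .
  have "ln K \<le> c1 * t + ln (2 * (A + 1)) + A * t + 1 / 6 * ln n" using \<open>K \<le> exp _\<close> K1 by (simp add: ln_le_exp)
  moreover have "ln n \<le> c2 + 2 * ln K + c1 * t"
  proof -
   have "ln n \<le> ln (2 * w)" using n w1 by simp
   also have "2 * w = exp (c2 + 2 * ln K + c1 * t)"
   proof -
    have "exp (2 * ln K) = K\<^sup>2" using K1 by (simp add: exp_double)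
    moreover have "exp c2 = 4 * D" unfolding c2_def D_def by (rule exp_ln) (simp add: add_pos_nonneg)
    ultimately show ?thesis unfolding w_def exp_add by simp
   qed
   finally show ?thesis by simp
  qed
  moreover have "ln (2 * (A + 1)) \<le> A1 * t" using A1 t mult_left_mono[of 1 t A1] by simp
  moreover have "A * t \<le> A1 * t" using A1 t by (intro mult_right_mono) auto
  moreover have "c2 \<le> c2 * t" using c2 t mult_left_mono[of 1 t c2] by simp
  moreover have "0 \<le> A1 * t" "0 \<le> c1 * t" "0 \<le> c2 * t" using A1 c1 c2 t by auto
  ultimately have "ln K \<le> C * t" unfolding C_def distrib_right mult.assoc by (rule bootstrap_arith)
  then have "K \<le> exp (C * t)" using K1 by (simp add: ln_le_exp)
  then show "(\<Sum>v\<in>B. cp p F B x v) \<le> exp (C * (L - a + 1))" using K[OF x] unfolding Kf_def t_def by linarith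
 qed
qed auto

text \<open>The closure of \<open>W\<close> under climbing inside the slab; \<open>J\<close> is to
  be large enough that \<open>J\<close> steps leave it through the top.\<close>

definition ups :: "real \<Rightarrow> real \<Rightarrow> nat \<Rightarrow> 'a set \<Rightarrow> 'a set" where
 "ups a L J W = (\<Union>w\<in>W. (\<lambda>i. (up ^^ i) w) ` {..J}) \<inter> band a L"

lemma ups_facts:
 assumes W: "finite W" "W \<subseteq> band a L" "\<And>w. w \<in> W ==> L - h w \<le> J * c0"
 shows "finite (ups a L J W)" "ups a L J W \<subseteq> band a L" "W \<subseteq> ups a L J W" "closed_in L ((\<lambda>v. {v, up v}) ` ups a L J W) (ups a L J W)"
proof -
 show "finite (ups a L J W)" "ups a L J W \<subseteq> band a L" unfolding ups_def using W by auto
 show "W \<subseteq> ups a L J W"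
 proof
  fix w assume w: "w \<in> W"
  then show "w \<in> ups a L J W" using W(2) unfolding ups_def by (auto intro!: bexI[of _ w] image_eqI[of _ _ 0])
 qed
 show "closed_in L ((\<lambda>v. {v, up v}) ` ups a L J W) (ups a L J W)"
  unfolding closed_in_def
 proof (intro ballI conjI impI)
  fix v assume v: "v \<in> ups a L J W"
  then show "{v, up v} \<in> (\<lambda>v. {v, up v}) ` ups a L J W" by auto
  assume lt: "h (up v) < L"
  obtain w i where w: "w \<in> W" "i \<le> J" "v = (up ^^ i) w" "v \<in> band a L" using v unfolding ups_def by auto
  have wV: "w \<in> V" using w(1) W(2) unfolding band_def by auto
  have "\<not> J \<le> i"
  proof
   assume "J \<le> i"
   then have "J * c0 \<le> Suc i * c0" using c0_pos by (intro mult_right_mono) auto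
   then have "L \<le> h ((up ^^ Suc i) w)" using upn_h[OF wV, of "Suc i"] W(3)[OF w(1)] by linarith
   then show False using lt w(3) by simp
  qed
  moreover have "a \<le> h (up v)" "up v \<in> V" using w(4) up_h[of v] c0_pos up_V[of v] unfolding band_def by auto
  ultimately show "up v \<in> ups a L J W" using w(1,3) lt unfolding ups_def band_def by (auto intro!: bexI[of _ w] image_eqI[of _ _ "Suc i"])
 qed
qed

lemma closed_in_mono: "closed_in L F B ==> F \<subseteq> F' ==> closed_in L F' B"
 unfolding closed_in_def by auto

text \<open>A second pass through \<open>hit_mean\<close>, with the susceptibility now known to be
  at most exponential in the width. The truncation point is a larger exponential, which makes the
  excess negligible, and \<open>d\<close> is so small that its power costs only the rate
  1/8.\<close>

lemma hits_small:
 assumes p: "0 < p" "p \<le> 1" and s: "subcr p"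
 obtains C where "0 \<le> C" "\<And>x a L F. x \<in> V ==> a \<le> h x ==> h x < L ==> h x - a \<le> 2 ==> finite F ==> F \<subseteq> E ==>
  pexp p F (\<lambda>S. real (card (hits a L x S))) \<le> C * exp (- (3 / 4) * (L - a))"
proof (rule susceptibility_slab[OF p s])
 fix D assume D: "0 \<le> D" and sus: "\<And>x a L F B. x \<in> B ==> finite B ==> B \<subseteq> band a L ==> finite F ==> F \<subseteq> E ==> closed_in L F B ==>
  (\<Sum>v\<in>B. cp p F B x v) \<le> exp (D * (L - a + 1))"
 have p0: "0 \<le> p" using p by simp
 \<comment> \<open>For \<open>n\<close> near \<open>exp ((3 * D + 1) * (t + 1))\<close> the factor
   \<open>real n powr (2 * d)\<close> is of order \<open>exp (t / 8)\<close>. The main term decays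
   at rate at least 7/8, and 7/8 - 1/8 = 3/4.\<close>
 define d where "d = 1 / (16 * (3 * D + 1))"
 have d: "0 < d" "d < 1" "d \<le> 1 / 8" "2 * d * (3 * D + 1) = 1 / 8" unfolding d_def using D by (auto simp: field_simps)
 show thesis
 proof (rule hit_mean[OF p s d(1,2)])
  fix A assume A: "0 \<le> A" and hm: "\<And>x a L F B n K. x \<in> B ==> finite B ==> B \<subseteq> band a L ==> finite F ==> F \<subseteq> E ==> 1 \<le> n ==>
   (\<And>y. y \<in> B ==> (\<Sum>v\<in>B. cp p F B y v) \<le> K) ==>
   pexp p F (\<lambda>S. real (card (hitU B L x S))) \<le> A * exp (A * (h x - a)) * exp (- (1 - d) * (L - h x)) * real n powr (2 * d) + (real deg)\<^sup>2 * K ^ 3 / n"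
  define C where "C = 2 * A * exp (2 * A) * exp 2 + (real deg)\<^sup>2"
  show thesis
  proof (rule that[of C])
   show "0 \<le> C" unfolding C_def using A by simp
   fix x a L F assume x: "x \<in> V" "a \<le> h x" "h x < L" "h x - a \<le> 2" and F: "finite F" "F \<subseteq> E"
   define t where "t = L - a"
   have t: "0 \<le> t" unfolding t_def using x by linarith
   define J where "J = nat \<lceil>t / c0\<rceil>"
   have J: "t \<le> J * c0" unfolding J_def by (rule nat_ceiling_bounds(1)[OF c0_pos])
   define W where "W = insert x (\<Union>F) \<inter> band a L"
   define B where "B = ups a L J W"
   define F' where "F' = F \<union> (\<lambda>v. {v, up v}) ` B"
   have W: "finite W" "W \<subseteq> band a L" unfolding W_def using finite_Union_edges[OF F] by auto
   have Wl: "L - h w \<le> J * c0" if "w \<in> W" for w using that W(2) J unfolding band_def t_def by auto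
   note B = ups_facts[OF W Wl, folded B_def]
   have xB: "x \<in> B" using B(3) x unfolding W_def band_def by auto
   have F': "finite F'" "F' \<subseteq> E" "F \<subseteq> F'" unfolding F'_def using F B(1,2) up_edge unfolding band_def by auto
   have cl: "closed_in L F' B" by (rule closed_in_mono[OF B(4)], assumption, unfold F'_def, rule Un_upper2)
   have sub: "hits a L x S \<subseteq> hitU B L x S" if S: "S \<subseteq> F" for S
   proof
    fix z assume "z \<in> hits a L x S"
    then have z: "L \<le> h z" "con (insert z (band a L)) S x z" unfolding hits_def by auto
    have "con (insert z B) S x y" if "con (insert z (band a L)) S x y" for y
     using that
    proof (induction rule: con_induct)
     case (step u v)
     have "v \<in> \<Union>F" using step(3) S by auto
     then have "v \<in> insert z B" using step(2) B(3) unfolding W_def by auto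
     then show ?case by (rule con_step[OF step(4) _ step(3)])
    qed (use xB in simp)
    from this[OF z(2)] show "z \<in> hitU B L x S" unfolding hitU_def using z(1) by simp
   qed
   have fin: "finite (hitU B L x S)" if "S \<subseteq> F'" for S by (rule finite_hitU[OF x(3)]) (use that F' finite_subset in auto)
   have "pexp p F (\<lambda>S. real (card (hits a L x S))) \<le> pexp p F (\<lambda>S. real (card (hitU B L x S)))"
    by (rule pexp_mono[OF p0 p(2)], rule of_nat_mono, rule card_mono[OF fin sub]) (use F'(3) in auto)
   also have "... \<le> pexp p F' (\<lambda>S. real (card (hitU B L x S)))"
   proof (rule pexp_mono_set[OF p0 p(2) F'(1,3)], rule of_nat_mono, rule card_mono[OF fin])
    fix S T :: "'a set set" assume ST: "S \<subseteq> T"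
    show "hitU B L x S \<subseteq> hitU B L x T" unfolding hitU_def
     by (intro Collect_mono conj_mono impI con_mono[OF _ order_refl ST])
   qed
   also have "... \<le> C * exp (- (3 / 4) * (L - a))"
   proof -
    define u where "u = exp ((3 * D + 1) * (t + 1))"
    have u: "1 \<le> u" unfolding u_def using D t by simp
    define n where "n = nat \<lceil>u\<rceil>"
    have n: "u \<le> n" "n \<le> 2 * u" "1 \<le> n" unfolding n_def using u by linarith+
    have Ks: "(\<Sum>v\<in>B. cp p F' B y v) \<le> exp (D * (t + 1))" if "y \<in> B" for y
     using sus[OF that B(1,2) F'(1,2) cl] unfolding t_def .
    have "pexp p F' (\<lambda>S. real (card (hitU B L x S))) \<le> A * exp (A * (h x - a)) * exp (- (1 - d) * (L - h x)) * real n powr (2 * d) + (real deg)\<^sup>2 * exp (D * (t + 1)) ^ 3 / n"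
     by (rule hm[OF xB B(1,2) F'(1,2) n(3) Ks])
    also have "... \<le> A * exp (2 * A) * exp (- (7 / 8) * (t - 2)) * (2 * exp ((t + 1) / 8)) + (real deg)\<^sup>2 * exp (- (3 / 4) * t)"
    proof (intro add_mono mult_mono)
     have "A * (h x - a) \<le> A * 2" using x by (intro mult_left_mono A) auto
     then show "exp (A * (h x - a)) \<le> exp (2 * A)" by (simp add: mult.commute)
     have "7 / 8 * (t - 2) \<le> (1 - d) * (L - h x)"
     proof -
      have "7 / 8 * (t - 2) \<le> 7 / 8 * (L - h x)" using x unfolding t_def by simp
      also have "... \<le> (1 - d) * (L - h x)" using x d by (intro mult_right_mono) auto
      finally show ?thesis .
     qed
     then show "exp (- (1 - d) * (L - h x)) \<le> exp (- (7 / 8) * (t - 2))" by (simp only: exp_le_cancel_iff mult_minus_left neg_le_iff_le)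
     have "real n powr (2 * d) \<le> (2 * u) powr (2 * d)" using n d by (intro powr_mono2) auto
     also have "... = 2 powr (2 * d) * u powr (2 * d)" using u by (simp add: powr_mult)
     also have "... \<le> 2 powr 1 * exp ((t + 1) / 8)"
     proof (intro mult_mono powr_mono)
      have "u powr (2 * d) = exp (2 * d * ((3 * D + 1) * (t + 1)))" unfolding u_def powr_def by simp
      also have "2 * d * ((3 * D + 1) * (t + 1)) = (2 * d * (3 * D + 1)) * (t + 1)" by (simp only: mult.assoc)
      finally show "u powr (2 * d) \<le> exp ((t + 1) / 8)" unfolding d(4) by simp
     qed (use d in auto)
     finally show "real n powr (2 * d) \<le> 2 * exp ((t + 1) / 8)" by simp
     have "(real deg)\<^sup>2 * exp (D * (t + 1)) ^ 3 / n \<le> (real deg)\<^sup>2 * exp (D * (t + 1)) ^ 3 / u"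
      using n u by (intro divide_left_mono) auto
     also have "... = (real deg)\<^sup>2 * (exp (3 * (D * (t + 1))) / exp ((3 * D + 1) * (t + 1)))"
      unfolding u_def using exp_of_nat_mult[of 3 "D * (t + 1)"] by simp
     also have "exp (3 * (D * (t + 1))) / exp ((3 * D + 1) * (t + 1)) = exp (- (t + 1))"
      unfolding exp_diff[symmetric] by (rule arg_cong[of _ _ exp]) (simp add: algebra_simps)
     also have "(real deg)\<^sup>2 * exp (- (t + 1)) \<le> (real deg)\<^sup>2 * exp (- (3 / 4) * t)" using t by (intro mult_left_mono) auto
     finally show "(real deg)\<^sup>2 * exp (D * (t + 1)) ^ 3 / n \<le> (real deg)\<^sup>2 * exp (- (3 / 4) * t)" .
    qed (use A in auto)
    also have "... = (2 * A * exp (2 * A)) * (exp (- (7 / 8) * (t - 2)) * exp ((t + 1) / 8)) + (real deg)\<^sup>2 * exp (- (3 / 4) * t)"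
     by (simp only: mult_ac)
    also have "... \<le> (2 * A * exp (2 * A)) * (exp 2 * exp (- (3 / 4) * t)) + (real deg)\<^sup>2 * exp (- (3 / 4) * t)"
    proof (intro add_right_mono mult_left_mono)
     have "- (7 / 8) * (t - 2) + (t + 1) / 8 = 15 / 8 + - (3 / 4) * t" by (simp add: field_simps)
     then have "- (7 / 8) * (t - 2) + (t + 1) / 8 \<le> 2 + - (3 / 4) * t" by linarith
     then show "exp (- (7 / 8) * (t - 2)) * exp ((t + 1) / 8) \<le> exp 2 * exp (- (3 / 4) * t)" by (simp only: exp_add[symmetric] exp_le_cancel_iff)
    qed (use A in auto)
    also have "... = C * exp (- (3 / 4) * (L - a))" unfolding C_def t_def by (simp only: distrib_right mult.assoc)
    finally show ?thesis .
   qed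
   finally show "pexp p F (\<lambda>S. real (card (hits a L x S))) \<le> C * exp (- (3 / 4) * (L - a))" .
  qed
 qed
qed

text \<open>Vertices near height \<open>h x + k\<close> are at most 4 below the level
  \<open>L\<close>, so pushing them up takes a bounded number of edges and their mean number is
  controlled by that of the hits.\<close>

lemma band_sum:
 assumes p: "0 < p" "p \<le> 1" and s: "subcr p"
 obtains C where "0 \<le> C" "\<And>x F A k. x \<in> V ==> 0 \<le> k ==> finite A ==> (\<And>y. y \<in> A ==> y \<in> V \<and> k - 1 \<le> h y - h x \<and> h y - h x \<le> k + 1) ==> finite F ==> F \<subseteq> E ==>
  (\<Sum>y\<in>A. cp p F {v \<in> V. h x - 2 \<le> h v \<and> h v \<le> h x + k + 2} x y) \<le> C * exp (- (3 / 4) * k)"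
proof (rule hits_small[OF p s])
 fix C assume C: "0 \<le> C" and hs: "\<And>x a L F. x \<in> V ==> a \<le> h x ==> h x < L ==> h x - a \<le> 2 ==> finite F ==> F \<subseteq> E ==>
  pexp p F (\<lambda>S. real (card (hits a L x S))) \<le> C * exp (- (3 / 4) * (L - a))"
 have p0: "0 \<le> p" using p by simp
 define J where "J = nat \<lceil>4 / c0\<rceil>"
 have J: "4 \<le> J * c0" unfolding J_def by (rule nat_ceiling_bounds(1)[OF c0_pos])
 define D where "D = real (Suc deg ^ J) / p ^ J * C"
 show thesis
 proof (rule that[of D])
  show "0 \<le> D" unfolding D_def using C p by simp
  fix x F A and k :: real
  assume x: "x \<in> V" "0 \<le> k" and A: "finite A" "\<And>y. y \<in> A ==> y \<in> V \<and> k - 1 \<le> h y - h x \<and> h y - h x \<le> k + 1" and F: "finite F" "F \<subseteq> E"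
  define a where "a = h x - 2"
  define L where "L = h x + k + 3"
  define B where "B = ups a L J A"
  define F' where "F' = F \<union> (\<lambda>v. {v, up v}) ` B"
  have Ab: "A \<subseteq> band a L" using A(2) x unfolding band_def a_def L_def by force
  have Al: "L - h y \<le> J * c0" if "y \<in> A" for y using A(2)[OF that] J unfolding L_def by linarith
  note B = ups_facts[OF A(1) Ab Al, folded B_def]
  have F': "finite F'" "F' \<subseteq> E" "F \<subseteq> F'" unfolding F'_def using F B(1,2) up_edge unfolding band_def by auto
  have cl: "closed_in L F' B" by (rule closed_in_mono[OF B(4)], assumption, unfold F'_def, rule Un_upper2)
  have xL: "h x < L" unfolding L_def using x by simp
  have "p ^ J * (\<Sum>y\<in>A. cp p F' (band a L) x y) \<le> real (Suc deg ^ J) * pexp p F' (\<lambda>S. real (card (hitU (band a L) L x S)))"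
  proof (rule force_up[OF p0 p(2) F'(1,2) A(1) _ xL])
   show "A \<subseteq> V" using A(2) by auto
   fix v assume v: "v \<in> A"
   then have "v \<in> B" "v \<in> V" "L - h v \<le> J * c0" using B(3) A(2) Al by auto
   from closed_exit[OF cl this] obtain j where j: "j \<le> J" "L \<le> h ((up ^^ j) v)" "\<forall>i<j. (up ^^ i) v \<in> B" "UP j v \<subseteq> F'" by auto
   then show "\<exists>j\<le>J. L \<le> h ((up ^^ j) v) \<and> (\<forall>i<j. (up ^^ i) v \<in> band a L) \<and> UP j v \<subseteq> F'"
    using B(2) by (intro exI[of _ j]) auto
  qed
  also have "... \<le> real (Suc deg ^ J) * (C * exp (- (3 / 4) * k))"
  proof (rule mult_left_mono)
   have "hitU (band a L) L x = hits a L x" unfolding hitU_def hits_def by (rule ext) simp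
   then have "pexp p F' (\<lambda>S. real (card (hitU (band a L) L x S))) \<le> C * exp (- (3 / 4) * (L - a))"
    using hs[of x a L F'] x(1) xL F' unfolding a_def by simp
   also have "... \<le> C * exp (- (3 / 4) * k)" unfolding L_def a_def by (intro mult_left_mono C) simp
   finally show "pexp p F' (\<lambda>S. real (card (hitU (band a L) L x S))) \<le> C * exp (- (3 / 4) * k)" .
  qed simp
  finally have "(\<Sum>y\<in>A. cp p F' (band a L) x y) \<le> D * exp (- (3 / 4) * k)" unfolding D_def using p by (simp add: field_simps)
  moreover have "(\<Sum>y\<in>A. cp p F {v \<in> V. h x - 2 \<le> h v \<and> h v \<le> h x + k + 2} x y) \<le> (\<Sum>y\<in>A. cp p F' (band a L) x y)"
   by (intro sum_mono cp_mono[OF p0 p(2) F'(1,3)]) (auto simp: band_def a_def L_def)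
  ultimately show "(\<Sum>y\<in>A. cp p F {v \<in> V. h x - 2 \<le> h v \<and> h v \<le> h x + k + 2} x y) \<le> D * exp (- (3 / 4) * k)" by linarith
 qed
qed

end

section \<open>Connections inside slabs in infinite volume, and their tilted sums\<close>

lemma sum_tau_SUP:
 assumes "0 \<le> p" "p \<le> 1" "finite A"
 shows "(\<Sum>y\<in>A. tau E p U x y) \<le> (SUP F\<in>{F. finite F \<and> F \<subseteq> E}. \<Sum>y\<in>A. ennreal (cp p F U x y))"
 using assms(3)
proof (induction rule: finite_induct)
 case (insert a A)
 let ?I = "{F. finite F \<and> F \<subseteq> E}"
 have "(\<Sum>y\<in>insert a A. tau E p U x y) \<le> tau E p U x a + (SUP F\<in>?I. \<Sum>y\<in>A. ennreal (cp p F U x y))"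
  using insert by (simp add: add_left_mono)
 also have "... = (SUP F\<in>?I. ennreal (cp p F U x a) + (\<Sum>y\<in>A. ennreal (cp p F U x y)))"
  unfolding tau_def
 proof (rule SUP_add_directed_ennreal[symmetric])
  fix F G assume F: "F \<in> ?I" "G \<in> ?I"
  have m: "ennreal (cp p F' U x y) \<le> ennreal (cp p (F \<union> G) U x y)" if "F' \<subseteq> F \<union> G" for F' y
   by (intro ennreal_leI cp_mono[OF assms(1,2)]) (use F that in auto)
  show "\<exists>H\<in>?I. ennreal (cp p F U x a) + (\<Sum>y\<in>A. ennreal (cp p G U x y)) \<le> ennreal (cp p H U x a) + (\<Sum>y\<in>A. ennreal (cp p H U x y))"
   by (rule bexI[of _ "F \<union> G"]) (use F in \<open>auto intro!: add_mono sum_mono m\<close>)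
 qed
 finally show ?case using insert by simp
qed simp

lemma sum_tau_le:
 assumes "0 \<le> p" "p \<le> 1" "finite A" "\<And>F. finite F ==> F \<subseteq> E ==> (\<Sum>y\<in>A. cp p F U x y) \<le> c"
 shows "(\<Sum>y\<in>A. tau E p U x y) \<le> ennreal c"
proof (rule order_trans[OF sum_tau_SUP[OF assms(1-3)]], rule SUP_least)
 fix F assume "F \<in> {F. finite F \<and> F \<subseteq> E}"
 then have F: "finite F" "F \<subseteq> E" by auto
 have "(\<Sum>y\<in>A. ennreal (cp p F U x y)) = ennreal (\<Sum>y\<in>A. cp p F U x y)" by (rule sum_ennreal) (rule cp_nonneg[OF assms(1,2)])
 then show "(\<Sum>y\<in>A. ennreal (cp p F U x y)) \<le> ennreal c" using assms(4)[OF F] by (simp add: ennreal_leI)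
qed

context hgraph
begin

lemma cp_act:
 assumes g: "g \<in> \<Gamma>" and U: "U \<subseteq> V" and x: "x \<in> V" "y \<in> V" and F: "F \<subseteq> E"
 shows "cp p ((`) g ` F) (g ` U) (g x) (g y) = cp p F U x y"
proof -
 have inj: "inj_on ((`) g) F"
 proof (rule inj_onI)
  fix d d' assume "d \<in> F" "d' \<in> F" "g ` d = g ` d'"
  moreover from this have "d \<subseteq> V" "d' \<subseteq> V" using F edge_sub by blast+
  moreover have "inj_on g V" using act_inj[OF g] by (auto simp: inj_on_def)
  ultimately show "d = d'" using inj_on_image_eq_iff[of g V d d'] by simp
 qed
 show ?thesis unfolding cp_def pexp_bij[OF inj]
 proof (rule pexp_cong)
  fix S assume S: "S \<subseteq> F"
  have "e \<subseteq> V" if "e \<in> S" for e using that S F edge_sub by blast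
  then show "of_bool (con (g ` U) ((`) g ` S) (g x) (g y)) = of_bool (con U S x y)" using con_act[OF g U _ x] by simp
 qed
qed

lemma tau_act_le:
 assumes g: "g \<in> \<Gamma>" and U: "U \<subseteq> V" and x: "x \<in> V" "y \<in> V" shows "tau E p U x y \<le> tau E p (g ` U) (g x) (g y)"
proof (rule tau_le)
 fix F assume F: "finite F" "F \<subseteq> E"
 have "(`) g ` F \<subseteq> E" using act_edge[OF g] edge_sub F(2) by blast
 then have "ennreal (cp p ((`) g ` F) (g ` U) (g x) (g y)) \<le> tau E p (g ` U) (g x) (g y)" by (intro cp_le_tau) (use F in auto)
 then show "ennreal (cp p F U x y) \<le> tau E p (g ` U) (g x) (g y)" unfolding cp_act[OF g U x F(2)] .
qed

text \<open>The margin 1 absorbs the rounding of heights to integer layers in the zigzag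
  decomposition.\<close>

definition SU :: "'a \<Rightarrow> 'a \<Rightarrow> 'a set" where
 "SU x y = {v \<in> V. min (h x) (h y) - 1 \<le> h v \<and> h v \<le> max (h x) (h y) + 1}"

definition SS :: "real \<Rightarrow> 'a \<Rightarrow> 'a \<Rightarrow> ennreal" where "SS p x y = tau E p (SU x y) x y"

lemma SS_sym: "SS p x y = SS p y x"
 unfolding SS_def SU_def by (subst tau_sym) (simp add: min.commute max.commute)

lemma SU_act: assumes g: "g \<in> \<Gamma>" "x \<in> V" "y \<in> V" shows "g ` SU x y \<subseteq> SU (g x) (g y)"
proof
 fix w assume "w \<in> g ` SU x y"
 then obtain v where v: "w = g v" "v \<in> V" "min (h x) (h y) - 1 \<le> h v" "h v \<le> max (h x) (h y) + 1" unfolding SU_def by auto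
 have "h (g v) - h (g x) = h v - h x" "h (g v) - h (g y) = h v - h y" using h_act[OF g(1) v(2)] g by auto
 then show "w \<in> SU (g x) (g y)" using v act_V[OF g(1)] unfolding SU_def min_def max_def by (auto split: if_splits)
qed

lemma SS_act: assumes p: "0 \<le> p" "p \<le> 1" and g: "g \<in> \<Gamma>" "x \<in> V" "y \<in> V" shows "SS p (g x) (g y) = SS p x y"
proof -
 have le: "SS p x y \<le> SS p (g x) (g y)" if g: "g \<in> \<Gamma>" "x \<in> V" "y \<in> V" for g x y
  unfolding SS_def
  by (rule order_trans[OF tau_act_le[OF g(1) _ g(2,3)] tau_mono[OF p SU_act[OF g]]]) (auto simp: SU_def)
 obtain l where l: "l \<in> \<Gamma>" "\<forall>x\<in>V. l (g x) = x \<and> g (l x) = x" using act_inv[OF g(1)] by auto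
 have "SS p (g x) (g y) \<le> SS p (l (g x)) (l (g y))" by (rule le[OF l(1)]) (use act_V g in auto)
 then show ?thesis using le[OF g] l g by (intro antisym) auto
qed

text \<open>The tilt is multiplicative along successive vertices and self-dual:
  \<open>ew y x\<close> times the mass transport density \<open>exp (h y - h x)\<close> is
  \<open>ew x y\<close>.\<close>

abbreviation ew :: "'a \<Rightarrow> 'a \<Rightarrow> ennreal" where "ew x y \<equiv> ennreal (exp ((h y - h x) / 2))"

definition shell :: "real \<Rightarrow> 'a \<Rightarrow> 'a \<Rightarrow> bool" where "shell k x y \<longleftrightarrow> k - 1 \<le> h y - h x \<and> h y - h x \<le> k + 1"

text \<open>The decay rate 3/4 of \<open>band_sum\<close> exceeds the growth rate 1/2 of the tilt by
  1/4.\<close>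

lemma up_sum:
 assumes p: "0 < p" "p \<le> 1" and s: "subcr p"
 obtains C where "0 \<le> C" "\<And>x k. x \<in> V ==> 0 \<le> k ==> nsum (\<lambda>y. of_bool (y \<in> V) * (of_bool (shell k x y) * SS p x y * ew x y)) \<le> ennreal (C * exp (- k / 4))"
proof (rule band_sum[OF p s])
 fix C assume C: "0 \<le> C" and bs: "\<And>x F A k. x \<in> V ==> 0 \<le> k ==> finite A ==> (\<And>y. y \<in> A ==> y \<in> V \<and> k - 1 \<le> h y - h x \<and> h y - h x \<le> k + 1) ==> finite F ==> F \<subseteq> E ==>
  (\<Sum>y\<in>A. cp p F {v \<in> V. h x - 2 \<le> h v \<and> h v \<le> h x + k + 2} x y) \<le> C * exp (- (3 / 4) * k)"
 have p0: "0 \<le> p" using p by simp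
 show thesis
 proof (rule that[of "C * exp (1 / 2)"])
  show "0 \<le> C * exp (1 / 2)" using C by simp
  fix x and k :: real assume x: "x \<in> V" and k: "0 \<le> k"
  let ?U = "{v \<in> V. h x - 2 \<le> h v \<and> h v \<le> h x + k + 2}"
  show "nsum (\<lambda>y. of_bool (y \<in> V) * (of_bool (shell k x y) * SS p x y * ew x y)) \<le> ennreal (C * exp (1 / 2) * exp (- k / 4))"
  proof (rule nsum_le)
   fix A :: "'a set" assume A: "finite A"
   define B where "B = {y \<in> A. y \<in> V \<and> shell k x y}"
   have B: "finite B" "B \<subseteq> A" unfolding B_def using A by auto
   have Bs: "y \<in> V \<and> k - 1 \<le> h y - h x \<and> h y - h x \<le> k + 1" if "y \<in> B" for y using that unfolding B_def shell_def by auto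
   have "(\<Sum>y\<in>A. of_bool (y \<in> V) * (of_bool (shell k x y) * SS p x y * ew x y)) = (\<Sum>y\<in>B. SS p x y * ew x y)"
    by (rule sum.mono_neutral_cong_right[OF A B(2)]) (auto simp: B_def)
   also have "... \<le> (\<Sum>y\<in>B. tau E p ?U x y * ennreal (exp ((k + 1) / 2)))"
   proof (intro sum_mono mult_mono)
    fix y assume y: "y \<in> B"
    show "SS p x y \<le> tau E p ?U x y" unfolding SS_def
     by (rule tau_mono[OF p0 p(2)]) (use Bs[OF y] k in \<open>auto simp: SU_def min_def max_def split: if_splits\<close>)
    show "ew x y \<le> ennreal (exp ((k + 1) / 2))" by (rule ennreal_leI) (use Bs[OF y] in simp)
   qed auto
   also have "... = (\<Sum>y\<in>B. tau E p ?U x y) * ennreal (exp ((k + 1) / 2))" by (rule sum_distrib_right[symmetric])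
   also have "... \<le> ennreal (C * exp (- (3 / 4) * k)) * ennreal (exp ((k + 1) / 2))"
    by (intro mult_right_mono sum_tau_le[OF p0 p(2) B(1)] bs[OF x k B(1) Bs]) auto
   also have "... = ennreal (C * exp (- (3 / 4) * k) * exp ((k + 1) / 2))" by (rule ennreal_mult''[symmetric]) simp
   also have "C * exp (- (3 / 4) * k) * exp ((k + 1) / 2) = C * (exp (1 / 2) * exp (- k / 4))"
    unfolding mult.assoc exp_add[symmetric] by (simp add: field_simps)
   finally show "(\<Sum>y\<in>A. of_bool (y \<in> V) * (of_bool (shell k x y) * SS p x y * ew x y)) \<le> ennreal (C * exp (1 / 2) * exp (- k / 4))"
    by (simp only: mult.assoc)
  qed
 qed
qed

text \<open>Mass transport reverses the pair and reproduces the tilt, so the shells below inherit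
  the bound for the shells above up to \<open>CM\<close>.\<close>

lemma down_sum:
 assumes p: "0 \<le> p" "p \<le> 1" and z: "z \<in> V"
  and up: "\<And>x. x \<in> V ==> nsum (\<lambda>y. of_bool (y \<in> V) * (of_bool (shell k x y) * SS p x y * ew x y)) \<le> c"
 shows "nsum (\<lambda>y. of_bool (y \<in> V) * (of_bool (shell k y z) * SS p z y * ew z y)) \<le> ennreal CM * c"
proof -
 let ?F = "\<lambda>w z. of_bool (shell k w z) * SS p w z * ew z w"
 have "nsum (\<lambda>y. of_bool (y \<in> V) * (of_bool (shell k y z) * SS p z y * ew z y)) = nsum (\<lambda>w. of_bool (w \<in> V) * ?F w z)"
  by (simp only: SS_sym[of p z])
 also have "... \<le> ennreal CM * (SUP x\<in>V. nsum (\<lambda>y. of_bool (y \<in> V) * (?F x y * ennreal (exp (h y - h x)))))"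
 proof (rule mtp_le[OF _ z])
  fix g u v assume g: "g \<in> \<Gamma>" "u \<in> V" "v \<in> V"
  have e: "h (g u) - h (g v) = h u - h v" "h (g v) - h (g u) = h v - h u" using h_act g by auto
  show "?F (g u) (g v) = ?F u v" unfolding shell_def SS_act[OF p g] e ..
 qed
 also have "... \<le> ennreal CM * c"
 proof (intro mult_left_mono SUP_least)
  fix x assume x: "x \<in> V"
  have e: "ew y x * ennreal (exp (h y - h x)) = ew x y" for y
   by (subst ennreal_mult'[symmetric]) (auto simp: field_simps simp flip: exp_add)
  have "nsum (\<lambda>y. of_bool (y \<in> V) * (?F x y * ennreal (exp (h y - h x)))) = nsum (\<lambda>y. of_bool (y \<in> V) * (of_bool (shell k x y) * SS p x y * ew x y))"
   by (simp only: mult.assoc e)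
  then show "nsum (\<lambda>y. of_bool (y \<in> V) * (?F x y * ennreal (exp (h y - h x)))) \<le> c" using up[OF x] by simp
 qed simp
 finally show ?thesis .
qed

end

section \<open>Zigzag decomposition and tilted susceptibility\<close>

context hgraph
begin

text \<open>The sign \<open>s\<close>, 1 or -1, reverses the orientation, so that one argument
  serves both lowest and highest layers.\<close>

definition lay :: "int \<Rightarrow> 'a \<Rightarrow> int" where "lay s v = s * \<lfloor>h v\<rfloor>"

text \<open>The region for paths that arrive at \<open>y\<close> strictly from its
  \<open>s\<close>-side; \<open>y\<close> is their only vertex in the extremal layer.\<close>

definition KU :: "int \<Rightarrow> nat \<Rightarrow> 'a \<Rightarrow> 'a set" where
 "KU s k y = insert y {v \<in> V. 0 < lay s v - lay s y \<and> lay s v - lay s y \<le> int k}"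

definition KK :: "real \<Rightarrow> int \<Rightarrow> nat \<Rightarrow> 'a \<Rightarrow> 'a \<Rightarrow> ennreal" where "KK p s k x y = tau E p (KU s k y) x y"

definition far :: "nat \<Rightarrow> 'a \<Rightarrow> 'a \<Rightarrow> bool" where "far k x y \<longleftrightarrow> \<bar>\<lfloor>h x\<rfloor> - \<lfloor>h y\<rfloor>\<bar> = int k"

text \<open>A path that comes to the layer at distance \<open>k + 1\<close> from \<open>y\<close> is
  cut at its first vertex \<open>z\<close> there. Before \<open>z\<close> it lies strictly between
  the two layers, a region of the same kind seen from \<open>z\<close> with reversed orientation and
  width \<open>k\<close>; after \<open>z\<close> it lies in the slab between \<open>z\<close> and
  \<open>y\<close>. Any other path fits into the region of width \<open>k\<close>.\<close>

lemma KK_step: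
 assumes p: "0 \<le> p" "p \<le> 1" and s: "s = 1 \<or> s = - 1" and y: "y \<in> V"
 shows "KK p s (Suc k) x y \<le> KK p s k x y + nsum (\<lambda>z. of_bool (z \<in> V \<and> far (Suc k) z y) * (KK p (- s) k x z * SS p z y))"
proof -
 define T where "T z \<longleftrightarrow> z \<in> V \<and> lay s z - lay s y = int (Suc k)" for z
 \<comment> \<open>The value \<open>z = y\<close> encodes the case without a cut; the second half is
   then the trivial path at \<open>y\<close>.\<close>
 define U1 where "U1 z = (if z = y then KU s k y else KU (- s) k z)" for z
 define U2 where "U2 z = (if z = y then {y} else SU z y)" for z
 have ny: "\<not> T y" unfolding T_def by simp
 have band: "SU z y \<supseteq> {v \<in> V. 0 \<le> lay s v - lay s y \<and> lay s v - lay s y \<le> lay s z - lay s y}" if T: "T z" for z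
 proof
  fix v assume v: "v \<in> {v \<in> V. 0 \<le> lay s v - lay s y \<and> lay s v - lay s y \<le> lay s z - lay s y}"
  from s show "v \<in> SU z y"
  proof
   assume s1: "s = 1"
   then have "\<lfloor>h y\<rfloor> \<le> \<lfloor>h v\<rfloor>" "\<lfloor>h v\<rfloor> \<le> \<lfloor>h z\<rfloor>" using v unfolding lay_def by auto
   then have "h y - 1 \<le> h v" "h v \<le> h z + 1" by linarith+
   then show ?thesis using v unfolding SU_def by auto
  next
   assume s1: "s = - 1"
   then have "\<lfloor>h z\<rfloor> \<le> \<lfloor>h v\<rfloor>" "\<lfloor>h v\<rfloor> \<le> \<lfloor>h y\<rfloor>" using v unfolding lay_def by auto
   then have "h z - 1 \<le> h v" "h v \<le> h y + 1" by linarith+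
   then show ?thesis using v unfolding SU_def by auto
  qed
 qed
 have "KK p s (Suc k) x y \<le> nsum (\<lambda>z. of_bool (z = y \<or> T z) * (tau E p (U1 z) x z * tau E p (U2 z) z y))"
  unfolding KK_def
 proof (rule tau_split[OF p finite_edge])
  fix xs assume xs: "spath (KU s (Suc k) y) xs x y" "ed xs \<subseteq> E"
  have xs': "xs \<noteq> []" "last xs = y" "distinct xs" "set xs \<subseteq> KU s (Suc k) y" using xs(1) unfolding spath_def by auto
  show "\<exists>z. (z = y \<or> T z) \<and> (\<exists>as bs. xs = as @ z # bs \<and> set (as @ [z]) \<subseteq> U1 z \<and> set (z # bs) \<subseteq> U2 z)"
  proof (cases "\<exists>z\<in>set xs. T z")
   case True
   then obtain z0 where z0: "z0 \<in> set xs" "T z0" by auto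
   obtain as w bs where w: "xs = as @ w # bs" "T w" "\<forall>a\<in>set as. \<not> T a" by (rule spath_first[where P = T, OF xs(1) z0])
   have wy: "w \<noteq> y" using w(2) ny by auto
   then have "bs \<noteq> []" using xs'(2) w(1) by auto
   then have "y \<in> set bs" using xs'(2) w(1) last_in_set[of bs] by simp
   then have yas: "y \<notin> set as" using xs'(3) w(1) by auto
   have "set (as @ [w]) \<subseteq> KU (- s) k w"
   proof
    fix a assume "a \<in> set (as @ [w])"
    then consider "a = w" | "a \<in> set as" by auto
    then show "a \<in> KU (- s) k w"
    proof cases
     case 2
     then have a: "a \<in> V" "0 < lay s a - lay s y" "lay s a - lay s y \<le> int (Suc k)" "\<not> T a"
      using xs'(4) w(1,3) yas unfolding KU_def by auto
     then have "lay s a - lay s y < int (Suc k)" unfolding T_def by linarith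
     then show ?thesis using a w(2) unfolding KU_def T_def lay_def by (auto simp: algebra_simps)
    qed (simp add: KU_def)
   qed
   moreover have "set (w # bs) \<subseteq> SU w y"
   proof
    fix a assume "a \<in> set (w # bs)"
    then have "a \<in> KU s (Suc k) y" using xs'(4) w(1) by auto
    then have "a \<in> {v \<in> V. 0 \<le> lay s v - lay s y \<and> lay s v - lay s y \<le> lay s w - lay s y}"
     using w(2) y unfolding KU_def T_def by auto
    then show "a \<in> SU w y" using band[OF w(2)] by blast
   qed
   ultimately show ?thesis using w(1,2) wy unfolding U1_def U2_def by (intro exI[of _ w]) auto
  next
   case False
   have "xs = butlast xs @ y # []" using xs'(1,2) append_butlast_last_id[of xs] by simp
   moreover have "set (butlast xs @ [y]) \<subseteq> KU s k y"
   proof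
    fix a assume "a \<in> set (butlast xs @ [y])"
    then have a: "a \<in> set xs" using \<open>xs = butlast xs @ y # []\<close> by metis
    then have "a = y \<or> a \<in> V \<and> 0 < lay s a - lay s y \<and> lay s a - lay s y \<le> int (Suc k)" "\<not> T a"
     using xs'(4) False unfolding KU_def by auto
    then show "a \<in> KU s k y" unfolding KU_def T_def by auto
   qed
   ultimately have "xs = butlast xs @ y # [] \<and> set (butlast xs @ [y]) \<subseteq> U1 y \<and> set (y # []) \<subseteq> U2 y"
    unfolding U1_def U2_def by simp
   then show ?thesis by blast
  qed
 qed
 also have "... \<le> nsum (\<lambda>z. of_bool (z = y) * KK p s k x y + of_bool (z \<in> V \<and> far (Suc k) z y) * (KK p (- s) k x z * SS p z y))"
 proof (rule nsum_mono)
  fix z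
  have t1: "tau E p {y} y y \<le> 1" by (rule tau_le) (use cp_le1[OF p] in \<open>simp add: ennreal_le_1\<close>)
  show "of_bool (z = y \<or> T z) * (tau E p (U1 z) x z * tau E p (U2 z) z y) \<le> of_bool (z = y) * KK p s k x y + of_bool (z \<in> V \<and> far (Suc k) z y) * (KK p (- s) k x z * SS p z y)"
  proof (cases "z = y")
   case True
   have "KK p s k x y * tau E p {y} y y \<le> KK p s k x y * 1" by (rule mult_left_mono[OF t1]) simp
   then show ?thesis using True unfolding U1_def U2_def KK_def by (simp add: add_increasing2)
  next
   case False
   have "T z ==> z \<in> V \<and> far (Suc k) z y" using s unfolding T_def far_def lay_def by auto
   then show ?thesis using False unfolding U1_def U2_def KK_def SS_def by (cases "T z") auto
  qed
 qed
 also have "... = KK p s k x y + nsum (\<lambda>z. of_bool (z \<in> V \<and> far (Suc k) z y) * (KK p (- s) k x z * SS p z y))"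
 proof -
  have "nsum (\<lambda>z. of_bool (z = y) * KK p s k x y) = (\<Sum>z\<in>{y}. of_bool (z = y) * KK p s k x y)" by (rule nsum_finite) auto
  then show ?thesis unfolding nsum_add by simp
 qed
 finally show ?thesis .
qed

lemma KK_zero: assumes "0 \<le> p" "p \<le> 1" shows "KK p s 0 x y \<le> of_bool (x = y)"
 unfolding KK_def
proof (rule tau_le)
 fix F assume F: "finite F" "F \<subseteq> E"
 have "\<not> con {y} S x y" if "x \<noteq> y" for S using con_in(1)[of "{y}" S x y] that by auto
 then have "x \<noteq> y ==> cp p F {y} x y = 0" unfolding cp_def by simp
 moreover have "KU s 0 y = {y}" unfolding KU_def by auto
 ultimately show "ennreal (cp p F (KU s 0 y) x y) \<le> of_bool (x = y)" using cp_le1[OF assms F(1), of "{y}" x y] by (cases "x = y") (auto simp: ennreal_le_1)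
qed

lemma ew_mult: "ew x z * ew z y = ew x y"
 by (subst ennreal_mult'[symmetric]) (auto simp: field_simps simp flip: exp_add)

lemma ew_self [simp]: "ew x x = 1" by simp

text \<open>Each additional layer of width costs a factor \<open>1 + g (Suc k)\<close>, the tilt
  being multiplicative over the cut. Both signs are treated together because the recursion
  alternates them.\<close>

lemma KK_rows:
 assumes p: "0 \<le> p" "p \<le> 1" and gam: "\<And>z k. z \<in> V ==> nsum (\<lambda>y. of_bool (y \<in> V) * (of_bool (far k z y) * SS p z y * ew z y)) \<le> ennreal (g k)" and g: "\<And>k. 0 \<le> g k"
  and s: "s = 1 \<or> s = - 1" and x: "x \<in> V"
 shows "nsum (\<lambda>y. of_bool (y \<in> V) * (KK p s k x y * ew x y)) \<le> ennreal (\<Prod>j<k. 1 + g (Suc j))"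
 using s
proof (induction k arbitrary: s)
 case 0
 have "nsum (\<lambda>y. of_bool (y \<in> V) * (KK p s 0 x y * ew x y)) \<le> nsum (\<lambda>y. of_bool (x = y))"
 proof (rule nsum_mono)
  fix y
  show "of_bool (y \<in> V) * (KK p s 0 x y * ew x y) \<le> of_bool (x = y)"
  proof (cases "x = y")
   case True
   then show ?thesis using KK_zero[OF p, of s y y] by (cases "y \<in> V") auto
  next
   case False
   then have "KK p s 0 x y = 0" using KK_zero[OF p, of s x y] by simp
   then show ?thesis by simp
  qed
 qed
 also have "... = (\<Sum>y\<in>{x}. of_bool (x = y))" by (rule nsum_finite) auto
 finally show ?case by simp
next
 case (Suc k)
 let ?P = "ennreal (\<Prod>j<k. 1 + g (Suc j))"
 have ms: "- s = 1 \<or> - s = - 1" using Suc(2) by auto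
 let ?f = "\<lambda>y z. (of_bool (z \<in> V) * (KK p (- s) k x z * ew x z)) * (of_bool (y \<in> V) * (of_bool (far (Suc k) z y) * SS p z y * ew z y))"
 have "nsum (\<lambda>y. of_bool (y \<in> V) * (KK p s (Suc k) x y * ew x y)) \<le> nsum (\<lambda>y. of_bool (y \<in> V) * (KK p s k x y * ew x y) + nsum (?f y))"
 proof (rule nsum_mono)
  fix y
  show "of_bool (y \<in> V) * (KK p s (Suc k) x y * ew x y) \<le> of_bool (y \<in> V) * (KK p s k x y * ew x y) + nsum (?f y)"
  proof (cases "y \<in> V")
   case True
   have "KK p s (Suc k) x y * ew x y \<le> (KK p s k x y + nsum (\<lambda>z. of_bool (z \<in> V \<and> far (Suc k) z y) * (KK p (- s) k x z * SS p z y))) * ew x y"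
    by (rule mult_right_mono[OF KK_step[OF p Suc(2) True]]) simp
   also have "... = KK p s k x y * ew x y + nsum (\<lambda>z. of_bool (z \<in> V \<and> far (Suc k) z y) * (KK p (- s) k x z * SS p z y) * ew x y)"
    by (simp only: distrib_right nsum_multc)
   also have "(\<lambda>z. of_bool (z \<in> V \<and> far (Suc k) z y) * (KK p (- s) k x z * SS p z y) * ew x y) = ?f y"
   proof
    fix z
    show "of_bool (z \<in> V \<and> far (Suc k) z y) * (KK p (- s) k x z * SS p z y) * ew x y = ?f y z"
     unfolding ew_mult[where x = x and z = z and y = y, symmetric] using True by (cases "z \<in> V"; cases "far (Suc k) z y") (simp_all add: mult_ac)
   qed
   finally show ?thesis using True by simp
  qed simp
 qed
 also have "... = nsum (\<lambda>y. of_bool (y \<in> V) * (KK p s k x y * ew x y)) + nsum (\<lambda>y. nsum (?f y))" by (rule nsum_add)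
 also have "nsum (\<lambda>y. nsum (?f y)) = nsum (\<lambda>z. nsum (\<lambda>y. ?f y z))" by (rule nsum_swap)
 also have "... \<le> nsum (\<lambda>z. (of_bool (z \<in> V) * (KK p (- s) k x z * ew x z)) * ennreal (g (Suc k)))"
 proof (rule nsum_mono)
  fix z
  show "nsum (\<lambda>y. ?f y z) \<le> (of_bool (z \<in> V) * (KK p (- s) k x z * ew x z)) * ennreal (g (Suc k))"
   unfolding nsum_cmult by (cases "z \<in> V") (auto intro!: mult_left_mono gam)
 qed
 also have "... \<le> ?P * ennreal (g (Suc k))" unfolding nsum_multc by (intro mult_right_mono Suc.IH[OF ms]) simp
 also have "nsum (\<lambda>y. of_bool (y \<in> V) * (KK p s k x y * ew x y)) \<le> ?P" by (rule Suc.IH[OF Suc(2)])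
 finally have "nsum (\<lambda>y. of_bool (y \<in> V) * (KK p s (Suc k) x y * ew x y)) \<le> ?P + ?P * ennreal (g (Suc k))" by (simp add: add_right_mono add_mono)
 also have "... = ennreal (\<Prod>j<Suc k. 1 + g (Suc j))"
  using g by (simp add: ennreal_mult'[symmetric] ennreal_plus[symmetric] prod_nonneg add_nonneg_nonneg distrib_left del: ennreal_plus)
 finally show ?case .
qed

text \<open>The same recursion with the target fixed: the sum over \<open>x\<close> is done first by
  the induction hypothesis at \<open>z\<close>, then the slab leg is summed, read from
  \<open>y\<close> by the symmetry of \<open>SS\<close>.\<close>

lemma KK_cols:
 assumes p: "0 \<le> p" "p \<le> 1" and gam: "\<And>z k. z \<in> V ==> nsum (\<lambda>y. of_bool (y \<in> V) * (of_bool (far k z y) * SS p z y * ew z y)) \<le> ennreal (g k)" and g: "\<And>k. 0 \<le> g k"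
  and s: "s = 1 \<or> s = - 1" and y: "y \<in> V"
 shows "nsum (\<lambda>x. of_bool (x \<in> V) * (KK p s k x y * ew y x)) \<le> ennreal (\<Prod>j<k. 1 + g (Suc j))"
 using s y
proof (induction k arbitrary: s y)
 case 0
 have "nsum (\<lambda>x. of_bool (x \<in> V) * (KK p s 0 x y * ew y x)) \<le> nsum (\<lambda>x. of_bool (x = y))"
 proof (rule nsum_mono)
  fix x
  show "of_bool (x \<in> V) * (KK p s 0 x y * ew y x) \<le> of_bool (x = y)"
  proof (cases "x = y")
   case True
   then show ?thesis using KK_zero[OF p, of s y y] by (cases "y \<in> V") auto
  next
   case False
   then have "KK p s 0 x y = 0" using KK_zero[OF p, of s x y] by simp
   then show ?thesis by simp
  qed
 qed
 also have "... = (\<Sum>x\<in>{y}. of_bool (x = y))" by (rule nsum_finite) auto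
 finally show ?case by simp
next
 case (Suc k)
 let ?P = "ennreal (\<Prod>j<k. 1 + g (Suc j))"
 have ms: "- s = 1 \<or> - s = - 1" using Suc(2) by auto
 let ?f = "\<lambda>x z. (of_bool (x \<in> V) * (KK p (- s) k x z * ew z x)) * (of_bool (z \<in> V) * (of_bool (far (Suc k) y z) * SS p y z * ew y z))"
 have "nsum (\<lambda>x. of_bool (x \<in> V) * (KK p s (Suc k) x y * ew y x)) \<le> nsum (\<lambda>x. of_bool (x \<in> V) * (KK p s k x y * ew y x) + nsum (?f x))"
 proof (rule nsum_mono)
  fix x
  show "of_bool (x \<in> V) * (KK p s (Suc k) x y * ew y x) \<le> of_bool (x \<in> V) * (KK p s k x y * ew y x) + nsum (?f x)"
  proof (cases "x \<in> V")
   case True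
   have "KK p s (Suc k) x y * ew y x \<le> (KK p s k x y + nsum (\<lambda>z. of_bool (z \<in> V \<and> far (Suc k) z y) * (KK p (- s) k x z * SS p z y))) * ew y x"
    by (rule mult_right_mono[OF KK_step[OF p Suc(2,3)]]) simp
   also have "... = KK p s k x y * ew y x + nsum (\<lambda>z. of_bool (z \<in> V \<and> far (Suc k) z y) * (KK p (- s) k x z * SS p z y) * ew y x)"
    by (simp only: distrib_right nsum_multc)
   also have "(\<lambda>z. of_bool (z \<in> V \<and> far (Suc k) z y) * (KK p (- s) k x z * SS p z y) * ew y x) = ?f x"
   proof
    fix z
    have fs: "far (Suc k) z y = far (Suc k) y z" unfolding far_def by (simp add: abs_minus_commute)
    show "of_bool (z \<in> V \<and> far (Suc k) z y) * (KK p (- s) k x z * SS p z y) * ew y x = ?f x z"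
     unfolding fs SS_sym[of p z y]
     unfolding ew_mult[where x = y and z = z and y = x, symmetric] using True by (cases "z \<in> V"; cases "far (Suc k) y z") (simp_all add: mult_ac)
   qed
   finally show ?thesis using True by simp
  qed simp
 qed
 also have "... = nsum (\<lambda>x. of_bool (x \<in> V) * (KK p s k x y * ew y x)) + nsum (\<lambda>x. nsum (?f x))" by (rule nsum_add)
 also have "nsum (\<lambda>x. nsum (?f x)) = nsum (\<lambda>z. nsum (\<lambda>x. ?f x z))" by (rule nsum_swap)
 also have "... \<le> nsum (\<lambda>z. ?P * (of_bool (z \<in> V) * (of_bool (far (Suc k) y z) * SS p y z * ew y z)))"
 proof (rule nsum_mono)
  fix z
  show "nsum (\<lambda>x. ?f x z) \<le> ?P * (of_bool (z \<in> V) * (of_bool (far (Suc k) y z) * SS p y z * ew y z))"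
   unfolding nsum_multc by (cases "z \<in> V") (auto intro!: mult_right_mono Suc.IH[OF ms])
 qed
 also have "... \<le> ?P * ennreal (g (Suc k))" unfolding nsum_cmult by (intro mult_left_mono gam Suc(3)) simp
 also have "nsum (\<lambda>x. of_bool (x \<in> V) * (KK p s k x y * ew y x)) \<le> ?P" by (rule Suc.IH[OF Suc(2,3)])
 finally have "nsum (\<lambda>x. of_bool (x \<in> V) * (KK p s (Suc k) x y * ew y x)) \<le> ?P + ?P * ennreal (g (Suc k))" by (simp add: add_right_mono add_mono)
 also have "... = ennreal (\<Prod>j<Suc k. 1 + g (Suc j))"
  using g by (simp add: ennreal_mult'[symmetric] ennreal_plus[symmetric] prod_nonneg add_nonneg_nonneg distrib_left del: ennreal_plus)
 finally show ?case .
qed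

text \<open>The version of \<open>KK\<close> for a half-space, without a bound on the width.\<close>

definition KI :: "real \<Rightarrow> int \<Rightarrow> 'a \<Rightarrow> 'a \<Rightarrow> ennreal" where
 "KI p s x y = tau E p (insert y {v \<in> V. 0 < lay s v - lay s y}) x y"

text \<open>A finite volume meets only finitely many layers.\<close>

lemma KI_SUP: assumes p: "0 \<le> p" "p \<le> 1" shows "KI p s x y \<le> (SUP k. KK p s k x y)"
 unfolding KI_def
proof (rule tau_le)
 fix F assume F: "finite F" "F \<subseteq> E"
 let ?U = "insert y {v \<in> V. 0 < lay s v - lay s y}"
 define W where "W = insert x (\<Union>F)"
 have W: "finite W" unfolding W_def using finite_Union_edges[OF F] by simp
 define k where "k = Max ((\<lambda>v. nat (lay s v - lay s y)) ` W)"
 have k: "nat (lay s v - lay s y) \<le> k" if "v \<in> W" for v unfolding k_def using that W by auto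
 have "cp p F ?U x y \<le> cp p F (KU s k y) x y" unfolding cp_def
 proof (rule pexp_mono[OF p], rule of_bool_mono)
  fix S assume S: "S \<subseteq> F" "con ?U S x y"
  have sub: "v \<in> KU s k y" if "v \<in> ?U" "v \<in> W" for v using that k[OF that(2)] unfolding KU_def by auto
  have "con (KU s k y) S x z" if "con ?U S x z" for z
   using that
  proof (induction rule: con_induct)
   case refl
   show ?case using con_in(1)[OF S(2)] sub[of x] unfolding W_def by simp
  next
   case (step u v)
   have "v \<in> W" using step(3) S(1) unfolding W_def by auto
   then show ?case by (rule con_step[OF step(4) sub[OF step(2)] step(3)])
  qed
  then show "con (KU s k y) S x y" using S(2) by simp
 qed
 then have "ennreal (cp p F ?U x y) \<le> ennreal (cp p F (KU s k y) x y)" by (rule ennreal_leI)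
 also have "... \<le> KK p s k x y" unfolding KK_def by (rule cp_le_tau[OF F])
 also have "... \<le> (SUP k. KK p s k x y)" by (rule SUP_upper) simp
 finally show "ennreal (cp p F ?U x y) \<le> (SUP k. KK p s k x y)" .
qed

lemma KI_sum:
 assumes p: "0 \<le> p" "p \<le> 1" and b: "\<And>k. nsum (\<lambda>z. w z * KK p s k (f z) (f' z)) \<le> c"
 shows "nsum (\<lambda>z. w z * KI p s (f z) (f' z)) \<le> c"
proof -
 have mono: "KK p s k x y \<le> KK p s (Suc k) x y" for k x y unfolding KK_def by (rule tau_mono[OF p]) (auto simp: KU_def)
 have "nsum (\<lambda>z. w z * KI p s (f z) (f' z)) \<le> nsum (\<lambda>z. SUP k. w z * KK p s k (f z) (f' z))"
  by (rule nsum_mono) (simp add: SUP_mult_left_ennreal[symmetric] mult_left_mono KI_SUP[OF p])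
 also have "... = (SUP k. nsum (\<lambda>z. w z * KK p s k (f z) (f' z)))"
  by (rule nn_integral_monotone_convergence_SUP) (auto intro!: incseq_SucI le_funI mult_left_mono mono)
 also have "... \<le> c" by (rule SUP_least) (rule b)
 finally show ?thesis .
qed

text \<open>The path is cut at its first vertex \<open>z\<close> in its lowest layer; the remainder,
  read from \<open>v\<close>, is cut at its first vertex \<open>z'\<close> in the highest layer of
  that remainder. The outer pieces are one-sided, and the middle piece lies in the slab between
  \<open>z\<close> and \<open>z'\<close>.\<close>

lemma tau_zigzag:
 assumes p: "0 \<le> p" "p \<le> 1" and x: "x \<in> V" "v \<in> V"
 shows "tau E p V x v \<le> nsum (\<lambda>z. of_bool (z \<in> V) * (KI p 1 x z * nsum (\<lambda>z'. of_bool (z' \<in> V) * (SS p z z' * KI p (- 1) v z'))))"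
proof -
 have ex_min: "\<exists>z\<in>set xs. \<forall>v\<in>set xs. lay s z \<le> lay s v" if "xs \<noteq> []" for xs :: "'a list" and s
 proof -
  have "Min (lay s ` set xs) \<in> lay s ` set xs" using that by (intro Min_in) auto
  then obtain z where "z \<in> set xs" "lay s z = Min (lay s ` set xs)" by auto
  then show ?thesis by (intro bexI[of _ z]) auto
 qed
 have step: "tau E p U x v \<le> nsum (\<lambda>z. of_bool (z \<in> U) * (KI p s x z * tau E p {w \<in> U. lay s z \<le> lay s w} z v))"
  if U: "U \<subseteq> V" for U x v s
  unfolding KI_def
 proof (rule tau_split[OF p finite_edge])
  fix xs assume xs: "spath U xs x v" "ed xs \<subseteq> E"
  have xs': "xs \<noteq> []" "set xs \<subseteq> U" "distinct xs" using xs(1) unfolding spath_def by auto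
  obtain z0 where z0: "z0 \<in> set xs" "\<forall>v\<in>set xs. lay s z0 \<le> lay s v" using ex_min[OF xs'(1)] by blast
  obtain as z bs where z: "xs = as @ z # bs" "lay s z = lay s z0" "\<forall>a\<in>set as. \<not> lay s a = lay s z0"
   by (rule spath_first[OF xs(1) z0(1), of "\<lambda>z. lay s z = lay s z0"]) auto
  have "set (as @ [z]) \<subseteq> insert z {v \<in> V. 0 < lay s v - lay s z}"
   using z z0(2) xs'(2) U by (auto simp: less_le)
  moreover have "set (z # bs) \<subseteq> {w \<in> U. lay s z \<le> lay s w}" using z z0(2) xs'(2) by auto
  moreover have "z \<in> U" using z(1) xs'(2) by auto
  ultimately show "\<exists>z. z \<in> U \<and> (\<exists>as bs. xs = as @ z # bs \<and> set (as @ [z]) \<subseteq> insert z {v \<in> V. 0 < lay s v - lay s z} \<and> set (z # bs) \<subseteq> {w \<in> U. lay s z \<le> lay s w})"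
   using z(1) by blast
 qed
 have inner: "tau E p {w \<in> V. lay 1 z \<le> lay 1 w} z v \<le> nsum (\<lambda>z'. of_bool (z' \<in> V) * (SS p z z' * KI p (- 1) v z'))" if z: "z \<in> V" for z
 proof -
  let ?U = "{w \<in> V. lay 1 z \<le> lay 1 w}"
  have "tau E p ?U z v = tau E p ?U v z" by (rule tau_sym)
  also have "... \<le> nsum (\<lambda>z'. of_bool (z' \<in> ?U) * (KI p (- 1) v z' * tau E p {w \<in> ?U. lay (- 1) z' \<le> lay (- 1) w} z' z))"
   by (rule step) auto
  also have "... \<le> nsum (\<lambda>z'. of_bool (z' \<in> V) * (SS p z z' * KI p (- 1) v z'))"
  proof (rule nsum_mono)
   fix z'
   have "tau E p {w \<in> ?U. lay (- 1) z' \<le> lay (- 1) w} z' z \<le> SS p z z'" if z': "z' \<in> ?U"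
    unfolding SS_sym[of p z z'] unfolding SS_def
   proof (rule tau_mono[OF p], rule subsetI)
    fix w assume "w \<in> {w \<in> ?U. lay (- 1) z' \<le> lay (- 1) w}"
    then have w: "w \<in> V" "\<lfloor>h z\<rfloor> \<le> \<lfloor>h w\<rfloor>" "\<lfloor>h w\<rfloor> \<le> \<lfloor>h z'\<rfloor>" unfolding lay_def by auto
    then have "h z - 1 \<le> h w" "h w \<le> h z' + 1" by linarith+
    then show "w \<in> SU z' z" using w(1) unfolding SU_def by auto
   qed
   note t = this
   show "of_bool (z' \<in> ?U) * (KI p (- 1) v z' * tau E p {w \<in> ?U. lay (- 1) z' \<le> lay (- 1) w} z' z) \<le> of_bool (z' \<in> V) * (SS p z z' * KI p (- 1) v z')"
   proof (cases "z' \<in> ?U")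
    case True
    then have "KI p (- 1) v z' * tau E p {w \<in> ?U. lay (- 1) z' \<le> lay (- 1) w} z' z \<le> KI p (- 1) v z' * SS p z z'"
     by (intro mult_left_mono t) auto
    then show ?thesis using True by (simp add: mult.commute)
   qed simp
  qed
  finally show ?thesis .
 qed
 show ?thesis
 proof (rule order_trans[OF step[OF order_refl, of x v 1]], rule nsum_mono)
  fix z
  show "of_bool (z \<in> V) * (KI p 1 x z * tau E p {w \<in> V. lay 1 z \<le> lay 1 w} z v) \<le>
   of_bool (z \<in> V) * (KI p 1 x z * nsum (\<lambda>z'. of_bool (z' \<in> V) * (SS p z z' * KI p (- 1) v z')))"
   by (cases "z \<in> V") (auto intro!: mult_left_mono inner)
 qed
qed

definition chi :: "real \<Rightarrow> 'a \<Rightarrow> ennreal" where "chi p x = nsum (\<lambda>v. of_bool (v \<in> V) * (tau E p V x v * ew x v))"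

text \<open>Row sums for the first piece, shells for the middle one and column sums for the last
  multiply up. The products over widths stay bounded because \<open>g\<close> is geometric.\<close>

lemma chi_finite:
 assumes p: "0 < p" "p \<le> 1" and s: "subcr p"
 obtains C where "0 \<le> C" "\<And>x. x \<in> V ==> chi p x \<le> ennreal C"
proof (rule up_sum[OF p s])
 fix C assume C: "0 \<le> C" and up: "\<And>x k. x \<in> V ==> 0 \<le> k ==> nsum (\<lambda>y. of_bool (y \<in> V) * (of_bool (shell k x y) * SS p x y * ew x y)) \<le> ennreal (C * exp (- k / 4))"
 have p0: "0 \<le> p" using p by simp
 \<comment> \<open>One unit for the shells above and \<open>CM\<close> for those below; the sign of
   \<open>CM\<close> is not prescribed, hence the absolute value.\<close>
 define C' where "C' = (1 + \<bar>CM\<bar>) * C"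
 define r where "r = exp (- (1 / 4) :: real)"
 have r: "0 < r" "r < 1" unfolding r_def by auto
 define g where "g k = C' * r ^ k" for k
 have C': "0 \<le> C'" unfolding C'_def using C by simp
 have g: "0 \<le> g k" for k unfolding g_def using C' r by simp
 have rk: "exp (- real k / 4) = r ^ k" for k unfolding r_def by (simp flip: exp_of_nat_mult)
 have gam: "nsum (\<lambda>y. of_bool (y \<in> V) * (of_bool (far k z y) * SS p z y * ew z y)) \<le> ennreal (g k)" if z: "z \<in> V" for z k
 proof -
  have "nsum (\<lambda>y. of_bool (y \<in> V) * (of_bool (far k z y) * SS p z y * ew z y)) \<le>
   nsum (\<lambda>y. of_bool (y \<in> V) * (of_bool (shell k z y) * SS p z y * ew z y) + of_bool (y \<in> V) * (of_bool (shell k y z) * SS p z y * ew z y))"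
  proof (rule nsum_mono)
   fix y
   have "far k z y ==> shell k z y \<or> shell k y z" unfolding far_def shell_def by linarith
   then show "of_bool (y \<in> V) * (of_bool (far k z y) * SS p z y * ew z y) \<le> of_bool (y \<in> V) * (of_bool (shell k z y) * SS p z y * ew z y) + of_bool (y \<in> V) * (of_bool (shell k y z) * SS p z y * ew z y)"
    by (cases "far k z y"; cases "shell k z y"; cases "shell k y z"; cases "y \<in> V") (auto simp: add_increasing2)
  qed
  also have "... \<le> ennreal (C * exp (- real k / 4)) + ennreal CM * ennreal (C * exp (- real k / 4))"
   unfolding nsum_add by (intro add_mono up[OF z] down_sum[OF p0 p(2) z up]) auto
  also have "... \<le> ennreal (C * exp (- real k / 4)) + ennreal \<bar>CM\<bar> * ennreal (C * exp (- real k / 4))"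
   by (intro add_left_mono mult_right_mono ennreal_leI) auto
  also have "... = ennreal (g k)" unfolding g_def C'_def rk using C r by (simp add: ennreal_mult'[symmetric] ennreal_plus[symmetric] algebra_simps del: ennreal_plus)
  finally show ?thesis .
 qed
 define Q where "Q = C' / (1 - r)"
 have Q: "0 \<le> Q" unfolding Q_def using C' r by simp
 have gs: "(\<Sum>j<k. g j) \<le> Q" for k
 proof -
  have "(\<Sum>j<k. g j) = C' * (\<Sum>j<k. r ^ j)" unfolding g_def by (rule sum_distrib_left[symmetric])
  also have "(\<Sum>j<k. r ^ j) = (1 - r ^ k) / (1 - r)" using geometric_sum[of r k] r by (simp add: field_simps)
  also have "C' * ((1 - r ^ k) / (1 - r)) \<le> C' * (1 / (1 - r))" using r by (intro mult_left_mono divide_right_mono C') auto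
  finally show ?thesis unfolding Q_def by simp
 qed
 define P where "P = exp Q"
 have prod: "(\<Prod>j<k. 1 + g (Suc j)) \<le> P" for k
 proof -
  have "(\<Prod>j<k. 1 + g (Suc j)) \<le> (\<Prod>j<k. exp (g (Suc j)))" by (intro prod_mono) (use g in \<open>auto simp: add_nonneg_nonneg\<close>)
  also have "... = exp (\<Sum>j<k. g (Suc j))" by (simp add: exp_sum)
  also have "(\<Sum>j<k. g (Suc j)) \<le> (\<Sum>j<Suc k. g j)" unfolding sum.lessThan_Suc_shift using g by simp
  also have "... \<le> Q" by (rule gs)
  finally show ?thesis unfolding P_def by simp
 qed
 have rows: "nsum (\<lambda>y. of_bool (y \<in> V) * ew x y * KI p 1 x y) \<le> ennreal P" if x: "x \<in> V" for x
 proof (rule KI_sum[OF p0 p(2)])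
  fix k
  have "nsum (\<lambda>y. of_bool (y \<in> V) * ew x y * KK p 1 k x y) = nsum (\<lambda>y. of_bool (y \<in> V) * (KK p 1 k x y * ew x y))" by (simp only: mult_ac)
  also have "... \<le> ennreal (\<Prod>j<k. 1 + g (Suc j))" by (rule KK_rows[OF p0 p(2) gam g _ x]) auto
  also have "... \<le> ennreal P" by (rule ennreal_leI[OF prod])
  finally show "nsum (\<lambda>y. of_bool (y \<in> V) * ew x y * KK p 1 k x y) \<le> ennreal P" .
 qed
 have cols: "nsum (\<lambda>x. of_bool (x \<in> V) * ew y x * KI p (- 1) x y) \<le> ennreal P" if y: "y \<in> V" for y
 proof (rule KI_sum[OF p0 p(2)])
  fix k
  have "nsum (\<lambda>x. of_bool (x \<in> V) * ew y x * KK p (- 1) k x y) = nsum (\<lambda>x. of_bool (x \<in> V) * (KK p (- 1) k x y * ew y x))" by (simp only: mult_ac)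
  also have "... \<le> ennreal (\<Prod>j<k. 1 + g (Suc j))" by (rule KK_cols[OF p0 p(2) gam g _ y]) auto
  also have "... \<le> ennreal P" by (rule ennreal_leI[OF prod])
  finally show "nsum (\<lambda>x. of_bool (x \<in> V) * ew y x * KK p (- 1) k x y) \<le> ennreal P" .
 qed
 have mid: "nsum (\<lambda>y. of_bool (y \<in> V) * (SS p z y * ew z y)) \<le> ennreal Q" if z: "z \<in> V" for z
 proof (rule nsum_le)
  fix A :: "'a set" assume A: "finite A"
  define n where "n = Suc (Max (insert 0 ((\<lambda>y. nat \<bar>\<lfloor>h z\<rfloor> - \<lfloor>h y\<rfloor>\<bar>) ` A)))"
  have n: "nat \<bar>\<lfloor>h z\<rfloor> - \<lfloor>h y\<rfloor>\<bar> < n" if "y \<in> A" for y unfolding n_def using that A by (auto simp: less_Suc_eq_le)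
  have "(\<Sum>y\<in>A. of_bool (y \<in> V) * (SS p z y * ew z y)) = (\<Sum>y\<in>A. \<Sum>k<n. of_bool (y \<in> V) * (of_bool (far k z y) * SS p z y * ew z y))"
  proof (rule sum.cong[OF refl])
   fix y assume y: "y \<in> A"
   have "(\<Sum>k<n. of_bool (y \<in> V) * (of_bool (far k z y) * SS p z y * ew z y)) =
    (\<Sum>k\<in>{nat \<bar>\<lfloor>h z\<rfloor> - \<lfloor>h y\<rfloor>\<bar>}. of_bool (y \<in> V) * (of_bool (far k z y) * SS p z y * ew z y))"
    by (rule sum.mono_neutral_right) (use n[OF y] in \<open>auto simp: far_def\<close>)
   then show "of_bool (y \<in> V) * (SS p z y * ew z y) = (\<Sum>k<n. of_bool (y \<in> V) * (of_bool (far k z y) * SS p z y * ew z y))"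
    by (simp add: far_def)
  qed
  also have "... = (\<Sum>k<n. \<Sum>y\<in>A. of_bool (y \<in> V) * (of_bool (far k z y) * SS p z y * ew z y))" by (rule sum.swap)
  also have "... \<le> (\<Sum>k<n. ennreal (g k))" by (intro sum_mono order_trans[OF sum_le_nsum[OF A] gam[OF z]])
  also have "... = ennreal (\<Sum>k<n. g k)" by (rule sum_ennreal) (rule g)
  also have "... \<le> ennreal Q" by (rule ennreal_leI[OF gs])
  finally show "(\<Sum>y\<in>A. of_bool (y \<in> V) * (SS p z y * ew z y)) \<le> ennreal Q" .
 qed
 show thesis
 proof (rule that[of "P * (Q * P)"])
  show "0 \<le> P * (Q * P)" unfolding P_def using Q by simp
  fix x assume x: "x \<in> V"
  let ?f = "\<lambda>v z z'. (of_bool (z \<in> V) * ew x z * KI p 1 x z) * ((of_bool (z' \<in> V) * (SS p z z' * ew z z')) * (of_bool (v \<in> V) * ew z' v * KI p (- 1) v z'))"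
  have "chi p x \<le> nsum (\<lambda>v. nsum (\<lambda>z. nsum (?f v z)))"
   unfolding chi_def
  proof (rule nsum_mono)
   fix v
   show "of_bool (v \<in> V) * (tau E p V x v * ew x v) \<le> nsum (\<lambda>z. nsum (?f v z))"
   proof (cases "v \<in> V")
    case True
    have "tau E p V x v * ew x v \<le> nsum (\<lambda>z. of_bool (z \<in> V) * (KI p 1 x z * nsum (\<lambda>z'. of_bool (z' \<in> V) * (SS p z z' * KI p (- 1) v z')))) * ew x v"
     by (rule mult_right_mono[OF tau_zigzag[OF p0 p(2) x True]]) simp
    also have "... = nsum (\<lambda>z. nsum (\<lambda>z'. of_bool (z \<in> V) * (KI p 1 x z * (of_bool (z' \<in> V) * (SS p z z' * KI p (- 1) v z'))) * ew x v))"
     by (simp only: nsum_multc nsum_cmult)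
    also have "(\<lambda>z. nsum (\<lambda>z'. of_bool (z \<in> V) * (KI p 1 x z * (of_bool (z' \<in> V) * (SS p z z' * KI p (- 1) v z'))) * ew x v)) = (\<lambda>z. nsum (?f v z))"
    proof (rule ext, rule arg_cong[of _ _ nsum], rule ext)
     fix z z'
     have e: "ew x v = ew x z * (ew z z' * ew z' v)" by (simp only: ew_mult)
     show "of_bool (z \<in> V) * (KI p 1 x z * (of_bool (z' \<in> V) * (SS p z z' * KI p (- 1) v z'))) * ew x v = ?f v z z'"
      unfolding e using True by (cases "z \<in> V"; cases "z' \<in> V") (simp_all add: mult_ac)
    qed
    finally show ?thesis using True by simp
   qed simp
  qed
  also have "... = nsum (\<lambda>z. nsum (\<lambda>v. nsum (?f v z)))" by (rule nsum_swap)
  also have "... = nsum (\<lambda>z. nsum (\<lambda>z'. nsum (\<lambda>v. ?f v z z')))" by (rule arg_cong[of _ _ nsum], rule ext, rule nsum_swap)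
  also have "... \<le> nsum (\<lambda>z. (of_bool (z \<in> V) * ew x z * KI p 1 x z) * (ennreal Q * ennreal P))"
  proof (rule nsum_mono)
   fix z
   have "nsum (\<lambda>z'. (of_bool (z' \<in> V) * (SS p z z' * ew z z')) * nsum (\<lambda>v. of_bool (v \<in> V) * ew z' v * KI p (- 1) v z')) \<le> ennreal Q * ennreal P" if z: "z \<in> V"
   proof -
    have "nsum (\<lambda>z'. (of_bool (z' \<in> V) * (SS p z z' * ew z z')) * nsum (\<lambda>v. of_bool (v \<in> V) * ew z' v * KI p (- 1) v z')) \<le> nsum (\<lambda>z'. (of_bool (z' \<in> V) * (SS p z z' * ew z z')) * ennreal P)"
    proof (rule nsum_mono)
     fix z'
     show "(of_bool (z' \<in> V) * (SS p z z' * ew z z')) * nsum (\<lambda>v. of_bool (v \<in> V) * ew z' v * KI p (- 1) v z') \<le> (of_bool (z' \<in> V) * (SS p z z' * ew z z')) * ennreal P"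
      by (cases "z' \<in> V") (auto intro!: mult_left_mono cols)
    qed
    also have "... \<le> ennreal Q * ennreal P" unfolding nsum_multc by (intro mult_right_mono mid z) simp
    finally show ?thesis .
   qed
   then show "nsum (\<lambda>z'. nsum (\<lambda>v. ?f v z z')) \<le> (of_bool (z \<in> V) * ew x z * KI p 1 x z) * (ennreal Q * ennreal P)"
    unfolding nsum_cmult by (cases "z \<in> V") (auto intro!: mult_left_mono)
  qed
  also have "... \<le> ennreal P * (ennreal Q * ennreal P)" unfolding nsum_multc by (intro mult_right_mono rows x) simp
  also have "... = ennreal (P * (Q * P))" using Q unfolding P_def by (simp add: ennreal_mult')
  finally show "chi p x \<le> ennreal (P * (Q * P))" .
 qed
qed

end

section \<open>Openness of the subcritical regime\<close>

lemma con_inside: "con U S x y \<longleftrightarrow> con U {e \<in> S. e \<subseteq> U} x y"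
proof
 assume c: "con U S x y"
 have "con U {e \<in> S. e \<subseteq> U} x z" if "con U S x z" for z
  using that
 proof (induction rule: con_induct)
  case refl
  show ?case using con_in[OF c] by simp
 next
  case (step u v)
  then have "{u, v} \<in> {e \<in> S. e \<subseteq> U}" using con_in(2)[OF step(1)] by simp
  then show ?case by (rule con_step[OF step(4,2)])
 qed
 then show "con U {e \<in> S. e \<subseteq> U} x y" using c by simp
next
 assume c: "con U {e \<in> S. e \<subseteq> U} x y"
 show "con U S x y" by (rule con_mono[OF c]) auto
qed

lemma cp_inside: assumes "finite F" shows "cp p F U x y = cp p {e \<in> F. e \<subseteq> U} U x y"
 unfolding cp_def
proof (rule pexp_superset[OF assms])
 fix S assume "S \<subseteq> F"
 then have "{e \<in> S. e \<subseteq> U} = S \<inter> {e \<in> F. e \<subseteq> U}" by auto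
 then show "of_bool (con U S x y) = of_bool (con U (S \<inter> {e \<in> F. e \<subseteq> U}) x y)" using con_inside[of U S x y] by simp
qed auto

context hgraph
begin

definition sph :: "nat \<Rightarrow> 'a \<Rightarrow> 'a set" where "sph n x = bal (Suc n) x - bal n x"

text \<open>A finite-size criterion: the tilted mean number of vertices on the next sphere that are
  reached inside the ball. It is polynomial in \<open>p\<close>, and values bounded below 1 control
  the tilted two-point function.\<close>

definition phi :: "real \<Rightarrow> nat \<Rightarrow> 'a \<Rightarrow> real" where
 "phi p n x = (\<Sum>z\<in>sph n x. cp p (Eb (Suc n) x) (bal (Suc n) x) x z * exp ((h z - h x) / 2))"

lemma finite_sph: "x \<in> V ==> finite (sph n x)" unfolding sph_def using finite_bal[of x "Suc n"] by blast

lemma phi_cont: "continuous_on UNIV (\<lambda>p. phi p n x)"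
 unfolding phi_def cp_def by (intro continuous_on_sum continuous_on_mult continuous_on_const pexp_continuous)

text \<open>The spheres are disjoint, so the sum of \<open>phi p n x\<close> over \<open>n\<close>
  is at most \<open>chi p x\<close>, and its terms cannot all be large.\<close>

lemma phi_small:
 assumes p: "0 \<le> p" "p \<le> 1" and x: "x \<in> V" and C: "chi p x \<le> ennreal C" "0 \<le> C"
 shows "\<exists>n. phi p n x < 1 / 2"
proof (rule ccontr)
 assume "\<nexists>n. phi p n x < 1 / 2"
 then have big: "1 / 2 \<le> phi p n x" for n by (simp add: not_less)
 let ?f = "\<lambda>z. of_bool (z \<in> V) * (tau E p V x z * ew x z)"
 have one: "ennreal (phi p n x) \<le> (\<Sum>z\<in>sph n x. ?f z)" for n
 proof -
  have "ennreal (phi p n x) = (\<Sum>z\<in>sph n x. ennreal (cp p (Eb (Suc n) x) (bal (Suc n) x) x z * exp ((h z - h x) / 2)))"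
   unfolding phi_def by (rule sum_ennreal[symmetric]) (intro mult_nonneg_nonneg cp_nonneg[OF p] exp_ge_zero)
  also have "... \<le> (\<Sum>z\<in>sph n x. ?f z)"
  proof (rule sum_mono)
   fix z assume z: "z \<in> sph n x"
   have zV: "z \<in> V" using z bal_V[OF x] unfolding sph_def by blast
   have "ennreal (cp p (Eb (Suc n) x) (bal (Suc n) x) x z) \<le> tau E p (bal (Suc n) x) x z"
    by (rule cp_le_tau[OF finite_Eb[OF x]]) (auto simp: Eb_def)
   also have "... \<le> tau E p V x z" by (rule tau_mono[OF p bal_V[OF x]])
   finally have "ennreal (cp p (Eb (Suc n) x) (bal (Suc n) x) x z) * ew x z \<le> tau E p V x z * ew x z" by (rule mult_right_mono) simp
   then show "ennreal (cp p (Eb (Suc n) x) (bal (Suc n) x) x z * exp ((h z - h x) / 2)) \<le> ?f z" using zV by (simp add: ennreal_mult'')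
  qed
  finally show ?thesis .
 qed
 have NC: "real N * (1 / 2) \<le> C" for N
 proof -
  have "ennreal (real N * (1 / 2)) = (\<Sum>n<N. ennreal (1 / 2))" by (subst sum_ennreal) auto
  also have "... \<le> (\<Sum>n<N. \<Sum>z\<in>sph n x. ?f z)" by (intro sum_mono order_trans[OF ennreal_leI[OF big] one])
  also have "... = (\<Sum>z\<in>(\<Union>n<N. sph n x). ?f z)"
  proof (rule sum.UNION_disjoint[symmetric])
   show "\<forall>i\<in>{..<N}. finite (sph i x)" using finite_sph[OF x] by blast
   show "\<forall>i\<in>{..<N}. \<forall>j\<in>{..<N}. i \<noteq> j \<longrightarrow> sph i x \<inter> sph j x = {}"
   proof (intro ballI impI)
    have lt: "sph i x \<inter> sph j x = {}" if "i < j" for i j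
     using bal_mono[of "Suc i" j x] that unfolding sph_def by auto
    fix i j :: nat assume "i \<noteq> j"
    then show "sph i x \<inter> sph j x = {}" using lt[of i j] lt[of j i] by (cases "i < j") auto
   qed
  qed simp
  also have "... \<le> nsum ?f" by (rule sum_le_nsum) (use finite_sph[OF x] in blast)
  also have "... \<le> ennreal C" using C(1) unfolding chi_def .
  finally show ?thesis using C(2) by (simp only: ennreal_le_iff)
 qed
 obtain N where "C * 2 < real N" using reals_Archimedean2[of "C * 2"] by auto
 then show False using NC[of N] by linarith
qed

lemma act_E_surj: assumes g: "g \<in> \<Gamma>" shows "(`) g ` E = E"
proof
 show "(`) g ` E \<subseteq> E" using act_edge[OF g] edge_sub by blast
 show "E \<subseteq> (`) g ` E"
 proof
  fix e assume e: "e \<in> E"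
  obtain l where l: "l \<in> \<Gamma>" "\<forall>x\<in>V. l (g x) = x \<and> g (l x) = x" using act_inv[OF g] by auto
  have eV: "e \<subseteq> V" using edge_sub[OF e] .
  have "g ` l ` e = e" using l eV by (force simp: image_image)
  moreover have "l ` e \<in> E" using act_edge[OF l(1) eV] e by simp
  ultimately show "e \<in> (`) g ` E" by (intro image_eqI[of _ _ "l ` e"]) auto
 qed
qed

lemma phi_act: assumes g: "g \<in> \<Gamma>" "x \<in> V" shows "phi p n (g x) = phi p n x"
proof -
 have Eb: "Eb k (g x) = (`) g ` Eb k x" for k
 proof -
  have "Eb k y \<subseteq> E" for y unfolding Eb_def by auto
  then have "E \<inter> Eb k (g x) = Eb k (g x)" "E \<inter> Eb k x = Eb k x" by blast+
  then show ?thesis using act_Eb[OF g order_refl, of k] act_E_surj[OF g(1)] by simp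
 qed
 have inj: "inj_on g V" using act_inj[OF g(1)] by (auto simp: inj_on_def)
 have sph: "sph n (g x) = g ` sph n x" unfolding sph_def act_bal[OF g]
  by (rule inj_on_image_set_diff[OF inj, symmetric]) (use bal_V[OF g(2)] in blast)+
 have sV: "sph n x \<subseteq> V" using bal_V[OF g(2)] unfolding sph_def by blast
 have "phi p n (g x) = (\<Sum>z\<in>sph n x. cp p (Eb (Suc n) (g x)) (bal (Suc n) (g x)) (g x) (g z) * exp ((h (g z) - h (g x)) / 2))"
  unfolding phi_def sph by (rule sum.reindex_cong[OF inj_on_subset[OF inj sV] refl refl])
 also have "... = phi p n x" unfolding phi_def
 proof (rule sum.cong[OF refl])
  fix z assume "z \<in> sph n x"
  then have z: "z \<in> V" using sV by auto
  have "cp p (Eb (Suc n) (g x)) (bal (Suc n) (g x)) (g x) (g z) = cp p (Eb (Suc n) x) (bal (Suc n) x) x z"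
   unfolding Eb act_bal[OF g] by (rule cp_act[OF g(1) bal_V[OF g(2)] g(2) z]) (auto simp: Eb_def)
  then show "cp p (Eb (Suc n) (g x)) (bal (Suc n) (g x)) (g x) (g z) * exp ((h (g z) - h (g x)) / 2) = cp p (Eb (Suc n) x) (bal (Suc n) x) x z * exp ((h z - h x) / 2)"
   using h_act[OF g(1) z g(2)] by simp
 qed
 finally show ?thesis .
qed

text \<open>Cutting paths at the exit from a ball around \<open>y\<close> gives
  \<open>X y \<le> K + m / 2\<close>, where \<open>m\<close> is the maximum of \<open>X\<close> over
  the finitely many vertices present. As \<open>m\<close> is finite, it is at most
  \<open>2 * K\<close>. The radius may vary with \<open>y\<close> as long as \<open>N\<close> bounds
  it.\<close>

lemma phi_bound:
 assumes p: "0 \<le> p" "p \<le> 1" and n: "\<And>x. x \<in> V ==> \<exists>n\<le>N. phi p n x < 1 / 2"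
  and F: "finite F" "F \<subseteq> E" and x: "x \<in> V" "v \<in> V"
 shows "cp p F V x v * exp ((h v - h x) / 2) \<le> 2 * (real (Suc deg ^ N) * exp (real N * M / 2))"
proof -
 define K where "K = real (Suc deg ^ N) * exp (real N * M / 2)"
 define W where "W = insert x (insert v (\<Union>F))"
 have W: "finite W" "W \<subseteq> V" unfolding W_def using finite_Union_edges[OF F] x F(2) edge_sub by auto
 define X where "X y = (\<Sum>v\<in>W. cp p F V y v * exp ((h v - h y) / 2))" for y
 define m where "m = Max (X ` W)"
 have m: "X y \<le> m" if "y \<in> W" for y unfolding m_def using that W(1) by simp
 have nn: "0 \<le> cp p F U a b" for U a b by (rule cp_nonneg[OF p])
 have X0: "0 \<le> X y" for y unfolding X_def by (intro sum_nonneg mult_nonneg_nonneg nn) auto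
 have m0: "0 \<le> m" using m[of x] X0[of x] unfolding W_def by simp
 have step: "X y \<le> K + m / 2" if yW: "y \<in> W" for y
 proof -
  have yV: "y \<in> V" using yW W by auto
  obtain n where n: "n \<le> N" "phi p n y < 1 / 2" using n[OF yV] by blast
  define Z where "Z = sph n y \<inter> W"
  let ?B = "bal n y" and ?U = "bal (Suc n) y"
  have Z: "finite Z" unfolding Z_def using W(1) by simp
  have sp: "cp p F V y u \<le> of_bool (u \<in> ?B) + (\<Sum>z\<in>Z. cp p F ?U y z * cp p F V z u)" if uW: "u \<in> W" for u
  proof (cases "u \<in> ?B")
   case True
   then show ?thesis using cp_le1[OF p F(1), of V y u] nn by (simp add: add_increasing2 sum_nonneg)
  next
   case False
   have "cp p F V y u \<le> (\<Sum>z\<in>Z. cp p F ?U y z * cp p F V z u)"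
   proof (rule cp_split[OF F(1) p Z])
    fix xs assume xs: "spath V xs y u" "ed xs \<subseteq> F"
    have xs': "xs \<noteq> []" "hd xs = y" "last xs = u" "set xs \<subseteq> V" using xs(1) unfolding spath_def by auto
    have "u \<in> set xs" using xs' last_in_set by metis
    then obtain as z bs where z: "xs = as @ z # bs" "z \<notin> ?B" "\<forall>a\<in>set as. \<not> a \<notin> ?B"
     by (rule spath_first[OF xs(1), of u "\<lambda>a. a \<notin> ?B"]) (use False in auto)
    have "as \<noteq> []" using z xs'(2) bal_self[of y n] by auto
    then have bl: "butlast as @ [last as] = as" by simp
    have "xs = (butlast as @ [last as]) @ z # bs" unfolding bl by (rule z(1))
    then have x1: "xs = butlast as @ last as # z # bs" by (simp only: append.assoc append_Cons append_Nil)
    have "ed xs = ed (butlast as @ [last as]) \<union> ed (last as # z # bs)"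
     unfolding x1 by (rule ed_append)
    then have e': "{last as, z} \<in> ed xs" by simp
    then have e: "{last as, z} \<in> E" using xs(2) F(2) by blast
    have "last as \<in> set as" using \<open>as \<noteq> []\<close> by simp
    then have "last as \<in> ?B" using z(3) by blast
    moreover have "z \<in> nb (last as)" using e unfolding nb_def by simp
    ultimately have zU: "z \<in> ?U" unfolding bal.simps by blast
    have "z \<in> W" using e' xs(2) unfolding W_def by blast
    then have "z \<in> Z" unfolding Z_def sph_def using zU z(2) by blast
    moreover have "set (as @ [z]) \<subseteq> ?U" using z(3) zU by auto
    moreover have "set (z # bs) \<subseteq> V" using xs'(4) z(1) by auto
    ultimately show "\<exists>z\<in>Z. \<exists>as bs. xs = as @ z # bs \<and> set (as @ [z]) \<subseteq> ?U \<and> set (z # bs) \<subseteq> V" using z(1) by blast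
   qed
   then show ?thesis by simp
  qed
  have "X y \<le> (\<Sum>u\<in>W. (of_bool (u \<in> ?B) + (\<Sum>z\<in>Z. cp p F ?U y z * cp p F V z u)) * exp ((h u - h y) / 2))"
   unfolding X_def by (intro sum_mono mult_right_mono sp) auto
  also have "... = (\<Sum>u\<in>W. of_bool (u \<in> ?B) * exp ((h u - h y) / 2)) + (\<Sum>u\<in>W. \<Sum>z\<in>Z. cp p F ?U y z * cp p F V z u * exp ((h u - h y) / 2))"
   by (simp only: distrib_right sum.distrib sum_distrib_right)
  also have "(\<Sum>u\<in>W. \<Sum>z\<in>Z. cp p F ?U y z * cp p F V z u * exp ((h u - h y) / 2)) = (\<Sum>z\<in>Z. \<Sum>u\<in>W. cp p F ?U y z * cp p F V z u * exp ((h u - h y) / 2))"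
   by (rule sum.swap)
  also have "... = (\<Sum>z\<in>Z. cp p F ?U y z * exp ((h z - h y) / 2) * X z)"
   unfolding X_def sum_distrib_left
  proof (rule sum.cong[OF refl], rule sum.cong[OF refl])
   fix z u
   have "exp ((h u - h y) / 2) = exp ((h z - h y) / 2) * exp ((h u - h z) / 2)" by (simp add: field_simps flip: exp_add)
   then show "cp p F ?U y z * cp p F V z u * exp ((h u - h y) / 2) = cp p F ?U y z * exp ((h z - h y) / 2) * (cp p F V z u * exp ((h u - h z) / 2))" by simp
  qed
  also have "... \<le> (\<Sum>z\<in>Z. cp p F ?U y z * exp ((h z - h y) / 2) * m)"
   by (intro sum_mono mult_left_mono m mult_nonneg_nonneg nn) (auto simp: Z_def)
  also have "... = (\<Sum>z\<in>Z. cp p F ?U y z * exp ((h z - h y) / 2)) * m" by (rule sum_distrib_right[symmetric])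
  also have "... \<le> phi p n y * m"
  proof (rule mult_right_mono[OF _ m0])
   have le: "cp p F ?U y z \<le> cp p (Eb (Suc n) y) ?U y z" for z
   proof -
    have "cp p F ?U y z = cp p {e \<in> F. e \<subseteq> ?U} ?U y z" by (rule cp_inside[OF F(1)])
    also have "... \<le> cp p (Eb (Suc n) y) ?U y z"
     by (rule cp_mono[OF p finite_Eb[OF yV]]) (use F(2) in \<open>auto simp: Eb_def\<close>)
    finally show ?thesis .
   qed
   have "(\<Sum>z\<in>Z. cp p F ?U y z * exp ((h z - h y) / 2)) \<le> (\<Sum>z\<in>Z. cp p (Eb (Suc n) y) ?U y z * exp ((h z - h y) / 2))"
    by (intro sum_mono mult_right_mono le) auto
   also have "... \<le> phi p n y" unfolding phi_def
    by (rule sum_mono2[OF finite_sph[OF yV]]) (auto simp: Z_def simp del: bal.simps intro!: mult_nonneg_nonneg cp_nonneg[OF p])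
   finally show "(\<Sum>z\<in>Z. cp p F ?U y z * exp ((h z - h y) / 2)) \<le> phi p n y" .
  qed
  also have "... \<le> 1 / 2 * m" using n(2) m0 by (intro mult_right_mono) auto
  also have "(\<Sum>u\<in>W. of_bool (u \<in> ?B) * exp ((h u - h y) / 2)) \<le> K"
  proof -
   have "(\<Sum>u\<in>W. of_bool (u \<in> ?B) * exp ((h u - h y) / 2)) = (\<Sum>u\<in>W \<inter> ?B. exp ((h u - h y) / 2))"
    by (rule sum.mono_neutral_cong_right) (use W in auto)
   also have "... \<le> (\<Sum>u\<in>W \<inter> ?B. exp (real N * M / 2))"
   proof (rule sum_mono)
    fix u assume "u \<in> W \<inter> ?B"
    then have "\<bar>h u - h y\<bar> \<le> n * M" using bal_h[OF yV, of u n] by simp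
    also have "... \<le> N * M" using n(1) M_nn by (intro mult_right_mono) auto
    finally show "exp ((h u - h y) / 2) \<le> exp (real N * M / 2)" by simp
   qed
   also have "... = real (card (W \<inter> ?B)) * exp (real N * M / 2)" by simp
   also have "... \<le> K" unfolding K_def
   proof (intro mult_right_mono of_nat_mono)
    have "card (W \<inter> ?B) \<le> card ?B" by (rule card_mono[OF finite_bal[OF yV]]) auto
    also have "... \<le> Suc deg ^ n" by (rule card_bal[OF yV])
    also have "... \<le> Suc deg ^ N" using n(1) by (intro power_increasing) auto
    finally show "card (W \<inter> ?B) \<le> Suc deg ^ N" .
   qed simp
   finally show ?thesis .
  qed
  finally show ?thesis by simp
 qed
 have "m \<in> X ` W" unfolding m_def by (rule Max_in) (use W in \<open>auto simp: W_def\<close>)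
 then have "m \<le> K + m / 2" using step by auto
 then have "m \<le> 2 * K" by simp
 moreover have "cp p F V x v * exp ((h v - h x) / 2) \<le> X x" unfolding X_def
  by (rule member_le_sum[of v]) (use W nn in \<open>auto simp: W_def\<close>)
 ultimately show ?thesis using m[of x] unfolding K_def W_def by simp
qed

text \<open>Up to \<Gamma> there are finitely many vertices, and for each of them the strict
  inequality for \<open>phi\<close> persists slightly above \<open>p\<close> by continuity.\<close>

lemma open_bound:
 assumes p: "0 \<le> p" "p < 1" and C: "0 \<le> C" "\<And>x. x \<in> V ==> chi p x \<le> ennreal C"
 shows "\<exists>p1 K. p < p1 \<and> p1 \<le> 1 \<and> (\<forall>F x v. finite F \<longrightarrow> F \<subseteq> E \<longrightarrow> x \<in> V \<longrightarrow> v \<in> V \<longrightarrow> cp p1 F V x v * exp ((h v - h x) / 2) \<le> K)"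
proof -
 obtain B where B: "finite B" "B \<subseteq> V" "\<forall>x\<in>V. \<exists>r\<in>B. \<exists>g\<in>\<Gamma>. x = g r" using quasi by auto
 have "\<forall>r\<in>B. \<exists>n. phi p n r < 1 / 2" using phi_small[OF p(1) less_imp_le[OF p(2)] _ C(2) C(1)] B(2) by blast
 then obtain nn where nn: "\<forall>r\<in>B. phi p (nn r) r < 1 / 2" by (rule bchoice[THEN exE])
 have "\<forall>r\<in>B. eventually (\<lambda>q. phi q (nn r) r < 1 / 2) (at_right p)"
 proof
  fix r assume r: "r \<in> B"
  have "isCont (\<lambda>q. phi q (nn r) r) p" using phi_cont[of "nn r" r] by (simp add: continuous_on_eq_continuous_at)
  then have "((\<lambda>q. phi q (nn r) r) \<longlongrightarrow> phi p (nn r) r) (at_right p)" unfolding isCont_def by (rule filterlim_at_split[THEN iffD1, THEN conjunct2])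
  then show "eventually (\<lambda>q. phi q (nn r) r < 1 / 2) (at_right p)" by (rule order_tendstoD(2)) (use nn r in simp)
 qed
 then have "eventually (\<lambda>q. \<forall>r\<in>B. phi q (nn r) r < 1 / 2) (at_right p)" using B(1) by (simp add: eventually_ball_finite_distrib)
 then obtain b where b: "p < b" "\<forall>q. p < q \<longrightarrow> q < b \<longrightarrow> (\<forall>r\<in>B. phi q (nn r) r < 1 / 2)"
  unfolding eventually_at_right_field by blast
 define p1 where "p1 = (p + min b 1) / 2"
 have p1: "p < p1" "p1 < b" "p1 \<le> 1" unfolding p1_def using b(1) p by auto
 define N where "N = Max (insert 0 (nn ` B))"
 have N: "nn r \<le> N" if "r \<in> B" for r unfolding N_def using that B(1) by simp
 have ex: "\<exists>n\<le>N. phi p1 n x < 1 / 2" if x: "x \<in> V" for x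
 proof -
  obtain r g where r: "r \<in> B" "g \<in> \<Gamma>" "x = g r" using B(3) x by blast
  have "phi p1 (nn r) x = phi p1 (nn r) r" unfolding r(3) by (rule phi_act[OF r(2)]) (use r(1) B(2) in blast)
  then show ?thesis using b(2) p1 r(1) N[OF r(1)] by (intro exI[of _ "nn r"]) auto
 qed
 have "cp p1 F V x v * exp ((h v - h x) / 2) \<le> 2 * (real (Suc deg ^ N) * exp (real N * M / 2))"
  if "finite F" "F \<subseteq> E" "x \<in> V" "v \<in> V" for F x v
  by (rule phi_bound[OF _ p1(3) ex that]) (use p p1 in auto)
 then show ?thesis using p1 by blast
qed

text \<open>Covers a critical parameter equal to 0, where the forcing estimates, which divide by
  powers of \<open>p\<close>, say nothing.\<close>

lemma chi_zero: assumes x: "x \<in> V" shows "chi 0 x \<le> ennreal 1"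
proof -
 have "chi 0 x \<le> nsum (\<lambda>v. of_bool (x = v))" unfolding chi_def
 proof (rule nsum_mono)
  fix v
  have "tau E 0 V x v \<le> of_bool (x = v)"
  proof (rule tau_le)
   fix F :: "'a set set" assume F: "finite F" "F \<subseteq> E"
   have "cp 0 F V x v \<le> of_bool (x = v)"
   proof (cases "x = v")
    case True
    then show ?thesis using cp_le1[of 0 F V x v] F by simp
   next
    case False
    have "(0::real) ^ card S * of_bool (con V S x v) = 0" if "S \<subseteq> F" for S
    proof (cases "S = {}")
     case True
     have "\<not> con V {} x v" using con_last[of V "{}" x v] False by auto
     then show ?thesis using True by simp
    qed (use that F finite_subset[of S F] in \<open>simp add: card_gt_0_iff\<close>)
    then have "cp 0 F V x v = 0" unfolding cp_def pexp_def by (intro sum.neutral) (auto simp: mult.assoc mult.left_commute)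
    then show ?thesis by simp
   qed
   then show "ennreal (cp 0 F V x v) \<le> of_bool (x = v)" by (cases "x = v") (auto simp: ennreal_le_1 ennreal_neg)
  qed
  then have "tau E 0 V x v * ew x v \<le> of_bool (x = v) * ew x v" by (rule mult_right_mono) simp
  also have "... \<le> of_bool (x = v)" by (cases "x = v") auto
  finally show "of_bool (v \<in> V) * (tau E 0 V x v * ew x v) \<le> of_bool (x = v)" by (cases "v \<in> V") auto
 qed
 also have "... = (\<Sum>v\<in>{x}. of_bool (x = v))" by (rule nsum_finite) auto
 finally show ?thesis by simp
qed

text \<open>At parameter 1 climbing is certain, against decay at rate 1. This later keeps the
  critical parameter below 1 and leaves room above it.\<close>

lemma not_subcr_one: "\<not> subcr 1"
proof
 assume s: "subcr 1"
 have "1 ^ 1 \<le> pexp 1 (UP 1 rt) (\<lambda>S. of_bool (UpTo rt c0 S))" by (rule UP_prob) (use rt_V in auto)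
 also have "... \<le> 1 / 1 ^ ll * exp (- 1 * c0)"
  by (rule decay_one[OF _ _ s orb_self[OF rt_V]]) (use c0_pos UP_E[OF rt_V] in auto)
 finally show False using c0_pos by simp
qed

end

section \<open>The percolation measure\<close>

text \<open>After its last passage through the removed edge, a path starts from one of the ends of
  that edge.\<close>

lemma con_remove:
 assumes "con U S x w" "u \<in> U" "v \<in> U"
 shows "con U (S - {{u, v}}) x w \<or> con U (S - {{u, v}}) u w \<or> con U (S - {{u, v}}) v w"
 using assms(1)
proof (induction rule: con_induct)
 case refl
 show ?case using con_in(1)[OF assms(1)] by simp
next
 case (step a b)
 show ?case
 proof (cases "{a, b} = {u, v}")
  case True
  then have "b = u \<or> b = v" by (auto simp: doubleton_eq_iff)
  then show ?thesis using assms(2,3) by auto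
 next
  case False
  then have e: "{a, b} \<in> S - {{u, v}}" using step(3) by simp
  from step(4) show ?thesis
   by (elim disjE) (blast intro: con_step[OF _ step(2) e])+
 qed
qed

lemma prob_space_percolation: "prob_space (percolation E p)"
 unfolding percolation_def by (intro prob_space_PiM prob_space_measure_pmf)

lemma percolation_Collect:
 assumes "K \<subseteq> E" "finite K"
 shows "measure (percolation E p) {\<omega> \<in> space (percolation E p). \<forall>e\<in>K. \<omega> e \<in> X e} = (\<Prod>e\<in>K. measure (bernoulli_pmf p) (X e))"
proof -
 interpret product_prob_space "\<lambda>_. measure_pmf (bernoulli_pmf p)" E
  by (intro product_prob_spaceI prob_space_measure_pmf)
 have "emeasure (percolation E p) {\<omega> \<in> space (percolation E p). \<forall>e\<in>K. \<omega> e \<in> X e} = (\<Prod>e\<in>K. emeasure (measure_pmf (bernoulli_pmf p)) (X e))"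
  unfolding percolation_def by (rule emeasure_PiM_Collect[OF assms]) simp
 also have "... = ennreal (\<Prod>e\<in>K. measure (bernoulli_pmf p) (X e))"
  unfolding measure_pmf.emeasure_eq_measure by (rule prod_ennreal) simp
 finally show ?thesis unfolding measure_def[of "percolation E p"] by (simp add: prod_nonneg)
qed

lemma sets_open: "e \<in> E ==> {\<omega> \<in> space (percolation E p). \<omega> e \<in> A} \<in> sets (percolation E p)"
proof -
 assume e: "e \<in> E"
 have "(\<lambda>\<omega>. \<omega> e) \<in> measurable (percolation E p) (measure_pmf (bernoulli_pmf p))"
  unfolding percolation_def by (rule measurable_component_singleton[OF e])
 from measurable_sets[OF this, of A] show ?thesis by (simp add: vimage_def Int_def conj_commute)
qed

lemma measure_bernoulli:
 assumes "0 \<le> p" "p \<le> 1" shows "measure (bernoulli_pmf p) {b} = (if b then p else 1 - p)"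
 using assms by (cases b) (simp_all add: measure_pmf_single)

text \<open>The bridge from the product measure to \<open>pexp\<close>: an event that reads finitely
  many edges is a disjoint union of the cylinders \<open>A S\<close>.\<close>

lemma finite_prob:
 assumes p: "0 \<le> p" "p \<le> 1" and F: "finite F" "F \<subseteq> E"
 shows "measure (percolation E p) {\<omega> \<in> space (percolation E p). Q (open_edges F \<omega>)} = pexp p F (\<lambda>S. of_bool (Q S))"
  and "{\<omega> \<in> space (percolation E p). Q (open_edges F \<omega>)} \<in> sets (percolation E p)"
proof -
 let ?M = "percolation E p"
 interpret prob_space ?M by (rule prob_space_percolation)
 define A where "A S = {\<omega> \<in> space ?M. \<forall>e\<in>F. \<omega> e \<in> {e \<in> S}}" for S
 have Aeq: "A S = {\<omega> \<in> space ?M. open_edges F \<omega> = S}" if "S \<subseteq> F" for S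
  unfolding A_def open_edges_def using that by auto
 have As: "A S \<in> sets ?M" for S
 proof (cases "F = {}")
  case True
  then show ?thesis unfolding A_def by simp
 next
  case False
  show ?thesis unfolding A_def by (rule sets.sets_Collect_finite_All'[OF _ F(1) False]) (use F(2) sets_open in blast)
 qed
 have Am: "prob (A S) = p ^ card S * (1 - p) ^ card (F - S)" if S: "S \<subseteq> F" for S
 proof -
  have "prob (A S) = (\<Prod>e\<in>F. measure (bernoulli_pmf p) {e \<in> S})" unfolding A_def by (rule percolation_Collect[OF F(2,1)])
  also have "... = (\<Prod>e\<in>F. if e \<in> S then p else 1 - p)" unfolding measure_bernoulli[OF p] ..
  also have "... = (\<Prod>e\<in>F \<inter> {e. e \<in> S}. p) * (\<Prod>e\<in>F \<inter> - {e. e \<in> S}. 1 - p)" by (rule prod.If_cases[OF F(1)])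
  also have "... = p ^ card S * (1 - p) ^ card (F - S)" using S by (simp add: Int_absorb1 Diff_eq)
  finally show ?thesis .
 qed
 have eq: "{\<omega> \<in> space ?M. Q (open_edges F \<omega>)} = (\<Union>S\<in>{S \<in> Pow F. Q S}. A S)"
 proof -
  have "open_edges F \<omega> \<subseteq> F" for \<omega> unfolding open_edges_def by auto
  then show ?thesis using Aeq by auto
 qed
 show "{\<omega> \<in> space ?M. Q (open_edges F \<omega>)} \<in> sets ?M" unfolding eq using As F(1) by (intro sets.finite_UN) auto
 have "prob (\<Union>S\<in>{S \<in> Pow F. Q S}. A S) = (\<Sum>S\<in>{S \<in> Pow F. Q S}. prob (A S))"
 proof (rule finite_measure_finite_Union)
  show "disjoint_family_on A {S \<in> Pow F. Q S}" unfolding disjoint_family_on_def using Aeq by auto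
 qed (use F(1) As in auto)
 also have "... = (\<Sum>S\<in>Pow F. p ^ card S * (1 - p) ^ card (F - S) * of_bool (Q S))"
  by (rule sum.mono_neutral_cong_left) (use F(1) Am in auto)
 finally show "measure ?M {\<omega> \<in> space ?M. Q (open_edges F \<omega>)} = pexp p F (\<lambda>S. of_bool (Q S))" unfolding eq pexp_def .
qed

section \<open>Infinite clusters, the zero-one law and translation invariance\<close>

context hgraph
begin

lemma V_Union: "V = (\<Union>n. bal n rt)"
 using bal_V[OF rt_V] bal_ex[OF rt_V] by blast

lemma countable_V: "countable V"
proof -
 have "countable (\<Union>n. bal n rt)" by (intro countable_UN countableI_type countable_finite finite_bal[OF rt_V])
 then show ?thesis unfolding V_Union[symmetric] .
qed

lemma E_Union: "E = (\<Union>n. Eb n rt)"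
proof
 show "E \<subseteq> (\<Union>n. Eb n rt)"
 proof
  fix e assume e: "e \<in> E"
  then obtain n where "{e} \<subseteq> Eb n rt" using edges_in_ball[of "{e}" rt] rt_V by auto
  then show "e \<in> (\<Union>n. Eb n rt)" by auto
 qed
qed (auto simp: Eb_def)

lemma countable_E: "countable E"
proof -
 have "countable (\<Union>n. Eb n rt)" by (intro countable_UN countableI_type countable_finite finite_Eb[OF rt_V])
 then show ?thesis unfolding E_Union[symmetric] .
qed

lemma infinite_V: "infinite V"
proof
 assume V: "finite V"
 have "inj (\<lambda>i. (up ^^ i) rt)"
 proof (rule injI)
  fix i j assume "(up ^^ i) rt = (up ^^ j) rt"
  then show "i = j" using upn_h_mono[OF rt_V, of i j] upn_h_mono[OF rt_V, of j i] by (cases i j rule: linorder_cases) auto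
 qed
 moreover have "finite (range (\<lambda>i. (up ^^ i) rt))" by (rule finite_subset[OF _ V]) (use upn_V[OF rt_V] in auto)
 ultimately show False using finite_imageD by blast
qed

definition infc :: "'a set set \<Rightarrow> 'a \<Rightarrow> bool" where "infc S x \<longleftrightarrow> infinite {v \<in> V. con V S x v}"

lemma infc_mono: "infc S x ==> S \<subseteq> T ==> infc T x"
 unfolding infc_def using con_mono[of V S x _ V T] by (elim contrapos_nn) (rule finite_subset, auto)

lemma infinite_iff_unbounded: assumes "C \<subseteq> V" shows "infinite C \<longleftrightarrow> (\<forall>n. \<exists>v\<in>V - bal n rt. v \<in> C)"
proof
 assume inf: "infinite C"
 show "\<forall>n. \<exists>v\<in>V - bal n rt. v \<in> C"
 proof (rule ccontr)
  assume "\<not> ?thesis"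
  then obtain n where "C \<subseteq> bal n rt" using assms by auto
  then show False using inf finite_subset[OF _ finite_bal[OF rt_V]] by blast
 qed
next
 assume a: "\<forall>n. \<exists>v\<in>V - bal n rt. v \<in> C"
 show "infinite C"
 proof
  assume "finite C"
  then have "\<exists>n. C \<subseteq> bal n rt" using assms
  proof (induction rule: finite_induct)
   case (insert c C)
   then obtain n where n: "C \<subseteq> bal n rt" by auto
   obtain k where "c \<in> bal k rt" using bal_ex[OF rt_V] insert by blast
   then have "insert c C \<subseteq> bal (max n k) rt" using n bal_mono[of n "max n k" rt] bal_mono[of k "max n k" rt] by auto
   then show ?case by blast
  qed auto
  then show False using a by blast
 qed
qed

text \<open>When one edge is removed, the old cluster is covered by the new clusters of the starting
  point and of the two ends, so one of these is infinite.\<close>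

lemma infc_remove:
 assumes "infc S x" "x \<in> V" "finite F" "F \<subseteq> E" shows "\<exists>y\<in>V. infc (S - F) y"
 using assms(3,4)
proof (induction rule: finite_induct)
 case empty
 then show ?case using assms by auto
next
 case (insert e F)
 then obtain y where y: "y \<in> V" "infc (S - F) y" by auto
 obtain u v where uv: "e = {u, v}" "u \<in> V" "v \<in> V" using insert simple by blast
 let ?C = "\<lambda>a. {w \<in> V. con V (S - F - {{u, v}}) a w}"
 have "{w \<in> V. con V (S - F) y w} \<subseteq> ?C y \<union> ?C u \<union> ?C v" using con_remove[of V "S - F" y _ u v] uv by auto
 then have "infinite (?C y \<union> ?C u \<union> ?C v)" using y(2) finite_subset unfolding infc_def by blast
 then have "infc (S - F - {{u, v}}) y \<or> infc (S - F - {{u, v}}) u \<or> infc (S - F - {{u, v}}) v" unfolding infc_def by simp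
 moreover have "S - insert e F = S - F - {{u, v}}" using uv(1) by auto
 ultimately show ?case using y(1) uv by (elim disjE) (simp_all, blast+)
qed

text \<open>Stated for an arbitrary \<sigma>-algebra containing the events of the edges in
  \<open>D\<close>, because the zero-one law requires measurability with respect to all but finitely
  many edges.\<close>

lemma sets_con:
 assumes s: "sigma_algebra \<Omega> \<S>" and D: "D \<subseteq> E" "\<And>e. e \<in> D ==> {\<omega> \<in> \<Omega>. \<omega> e} \<in> \<S>"
 shows "{\<omega> \<in> \<Omega>. con V (open_edges D \<omega>) x y} \<in> \<S>"
proof -
 interpret sigma_algebra \<Omega> \<S> by (rule s)
 let ?L = "{xs \<in> lists V. spath V xs x y \<and> ed xs \<subseteq> D}"
 have "con V (open_edges D \<omega>) x y \<longleftrightarrow> (\<exists>xs\<in>?L. \<forall>e\<in>ed xs. \<omega> e)" for \<omega>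
  unfolding con_iff_spath open_edges_def by (auto simp: spath_def)
 moreover have "{\<omega> \<in> \<Omega>. \<exists>xs\<in>?L. \<forall>e\<in>ed xs. \<omega> e} \<in> \<S>"
 proof (rule sets_Collect_countable_Ex')
  show "countable ?L" by (rule countable_subset[OF _ countable_lists[OF countable_V]]) auto
  fix xs assume xs: "xs \<in> ?L"
  show "{\<omega> \<in> \<Omega>. \<forall>e\<in>ed xs. \<omega> e} \<in> \<S>"
  proof (cases "ed xs = {}")
   case False
   show ?thesis by (rule sets_Collect_finite_All'[OF _ finite_ed False]) (use xs D(2) in auto)
  qed simp
 qed
 ultimately show ?thesis by simp
qed

lemma sets_infc:
 assumes s: "sigma_algebra \<Omega> \<S>" and D: "D \<subseteq> E" "\<And>e. e \<in> D ==> {\<omega> \<in> \<Omega>. \<omega> e} \<in> \<S>"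
 shows "{\<omega> \<in> \<Omega>. infc (open_edges D \<omega>) x} \<in> \<S>"
proof -
 interpret sigma_algebra \<Omega> \<S> by (rule s)
 have "infc (open_edges D \<omega>) x \<longleftrightarrow> (\<forall>n. \<exists>v\<in>V - bal n rt. con V (open_edges D \<omega>) x v)" for \<omega>
  unfolding infc_def by (subst infinite_iff_unbounded) auto
 moreover have "{\<omega> \<in> \<Omega>. \<forall>n. \<exists>v\<in>V - bal n rt. con V (open_edges D \<omega>) x v} \<in> \<S>"
  by (intro sets_Collect_countable_All sets_Collect_countable_Ex' sets_con[OF s D] countable_Diff countable_V)
 ultimately show ?thesis by simp
qed

lemma sets_infc_ex:
 assumes s: "sigma_algebra \<Omega> \<S>" and D: "D \<subseteq> E" "\<And>e. e \<in> D ==> {\<omega> \<in> \<Omega>. \<omega> e} \<in> \<S>" and W: "W \<subseteq> V"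
 shows "{\<omega> \<in> \<Omega>. \<exists>x\<in>W. infc (open_edges D \<omega>) x} \<in> \<S>"
proof -
 interpret sigma_algebra \<Omega> \<S> by (rule s)
 show ?thesis by (intro sets_Collect_countable_Ex' sets_infc[OF s D] countable_subset[OF W countable_V])
qed

lemma sets_edge: "e \<in> E ==> {\<omega> \<in> space (percolation E p). \<omega> e} \<in> sets (percolation E p)"
 using sets_open[of e E p "{True}"] by simp

lemma percolation_sets:
 "{\<omega> \<in> space (percolation E p). con V (open_edges E \<omega>) x y} \<in> sets (percolation E p)"
 "W \<subseteq> V ==> {\<omega> \<in> space (percolation E p). \<exists>x\<in>W. infc (open_edges E \<omega>) x} \<in> sets (percolation E p)"
 by (rule sets_con[OF sets.sigma_algebra_axioms order_refl sets_edge], assumption)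
  (rule sets_infc_ex[OF sets.sigma_algebra_axioms order_refl sets_edge], assumption+)

lemma prob_open:
 assumes p: "0 \<le> p" "p \<le> 1" and K: "K \<subseteq> E" "finite K"
 shows "measure (percolation E p) {\<omega> \<in> space (percolation E p). \<forall>e\<in>K. \<omega> e} = p ^ card K"
 using percolation_Collect[OF K, of p "\<lambda>_. {True}"] measure_bernoulli[OF p, of True] by simp

lemma infinite_E: "infinite E"
proof
 assume E: "finite E"
 have "V \<subseteq> \<Union>E" using up_edge by blast
 moreover have "finite (\<Union>E)" using E finite_edge by auto
 ultimately show False using infinite_V finite_subset by blast
qed

text \<open>Kolmogorov's law along an enumeration of the edges: removing finitely many edges does
  not affect the existence of an infinite cluster, so this is a tail event.\<close>

lemma zero_one:
 assumes p: "0 \<le> p" "p \<le> 1"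
 shows "measure (percolation E p) {\<omega> \<in> space (percolation E p). \<exists>x\<in>V. infc (open_edges E \<omega>) x} \<in> {0, 1}"
proof -
 let ?M = "percolation E p"
 interpret prob_space ?M by (rule prob_space_percolation)
 define en where "en = from_nat_into E"
 have bij: "bij_betw en UNIV E" unfolding en_def by (rule bij_betw_from_nat_into[OF countable_E infinite_E])
 have enE: "en i \<in> E" for i using bij unfolding bij_betw_def by auto
 have inj: "inj en" using bij unfolding bij_betw_def by simp
 define Fi where "Fi i = {\<omega> \<in> space ?M. \<omega> (en i)}" for i
 have Fi: "Fi i \<in> events" for i unfolding Fi_def by (rule sets_edge[OF enE])
 define A where "A i = sigma_sets (space ?M) {Fi i}" for i
 let ?X = "{\<omega> \<in> space ?M. \<exists>x\<in>V. infc (open_edges E \<omega>) x}"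
 have "prob ?X = 0 \<or> prob ?X = 1"
 proof (rule kolmogorov_0_1_law[of A])
  show "sigma_algebra (space ?M) (A i)" for i
   unfolding A_def by (rule sigma_algebra_sigma_sets) (auto simp: Fi_def)
  have "indep_sets (\<lambda>i. {Fi i}) UNIV"
  proof (rule indep_setsI)
   show "{Fi i} \<subseteq> events" for i using Fi by simp
   fix B :: "nat \<Rightarrow> _" and J :: "nat set"
   assume J: "J \<noteq> {}" "finite J" "\<forall>j\<in>J. B j \<in> {Fi j}"
   have "(\<Inter>j\<in>J. B j) = {\<omega> \<in> space ?M. \<forall>e\<in>en ` J. \<omega> e}" using J unfolding Fi_def by auto
   then have "prob (\<Inter>j\<in>J. B j) = p ^ card (en ` J)" using prob_open[OF p, of "en ` J"] enE J by auto
   also have "... = p ^ card J" using inj by (simp add: card_image inj_on_subset)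
   also have "... = (\<Prod>j\<in>J. prob (B j))"
   proof -
    have "prob (Fi j) = p" for j using prob_open[OF p, of "{en j}"] enE unfolding Fi_def by simp
    then have "(\<Prod>j\<in>J. prob (B j)) = (\<Prod>j\<in>J. p)" using J(3) by (intro prod.cong) auto
    then show ?thesis by simp
   qed
   finally show "prob (\<Inter>j\<in>J. B j) = (\<Prod>j\<in>J. prob (B j))" .
  qed
  then show "indep_sets A UNIV" unfolding A_def by (rule indep_sets_sigma) (simp add: Int_stable_def)
  show "?X \<in> tail_events A" unfolding tail_events_def
  proof
   fix n :: nat
   define D where "D = E - en ` {..<n}"
   have "(\<exists>x\<in>V. infc (open_edges E \<omega>) x) \<longleftrightarrow> (\<exists>x\<in>V. infc (open_edges D \<omega>) x)" for \<omega>
   proof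
    assume "\<exists>x\<in>V. infc (open_edges E \<omega>) x"
    then obtain x where x: "x \<in> V" "infc (open_edges E \<omega>) x" by auto
    have "\<exists>y\<in>V. infc (open_edges E \<omega> - en ` {..<n}) y" by (rule infc_remove[OF x(2,1)]) (use enE in auto)
    moreover have "open_edges E \<omega> - en ` {..<n} = open_edges D \<omega>" unfolding open_edges_def D_def by auto
    ultimately show "\<exists>x\<in>V. infc (open_edges D \<omega>) x" by simp
   next
    assume "\<exists>x\<in>V. infc (open_edges D \<omega>) x"
    moreover have "open_edges D \<omega> \<subseteq> open_edges E \<omega>" unfolding open_edges_def D_def by auto
    ultimately show "\<exists>x\<in>V. infc (open_edges E \<omega>) x" using infc_mono by (elim bexE) (rule bexI)
   qed
   then have eq: "?X = {\<omega> \<in> space ?M. \<exists>x\<in>V. infc (open_edges D \<omega>) x}" by simp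
   show "?X \<in> sigma_sets (space ?M) (\<Union> (A ` {n..}))" unfolding eq
   proof (rule sets_infc_ex[OF _ _ _ order_refl])
    have "A i \<subseteq> Pow (space ?M)" for i unfolding A_def by (rule sigma_sets_into_sp[THEN subsetI[OF PowI]]) (auto simp: Fi_def)
    then show "sigma_algebra (space ?M) (sigma_sets (space ?M) (\<Union> (A ` {n..})))" by (intro sigma_algebra_sigma_sets) auto
    show "D \<subseteq> E" unfolding D_def by auto
    fix e assume e: "e \<in> D"
    then have "e \<in> en ` UNIV" using bij unfolding D_def bij_betw_def by auto
    then obtain i where i: "e = en i" by auto
    then have "n \<le> i" using e unfolding D_def by (auto simp: not_less[symmetric])
    then have "Fi i \<in> \<Union> (A ` {n..})" unfolding A_def by auto
    then show "{\<omega> \<in> space ?M. \<omega> e} \<in> sigma_sets (space ?M) (\<Union> (A ` {n..}))" using i unfolding Fi_def[symmetric] by (auto simp: Fi_def intro: sigma_sets.Basic)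
   qed
  qed
 qed
 then show ?thesis by simp
qed

lemma joined_con: assumes "S \<subseteq> E" "x \<in> V" shows "joined S x y \<longleftrightarrow> con V S x y"
proof
 assume "joined S x y"
 then show "con V S x y" unfolding joined_def
 proof (induction rule: rtranclp_induct)
  case (step y z)
  then have "z \<in> V" using edge_V[of y z] assms(1) by blast
  then show ?case by (rule con_step[OF step(3) _ step(2)])
 qed (use assms in simp)
next
 assume "con V S x y"
 then show "joined S x y" unfolding joined_def
  by (induction rule: con_induct) (auto intro: rtranclp.rtrancl_into_rtrancl)
qed

lemma clusters_eq: "clusters V E \<omega> = (\<lambda>x. {v \<in> V. con V (open_edges E \<omega>) x v}) ` V"
proof -
 have sub: "open_edges E \<omega> \<subseteq> E" unfolding open_edges_def by auto
 show ?thesis unfolding clusters_def components_of_graph_def using joined_con[OF sub] by (auto simp: image_iff)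
qed

lemma infinite_cluster_iff: "(\<exists>C\<in>clusters V E \<omega>. infinite C) \<longleftrightarrow> (\<exists>x\<in>V. infc (open_edges E \<omega>) x)"
 unfolding clusters_eq infc_def by auto

text \<open>Reaching depth \<open>k * R0\<close> is an event decreasing in \<open>k\<close>, so with
  probability at least \<open>c\<close> the root reaches every depth. Heights on a finite set are
  bounded below, hence its cluster is then infinite, and the zero-one law applies.\<close>

lemma AE_infinite_cluster:
 assumes p: "0 \<le> p" "p \<le> 1" and c: "0 < c"
  and F: "\<And>k::nat. \<exists>F. finite F \<and> F \<subseteq> E \<and> c \<le> pexp p F (\<lambda>S. of_bool (\<exists>x\<in>V. h x + k * R0 \<le> h rt \<and> con V S x rt))" and R0: "0 < R0"
 shows "AE \<omega> in percolation E p. \<exists>C\<in>clusters V E \<omega>. infinite C"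
proof -
 let ?M = "percolation E p"
 interpret prob_space ?M by (rule prob_space_percolation)
 let ?X = "{\<omega> \<in> space ?M. \<exists>x\<in>V. infc (open_edges E \<omega>) x}"
 define A where "A k = {\<omega> \<in> space ?M. \<exists>x\<in>{x \<in> V. h x + k * R0 \<le> h rt}. con V (open_edges E \<omega>) x rt}" for k :: nat
 have As: "A k \<in> events" for k unfolding A_def
  by (intro sets.sets_Collect_countable_Ex' percolation_sets(1) countable_subset[OF _ countable_V]) auto
 have Ac: "c \<le> prob (A k)" for k
 proof -
  obtain F where F: "finite F" "F \<subseteq> E" "c \<le> pexp p F (\<lambda>S. of_bool (\<exists>x\<in>V. h x + k * R0 \<le> h rt \<and> con V S x rt))" using F by blast
  have "pexp p F (\<lambda>S. of_bool (\<exists>x\<in>V. h x + k * R0 \<le> h rt \<and> con V S x rt)) =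
   prob {\<omega> \<in> space ?M. \<exists>x\<in>V. h x + k * R0 \<le> h rt \<and> con V (open_edges F \<omega>) x rt}"
   by (rule finite_prob(1)[OF p F(1,2), symmetric])
  also have "... \<le> prob (A k)"
  proof (rule finite_measure_mono[OF _ As])
   have sub: "open_edges F \<omega> \<subseteq> open_edges E \<omega>" for \<omega> using F(2) unfolding open_edges_def by auto
   have "con V (open_edges E \<omega>) x rt" if "con V (open_edges F \<omega>) x rt" for \<omega> x by (rule con_mono[OF that order_refl sub])
   then show "{\<omega> \<in> space ?M. \<exists>x\<in>V. h x + k * R0 \<le> h rt \<and> con V (open_edges F \<omega>) x rt} \<subseteq> A k"
    unfolding A_def by auto
  qed
  finally show ?thesis using F(3) by simp
 qed
 have dec: "decseq A"
 proof (rule decseq_SucI)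
  fix k
  have "h x + real (Suc k) * R0 \<le> h rt ==> h x + real k * R0 \<le> h rt" for x using R0 by (simp add: algebra_simps)
  then show "A (Suc k) \<subseteq> A k" unfolding A_def by blast
 qed
 have "(\<lambda>k. prob (A k)) \<longlonglongrightarrow> prob (\<Inter>k. A k)" by (rule finite_Lim_measure_decseq[OF _ dec]) (use As in auto)
 then have "c \<le> prob (\<Inter>k. A k)" by (rule LIMSEQ_le_const) (use Ac in auto)
 also have "... \<le> prob ?X"
 proof (rule finite_measure_mono[OF _ percolation_sets(2)[OF order_refl]])
  show "(\<Inter>k. A k) \<subseteq> ?X"
  proof
   fix \<omega> assume w: "\<omega> \<in> (\<Inter>k. A k)"
   have "infc (open_edges E \<omega>) rt" unfolding infc_def
   proof
    let ?C = "{v \<in> V. con V (open_edges E \<omega>) rt v}"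
    assume fin: "finite ?C"
    define m where "m = Min (insert 0 (h ` ?C))"
    obtain k :: nat where "(h rt - m) / R0 < k" using reals_Archimedean2 by blast
    then have k: "h rt - m < k * R0" using R0 by (simp add: pos_divide_less_eq)
    have "\<omega> \<in> A k" using w by (rule INT_D) simp
    then obtain x where x: "x \<in> V" "h x + k * R0 \<le> h rt" "con V (open_edges E \<omega>) x rt" unfolding A_def by auto
    then have "x \<in> ?C" using con_sym[OF x(3)] by simp
    then have "m \<le> h x" unfolding m_def using fin by (intro Min_le) auto
    then show False using x(2) k by linarith
   qed
   moreover have "\<omega> \<in> space ?M" using INT_D[OF w, of 0] unfolding A_def by simp
   ultimately show "\<omega> \<in> ?X" using rt_V by blast
  qed
 qed
 finally have "0 < prob ?X" using c by linarith
 then have "prob ?X = 1" using zero_one[OF p] by auto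
 then have "AE \<omega> in ?M. \<omega> \<in> ?X" by (simp only: AE_in_set_eq_1[OF percolation_sets(2)[OF order_refl]])
 then show ?thesis by eventually_elim (simp add: infinite_cluster_iff)
qed

lemma con_prob_le:
 assumes p: "0 \<le> p" "p \<le> 1" and b: "\<And>F. finite F ==> F \<subseteq> E ==> cp p F V x v \<le> K"
 shows "measure (percolation E p) {\<omega> \<in> space (percolation E p). con V (open_edges E \<omega>) x v} \<le> K"
proof -
 let ?M = "percolation E p"
 interpret prob_space ?M by (rule prob_space_percolation)
 define A where "A n = {\<omega> \<in> space ?M. con V (open_edges (Eb n rt) \<omega>) x v}" for n
 have EbE: "Eb n rt \<subseteq> E" for n unfolding Eb_def by auto
 have As: "A n \<in> events" for n unfolding A_def by (rule finite_prob(2)[OF p finite_Eb[OF rt_V] EbE])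
 have Am: "prob (A n) \<le> K" for n
 proof -
  have "prob (A n) = cp p (Eb n rt) V x v" unfolding A_def cp_def by (rule finite_prob(1)[OF p finite_Eb[OF rt_V] EbE])
  then show ?thesis using b[OF finite_Eb[OF rt_V] EbE, of n] by simp
 qed
 have mono: "open_edges (Eb n rt) \<omega> \<subseteq> open_edges (Eb m rt) \<omega>" if "n \<le> m" for n m \<omega>
  using bal_mono[OF that, of rt] unfolding open_edges_def Eb_def by blast
 have inc: "incseq A"
 proof (rule incseq_SucI)
  fix n show "A n \<subseteq> A (Suc n)" unfolding A_def by (intro Collect_mono conj_mono impI) (assumption | erule con_mono[OF _ order_refl mono[of n "Suc n"]] | simp)+
 qed
 have "(\<lambda>n. prob (A n)) \<longlonglongrightarrow> prob (\<Union>n. A n)" by (rule finite_Lim_measure_incseq[OF _ inc]) (use As in auto)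
 then have "prob (\<Union>n. A n) \<le> K" by (rule LIMSEQ_le_const2) (use Am in auto)
 moreover have "{\<omega> \<in> space ?M. con V (open_edges E \<omega>) x v} \<subseteq> (\<Union>n. A n)"
 proof
  fix \<omega> assume w: "\<omega> \<in> {\<omega> \<in> space ?M. con V (open_edges E \<omega>) x v}"
  then obtain xs where xs: "spath V xs x v" "ed xs \<subseteq> open_edges E \<omega>" unfolding con_iff_spath by auto
  have "ed xs \<subseteq> E" using xs(2) unfolding open_edges_def by auto
  then obtain n where "ed xs \<subseteq> Eb n rt" using edges_in_ball[OF finite_ed _ rt_V] by blast
  then have "ed xs \<subseteq> open_edges (Eb n rt) \<omega>" using xs(2) unfolding open_edges_def by auto
  then have "\<omega> \<in> A n" unfolding A_def con_iff_spath using xs(1) w by auto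
  then show "\<omega> \<in> (\<Union>n. A n)" by blast
 qed
 then have "prob {\<omega> \<in> space ?M. con V (open_edges E \<omega>) x v} \<le> prob (\<Union>n. A n)" by (rule finite_measure_mono) (use As in auto)
 ultimately show ?thesis by linarith
qed

text \<open>Reindexing the edges by \<open>g\<close> preserves the product measure and carries the
  cluster of \<open>x\<close> to the cluster of \<open>g x\<close>.\<close>

lemma ball_meets_invariant:
 assumes g: "g \<in> \<Gamma>"
 shows "measure (percolation E p) {\<omega> \<in> space (percolation E p). \<exists>x\<in>bal n (g rt). infc (open_edges E \<omega>) x} =
  measure (percolation E p) {\<omega> \<in> space (percolation E p). \<exists>x\<in>bal n rt. infc (open_edges E \<omega>) x}"
proof -
 let ?M = "percolation E p"
 let ?B = "{\<omega> \<in> space ?M. \<exists>x\<in>bal n rt. infc (open_edges E \<omega>) x}"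
 define T where "T = (\<lambda>\<omega>::'a set \<Rightarrow> bool. \<lambda>e\<in>E. \<omega> (g ` e))"
 have gE: "g ` e \<in> E" if "e \<in> E" for e using act_edge[OF g edge_sub[OF that]] that by simp
 have inj: "inj_on g V" using act_inj[OF g] by (auto simp: inj_on_def)
 have "inj_on ((`) g) E"
 proof (rule inj_onI)
  fix d d' assume "d \<in> E" "d' \<in> E" "g ` d = g ` d'"
  moreover from this have "d \<subseteq> V" "d' \<subseteq> V" using edge_sub by blast+
  ultimately show "d = d'" using inj_on_image_eq_iff[OF inj, of d d'] by simp
 qed
 then have dist: "distr ?M ?M T = ?M" unfolding percolation_def T_def
  by (intro distr_PiM_reindex prob_space_measure_pmf) (use gE in auto)
 have Tm: "T \<in> measurable ?M ?M" unfolding percolation_def T_def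
  by (intro measurable_restrict measurable_component_singleton gE)
 have gV: "g ` V = V" using act_V[OF g] act_surj[OF g] by (auto simp: image_iff)
 have key: "infc (open_edges E (T \<omega>)) x \<longleftrightarrow> infc (open_edges E \<omega>) (g x)" if x: "x \<in> V" for \<omega> x
 proof -
  let ?S = "open_edges E (T \<omega>)"
  have S: "(`) g ` ?S = open_edges E \<omega>"
  proof
   show "(`) g ` ?S \<subseteq> open_edges E \<omega>" unfolding open_edges_def T_def using gE by auto
   show "open_edges E \<omega> \<subseteq> (`) g ` ?S"
   proof
    fix e assume e: "e \<in> open_edges E \<omega>"
    then have "e \<in> (`) g ` E" using act_E_surj[OF g] unfolding open_edges_def by simp
    then obtain d where "d \<in> E" "e = g ` d" by auto
    then show "e \<in> (`) g ` ?S" using e unfolding open_edges_def T_def by auto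
   qed
  qed
  have SV: "e \<subseteq> V" if "e \<in> ?S" for e using that edge_sub unfolding open_edges_def by auto
  have cg: "con V (open_edges E \<omega>) (g x) (g v) \<longleftrightarrow> con V ?S x v" if v: "v \<in> V" for v
  proof -
   have "con (g ` V) ((`) g ` ?S) (g x) (g v) \<longleftrightarrow> con V ?S x v" by (rule con_act[OF g order_refl _ x v]) (rule SV)
   then show ?thesis unfolding gV S .
  qed
  have "{w \<in> V. con V (open_edges E \<omega>) (g x) w} = g ` {v \<in> V. con V ?S x v}"
  proof
   show "{w \<in> V. con V (open_edges E \<omega>) (g x) w} \<subseteq> g ` {v \<in> V. con V ?S x v}"
   proof
    fix w assume w: "w \<in> {w \<in> V. con V (open_edges E \<omega>) (g x) w}"
    then obtain v where "v \<in> V" "w = g v" using act_surj[OF g, of w] by auto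
    then show "w \<in> g ` {v \<in> V. con V ?S x v}" using w cg by auto
   qed
   show "g ` {v \<in> V. con V ?S x v} \<subseteq> {w \<in> V. con V (open_edges E \<omega>) (g x) w}" using cg act_V[OF g] by auto
  qed
  moreover have "finite (g ` {v \<in> V. con V ?S x v}) \<longleftrightarrow> finite {v \<in> V. con V ?S x v}"
   by (rule finite_image_iff) (rule inj_on_subset[OF inj], auto)
  ultimately show ?thesis unfolding infc_def by simp
 qed
 have "measure ?M ?B = measure (distr ?M ?M T) ?B" unfolding dist ..
 also have "... = measure ?M (T -` ?B \<inter> space ?M)" by (rule measure_distr[OF Tm percolation_sets(2)[OF bal_V[OF rt_V]]])
 also have "T -` ?B \<inter> space ?M = {\<omega> \<in> space ?M. \<exists>x\<in>bal n (g rt). infc (open_edges E \<omega>) x}"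
 proof -
  have key': "(\<exists>x\<in>bal n rt. infc (open_edges E (T \<omega>)) x) \<longleftrightarrow> (\<exists>x\<in>bal n rt. infc (open_edges E \<omega>) (g x))" for \<omega>
   by (rule bex_cong[OF refl], rule key) (use bal_V[OF rt_V, of n] in blast)
  show ?thesis
  proof (rule Set.set_eqI)
   fix \<omega>
   show "\<omega> \<in> T -` ?B \<inter> space ?M \<longleftrightarrow> \<omega> \<in> {\<omega> \<in> space ?M. \<exists>x\<in>bal n (g rt). infc (open_edges E \<omega>) x}"
    using measurable_space[OF Tm, of \<omega>] key'[of \<omega>] unfolding act_bal[OF g rt_V]
    by (cases "\<omega> \<in> space ?M") simp_all
  qed
 qed
 finally show ?thesis ..
qed

lemma shift_power: "\<exists>c>0. \<forall>j::nat. \<exists>g\<in>\<Gamma>. h (g rt) = h rt + j * c"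
proof -
 obtain g where g: "g \<in> \<Gamma>" "h (g rt) > h rt" using shift by auto
 have "\<exists>k\<in>\<Gamma>. h (k rt) = h rt + j * (h (g rt) - h rt)" for j :: nat
 proof (induction j)
  case 0
  obtain e where "e \<in> \<Gamma>" "\<forall>x\<in>V. e x = x" using act_id by auto
  then show ?case using rt_V by (intro bexI[of _ e]) auto
 next
  case (Suc j)
  then obtain k where k: "k \<in> \<Gamma>" "h (k rt) = h rt + j * (h (g rt) - h rt)" by auto
  obtain l where l: "l \<in> \<Gamma>" "\<forall>x\<in>V. l x = g (k x)" using act_comp[OF g(1) k(1)] by auto
  have "h (g (k rt)) - h (g rt) = h (k rt) - h rt" by (rule h_act[OF g(1) act_V[OF k(1) rt_V] rt_V])
  then have "h (l rt) = h rt + Suc j * (h (g rt) - h rt)" using l(2) rt_V k(2) by (simp add: algebra_simps)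
  then show ?case using l(1) by blast
 qed
 then show ?thesis using g(2) by (intro exI[of _ "h (g rt) - h rt"]) auto
qed

text \<open>Some ball meets the infinite cluster with probability above 3/4, and so does each
  translate of it. By uniqueness the ball and its translate are joined with probability at least
  1/2. A union bound over pairs of points makes this at most a constant times
  \<open>exp (- (j * c / 2))\<close>, which tends to 0 as the translate rises.\<close>

lemma not_unique:
 assumes p: "0 \<le> p" "p \<le> 1"
  and b: "\<And>F x v. finite F ==> F \<subseteq> E ==> x \<in> V ==> v \<in> V ==> cp p F V x v * exp ((h v - h x) / 2) \<le> K"
  and u: "AE \<omega> in percolation E p. \<exists>!C. C \<in> clusters V E \<omega> \<and> infinite C"
 shows False
proof -
 let ?M = "percolation E p"
 interpret prob_space ?M by (rule prob_space_percolation)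
 define B where "B n y = {\<omega> \<in> space ?M. \<exists>x\<in>bal n y. infc (open_edges E \<omega>) x}" for n y
 have Bs: "B n y \<in> events" if "y \<in> V" for n y unfolding B_def by (rule percolation_sets(2)[OF bal_V[OF that]])
 have inc: "incseq (\<lambda>n. B n rt)"
  using bal_mono unfolding B_def incseq_def by blast
 have "AE \<omega> in ?M. \<omega> \<in> (\<Union>n. B n rt)"
  using u AE_space
 proof eventually_elim
  case (elim \<omega>)
  then have "\<exists>C\<in>clusters V E \<omega>. infinite C" by blast
  then have "\<exists>x\<in>V. infc (open_edges E \<omega>) x" by (simp only: infinite_cluster_iff)
  then obtain x where x: "x \<in> V" "infc (open_edges E \<omega>) x" by auto
  then obtain n where "x \<in> bal n rt" using bal_ex[OF rt_V] by blast
  then have "\<omega> \<in> B n rt" unfolding B_def using x elim by auto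
  then show ?case by blast
 qed
 moreover have "(\<Union>n. B n rt) \<in> events" using Bs[OF rt_V] by blast
 ultimately have "prob (\<Union>n. B n rt) = 1" by (simp only: AE_in_set_eq_1)
 moreover have "(\<lambda>n. prob (B n rt)) \<longlonglongrightarrow> prob (\<Union>n. B n rt)" by (rule finite_Lim_measure_incseq[OF _ inc]) (use Bs[OF rt_V] in auto)
 ultimately have "(\<lambda>n. prob (B n rt)) \<longlonglongrightarrow> 1" by simp
 then have "eventually (\<lambda>n. 3 / 4 < prob (B n rt)) sequentially" by (rule order_tendstoD(1)) simp
 then obtain n where n: "3 / 4 < prob (B n rt)" by (auto simp: eventually_sequentially)
 obtain c where c: "0 < c" "\<And>j::nat. \<exists>g\<in>\<Gamma>. h (g rt) = h rt + j * c" using shift_power by auto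
 define N where "N = real (Suc deg ^ n)"
 have N: "0 < N" unfolding N_def by simp
 have K0: "0 \<le> K"
  using b[of "{}" rt rt] rt_V cp_nonneg[OF p, of "{}" V rt rt] by (auto intro: order_trans)
 have main: "1 / 2 \<le> N * (N * (K * exp (n * M) * exp (- (j * c / 2))))" for j :: nat
 proof -
  obtain g where g: "g \<in> \<Gamma>" "h (g rt) = h rt + j * c" using c(2) by blast
  have gV: "g rt \<in> V" by (rule act_V[OF g(1) rt_V])
  define Q where "Q x y = {\<omega> \<in> space ?M. con V (open_edges E \<omega>) x y}" for x y
  have Qs: "Q x y \<in> events" for x y unfolding Q_def by (rule percolation_sets(1))
  let ?U = "\<Union>x\<in>bal n rt. \<Union>y\<in>bal n (g rt). Q x y"
  have "prob (B n (g rt)) = prob (B n rt)" unfolding B_def by (rule ball_meets_invariant[OF g(1)])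
  then have n': "3 / 4 < prob (B n (g rt))" using n by simp
  have "prob (B n rt) \<le> prob (B n rt \<inter> B n (g rt) \<union> (space ?M - B n (g rt)))"
  proof (rule finite_measure_mono)
   show "B n rt \<subseteq> B n rt \<inter> B n (g rt) \<union> (space ?M - B n (g rt))" using sets.sets_into_space[OF Bs[OF rt_V, of n]] by blast
   show "B n rt \<inter> B n (g rt) \<union> (space ?M - B n (g rt)) \<in> events" by (intro sets.Un sets.Int sets.Diff sets.top Bs rt_V gV)
  qed
  also have "... \<le> prob (B n rt \<inter> B n (g rt)) + prob (space ?M - B n (g rt))"
   by (rule measure_Un_le) (intro sets.Int sets.Diff sets.top Bs rt_V gV)+
  also have "prob (space ?M - B n (g rt)) = 1 - prob (B n (g rt))" by (rule prob_compl[OF Bs[OF gV]])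
  finally have "1 / 2 \<le> prob (B n rt \<inter> B n (g rt))" using n n' by linarith
  also have "... \<le> prob ?U"
  proof (rule finite_measure_mono_AE)
   show "AE \<omega> in ?M. \<omega> \<in> B n rt \<inter> B n (g rt) \<longrightarrow> \<omega> \<in> ?U"
    using u
   proof eventually_elim
    case (elim \<omega>)
    show ?case
    proof
     assume w: "\<omega> \<in> B n rt \<inter> B n (g rt)"
     then obtain x y where xy: "x \<in> bal n rt" "infc (open_edges E \<omega>) x" "y \<in> bal n (g rt)" "infc (open_edges E \<omega>) y" unfolding B_def by auto
     have V: "x \<in> V" "y \<in> V" using xy bal_V[OF rt_V] bal_V[OF gV] by blast+
     let ?C = "\<lambda>x. {v \<in> V. con V (open_edges E \<omega>) x v}"
     have "?C x \<in> clusters V E \<omega>" "infinite (?C x)" "?C y \<in> clusters V E \<omega>" "infinite (?C y)"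
      using xy V unfolding clusters_eq infc_def by auto
     then have "?C x = ?C y" using elim by blast
     moreover have "y \<in> ?C y" using V(2) by simp
     ultimately have "con V (open_edges E \<omega>) x y" by blast
     then have "\<omega> \<in> Q x y" using w unfolding Q_def B_def by simp
     then show "\<omega> \<in> ?U" using xy(1,3) by blast
    qed
   qed
   show "?U \<in> events" using finite_bal[OF rt_V] finite_bal[OF gV] Qs by (intro sets.finite_UN) auto
  qed
  also have "... \<le> (\<Sum>x\<in>bal n rt. prob (\<Union>y\<in>bal n (g rt). Q x y))"
   by (rule measure_UNION_le[OF finite_bal[OF rt_V]]) (use finite_bal[OF gV] Qs in \<open>auto intro: sets.finite_UN\<close>)
  also have "... \<le> (\<Sum>x\<in>bal n rt. \<Sum>y\<in>bal n (g rt). prob (Q x y))"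
   by (intro sum_mono measure_UNION_le[OF finite_bal[OF gV]] Qs)
  also have "... \<le> (\<Sum>x\<in>bal n rt. \<Sum>y\<in>bal n (g rt). K * exp (n * M) * exp (- (j * c / 2)))"
  proof (intro sum_mono)
   fix x y assume xy: "x \<in> bal n rt" "y \<in> bal n (g rt)"
   have V: "x \<in> V" "y \<in> V" using xy bal_V[OF rt_V] bal_V[OF gV] by blast+
   have d: "j * c / 2 - n * M \<le> (h y - h x) / 2" using bal_h[OF rt_V xy(1)] bal_h[OF gV xy(2)] g(2) by (simp add: field_simps abs_le_iff)
   show "prob (Q x y) \<le> K * exp (n * M) * exp (- (j * c / 2))" unfolding Q_def
   proof (rule con_prob_le[OF p])
    fix F assume F: "finite F" "F \<subseteq> E"
    have "cp p F V x y * exp (j * c / 2 - n * M) \<le> cp p F V x y * exp ((h y - h x) / 2)"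
     by (rule mult_left_mono) (use d cp_nonneg[OF p] in auto)
    also have "... \<le> K" by (rule b[OF F V])
    finally have "cp p F V x y * exp (j * c / 2 - n * M) \<le> K" .
    then have "cp p F V x y * exp (j * c / 2 - n * M) * (exp (n * M) * exp (- (j * c / 2))) \<le> K * (exp (n * M) * exp (- (j * c / 2)))"
     by (rule mult_right_mono) simp
    moreover have "exp (j * c / 2 - n * M) * (exp (n * M) * exp (- (j * c / 2))) = 1" by (simp flip: exp_add)
    ultimately show "cp p F V x y \<le> K * exp (n * M) * exp (- (j * c / 2))" by (simp only: mult.assoc mult_1_right)
   qed
  qed
  also have "... = real (card (bal n rt)) * (real (card (bal n (g rt))) * (K * exp (n * M) * exp (- (j * c / 2))))" by simp
  also have "... \<le> N * (N * (K * exp (n * M) * exp (- (j * c / 2))))"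
   unfolding N_def by (intro mult_mono of_nat_mono card_bal rt_V gV) (use K0 in auto)
  finally show ?thesis .
 qed
 have "(\<lambda>j::nat. exp (- (c / 2)) ^ j) \<longlonglongrightarrow> 0" by (rule LIMSEQ_power_zero) (use c in simp)
 then have "(\<lambda>j::nat. N * (N * (K * exp (n * M) * exp (- (c / 2)) ^ j))) \<longlonglongrightarrow> N * (N * (K * exp (n * M) * 0))"
  by (intro tendsto_mult tendsto_const)
 moreover have "exp (- (c / 2)) ^ j = exp (- (j * c / 2))" for j :: nat by (simp flip: exp_of_nat_mult)
 ultimately have lim: "(\<lambda>j::nat. N * (N * (K * exp (n * M) * exp (- (j * c / 2))))) \<longlonglongrightarrow> 0" by simp
 have "1 / 2 \<le> (0::real)" by (rule LIMSEQ_le_const[OF lim]) (use main in auto)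
 then show False by simp
qed

section \<open>Comparison of the two thresholds\<close>

lemma AE_unique_one: "AE \<omega> in percolation E 1. \<exists>!C. C \<in> clusters V E \<omega> \<and> infinite C"
proof -
 let ?M = "percolation E 1"
 interpret prob_space ?M by (rule prob_space_percolation)
 have "AE \<omega> in ?M. \<forall>e\<in>E. \<omega> e"
 proof (rule AE_ball_countable[THEN iffD2, OF countable_E], rule ballI)
  fix e assume e: "e \<in> E"
  have "prob {\<omega> \<in> space ?M. \<omega> e} = 1" using prob_open[of 1 "{e}"] e by simp
  then have "AE \<omega> in ?M. \<omega> \<in> {\<omega> \<in> space ?M. \<omega> e}" by (simp only: AE_in_set_eq_1[OF sets_edge[OF e]])
  then show "AE \<omega> in ?M. \<omega> e" by eventually_elim simp
 qed
 then show ?thesis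
 proof eventually_elim
  case (elim \<omega>)
  then have "open_edges E \<omega> = E" unfolding open_edges_def by auto
  moreover have "con V E x v" if "x \<in> V" "v \<in> V" for x v using connected[OF that] joined_con[OF order_refl that(1)] by simp
  ultimately have "clusters V E \<omega> = {V}" unfolding clusters_eq using rt_V by auto
  then show ?case using infinite_V by auto
 qed
qed

theorem pc_less_pu: "p_c V E < p_u V E"
proof -
 define Sc where "Sc = {p \<in> {0..1}. AE \<omega> in percolation E p. \<exists>C\<in>clusters V E \<omega>. infinite C}"
 define Su where "Su = {p \<in> {0..1}. AE \<omega> in percolation E p. \<exists>!C. C \<in> clusters V E \<omega> \<and> infinite C}"
 define pc where "pc = p_c V E"
 have pc: "pc = Inf Sc" unfolding pc_def p_c_def Sc_def ..
 have pu: "p_u V E = Inf Su" unfolding p_u_def Su_def ..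
 have one: "1 \<in> Su" unfolding Su_def using AE_unique_one by simp
 have "1 \<in> Sc" unfolding Sc_def using AE_unique_one by (auto elim!: eventually_mono)
 moreover have bdd: "bdd_below Sc" unfolding Sc_def by (rule bdd_belowI[of _ 0]) auto
 ultimately have pc01: "0 \<le> pc" "pc \<le> 1" unfolding pc
  by (auto intro!: cInf_greatest cInf_lower simp: Sc_def)
 have low: "pc \<le> q" if q: "0 \<le> q" "q \<le> 1" "0 < R0" "1 < mmp q R0 R" for q R0 R
 proof -
  have "\<exists>c>0. \<forall>k::nat. \<exists>F. finite F \<and> F \<subseteq> E \<and> c \<le> pexp q F (\<lambda>S. of_bool (\<exists>x\<in>V. h x + k * R0 \<le> h rt \<and> con V S x rt))"
   by (rule hchain.deep[OF hchainI[OF q(1-3)] q(4)])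
  then obtain c where c: "0 < c" "\<And>k::nat. \<exists>F. finite F \<and> F \<subseteq> E \<and> c \<le> pexp q F (\<lambda>S. of_bool (\<exists>x\<in>V. h x + k * R0 \<le> h rt \<and> con V S x rt))" by auto
  have "AE \<omega> in percolation E q. \<exists>C\<in>clusters V E \<omega>. infinite C" by (rule AE_infinite_cluster[OF q(1,2) c q(3)])
  then have "q \<in> Sc" unfolding Sc_def using q by simp
  then show ?thesis unfolding pc by (rule cInf_lower[OF _ bdd])
 qed
 have chi: "pc < 1 \<and> (\<exists>C\<ge>0. \<forall>x\<in>V. chi pc x \<le> ennreal C)"
 proof (cases "pc = 0")
  case True
  then show ?thesis using chi_zero by (auto intro!: exI[of _ 1])
 next
  case False
  then have p0: "0 < pc" using pc01 by simp
  have s: "subcr pc" unfolding subcr_def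
  proof (intro allI impI, rule ccontr)
   fix R0 :: real and R assume R0: "0 < R0" and big: "\<not> mmp pc R0 R \<le> 1"
   have "continuous (at pc within {0..1}) (\<lambda>p. mmp p R0 R)" using mm_cont[OF R0, of R] pc01 by (simp add: continuous_on_eq_continuous_within)
   then have "((\<lambda>p. mmp p R0 R) \<longlongrightarrow> mmp pc R0 R) (at pc within {0..1})" by (simp add: continuous_within)
   then have "eventually (\<lambda>p. 1 < mmp p R0 R) (at pc within {0..1})" by (rule order_tendstoD(1)) (use big in simp)
   then obtain d where d: "0 < d" "\<forall>x\<in>{0..1}. x \<noteq> pc \<and> dist x pc < d \<longrightarrow> 1 < mmp x R0 R" unfolding eventually_at by blast
   \<comment> \<open>A parameter strictly below \<open>pc\<close> at which the mean offspring still
     exceeds 1; the maximum keeps it nonnegative.\<close>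
   define q where "q = max 0 (pc - d / 2)"
   have q: "0 \<le> q" "q \<le> 1" "q < pc" "dist q pc < d" unfolding q_def using p0 pc01 d(1) by (auto simp: dist_real_def max_def)
   have "1 < mmp q R0 R" using d(2) q by auto
   then have "pc \<le> q" by (rule low[OF q(1,2) R0])
   then show False using q(3) by simp
  qed
  have "pc \<noteq> 1" using s not_subcr_one by auto
  then have "pc < 1" using pc01 by simp
  moreover obtain C where "0 \<le> C" "\<And>x. x \<in> V ==> chi pc x \<le> ennreal C" by (rule chi_finite[OF p0 pc01(2) s]) blast
  ultimately show ?thesis by blast
 qed
 then obtain C where C: "0 \<le> C" "\<And>x. x \<in> V ==> chi pc x \<le> ennreal C" by blast
 obtain p1 K where p1: "pc < p1" "p1 \<le> 1" and
  b: "\<forall>F x v. finite F \<longrightarrow> F \<subseteq> E \<longrightarrow> x \<in> V \<longrightarrow> v \<in> V \<longrightarrow> cp p1 F V x v * exp ((h v - h x) / 2) \<le> K"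
  using open_bound[OF pc01(1) _ C] chi by blast
 \<comment> \<open>Connection probabilities in finite volume grow with the parameter, so every
   \<open>q\<close> below \<open>p1\<close> inherits the bound obtained at \<open>p1\<close> and is
   excluded from \<open>Su\<close>.\<close>
 have "p1 \<le> Inf Su"
 proof (rule cInf_greatest)
  show "Su \<noteq> {}" using one by auto
  fix q assume q: "q \<in> Su"
  show "p1 \<le> q"
  proof (rule ccontr)
   assume "\<not> p1 \<le> q"
   then have q1: "0 \<le> q" "q \<le> 1" "q \<le> p1" using q unfolding Su_def by auto
   show False
   proof (rule not_unique[OF q1(1,2)])
    show "AE \<omega> in percolation E q. \<exists>!C. C \<in> clusters V E \<omega> \<and> infinite C" using q unfolding Su_def by simp
    fix F x v assume F: "finite F" "F \<subseteq> E" and x: "x \<in> V" "v \<in> V"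
    have "cp q F V x v \<le> cp p1 F V x v" unfolding cp_def
    proof (rule pexp_mono_p[OF F(1) q1(1,3) p1(2)], rule of_bool_mono)
     fix S T :: "'a set set" assume "S \<subseteq> T" "con V S x v"
     then show "con V T x v" by (intro con_mono[of V S x v V T]) auto
    qed
    then have "cp q F V x v * exp ((h v - h x) / 2) \<le> cp p1 F V x v * exp ((h v - h x) / 2)" by (rule mult_right_mono) simp
    also have "... \<le> K" using b F x by blast
    finally show "cp q F V x v * exp ((h v - h x) / 2) \<le> K" .
   qed
  qed
 qed
 then show ?thesis using p1(1) unfolding pu pc_def[symmetric] by linarith
qed

end

theorem theorem1p2:
  fixes V :: "'a set" and E :: "'a set set" and \<Gamma> :: "('a \<Rightarrow> 'a) set"
  assumes "simple_graph V E"
    and "connected_graph V E"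
    and "locally_finite_graph V E"
    and "subgroup \<Gamma> (GraphAutoGroup V E)"
    and "quasi_transitive V E \<Gamma>"
    and "\<not> unimodular V E \<Gamma>"
  shows "p_c V E < p_u V E"
proof -
 let ?G = "GraphAutoGroup V E"
 interpret G: group ?G by (rule group_GraphAutoGroup)
 have car: "carrier ?G = graph_auto V E" unfolding GraphAutoGroup_def by simp
 have \<Gamma>: "g \<in> graph_auto V E" if "g \<in> \<Gamma>" for g using subgroup.subset[OF assms(4)] that car by auto
 have bij: "g \<in> Bij V" if "g \<in> \<Gamma>" for g using \<Gamma>[OF that] unfolding graph_auto_def by simp
 have mult: "(g \<otimes>\<^bsub>?G\<^esub> k) x = g (k x)" if "g \<in> \<Gamma>" "k \<in> \<Gamma>" "x \<in> V" for g k x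
  using bij that unfolding GraphAutoGroup_def BijGroup_def by (simp add: compose_eq)
 have one: "\<one>\<^bsub>?G\<^esub> x = x" if "x \<in> V" for x
  using that unfolding GraphAutoGroup_def BijGroup_def by simp
 have simple: "\<exists>u v. e = {u, v} \<and> u \<noteq> v \<and> u \<in> V \<and> v \<in> V" if "e \<in> E" for e
 proof -
  have e: "e \<subseteq> V" "card e = 2" using assms(1) that unfolding simple_graph_def by auto
  then obtain u v where "e = {u, v}" "u \<noteq> v" by (auto simp: card_2_iff)
  then show ?thesis using e by auto
 qed
 have actV: "g x \<in> V" if "g \<in> \<Gamma>" "x \<in> V" for g x using Bij_imp_funcset[OF bij[OF that(1)]] that(2) by auto
 have orbit: "orbit (?G \<lparr>carrier := \<Gamma>\<rparr>) (\<lambda>g. g) x = {g x | g. g \<in> \<Gamma>}" for x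
  unfolding orbit_def by simp
 have so: "stab_orbit V E \<Gamma> x y = {g y | g. g \<in> \<Gamma> \<and> g x = x}" for x y
  unfolding stab_orbit_def orbit_def stabilizer_def by (simp add: Let_def)
 have one\<Gamma>: "\<one>\<^bsub>?G\<^esub> \<in> \<Gamma>" by (rule subgroup.one_closed[OF assms(4)])
 interpret gact V E \<Gamma>
 proof
  show "\<exists>u v. e = {u, v} \<and> u \<noteq> v \<and> u \<in> V \<and> v \<in> V" if "e \<in> E" for e by (rule simple[OF that])
  show "joined E x y" if "x \<in> V" "y \<in> V" for x y using assms(2) that unfolding connected_graph_def by simp
  show "finite {e \<in> E. x \<in> e}" if "x \<in> V" for x using assms(3) that unfolding locally_finite_graph_def by simp
  show "g x \<in> V" if "g \<in> \<Gamma>" "x \<in> V" for g x by (rule actV[OF that])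
  show "{g x, g y} \<in> E \<longleftrightarrow> {x, y} \<in> E" if "g \<in> \<Gamma>" "x \<in> V" "y \<in> V" for g x y
   using \<Gamma>[OF that(1)] that unfolding graph_auto_def by simp
  show "\<exists>e\<in>\<Gamma>. \<forall>x\<in>V. e x = x" using one\<Gamma> one by blast
  show "\<exists>l\<in>\<Gamma>. \<forall>x\<in>V. l x = g (k x)" if "g \<in> \<Gamma>" "k \<in> \<Gamma>" for g k
   using subgroup.m_closed[OF assms(4) that] mult[OF that] by blast
  show "\<exists>l\<in>\<Gamma>. \<forall>x\<in>V. l (g x) = x \<and> g (l x) = x" if g: "g \<in> \<Gamma>" for g
  proof -
   have gc: "g \<in> carrier ?G" using \<Gamma>[OF g] car by simp
   have i: "inv\<^bsub>?G\<^esub> g \<in> \<Gamma>" by (rule subgroup.m_inv_closed[OF assms(4) g])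
   have "(inv\<^bsub>?G\<^esub> g) (g x) = x \<and> g ((inv\<^bsub>?G\<^esub> g) x) = x" if x: "x \<in> V" for x
    using mult[OF i g x] mult[OF g i x] one[OF x] G.l_inv[OF gc] G.r_inv[OF gc] by simp
   then show ?thesis using i by blast
  qed
  show "\<exists>R. finite R \<and> R \<subseteq> V \<and> (\<forall>x\<in>V. \<exists>r\<in>R. \<exists>g\<in>\<Gamma>. x = g r)"
  proof -
   let ?O = "(\<lambda>x. {g x | g. g \<in> \<Gamma>}) ` V"
   have "?O = orbits (?G \<lparr>carrier := \<Gamma>\<rparr>) V (\<lambda>g. g)" unfolding orbits_def orbit by auto
   then have "finite ?O" using assms(5) unfolding quasi_transitive_def by simp
   then obtain R where R: "R \<subseteq> V" "finite R" "?O = (\<lambda>x. {g x | g. g \<in> \<Gamma>}) ` R"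
    using finite_subset_image[of ?O "\<lambda>x. {g x | g. g \<in> \<Gamma>}" V] by auto
   have "\<exists>r\<in>R. \<exists>g\<in>\<Gamma>. x = g r" if x: "x \<in> V" for x
   proof -
    have "{g x | g. g \<in> \<Gamma>} \<in> (\<lambda>x. {g x | g. g \<in> \<Gamma>}) ` R" using x R(3) by blast
    then obtain r where r: "r \<in> R" "{g x | g. g \<in> \<Gamma>} = {g r | g. g \<in> \<Gamma>}" by auto
    have "x \<in> {g x | g. g \<in> \<Gamma>}" using one\<Gamma> one[OF x] by (intro CollectI exI[of _ "\<one>\<^bsub>?G\<^esub>"]) auto
    then show ?thesis using r by auto
   qed
   then show ?thesis using R by blast
  qed
 qed
 obtain u v where uv: "u \<in> V" "v \<in> V" "v \<in> {g u | g. g \<in> \<Gamma>}" "card (so v u) \<noteq> card (so u v)"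
  using assms(6) unfolding unimodular_def orbit so so_def by blast
 then obtain g where g: "g \<in> \<Gamma>" "v = g u" by auto
 have ne: "V \<noteq> {}" using uv by auto
 \<comment> \<open>Unequal stabilizer orbits inside one orbit of \<Gamma> mean that
   \<open>hw\<close> is not constant on it, the input for the height.\<close>
 have "hw v / hw u = card (so v u) / card (so u v)" by (rule hw_ratio[OF ne uv(2,1)])
 then have "hw (g u) \<noteq> hw u"
  using uv(4) g(2) hw_pos[OF ne uv(1)] card_so_pos[OF uv(1,2)] by (auto simp: field_simps)
 then obtain h up rt c0 M CM ll deg where "hgraph V E \<Gamma> h up rt c0 M CM ll deg"
  by (rule height_exists[OF uv(1) g(1)])
 then show ?thesis by (rule hgraph.pc_less_pu)
qed

end
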